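(* Let $s\ge 1$ be a fixed integer. Suppose that: (a) $(\varepsilon_t)_{t}$ is a sequence of independent $p$-dimensional real random vectors with independent entries $\varepsilon_{it}$, $i=1,\dots,p$, satisfying $\mathbb{E}(\varepsilon_{ij})=0$, $\mathbb{E}(\varepsilon_{ij}^2)=1$, and, for every $\eta>0$, $$\frac{1}{\eta^4 pT}\sum_{i=1}^{p}\sum_{j=1}^{T+s}\mathbb{E}\left(|\varepsilon_{ij}|^4\,\mathbf 1_{\{|\varepsilon_{ij}|\ge \eta T^{1/4}\}}\right)\longrightarrow 0\qquad\text{as } p,T\to\infty;$$ (b) $p\to\infty$ and $T\to\infty$ with $y_T:=p/T\to y\in(0,\infty)$. Let $X_T=\frac1T\sum_{t=s+1}^{s+T}\varepsilon_t\varepsilon_{t-s}^{\top}$ and $A_T=X_TX_T^{\top}$. Then, with probability one, the empirical spectral distribution $F^{A_T}$ of $A_T$ converges weakly to a (nonrandom) limiting probability distribution $F$ whose $k$-th moment, for every integer $k\ge1$, is $$m_k=\sum_{i=0}^{k-1}\frac1k\binom{2k}{i}\binom{k}{i+1}y^{2k-1-i}.$$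
   Context: All random variables are defined on a common probability space. The dimension $p=p(T)$ depends on $T$; the vectors $\varepsilon_t=(\varepsilon_{1t},\dots,\varepsilon_{pt})^{\top}$ are $p$-dimensional, and the matrix $X_T$ (a $p\times p$ matrix, the lag-$s$ sample auto-covariance matrix) involves $\varepsilon_1,\dots,\varepsilon_{T+s}$. The superscript $\top$ denotes transpose. For a real symmetric $p\times p$ matrix $A$ with eigenvalues $l_1,\dots,l_p$, its empirical spectral distribution is the probability measure $F^{A}=\frac1p\sum_{j=1}^p\delta_{l_j}$. *)

theory Defs
  imports
    "HOL-Probability.Probability"
    "Jordan_Normal_Form.Char_Poly"
begin

(* The rows of the data array are numbered 0, ..., p - 1, following the indexing of the type mat;
   the time index runs from 1 to T + s. *)
definition sample_autocov :: "nat \<Rightarrow> nat \<Rightarrow> nat \<Rightarrow> (nat \<Rightarrow> nat \<Rightarrow> real) \<Rightarrow> real mat" where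
  "sample_autocov s p T x =
     mat p p (\<lambda>(i, j). 1 / real T * (\<Sum>t = s + 1..s + T. x i t * x j (t - s)))"

(* Eigenvalues are the roots of the characteristic polynomial, listed with multiplicity. For a real
   symmetric p x p matrix with p > 0 there are exactly p of them, so each carries mass 1/p.
   The distr only moves the measure from the discrete to the Borel sigma-algebra. *)
definition esd :: "real mat \<Rightarrow> real measure" where
  "esd A = distr (measure_pmf (pmf_of_multiset (proots (char_poly A)))) borel (\<lambda>x. x)"

end

theory Submission
  imports Defs "HOL-Computational_Algebra.Computational_Algebra" "HOL-Real_Asymp.Real_Asymp"
begin

text \<open>
  The proof is a moment method carried out on averages, followed by concentration.

  Changing one time column of the data changes \<open>X\<close> by a matrix of rank at most two, hence moves the
  distribution function of the spectrum of \<open>X X\<^sup>T\<close> by at most \<open>2 / p\<close>. The bounded differences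
  inequality and Borel--Cantelli therefore reduce the claim to the convergence of the expected
  distribution functions.

  In expectation the entries may be replaced, on an enlarged probability space, by standardised entries
  bounded by \<open>3 T\<^bsup>1/4\<^esup>\<close>, and \<open>X\<close> by its variant with cyclic time shift: by the Lindeberg condition
  the mean squared Frobenius norm of the change is \<open>o(p)\<close>. With a cyclic shift the moments become
  normalised traces of words in the Gram matrix of the columns and powers of a shift matrix. Expanding such
  a trace into products of entries, only products in which every entry occurs exactly twice matter:
  those with a simple factor have mean zero, and those with fewer distinct entries are rarer by a factor
  \<open>N\<close> for each lost entry, against at most \<open>9 T\<^bsup>1/2\<^esup>\<close> gained in size. So the traces have the same
  limits as for Gaussian entries. For Gaussian entries integration by parts
  gives a recursion whose limit splits a word into two subwords; for the alternating words it amounts to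
  the equation \<open>a = z (1 + a) (y + a)\<^sup>2\<close> for the generating function, and Lagrange inversion yields the
  stated moments. They grow at most exponentially, so they determine the limiting distribution.
\<close>

unbundle no vec_syntax

section \<open>Spectral decomposition of real symmetric matrices\<close>

text \<open>Entries need not have finite moments of order above four, so the spectral moments of the
  original \<open>X X^T\<close> need not be integrable. The original array is therefore handled
  through distribution functions alone, which are bounded: rank changes serve the concentration,
  Frobenius changes the comparison. Moments are taken of the bounded cyclic model. There
  \<open>X = w J^(-1) w^T / T\<close> with a permutation matrix \<open>J\<close> and the
  \<open>p\<close> by \<open>N\<close> array \<open>w\<close>, \<open>N = T + s\<close>, and the
  words in \<open>J\<close> and the Gram matrix are closed under the rotations, transpositions and
  cuts that integration by parts produces. The recursion runs on expectations of products of traces,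
  since cutting one trace yields two. Convergence of all products at once makes the limit factorise
  without a separate variance estimate. The sign added after truncation keeps the second moments
  exactly 1. Products with every entry paired then agree exactly with the Gaussian ones, and the
  remaining error is of order \<open>q^2 / N\<close> with \<open>q = 3 T^(1/4)\<close>, that is, of
  order \<open>T^(-1/2)\<close>.\<close>

lemma symmetric_real_eigenvalue:
  fixes A :: "real mat"
  assumes A: "A \<in> carrier_mat n n" and n: "n > 0"
    and sym: "\<And>i j. i < n \<Longrightarrow> j < n \<Longrightarrow> A $$ (i, j) = A $$ (j, i)"
  obtains e where "eigenvalue A e"
proof -
  define B where "B = map_mat complex_of_real A"
  have B: "B \<in> carrier_mat n n" using A by (simp add: B_def)
  have "degree (char_poly B) = n" using degree_monic_char_poly[OF B] by simp
  then have "\<not> constant (poly (char_poly B))" using n by (simp add: constant_degree)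
  then obtain l where l: "poly (char_poly B) l = 0"
    using fundamental_theorem_of_algebra by blast
  then have "eigenvalue B l" by (simp add: eigenvalue_root_char_poly[OF B])
  then obtain v where v: "v \<in> carrier_vec n" "v \<noteq> 0\<^sub>v n" "B *\<^sub>v v = l \<cdot>\<^sub>v v"
    unfolding eigenvalue_def eigenvector_def using B by auto
  have Bv: "(\<Sum>j<n. of_real (A $$ (i,j)) * v $ j) = l * v $ i" if "i < n" for i
  proof -
    have "(B *\<^sub>v v) $ i = (\<Sum>j<n. of_real (A $$ (i,j)) * v $ j)"
      using that v(1) A by (simp add: B_def scalar_prod_def atLeast0LessThan)
    then show ?thesis using v(1,3) that by simp
  qed
  \<comment> \<open>\<open>c\<close> is the Hermitian form of \<open>A\<close> at \<open>v\<close>.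
    It equals \<open>l\<close> times the squared norm of \<open>v\<close>, and it is real because
    \<open>A\<close> is real and symmetric; hence \<open>l\<close> is real.\<close>
  define c where "c = (\<Sum>i<n. \<Sum>j<n. of_real (A $$ (i,j)) * v $ j * cnj (v $ i))"
  have c1: "c = l * of_real (\<Sum>i<n. (cmod (v $ i))\<^sup>2)"
  proof -
    have "c = (\<Sum>i<n. (l * v $ i) * cnj (v $ i))"
      unfolding c_def by (intro sum.cong refl) (simp add: Bv[symmetric] sum_distrib_right)
    also have "\<dots> = (\<Sum>i<n. l * of_real ((cmod (v $ i))\<^sup>2))"
      by (intro sum.cong refl) (simp only: mult.assoc complex_norm_square)
    finally show ?thesis by (simp add: sum_distrib_left)
  qed
  have "cnj c = (\<Sum>i<n. \<Sum>j<n. of_real (A $$ (i,j)) * cnj (v $ j) * v $ i)"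
    by (simp add: c_def)
  also have "\<dots> = (\<Sum>j<n. \<Sum>i<n. of_real (A $$ (i,j)) * cnj (v $ j) * v $ i)"
    by (rule sum.swap)
  also have "\<dots> = c"
    unfolding c_def by (intro sum.cong refl) (auto simp: sym mult_ac)
  finally have cr: "cnj c = c" .
  have pos: "(\<Sum>i<n. (cmod (v $ i))\<^sup>2) > 0"
  proof -
    obtain i where i: "i < n" "v $ i \<noteq> 0"
      using v(1,2) by (metis carrier_vecD eq_vecI index_zero_vec(1,2))
    then have "(cmod (v $ i))\<^sup>2 > 0" by simp
    also have "(cmod (v $ i))\<^sup>2 \<le> (\<Sum>i<n. (cmod (v $ i))\<^sup>2)"
      using i by (intro member_le_sum) auto
    finally show ?thesis .
  qed
  have "cnj l = l"
  proof -
    have "cnj l * of_real (\<Sum>i<n. (cmod (v $ i))\<^sup>2) = l * of_real (\<Sum>i<n. (cmod (v $ i))\<^sup>2)"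
      using cr unfolding c1 by (simp only: complex_cnj_mult complex_cnj_complex_of_real)
    moreover have "complex_of_real (\<Sum>i<n. (cmod (v $ i))\<^sup>2) \<noteq> 0"
      using pos by (metis less_irrefl of_real_eq_0_iff)
    ultimately show ?thesis by (metis mult_right_cancel)
  qed
  then have lr: "l = of_real (Re l)" by (simp add: complex_eq_iff)
  have "char_poly B = map_poly complex_of_real (char_poly A)"
    unfolding B_def by (rule of_real_hom.char_poly_hom[OF A])
  then have "complex_of_real (poly (char_poly A) (Re l)) = 0"
    using l by (metis lr of_real_hom.poly_map_poly)
  then have "eigenvalue A (Re l)" by (simp add: eigenvalue_root_char_poly[OF A])
  then show ?thesis using that by blast
qed

text \<open>The reflection in the hyperplane orthogonal to \<open>u - e_0\<close> exchanges the unit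
  vectors \<open>u\<close> and \<open>e_0\<close>; for \<open>u = e_0\<close> there is no such
  hyperplane and the identity serves. In the deflation below, \<open>H\<close> plays the role of an
  orthonormal basis that starts with an eigenvector.\<close>

lemma householder:
  fixes u :: "nat \<Rightarrow> real"
  assumes n: "n > 0" and u: "(\<Sum>i<n. (u i)\<^sup>2) = 1"
  obtains H where "H \<in> carrier_mat n n" "H * H = 1\<^sub>m n" "H\<^sup>T = H" "\<And>i. i < n \<Longrightarrow> H $$ (i, 0) = u i"
proof -
  define v where "v i = u i - (if i = 0 then 1 else 0)" for i :: nat
  define S where "S = (\<Sum>i<n. (v i)\<^sup>2)"
  have S: "S = 2 - 2 * u 0"
  proof -
    have "S = (\<Sum>i<n. (u i)\<^sup>2 + (if i = 0 then 1 - 2 * u 0 else 0))"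
      unfolding S_def by (intro sum.cong refl) (simp add: v_def power2_eq_square algebra_simps)
    also have "\<dots> = 1 + (1 - 2 * u 0)" using n u by (simp add: sum.distrib)
    finally show ?thesis by simp
  qed
  show ?thesis
  proof (cases "S = 0")
    case True
    then have "v i = 0" if "i < n" for i
      using that unfolding S_def by (subst (asm) sum_nonneg_eq_0_iff) auto
    then have "u i = (if i = 0 then 1 else 0)" if "i < n" for i
      using that by (force simp: v_def split: if_splits)
    then show ?thesis using that[of "1\<^sub>m n"] n by simp
  next
    case False
    define H where "H = mat n n (\<lambda>(i,j). (if i = j then 1 else 0) - 2 * v i * v j / S)"
    have HH: "(\<Sum>k<n. ((if i = k then 1 else 0) - 2 * v i * v k / S) *
         ((if k = j then 1 else 0) - 2 * v k * v j / S)) = (if i = j then 1 else 0)"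
      if "i < n" "j < n" for i j
    proof -
      have "(\<Sum>k<n. ((if i = k then 1 else 0) - 2 * v i * v k / S) *
         ((if k = j then 1 else 0) - 2 * v k * v j / S))
        = (\<Sum>k<n. (if i = k then (if k = j then 1 else 0) - 2 * v k * v j / S else 0)
             - (if k = j then 2 * v i * v k / S else 0)
             + (4 * v i * v j / S\<^sup>2) * (v k)\<^sup>2)"
        by (intro sum.cong refl) (auto simp: algebra_simps power2_eq_square)
      also have "\<dots> = (if i = j then 1 else 0) - 2 * v i * v j / S - 2 * v i * v j / S
            + (4 * v i * v j / S\<^sup>2) * S"
        unfolding S_def[symmetric] using that
        by (simp only: sum.distrib sum_subtractf sum_distrib_left[symmetric] S_def) simp
      also have "\<dots> = (if i = j then 1 else 0)"
        using False by (simp add: power2_eq_square)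
      finally show ?thesis .
    qed
    show ?thesis
    proof (rule that[of H])
      show "H \<in> carrier_mat n n" by (simp add: H_def)
      show "H * H = 1\<^sub>m n"
        by (rule eq_matI) (simp_all add: H_def scalar_prod_def atLeast0LessThan HH)
      show "H\<^sup>T = H" by (rule eq_matI) (auto simp: H_def)
      show "H $$ (i, 0) = u i" if "i < n" for i
      proof -
        have "H $$ (i, 0) = (if i = 0 then 1 else 0) - 2 * v i * (u 0 - 1) / S"
          using that n by (simp add: H_def v_def)
        also have "2 * v i * (u 0 - 1) / S = - v i"
        proof -
          have "2 * v i * (u 0 - 1) = - v i * S" unfolding S by (simp add: algebra_simps)
          then show ?thesis using False by simp
        qed
        finally show ?thesis by (simp add: v_def)
      qed
    qed
  qed
qed

lemma symmetric_real_unit_eigenvector: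
  fixes A :: "real mat"
  assumes A: "A \<in> carrier_mat n n" and n: "n > 0"
    and sym: "\<And>i j. i < n \<Longrightarrow> j < n \<Longrightarrow> A $$ (i, j) = A $$ (j, i)"
  obtains e u where "(\<Sum>i<n. (u i)\<^sup>2) = 1" "\<And>i. i < n \<Longrightarrow> (\<Sum>j<n. A $$ (i,j) * u j) = e * u i"
proof -
  obtain e where "eigenvalue A e" using symmetric_real_eigenvalue[OF A n sym] by blast
  then obtain v where v: "v \<in> carrier_vec n" "v \<noteq> 0\<^sub>v n" "A *\<^sub>v v = e \<cdot>\<^sub>v v"
    unfolding eigenvalue_def eigenvector_def using A by auto
  define S where "S = (\<Sum>i<n. (v $ i)\<^sup>2)"
  have pos: "S > 0"
  proof -
    obtain i where i: "i < n" "v $ i \<noteq> 0"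
      using v(1,2) by (metis carrier_vecD eq_vecI index_zero_vec(1,2))
    then have "(v $ i)\<^sup>2 > 0" by simp
    also have "(v $ i)\<^sup>2 \<le> S"
      unfolding S_def using i by (intro member_le_sum) auto
    finally show ?thesis .
  qed
  have Av: "(\<Sum>j<n. A $$ (i,j) * v $ j) = e * v $ i" if "i < n" for i
  proof -
    have "(A *\<^sub>v v) $ i = (\<Sum>j<n. A $$ (i,j) * v $ j)"
      using that v(1) A by (simp add: scalar_prod_def atLeast0LessThan)
    then show ?thesis using v(1,3) that by simp
  qed
  show ?thesis
  proof (rule that[of "\<lambda>i. v $ i / sqrt S" e])
    show "(\<Sum>i<n. (v $ i / sqrt S)\<^sup>2) = 1"
      using pos by (simp add: power_divide sum_divide_distrib[symmetric] S_def[symmetric])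
    show "(\<Sum>j<n. A $$ (i,j) * (v $ j / sqrt S)) = e * (v $ i / sqrt S)" if "i < n" for i
      using Av[OF that] by (simp add: sum_divide_distrib[symmetric])
  qed
qed

text \<open>Deflation. With \<open>H\<close> the Householder matrix carrying the first basis vector
  to a unit eigenvector, \<open>H A H\<close> has the eigenvalue times the first basis vector as
  first column. By symmetry it splits into a 1 by 1 block and a symmetric block of size
  \<open>n\<close>, to which the induction hypothesis applies.\<close>

lemma spectral_theorem_mat:
  fixes A :: "real mat"
  assumes "A \<in> carrier_mat n n"
    and "\<And>i j. i < n \<Longrightarrow> j < n \<Longrightarrow> A $$ (i, j) = A $$ (j, i)"
  shows "\<exists>U d. U \<in> carrier_mat n n \<and> U\<^sup>T * U = 1\<^sub>m n \<and> A = U * mat n n (\<lambda>(i,j). if i = j then d i else 0) * U\<^sup>T"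
  using assms
proof (induction n arbitrary: A)
  case 0
  then show ?case by (intro exI[of _ "1\<^sub>m 0"] exI) auto
next
  case (Suc n A)
  note A = Suc.prems(1)
  obtain e u where u: "(\<Sum>i<Suc n. (u i)\<^sup>2) = 1"
      "\<And>i. i < Suc n \<Longrightarrow> (\<Sum>j<Suc n. A $$ (i,j) * u j) = e * u i"
    using symmetric_real_unit_eigenvector[OF Suc.prems(1) _ Suc.prems(2)] by blast
  obtain H where H: "H \<in> carrier_mat (Suc n) (Suc n)" "H * H = 1\<^sub>m (Suc n)" "H\<^sup>T = H"
      "\<And>i. i < Suc n \<Longrightarrow> H $$ (i, 0) = u i"
    using householder[OF _ u(1)] by blast
  define A' where "A' = H * A * H"
  have A': "A' \<in> carrier_mat (Suc n) (Suc n)" using H A by (simp add: A'_def)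
  have AT: "A\<^sup>T = A" by (rule eq_matI) (use A Suc.prems(2) in auto)
  have "A'\<^sup>T = A'"
  proof -
    have "A'\<^sup>T = H\<^sup>T * (H * A)\<^sup>T" unfolding A'_def
      by (rule transpose_mult[of _ "Suc n" "Suc n" _ "Suc n"]) (use H A in auto)
    also have "(H * A)\<^sup>T = A\<^sup>T * H\<^sup>T"
      by (rule transpose_mult[of _ "Suc n" "Suc n" _ "Suc n"]) (use H A in auto)
    finally show ?thesis unfolding A'_def H AT
      using H A by (simp add: assoc_mult_mat[of _ "Suc n" "Suc n" _ "Suc n" _ "Suc n"])
  qed
  then have A'sym: "A' $$ (i,j) = A' $$ (j,i)" if "i < Suc n" "j < Suc n" for i j
    using A' that by (metis carrier_matD index_transpose_mat(1))
  have A'0: "A' $$ (i, 0) = (if i = 0 then e else 0)" if i: "i < Suc n" for i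
  proof -
    have "col (A * H) 0 = e \<cdot>\<^sub>v col H 0"
    proof (rule eq_vecI)
      show "dim_vec (col (A * H) 0) = dim_vec (e \<cdot>\<^sub>v col H 0)" using A H by simp
      fix i assume "i < dim_vec (e \<cdot>\<^sub>v col H 0)"
      then have i: "i < Suc n" using H by simp
      have "col (A * H) 0 $ i = (\<Sum>j<Suc n. A $$ (i,j) * H $$ (j,0))"
        using i A H(1) by (simp add: scalar_prod_def atLeast0LessThan del: sum.lessThan_Suc)
      also have "\<dots> = (\<Sum>j<Suc n. A $$ (i,j) * u j)"
        by (intro sum.cong refl) (use H(4) in auto)
      also have "\<dots> = e * u i" using u(2)[OF i] .
      finally show "col (A * H) 0 $ i = (e \<cdot>\<^sub>v col H 0) $ i"
        using i H by simp
    qed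
    have "A' = H * (A * H)" unfolding A'_def using H A by (simp add: assoc_mult_mat[of _ "Suc n" "Suc n" _ "Suc n" _ "Suc n"])
    then have "A' $$ (i, 0) = row H i \<bullet> col (A * H) 0" using i H A by simp
    also have "\<dots> = row H i \<bullet> (e \<cdot>\<^sub>v col H 0)" by (simp add: \<open>col (A * H) 0 = _\<close>)
    also have "\<dots> = e * (row H i \<bullet> col H 0)" using H i by simp
    also have "row H i \<bullet> col H 0 = (H * H) $$ (i, 0)" using i H(1) by simp
    also have "\<dots> = (if i = 0 then 1 else 0)" using H(2) i by simp
    finally show ?thesis by simp
  qed
  define A3 where "A3 = mat n n (\<lambda>(i,j). A' $$ (Suc i, Suc j))"
  have A3: "A3 \<in> carrier_mat n n" by (simp add: A3_def)
  have "A3 $$ (i,j) = A3 $$ (j,i)" if "i < n" "j < n" for i j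
    using that A'sym[of "Suc i" "Suc j"] by (simp add: A3_def)
  from Suc.IH[OF A3 this] obtain U d where U: "U \<in> carrier_mat n n" "U\<^sup>T * U = 1\<^sub>m n"
     "A3 = U * mat n n (\<lambda>(i,j). if i = j then d i else 0) * U\<^sup>T" by blast
  define d' where "d' i = (if i = 0 then e else d (i - 1))" for i
  define D where "D = mat n n (\<lambda>(i,j). if i = j then d i else 0)"
  define D' where "D' = mat (Suc n) (Suc n) (\<lambda>(i,j). if i = j then d' i else 0)"
  define V where "V = four_block_mat (1\<^sub>m 1) (0\<^sub>m 1 n) (0\<^sub>m n 1) U"
  have D: "D \<in> carrier_mat n n" by (simp add: D_def)
  have V: "V \<in> carrier_mat (Suc n) (Suc n)" unfolding V_def using U by (simp add: four_block_mat_def)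
  have D'b: "D' = four_block_mat (mat 1 1 (\<lambda>_. e)) (0\<^sub>m 1 n) (0\<^sub>m n 1) D"
    by (rule eq_matI) (auto simp: D'_def D_def d'_def four_block_mat_def)
  have VT: "V\<^sup>T = four_block_mat (1\<^sub>m 1) (0\<^sub>m 1 n) (0\<^sub>m n 1) (U\<^sup>T)"
    unfolding V_def by (subst transpose_four_block_mat) (use U in auto)
  have VV: "V\<^sup>T * V = 1\<^sub>m (Suc n)"
    unfolding VT unfolding V_def
    by (subst mult_four_block_mat[of _ 1 1 _ n _ n _ _ 1 _ n]) (use U in \<open>auto intro!: eq_matI simp: four_block_mat_def\<close>)
  have A'b: "A' = four_block_mat (mat 1 1 (\<lambda>_. e)) (0\<^sub>m 1 n) (0\<^sub>m n 1) A3"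
  proof (rule eq_matI)
    fix i j assume "i < dim_row (four_block_mat (mat 1 1 (\<lambda>_. e)) (0\<^sub>m 1 n) (0\<^sub>m n 1) A3)"
      "j < dim_col (four_block_mat (mat 1 1 (\<lambda>_. e)) (0\<^sub>m 1 n) (0\<^sub>m n 1) A3)"
    then have ij: "i < Suc n" "j < Suc n" using A3 by auto
    show "A' $$ (i,j) = four_block_mat (mat 1 1 (\<lambda>_. e)) (0\<^sub>m 1 n) (0\<^sub>m n 1) A3 $$ (i,j)"
      using ij A3 A'0[of i] A'0[of j] A'sym[of i j] by (auto simp: four_block_mat_def A3_def)
  qed (use A' A3 in auto)
  have A'V: "A' = V * D' * V\<^sup>T"
    unfolding A'b VT D'b unfolding V_def
    apply (subst mult_four_block_mat[of _ 1 1 _ n _ n _ _ 1 _ n])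
    using U D apply (simp_all only: one_carrier_mat zero_carrier_mat mat_carrier)
    apply (subst mult_four_block_mat[of _ 1 1 _ n _ n _ _ 1 _ n])
    using U D by (auto simp: D_def[symmetric] left_mult_zero_mat right_mult_zero_mat)
  have D': "D' \<in> carrier_mat (Suc n) (Suc n)" by (simp add: D'_def)
  note as = assoc_mult_mat[of _ "Suc n" "Suc n" _ "Suc n" _ "Suc n"]
  have HA'H: "A = H * A' * H"
  proof -
    have "H * A' * H = (H * H) * A * (H * H)" unfolding A'_def using H(1) A by (simp add: as)
    then show ?thesis using H A by simp
  qed
  have HVT: "(H * V)\<^sup>T = V\<^sup>T * H"
    using transpose_mult[OF H(1) V] H(3) by simp
  have "A = (H * V) * D' * (H * V)\<^sup>T"
    unfolding HVT using H(1) V D' HA'H A'V by (simp add: as)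
  moreover have "(H * V)\<^sup>T * (H * V) = 1\<^sub>m (Suc n)"
  proof -
    have "(H * V)\<^sup>T * (H * V) = V\<^sup>T * ((H * H) * V)" unfolding HVT using H(1) V by (simp add: as)
    then show ?thesis using H V VV by simp
  qed
  moreover have "H * V \<in> carrier_mat (Suc n) (Suc n)" using H V by simp
  ultimately show ?case unfolding D'_def by blast
qed

text \<open>Row \<open>i\<close> of \<open>u\<close> is the eigenvector for \<open>d i\<close>. The
  factorised characteristic polynomial belongs to the data because \<open>esd\<close> is defined by
  its roots.\<close>

definition is_spectral :: "nat \<Rightarrow> real mat \<Rightarrow> (nat \<Rightarrow> real) \<Rightarrow> (nat \<Rightarrow> nat \<Rightarrow> real) \<Rightarrow> bool" where
  "is_spectral n A d u \<longleftrightarrow>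
     (\<forall>i<n. \<forall>j<n. (\<Sum>k<n. u i k * u j k) = (if i = j then 1 else 0)) \<and>
     (\<forall>k<n. \<forall>l<n. (\<Sum>i<n. u i k * u i l) = (if k = l then 1 else 0)) \<and>
     (\<forall>k<n. \<forall>l<n. A $$ (k, l) = (\<Sum>i<n. d i * u i k * u i l)) \<and>
     char_poly A = (\<Prod>i\<leftarrow>[0..<n]. [:- d i, 1:])"

lemma is_spectralD:
  assumes "is_spectral n A d u"
  shows "\<And>i j. i < n \<Longrightarrow> j < n \<Longrightarrow> (\<Sum>k<n. u i k * u j k) = (if i = j then 1 else 0)"
    "\<And>k l. k < n \<Longrightarrow> l < n \<Longrightarrow> (\<Sum>i<n. u i k * u i l) = (if k = l then 1 else 0)"
    "\<And>k l. k < n \<Longrightarrow> l < n \<Longrightarrow> A $$ (k, l) = (\<Sum>i<n. d i * u i k * u i l)"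
    "char_poly A = (\<Prod>i\<leftarrow>[0..<n]. [:- d i, 1:])"
  using assms unfolding is_spectral_def by blast+

lemma spectral_decomposition:
  fixes A :: "real mat"
  assumes A: "A \<in> carrier_mat n n"
    and sym: "\<And>i j. i < n \<Longrightarrow> j < n \<Longrightarrow> A $$ (i, j) = A $$ (j, i)"
  obtains d u where "is_spectral n A d u"
proof -
  obtain U d where U: "U \<in> carrier_mat n n" "U\<^sup>T * U = 1\<^sub>m n"
      and AU: "A = U * mat n n (\<lambda>(i,j). if i = j then d i else 0) * U\<^sup>T"
    using spectral_theorem_mat[OF A sym] by blast
  define D where "D = mat n n (\<lambda>(i,j). if i = j then d i else 0)"
  have D: "D \<in> carrier_mat n n" by (simp add: D_def)
  have UU: "U * U\<^sup>T = 1\<^sub>m n" using mat_mult_left_right_inverse[of "U\<^sup>T" n U] U by simp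
  have "is_spectral n A d (\<lambda>i k. U $$ (k, i))"
    unfolding is_spectral_def
  proof (intro conjI allI impI)
    fix i j assume ij: "i < n" "j < n"
    have "(U\<^sup>T * U) $$ (i, j) = (\<Sum>k<n. U $$ (k, i) * U $$ (k, j))"
      using ij U(1) by (simp add: scalar_prod_def atLeast0LessThan)
    then show "(\<Sum>k<n. U $$ (k, i) * U $$ (k, j)) = (if i = j then 1 else 0)"
      using U(2) ij by simp
    have "(U * U\<^sup>T) $$ (i, j) = (\<Sum>k<n. U $$ (i, k) * U $$ (j, k))"
      using ij U(1) by (simp add: scalar_prod_def atLeast0LessThan)
    then show "(\<Sum>k<n. U $$ (i, k) * U $$ (j, k)) = (if i = j then 1 else 0)"
      using UU ij by simp
    have UD: "(U * D) $$ (i, l) = U $$ (i, l) * d l" if "l < n" for l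
    proof -
      have "(U * D) $$ (i, l) = (\<Sum>k<n. U $$ (i, k) * (if k = l then d k else 0))"
        using ij U(1) that by (simp add: scalar_prod_def atLeast0LessThan D_def)
      also have "\<dots> = (\<Sum>k<n. if k = l then U $$ (i, k) * d k else 0)"
        by (intro sum.cong refl) auto
      finally show ?thesis using that by simp
    qed
    have "(V * U\<^sup>T) $$ (i, j) = (\<Sum>k<n. V $$ (i, k) * U $$ (j, k))" if "V \<in> carrier_mat n n" for V
      using ij U(1) that by (simp add: scalar_prod_def atLeast0LessThan)
    from this[of "U * D"] have "A $$ (i, j) = (\<Sum>k<n. (U * D) $$ (i, k) * U $$ (j, k))"
      unfolding AU D_def[symmetric] using U(1) D by simp
    also have "\<dots> = (\<Sum>k<n. d k * U $$ (i, k) * U $$ (j, k))"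
      by (intro sum.cong refl) (use UD in auto)
    finally show "A $$ (i, j) = (\<Sum>k<n. d k * U $$ (i, k) * U $$ (j, k))" .
  next
    have "similar_mat A D"
      by (rule similar_matI[of _ _ U "U\<^sup>T" n]) (use A D U UU AU in \<open>auto simp: D_def\<close>)
    then have "char_poly A = char_poly D" by (rule char_poly_similar)
    also have "\<dots> = (\<Prod>a\<leftarrow>diag_mat D. [:- a, 1:])"
      by (rule char_poly_upper_triangular[OF D]) (auto simp: D_def)
    also have "diag_mat D = map d [0..<n]"
      by (auto simp: diag_mat_def D_def)
    finally show "char_poly A = (\<Prod>i\<leftarrow>[0..<n]. [:- d i, 1:])" by (simp add: o_def)
  qed
  then show ?thesis by (rule that)
qed

lemma index_pow_mat_Suc:
  fixes A :: "'a :: semiring_1 mat"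
  assumes "A \<in> carrier_mat n n" "i < n" "j < n"
  shows "(A ^\<^sub>m Suc m) $$ (i, j) = (\<Sum>k<n. (A ^\<^sub>m m) $$ (i, k) * A $$ (k, j))"
  using assms by (simp add: scalar_prod_def atLeast0LessThan)

lemma spectral_pow_trace:
  fixes A :: "real mat"
  assumes A: "A \<in> carrier_mat n n" and spec: "is_spectral n A d u"
  shows "(\<Sum>k<n. (A ^\<^sub>m m) $$ (k, k)) = (\<Sum>i<n. d i ^ m)"
proof -
  note orth = is_spectralD(1)[OF spec] and orth' = is_spectralD(2)[OF spec] and dec = is_spectralD(3)[OF spec]
  have pow: "(A ^\<^sub>m m) $$ (k, l) = (\<Sum>i<n. d i ^ m * u i k * u i l)" if "k < n" "l < n" for k l
    using that
  proof (induction m arbitrary: k l)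
    case 0
    then show ?case using orth'[of k l] A by simp
  next
    case (Suc m)
    have "(A ^\<^sub>m Suc m) $$ (k, l) = (\<Sum>r<n. (\<Sum>i<n. d i ^ m * u i k * u i r) * (\<Sum>j<n. d j * u j r * u j l))"
      unfolding index_pow_mat_Suc[OF A Suc.prems]
      by (rule sum.cong) (use Suc.prems in \<open>simp_all add: Suc.IH dec\<close>)
    also have "\<dots> = (\<Sum>r<n. \<Sum>i<n. \<Sum>j<n. d i ^ m * u i k * d j * u j l * (u i r * u j r))"
      unfolding sum_product by (intro sum.cong refl) (simp add: mult_ac)
    also have "\<dots> = (\<Sum>i<n. \<Sum>j<n. d i ^ m * u i k * d j * u j l * (\<Sum>r<n. u i r * u j r))"
      unfolding sum_distrib_left by (rule trans[OF sum.swap]) (rule sum.cong[OF refl], rule sum.swap)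
    also have "\<dots> = (\<Sum>i<n. \<Sum>j<n. if i = j then d i ^ m * u i k * d j * u j l else 0)"
      by (intro sum.cong refl) (auto simp: orth)
    also have "\<dots> = (\<Sum>i<n. d i ^ Suc m * u i k * u i l)"
      by (intro sum.cong refl) (auto simp: mult_ac)
    finally show ?case .
  qed
  have "(\<Sum>k<n. (A ^\<^sub>m m) $$ (k, k)) = (\<Sum>k<n. \<Sum>i<n. d i ^ m * (u i k * u i k))"
    by (intro sum.cong refl) (simp add: pow mult_ac)
  also have "\<dots> = (\<Sum>i<n. d i ^ m * (\<Sum>k<n. u i k * u i k))"
    by (subst sum.swap) (simp add: sum_distrib_left)
  also have "\<dots> = (\<Sum>i<n. d i ^ m)"
    by (intro sum.cong refl) (simp add: orth)
  finally show ?thesis .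
qed

section \<open>The empirical spectral distribution in terms of an eigenvalue list\<close>

lemma esd_eq_distr:
  assumes n: "n > 0" and cp: "char_poly A = (\<Prod>i\<leftarrow>[0..<n]. [:- d i, 1:])"
  shows "esd A = distr (measure_pmf (pmf_of_set {..<n})) borel d"
proof -
  have nz: "(\<Prod>i\<leftarrow>is. [:- d i, 1:]) \<noteq> 0" for "is" by (auto simp: prod_list_zero_iff)
  have "proots (\<Prod>i\<leftarrow>is. [:- d i, 1:]) = image_mset d (mset is)" for "is"
    using nz by (induction "is") (simp_all add: proots_mult del: mult_pCons_left)
  then have "proots (char_poly A) = image_mset d (mset [0..<n])" unfolding cp .
  also have "mset [0..<n] = mset_set {..<n}"
    by (simp add: atLeast0LessThan)
  finally have "pmf_of_multiset (proots (char_poly A)) = map_pmf d (pmf_of_set {..<n})"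
    using n by (subst map_pmf_of_set) (auto simp: lessThan_empty_iff)
  then show ?thesis
    unfolding esd_def by (simp add: map_pmf_rep_eq distr_distr o_def)
qed

lemma real_distribution_esd: "real_distribution (esd A)"
  unfolding esd_def
  by (intro real_distribution.intro real_distribution_axioms.intro measure_pmf.prob_space_distr) auto

lemma integral_esd:
  assumes n: "n > 0" and cp: "char_poly A = (\<Prod>i\<leftarrow>[0..<n]. [:- d i, 1:])"
    and f: "f \<in> borel_measurable borel"
  shows "integrable (esd A) f" "(\<integral>x. f x \<partial>esd A) = (\<Sum>i<n. f (d i)) / n"
proof -
  note e = esd_eq_distr[OF n cp]
  have "integrable (measure_pmf (pmf_of_set {..<n})) (\<lambda>i. f (d i))"
    using n by (intro integrable_measure_pmf_finite) (subst set_pmf_of_set; auto simp: lessThan_empty_iff)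
  then show "integrable (esd A) f" unfolding e using f by (subst integrable_distr_eq) auto
  have "(\<integral>x. f x \<partial>esd A) = (\<integral>i. f (d i) \<partial>measure_pmf (pmf_of_set {..<n}))"
    unfolding e using f by (subst integral_distr) auto
  also have "\<dots> = (\<Sum>i<n. f (d i)) / n"
    using n by (subst integral_pmf_of_set) auto
  finally show "(\<integral>x. f x \<partial>esd A) = (\<Sum>i<n. f (d i)) / n" .
qed

lemma cdf_esd:
  assumes n: "n > 0" and cp: "char_poly A = (\<Prod>i\<leftarrow>[0..<n]. [:- d i, 1:])"
  shows "cdf (esd A) x = card {i. i < n \<and> d i \<le> x} / n"
proof -
  interpret real_distribution "esd A" by (rule real_distribution_esd)
  have "cdf (esd A) x = (\<integral>t. indicator {..x} t \<partial>esd A)" by (simp add: cdf_def)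
  also have "\<dots> = (\<Sum>i<n. indicator {..x} (d i)) / n"
    by (rule integral_esd[OF n cp]) auto
  also have "(\<Sum>i<n. indicator {..x} (d i) :: real) = card {i. i < n \<and> d i \<le> x}"
    by (simp add: indicator_def sum.If_cases Int_def)
  finally show ?thesis .
qed

text \<open>The moments of the spectrum are polynomials in the entries of \<open>A\<close>. Both the
  measurability of spectral quantities and the later computation of moments rest on this.\<close>

lemma moment_esd:
  fixes A :: "real mat"
  assumes n: "n > 0" and A: "A \<in> carrier_mat n n"
    and sym: "\<And>i j. i < n \<Longrightarrow> j < n \<Longrightarrow> A $$ (i, j) = A $$ (j, i)"
  shows "(\<integral>x. x ^ m \<partial>esd A) = (\<Sum>k<n. (A ^\<^sub>m m) $$ (k, k)) / n"
proof -
  obtain d u where s: "is_spectral n A d u"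
    using spectral_decomposition[OF A sym] by blast
  have "(\<integral>x. x ^ m \<partial>esd A) = (\<Sum>i<n. d i ^ m) / n"
    by (rule integral_esd(2)[OF n is_spectralD(4)[OF s]]) measurable
  also have "(\<Sum>i<n. d i ^ m) = (\<Sum>k<n. (A ^\<^sub>m m) $$ (k, k))"
    by (rule spectral_pow_trace[OF A s, symmetric])
  finally show ?thesis .
qed

text \<open>Padding the coefficient matrix of fewer than \<open>n\<close> equations with zero rows
  makes it square and singular. This is the dimension count behind the eigenvalue
  inequalities.\<close>

lemma homogeneous_system_nontrivial:
  fixes qs :: "(nat \<Rightarrow> real) list"
  assumes "length qs < n"
  obtains w where "\<exists>i<n. w i \<noteq> 0" "\<And>q. q \<in> set qs \<Longrightarrow> (\<Sum>i<n. q i * w i) = 0"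
proof -
  define M where "M = mat n n (\<lambda>(i,j). if i < length qs then (qs ! i) j else 0)"
  have M: "M \<in> carrier_mat n n" by (simp add: M_def)
  have "M\<^sup>T *\<^sub>v unit_vec n (length qs) = 0\<^sub>v n"
  proof (rule eq_vecI)
    fix i assume "i < dim_vec (0\<^sub>v n :: real vec)"
    then show "(M\<^sup>T *\<^sub>v unit_vec n (length qs)) $ i = 0\<^sub>v n $ i"
      using assms by (simp add: M_def)
  qed (simp add: M_def)
  then have "det M\<^sup>T = 0"
    using M assms by (subst det_0_iff_vec_prod_zero_field[of _ n])
      (auto intro!: exI[of _ "unit_vec n (length qs)"])
  then have "det M = 0" using M by (simp add: det_transpose)
  then obtain v where v: "v \<in> carrier_vec n" "v \<noteq> 0\<^sub>v n" "M *\<^sub>v v = 0\<^sub>v n"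
    using det_0_iff_vec_prod_zero_field[OF M] by auto
  show ?thesis
  proof (rule that[of "\<lambda>i. v $ i"])
    show "\<exists>i<n. v $ i \<noteq> 0"
      using v(1,2) by (metis carrier_vecD eq_vecI index_zero_vec(1,2))
    fix q assume "q \<in> set qs"
    then obtain k where k: "k < length qs" "q = qs ! k" by (auto simp: in_set_conv_nth)
    have "(M *\<^sub>v v) $ k = (\<Sum>i<n. q i * v $ i)"
      using k assms v(1) by (simp add: M_def scalar_prod_def atLeast0LessThan)
    then show "(\<Sum>i<n. q i * v $ i) = 0" using v(3) k assms by simp
  qed
qed

section \<open>Perturbation of the singular value distribution\<close>

lemma spectral_quadratic_form:
  fixes A :: "real mat"
  assumes dec: "\<And>k l. k < n \<Longrightarrow> l < n \<Longrightarrow> A $$ (k, l) = (\<Sum>i<n. d i * u i k * u i l)"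
  shows "(\<Sum>k<n. \<Sum>l<n. w k * A $$ (k, l) * w l) = (\<Sum>i<n. d i * (\<Sum>k<n. u i k * w k)\<^sup>2)"
proof -
  have "(\<Sum>k<n. \<Sum>l<n. w k * A $$ (k, l) * w l)
      = (\<Sum>k<n. \<Sum>l<n. \<Sum>i<n. d i * ((u i k * w k) * (u i l * w l)))"
    by (intro sum.cong refl) (simp add: dec sum_distrib_left sum_distrib_right mult_ac)
  also have "\<dots> = (\<Sum>k<n. \<Sum>i<n. \<Sum>l<n. d i * ((u i k * w k) * (u i l * w l)))"
    by (rule sum.cong[OF refl], rule sum.swap)
  also have "\<dots> = (\<Sum>i<n. \<Sum>k<n. \<Sum>l<n. d i * ((u i k * w k) * (u i l * w l)))"
    by (rule sum.swap)
  also have "\<dots> = (\<Sum>i<n. d i * (\<Sum>k<n. u i k * w k)\<^sup>2)"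
    by (rule sum.cong[OF refl]) (simp only: power2_eq_square sum_product, simp only: sum_distrib_left)
  finally show ?thesis .
qed

lemma parseval:
  fixes u :: "nat \<Rightarrow> nat \<Rightarrow> real"
  assumes "\<And>k l. k < n \<Longrightarrow> l < n \<Longrightarrow> (\<Sum>i<n. u i k * u i l) = (if k = l then 1 else 0)"
  shows "(\<Sum>i<n. (\<Sum>k<n. u i k * w k)\<^sup>2) = (\<Sum>k<n. (w k)\<^sup>2)"
proof -
  have "(\<Sum>i<n. 1 * (\<Sum>k<n. u i k * w k)\<^sup>2) = (\<Sum>k<n. \<Sum>l<n. w k * 1\<^sub>m n $$ (k, l) * w l)"
    by (rule spectral_quadratic_form[symmetric]) (simp add: assms)
  also have "\<dots> = (\<Sum>k<n. \<Sum>l<n. if k = l then (w k)\<^sup>2 else 0)"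
    by (intro sum.cong refl) (auto simp: power2_eq_square)
  finally show ?thesis by simp
qed

lemma gram_index:
  fixes X :: "real mat"
  assumes "X \<in> carrier_mat n m" "k < n" "l < n"
  shows "(X * X\<^sup>T) $$ (k, l) = (\<Sum>j<m. X $$ (k, j) * X $$ (l, j))"
  using assms by (simp add: scalar_prod_def atLeast0LessThan)

lemma gram_quadratic_form:
  fixes X :: "real mat"
  assumes X: "X \<in> carrier_mat n m"
  shows "(\<Sum>k<n. \<Sum>l<n. w k * (X * X\<^sup>T) $$ (k, l) * w l) = (\<Sum>j<m. (\<Sum>i<n. X $$ (i, j) * w i)\<^sup>2)"
proof -
  have "(\<Sum>k<n. \<Sum>l<n. w k * (X * X\<^sup>T) $$ (k, l) * w l)
      = (\<Sum>k<n. \<Sum>l<n. \<Sum>j<m. (X $$ (k, j) * w k) * (X $$ (l, j) * w l))"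
    by (intro sum.cong refl) (simp add: gram_index[OF X] sum_distrib_left sum_distrib_right mult_ac)
  also have "\<dots> = (\<Sum>k<n. \<Sum>j<m. \<Sum>l<n. (X $$ (k, j) * w k) * (X $$ (l, j) * w l))"
    by (rule sum.cong[OF refl], rule sum.swap)
  also have "\<dots> = (\<Sum>j<m. \<Sum>k<n. \<Sum>l<n. (X $$ (k, j) * w k) * (X $$ (l, j) * w l))"
    by (rule sum.swap)
  also have "\<dots> = (\<Sum>j<m. (\<Sum>i<n. X $$ (i, j) * w i)\<^sup>2)"
    by (intro sum.cong refl) (simp only: power2_eq_square sum_product)
  finally show ?thesis .
qed

lemma gram_carrier: "X \<in> carrier_mat n m \<Longrightarrow> X * X\<^sup>T \<in> carrier_mat n n"
  by simp

lemma gram_symmetric: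
  fixes X :: "real mat"
  assumes "X \<in> carrier_mat n m" "k < n" "l < n"
  shows "(X * X\<^sup>T) $$ (k, l) = (X * X\<^sup>T) $$ (l, k)"
  using assms by (simp add: gram_index mult.commute del: index_mult_mat)

text \<open>The spectral data of \<open>X X^T\<close> seen through quadratic forms: the squared norm
  of \<open>X^T w\<close> is the sum of the squared coordinates of \<open>w\<close> weighted by the
  eigenvalues, which are the squared singular values. Their sum is the squared Frobenius
  norm.\<close>

definition is_gram_spectral ::
    "nat \<Rightarrow> nat \<Rightarrow> real mat \<Rightarrow> (nat \<Rightarrow> real) \<Rightarrow> (nat \<Rightarrow> nat \<Rightarrow> real) \<Rightarrow> bool" where
  "is_gram_spectral n m X d u \<longleftrightarrow>
     (\<forall>i<n. 0 \<le> d i) \<and>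
     (\<forall>w. (\<Sum>j<m. (\<Sum>i<n. X $$ (i, j) * w i)\<^sup>2) = (\<Sum>i<n. d i * (\<Sum>k<n. u i k * w k)\<^sup>2)) \<and>
     (\<forall>w. (\<Sum>i<n. (\<Sum>k<n. u i k * w k)\<^sup>2) = (\<Sum>k<n. (w k)\<^sup>2)) \<and>
     char_poly (X * X\<^sup>T) = (\<Prod>i\<leftarrow>[0..<n]. [:- d i, 1:]) \<and>
     (\<Sum>i<n. d i) = (\<Sum>i<n. \<Sum>j<m. (X $$ (i, j))\<^sup>2)"

lemma is_gram_spectralD:
  assumes "is_gram_spectral n m X d u"
  shows "\<And>i. i < n \<Longrightarrow> 0 \<le> d i"
    "\<And>w. (\<Sum>j<m. (\<Sum>i<n. X $$ (i, j) * w i)\<^sup>2) = (\<Sum>i<n. d i * (\<Sum>k<n. u i k * w k)\<^sup>2)"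
    "\<And>w. (\<Sum>i<n. (\<Sum>k<n. u i k * w k)\<^sup>2) = (\<Sum>k<n. (w k)\<^sup>2)"
    "char_poly (X * X\<^sup>T) = (\<Prod>i\<leftarrow>[0..<n]. [:- d i, 1:])"
    "(\<Sum>i<n. d i) = (\<Sum>i<n. \<Sum>j<m. (X $$ (i, j))\<^sup>2)"
  using assms unfolding is_gram_spectral_def by blast+

lemma gram_spectrum:
  fixes X :: "real mat"
  assumes X: "X \<in> carrier_mat n m"
  obtains d u where "is_gram_spectral n m X d u"
proof -
  obtain d u where s: "is_spectral n (X * X\<^sup>T) d u"
    using spectral_decomposition[OF gram_carrier[OF X] gram_symmetric[OF X]] by blast
  note s1 = is_spectralD(1)[OF s] and s2 = is_spectralD(2)[OF s] and s3 = is_spectralD(3)[OF s]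
  have q: "(\<Sum>j<m. (\<Sum>i<n. X $$ (i, j) * w i)\<^sup>2) = (\<Sum>i<n. d i * (\<Sum>k<n. u i k * w k)\<^sup>2)" for w
    using gram_quadratic_form[OF X, of w, symmetric] spectral_quadratic_form[OF s3, of w] by (rule trans)
  have nn: "d i \<ge> 0" if i: "i < n" for i
  proof -
    have "(\<Sum>j<n. d j * (\<Sum>k<n. u j k * u i k)\<^sup>2) = (\<Sum>j<n. if j = i then d j else 0)"
      by (intro sum.cong refl) (use i s1 in auto)
    also have "\<dots> = d i" using i by simp
    finally have "d i = (\<Sum>j<m. (\<Sum>k<n. X $$ (k, j) * u i k)\<^sup>2)" by (simp only: q)
    also have "\<dots> \<ge> 0" by (intro sum_nonneg) simp
    finally show ?thesis .
  qed
  have tr: "(\<Sum>i<n. d i) = (\<Sum>i<n. \<Sum>j<m. (X $$ (i, j))\<^sup>2)"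
  proof -
    have "(\<Sum>i<n. d i) = (\<Sum>i<n. d i ^ 1)" by simp
    also have "\<dots> = (\<Sum>k<n. ((X * X\<^sup>T) ^\<^sub>m 1) $$ (k, k))"
      by (rule spectral_pow_trace[OF gram_carrier[OF X] s, symmetric])
    also have "(X * X\<^sup>T) ^\<^sub>m 1 = X * X\<^sup>T" using X by simp
    also have "(\<Sum>k<n. (X * X\<^sup>T) $$ (k, k)) = (\<Sum>k<n. \<Sum>j<m. (X $$ (k, j))\<^sup>2)"
      by (intro sum.cong refl, subst gram_index[OF X]) (simp_all add: power2_eq_square)
    finally show ?thesis .
  qed
  have "is_gram_spectral n m X d u"
    unfolding is_gram_spectral_def
    using nn q parseval[OF s2] is_spectralD(4)[OF s] tr by blast
  then show ?thesis by (rule that)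
qed

text \<open>A Weyl type inequality by counting dimensions. If it failed, some nonzero
  \<open>w\<close> would be orthogonal to all \<open>qs\<close>, to the eigenvectors of
  \<open>X X^T\<close> above \<open>x\<close>, and to those of \<open>Y Y^T\<close> up to
  \<open>y = (sqrt x + \<theta>)^2\<close>. Then \<open>X^T w\<close> has norm at most
  \<open>sqrt x |w|\<close> and \<open>(Y - X)^T w\<close> at most \<open>\<theta> |w|\<close>,
  while the norm of \<open>Y^T w\<close> exceeds the sum of these bounds.\<close>

lemma cdf_gram_perturb:
  fixes X Y :: "real mat" and qs :: "(nat \<Rightarrow> real) list"
  assumes n: "n > 0" and X: "X \<in> carrier_mat n m" and Y: "Y \<in> carrier_mat n m"
    and \<theta>: "\<theta> \<ge> 0" and x: "x \<ge> 0"
    and small: "\<And>w. (\<And>q. q \<in> set qs \<Longrightarrow> (\<Sum>i<n. q i * w i) = 0) \<Longrightarrow>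
        (\<Sum>j<m. (\<Sum>i<n. (Y $$ (i, j) - X $$ (i, j)) * w i)\<^sup>2) \<le> \<theta>\<^sup>2 * (\<Sum>i<n. (w i)\<^sup>2)"
  shows "cdf (esd (X * X\<^sup>T)) x \<le> cdf (esd (Y * Y\<^sup>T)) ((sqrt x + \<theta>)\<^sup>2) + length qs / n"
proof -
  obtain d u where X0: "is_gram_spectral n m X d u"
    using gram_spectrum[OF X] by blast
  note X' = is_gram_spectralD[OF X0]
  obtain b v where Y0: "is_gram_spectral n m Y b v"
    using gram_spectrum[OF Y] by blast
  note Y' = is_gram_spectralD[OF Y0]
  define y where "y = (sqrt x + \<theta>)\<^sup>2"
  define I where "I = {i. i < n \<and> d i \<le> x}"
  define J where "J = {i. i < n \<and> b i \<le> y}"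
  have "card I \<le> card J + length qs"
  proof (rule ccontr)
    assume "\<not> card I \<le> card J + length qs"
    then have less: "card J + length qs < card I" by simp
    have "card ({..<n} - I) = n - card I"
      by (subst card_Diff_subset) (auto simp: I_def)
    moreover have "card I \<le> n" using card_mono[of "{..<n}" I] by (auto simp: I_def)
    ultimately have c: "card ({..<n} - I) + card J + length qs < n" using less by linarith
    define rs where "rs = map u (sorted_list_of_set ({..<n} - I)) @ map v (sorted_list_of_set J) @ qs"
    have fin: "finite ({..<n} - I)" "finite J" by (auto simp: J_def)
    have "length rs < n" using c by (simp add: rs_def)
    then obtain w where w: "\<exists>i<n. w i \<noteq> 0" "\<And>q. q \<in> set rs \<Longrightarrow> (\<Sum>i<n. q i * w i) = 0"
      using homogeneous_system_nontrivial by metis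
    define S where "S = (\<Sum>i<n. (w i)\<^sup>2)"
    have S: "S > 0"
    proof -
      obtain i where i: "i < n" "w i \<noteq> 0" using w(1) by blast
      then have "(w i)\<^sup>2 > 0" by simp
      also have "(w i)\<^sup>2 \<le> S" unfolding S_def using i by (intro member_le_sum) auto
      finally show ?thesis .
    qed
    define x' where "x' j = (\<Sum>i<n. X $$ (i, j) * w i)" for j
    define y' where "y' j = (\<Sum>i<n. Y $$ (i, j) * w i)" for j
    have "(\<Sum>j<m. (x' j)\<^sup>2) \<le> (\<Sum>i<n. x * (\<Sum>k<n. u i k * w k)\<^sup>2)"
      unfolding x'_def X'(2)
    proof (rule sum_mono)
      fix i assume i: "i \<in> {..<n}"
      show "d i * (\<Sum>k<n. u i k * w k)\<^sup>2 \<le> x * (\<Sum>k<n. u i k * w k)\<^sup>2"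
      proof (cases "i \<in> I")
        case True
        then show ?thesis by (intro mult_right_mono) (auto simp: I_def)
      next
        case False
        then have "u i \<in> set rs" using i fin by (simp add: rs_def)
        then show ?thesis using w(2) by simp
      qed
    qed
    also have "\<dots> = x * S" by (simp add: sum_distrib_left[symmetric] X'(3) S_def)
    finally have xb: "(\<Sum>j<m. (x' j)\<^sup>2) \<le> x * S" .
    have yb: "y * S < (\<Sum>j<m. (y' j)\<^sup>2)"
    proof -
      have ge: "y * (\<Sum>k<n. v i k * w k)\<^sup>2 \<le> b i * (\<Sum>k<n. v i k * w k)\<^sup>2"
         and gt: "(\<Sum>k<n. v i k * w k)\<^sup>2 \<noteq> 0 \<Longrightarrow> y * (\<Sum>k<n. v i k * w k)\<^sup>2 < b i * (\<Sum>k<n. v i k * w k)\<^sup>2"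
         if i: "i < n" for i
      proof -
        have "(\<Sum>k<n. v i k * w k) = 0" if "i \<in> J"
          using that w(2)[of "v i"] fin by (simp add: rs_def)
        moreover have "y < b i" if "i \<notin> J" using that i by (auto simp: J_def)
        ultimately show "y * (\<Sum>k<n. v i k * w k)\<^sup>2 \<le> b i * (\<Sum>k<n. v i k * w k)\<^sup>2"
         and "(\<Sum>k<n. v i k * w k)\<^sup>2 \<noteq> 0 \<Longrightarrow> y * (\<Sum>k<n. v i k * w k)\<^sup>2 < b i * (\<Sum>k<n. v i k * w k)\<^sup>2"
          by (cases "i \<in> J"; auto intro!: mult_right_mono mult_strict_right_mono)+
      qed
      \<comment> \<open>A strict inequality needs one nonzero coordinate of \<open>w\<close> in the
        basis \<open>v\<close>; Parseval provides it.\<close>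
      have "\<exists>i<n. (\<Sum>k<n. v i k * w k)\<^sup>2 \<noteq> 0"
      proof (rule ccontr)
        assume "\<not> (\<exists>i<n. (\<Sum>k<n. v i k * w k)\<^sup>2 \<noteq> 0)"
        then have "(\<Sum>i<n. (\<Sum>k<n. v i k * w k)\<^sup>2) = 0" by (intro sum.neutral) auto
        then show False using S by (simp add: Y'(3) S_def)
      qed
      then have "(\<Sum>i<n. y * (\<Sum>k<n. v i k * w k)\<^sup>2) < (\<Sum>i<n. b i * (\<Sum>k<n. v i k * w k)\<^sup>2)"
        using ge gt by (intro sum_strict_mono_ex1) (auto simp del: power_eq_0_iff zero_eq_power2)
      then show ?thesis
        by (simp add: sum_distrib_left[symmetric] Y'(3) S_def y'_def Y'(2))
    qed
    have zb: "(\<Sum>j<m. (y' j - x' j)\<^sup>2) \<le> \<theta>\<^sup>2 * S"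
    proof -
      have "y' j - x' j = (\<Sum>i<n. (Y $$ (i, j) - X $$ (i, j)) * w i)" for j
        by (simp add: y'_def x'_def sum_subtractf algebra_simps)
      then show ?thesis
        using small[of w] w(2) by (simp add: S_def rs_def)
    qed
    have "L2_set y' {..<m} \<le> L2_set x' {..<m} + L2_set (\<lambda>j. y' j - x' j) {..<m}"
      using L2_set_triangle_ineq[of x' "\<lambda>j. y' j - x' j" "{..<m}"] by simp
    also have "\<dots> \<le> sqrt (x * S) + sqrt (\<theta>\<^sup>2 * S)"
      unfolding L2_set_def using xb zb by (intro add_mono real_sqrt_le_mono)
    also have "\<dots> = (sqrt x + \<theta>) * sqrt S"
      using \<theta> by (simp add: real_sqrt_mult algebra_simps)
    also have "\<dots> = sqrt (y * S)"
      unfolding y_def using \<theta> x by (simp add: real_sqrt_mult)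
    also have "\<dots> < L2_set y' {..<m}"
      unfolding L2_set_def using yb by (intro real_sqrt_less_mono)
    finally show False by simp
  qed
  then have "real (card I) / n \<le> (real (card J) + real (length qs)) / n"
    by (intro divide_right_mono) linarith+
  then show ?thesis
    unfolding cdf_esd[OF n X'(4)] cdf_esd[OF n Y'(4)] I_def J_def y_def by (simp add: add_divide_distrib)
qed

lemma cdf_gram_neg:
  fixes X :: "real mat"
  assumes n: "n > 0" and X: "X \<in> carrier_mat n m" and x: "x < 0"
  shows "cdf (esd (X * X\<^sup>T)) x = 0"
proof -
  obtain d u where s: "is_gram_spectral n m X d u"
    using gram_spectrum[OF X] by blast
  have "{i. i < n \<and> d i \<le> x} = {}" using is_gram_spectralD(1)[OF s] x by force
  then show ?thesis using cdf_esd[OF n is_gram_spectralD(4)[OF s], of x] by simp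
qed

text \<open>The case \<open>\<theta> = 0\<close> in both directions: on the orthogonal complement of
  \<open>qs\<close> the two transposed matrices act alike, so the threshold does not move and only
  the excluded directions count.\<close>

lemma cdf_gram_perturb_rank:
  fixes X Y :: "real mat" and qs :: "(nat \<Rightarrow> real) list"
  assumes n: "n > 0" and X: "X \<in> carrier_mat n m" and Y: "Y \<in> carrier_mat n m"
    and ker: "\<And>w j. (\<And>q. q \<in> set qs \<Longrightarrow> (\<Sum>i<n. q i * w i) = 0) \<Longrightarrow> j < m \<Longrightarrow>
        (\<Sum>i<n. Y $$ (i, j) * w i) = (\<Sum>i<n. X $$ (i, j) * w i)"
  shows "\<bar>cdf (esd (X * X\<^sup>T)) x - cdf (esd (Y * Y\<^sup>T)) x\<bar> \<le> length qs / n"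
proof (cases "x \<ge> 0")
  case True
  have "cdf (esd (X * X\<^sup>T)) x \<le> cdf (esd (Y * Y\<^sup>T)) ((sqrt x + 0)\<^sup>2) + length qs / n"
    by (rule cdf_gram_perturb[OF n X Y _ True])
       (auto simp: left_diff_distrib sum_subtractf ker intro!: sum_nonpos)
  moreover have "cdf (esd (Y * Y\<^sup>T)) x \<le> cdf (esd (X * X\<^sup>T)) ((sqrt x + 0)\<^sup>2) + length qs / n"
    by (rule cdf_gram_perturb[OF n Y X _ True])
       (auto simp: left_diff_distrib sum_subtractf ker intro!: sum_nonpos)
  ultimately show ?thesis using True by (simp add: abs_le_iff)
next
  case False
  then show ?thesis using cdf_gram_neg[OF n X] cdf_gram_neg[OF n Y] by simp
qed

text \<open>The directions in which \<open>Z = Y - X\<close> is large are excluded: the eigenvectors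
  of \<open>Z Z^T\<close> with eigenvalue above \<open>\<theta>^2\<close> serve as
  \<open>qs\<close>. Their number is at most the trace of \<open>Z Z^T\<close> divided by
  \<open>\<theta>^2\<close>, and this trace is the squared Frobenius norm.\<close>

lemma cdf_gram_perturb_frobenius:
  fixes X Y :: "real mat"
  assumes n: "n > 0" and X: "X \<in> carrier_mat n m" and Y: "Y \<in> carrier_mat n m"
    and \<theta>: "\<theta> > 0" and x: "x \<ge> 0"
  shows "cdf (esd (X * X\<^sup>T)) x \<le> cdf (esd (Y * Y\<^sup>T)) ((sqrt x + \<theta>)\<^sup>2)
           + (\<Sum>i<n. \<Sum>j<m. (Y $$ (i, j) - X $$ (i, j))\<^sup>2) / (n * \<theta>\<^sup>2)"
proof -
  define Z where "Z = Y - X"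
  have Z: "Z \<in> carrier_mat n m" and Zi: "i < n \<Longrightarrow> j < m \<Longrightarrow> Z $$ (i, j) = Y $$ (i, j) - X $$ (i, j)" for i j
    using X Y by (auto simp: Z_def)
  obtain d u where Z0: "is_gram_spectral n m Z d u"
    using gram_spectrum[OF Z] by blast
  note Z' = is_gram_spectralD[OF Z0]
  define L where "L = {i. i < n \<and> \<theta>\<^sup>2 < d i}"
  have fin: "finite L" by (simp add: L_def)
  define qs where "qs = map u (sorted_list_of_set L)"
  have "cdf (esd (X * X\<^sup>T)) x \<le> cdf (esd (Y * Y\<^sup>T)) ((sqrt x + \<theta>)\<^sup>2) + length qs / n"
  proof (rule cdf_gram_perturb[OF n X Y _ x])
    fix w assume w: "\<And>q. q \<in> set qs \<Longrightarrow> (\<Sum>i<n. q i * w i) = 0"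
    have "(\<Sum>j<m. (\<Sum>i<n. (Y $$ (i, j) - X $$ (i, j)) * w i)\<^sup>2) = (\<Sum>j<m. (\<Sum>i<n. Z $$ (i, j) * w i)\<^sup>2)"
      by (intro sum.cong refl arg_cong[of _ _ "\<lambda>t. t\<^sup>2"]) (simp add: Zi)
    also have "\<dots> \<le> (\<Sum>i<n. \<theta>\<^sup>2 * (\<Sum>k<n. u i k * w k)\<^sup>2)"
      unfolding Z'(2)
    proof (rule sum_mono)
      fix i assume i: "i \<in> {..<n}"
      show "d i * (\<Sum>k<n. u i k * w k)\<^sup>2 \<le> \<theta>\<^sup>2 * (\<Sum>k<n. u i k * w k)\<^sup>2"
      proof (cases "i \<in> L")
        case True
        then have "u i \<in> set qs" using fin by (simp add: qs_def)
        then show ?thesis using w by simp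
      next
        case False
        then show ?thesis using i by (intro mult_right_mono) (auto simp: L_def)
      qed
    qed
    also have "\<dots> = \<theta>\<^sup>2 * (\<Sum>i<n. (w i)\<^sup>2)" by (simp add: sum_distrib_left[symmetric] Z'(3))
    finally show "(\<Sum>j<m. (\<Sum>i<n. (Y $$ (i, j) - X $$ (i, j)) * w i)\<^sup>2) \<le> \<theta>\<^sup>2 * (\<Sum>i<n. (w i)\<^sup>2)" .
  qed (use \<theta> in simp)
  moreover have "real (length qs) * \<theta>\<^sup>2 \<le> (\<Sum>i<n. \<Sum>j<m. (Y $$ (i, j) - X $$ (i, j))\<^sup>2)"
  proof -
    have "real (length qs) * \<theta>\<^sup>2 = (\<Sum>i\<in>L. \<theta>\<^sup>2)" using fin by (simp add: qs_def)
    also have "\<dots> \<le> (\<Sum>i\<in>L. d i)" by (intro sum_mono) (simp add: L_def)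
    also have "\<dots> \<le> (\<Sum>i<n. d i)" using Z'(1) by (intro sum_mono2) (auto simp: L_def)
    also have "\<dots> = (\<Sum>i<n. \<Sum>j<m. (Y $$ (i, j) - X $$ (i, j))\<^sup>2)"
      unfolding Z'(5) by (intro sum.cong refl) (simp add: Zi)
    finally show ?thesis .
  qed
  then have "length qs / n \<le> (\<Sum>i<n. \<Sum>j<m. (Y $$ (i, j) - X $$ (i, j))\<^sup>2) / (n * \<theta>\<^sup>2)"
    using \<theta> n by (simp add: field_simps)
  ultimately show ?thesis by linarith
qed

section \<open>Measurability\<close>

lemma borel_measurable_pow_mat:
  fixes A :: "'w \<Rightarrow> real mat"
  assumes A: "\<And>w. A w \<in> carrier_mat n n"
    and meas: "\<And>i j. i < n \<Longrightarrow> j < n \<Longrightarrow> (\<lambda>w. A w $$ (i, j)) \<in> borel_measurable M"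
    and ij: "i < n" "j < n"
  shows "(\<lambda>w. (A w ^\<^sub>m m) $$ (i, j)) \<in> borel_measurable M"
  using ij
proof (induction m arbitrary: i j)
  case 0
  then show ?case by (simp add: carrier_matD[OF A])
next
  case (Suc m)
  then show ?case
    unfolding index_pow_mat_Suc[OF A Suc.prems]
    using Suc.IH meas by (intro borel_measurable_sum borel_measurable_times) auto
qed

text \<open>The eigenvalues are never constructed as measurable functions. Moments are measurable as
  traces of matrix powers, polynomials follow by linearity, and a continuous \<open>f\<close>
  follows by Weierstrass approximation on the growing intervals from \<open>-m\<close> to
  \<open>m\<close>, since the spectrum of a fixed matrix is a finite set.\<close>

lemma borel_measurable_integral_esd:
  fixes A :: "'w \<Rightarrow> real mat" and f :: "real \<Rightarrow> real"
  assumes n: "n > 0" and A: "\<And>w. A w \<in> carrier_mat n n"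
    and meas: "\<And>i j. i < n \<Longrightarrow> j < n \<Longrightarrow> (\<lambda>w. A w $$ (i, j)) \<in> borel_measurable M"
    and sym: "\<And>w i j. i < n \<Longrightarrow> j < n \<Longrightarrow> A w $$ (i, j) = A w $$ (j, i)"
    and f: "continuous_on UNIV f"
  shows "(\<lambda>w. \<integral>x. f x \<partial>esd (A w)) \<in> borel_measurable M"
proof -
  have "\<exists>g. real_polynomial_function g \<and> (\<forall>x\<in>{- real m..real m}. \<bar>f x - g x\<bar> < 1 / (real m + 1))" for m :: nat
  proof -
    have cf: "continuous_on {- real m..real m} f" using f by (rule continuous_on_subset) simp
    from Stone_Weierstrass_real_polynomial_function[OF compact_Icc cf, of "1 / (real m + 1)"]
    obtain h where "real_polynomial_function h" "\<And>x. x \<in> {- real m..real m} \<Longrightarrow> \<bar>f x - h x\<bar> < 1 / (real m + 1)"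
      by auto
    then show ?thesis by (intro exI[of _ h]) (auto simp: add.commute)
  qed
  then obtain g where g: "\<And>m. real_polynomial_function (g m)"
      "\<And>m x. x \<in> {- real m..real m} \<Longrightarrow> \<bar>f x - g m x\<bar> < 1 / (real m + 1)" by metis
  have cg: "g m \<in> borel_measurable borel" for m
    by (intro borel_measurable_continuous_onI continuous_at_imp_continuous_on)
      (use g(1) continuous_real_polymonial_function in blast)
  have mg: "(\<lambda>w. \<integral>x. g m x \<partial>esd (A w)) \<in> borel_measurable M" for m
  proof -
    obtain a N where aN: "g m = (\<lambda>x. \<Sum>i\<le>N. a i * x ^ i)"
      using g(1)[of m] by (auto simp: real_polynomial_function_iff_sum)
    have "(\<integral>x. g m x \<partial>esd (A w)) = (\<Sum>i\<le>N. a i * ((\<Sum>k<n. (A w ^\<^sub>m i) $$ (k, k)) / n))" for w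
    proof -
      obtain d u where s: "is_spectral n (A w) d u"
        using spectral_decomposition[OF A sym] by blast
      have "(\<integral>x. g m x \<partial>esd (A w)) = (\<Sum>i\<le>N. a i * (\<integral>x. x ^ i \<partial>esd (A w)))"
        unfolding aN by (subst Bochner_Integration.integral_sum)
          (auto intro!: integral_esd(1)[OF n is_spectralD(4)[OF s]])
      then show ?thesis by (simp only: moment_esd[OF n A sym])
    qed
    then show ?thesis
      using borel_measurable_pow_mat[of A n M, OF A meas] by simp
  qed
  show ?thesis
  proof (rule borel_measurable_LIMSEQ_real[OF _ mg])
    fix w assume "w \<in> space M"
    obtain d u where s: "is_spectral n (A w) d u"
      using spectral_decomposition[OF A sym] by blast
    note cp = is_spectralD(4)[OF s]
    have "(\<lambda>m. g m t) \<longlonglongrightarrow> f t" for t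
    proof -
      have "\<forall>\<^sub>F m in sequentially. norm (g m t - f t) \<le> 1 / (real m + 1)"
        using eventually_ge_at_top[of "nat \<lceil>\<bar>t\<bar>\<rceil>"]
      proof eventually_elim
        case (elim m)
        then have "\<bar>t\<bar> \<le> real m" by linarith
        then show ?case using g(2)[of t m] by (auto simp: abs_le_iff abs_minus_commute)
      qed
      moreover have "(\<lambda>m. 1 / (real m + 1)) \<longlonglongrightarrow> 0"
        using LIMSEQ_inverse_real_of_nat by (simp add: inverse_eq_divide add.commute)
      ultimately have "(\<lambda>m. g m t - f t) \<longlonglongrightarrow> 0" by (rule Lim_null_comparison)
      then show ?thesis by (simp add: LIM_zero_iff)
    qed
    then have "(\<lambda>m. (\<Sum>i<n. g m (d i)) / n) \<longlonglongrightarrow> (\<Sum>i<n. f (d i)) / n"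
      by (intro tendsto_intros) (use n in auto)
    then show "(\<lambda>m. \<integral>x. g m x \<partial>esd (A w)) \<longlonglongrightarrow> (\<integral>x. f x \<partial>esd (A w))"
      by (simp add: integral_esd(2)[OF n cp] cg borel_measurable_continuous_onI[OF f])
  qed
qed

text \<open>The indicator of a half-line is the pointwise limit of the continuous steps
  \<open>h m\<close>, which descend from 1 to 0 on an interval of length \<open>1 / (m + 1)\<close>
  to the right of \<open>x\<close>.\<close>

lemma borel_measurable_cdf_esd:
  fixes A :: "'w \<Rightarrow> real mat"
  assumes n: "n > 0" and A: "\<And>w. A w \<in> carrier_mat n n"
    and meas: "\<And>i j. i < n \<Longrightarrow> j < n \<Longrightarrow> (\<lambda>w. A w $$ (i, j)) \<in> borel_measurable M"
    and sym: "\<And>w i j. i < n \<Longrightarrow> j < n \<Longrightarrow> A w $$ (i, j) = A w $$ (j, i)"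
  shows "(\<lambda>w. cdf (esd (A w)) x) \<in> borel_measurable M"
proof (rule borel_measurable_LIMSEQ_real)
  define h where "h m = cts_step x (x + 1 / (real m + 1))" for m :: nat
  have hc: "continuous_on UNIV (h m)" for m
    unfolding h_def by (intro uniformly_continuous_imp_continuous cts_step_uniformly_continuous) simp
  show "(\<lambda>w. \<integral>t. h m t \<partial>esd (A w)) \<in> borel_measurable M" for m
    by (rule borel_measurable_integral_esd[OF n A meas sym hc])
  fix w assume "w \<in> space M"
  obtain d u where s: "is_spectral n (A w) d u"
    using spectral_decomposition[OF A sym] by blast
  note cp = is_spectralD(4)[OF s]
  have "(\<lambda>m. h m t) \<longlonglongrightarrow> indicator {..x} t" for t
  proof (cases "t \<le> x")
    case True
    then show ?thesis by (simp add: h_def cts_step_def)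
  next
    case False
    have "(\<lambda>m. 1 / (real m + 1)) \<longlonglongrightarrow> 0"
      using LIMSEQ_inverse_real_of_nat by (simp add: inverse_eq_divide add.commute)
    then have "\<forall>\<^sub>F m in sequentially. 1 / (real m + 1) < t - x"
      using False by (intro order_tendstoD) auto
    then have "\<forall>\<^sub>F m in sequentially. h m t = indicator {..x} t"
      by eventually_elim (use False in \<open>auto simp: h_def cts_step_def\<close>)
    then show ?thesis by (rule tendsto_eventually)
  qed
  then have "(\<lambda>m. (\<Sum>i<n. h m (d i)) / n) \<longlonglongrightarrow> (\<Sum>i<n. indicator {..x} (d i)) / n"
    by (intro tendsto_intros) (use n in auto)
  moreover have "(\<Sum>i<n. indicator {..x} (d i) :: real) = card {i. i < n \<and> d i \<le> x}"
    by (simp add: indicator_def sum.If_cases Int_def)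
  ultimately show "(\<lambda>m. \<integral>t. h m t \<partial>esd (A w)) \<longlonglongrightarrow> cdf (esd (A w)) x"
    by (simp add: integral_esd(2)[OF n cp] cdf_esd[OF n cp] borel_measurable_continuous_onI[OF hc])
qed

lemma borel_measurable_gram_entry:
  fixes X :: "'w \<Rightarrow> real mat"
  assumes X: "\<And>w. X w \<in> carrier_mat n m"
    and meas: "\<And>i j. i < n \<Longrightarrow> j < m \<Longrightarrow> (\<lambda>w. X w $$ (i, j)) \<in> borel_measurable M"
    and ij: "i < n" "j < n"
  shows "(\<lambda>w. (X w * (X w)\<^sup>T) $$ (i, j)) \<in> borel_measurable M"
  unfolding gram_index[OF X ij] using meas ij by (intro borel_measurable_sum borel_measurable_times) auto

lemma borel_measurable_cdf_gram:
  fixes X :: "'w \<Rightarrow> real mat"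
  assumes n: "n > 0" and X: "\<And>w. X w \<in> carrier_mat n m"
    and meas: "\<And>i j. i < n \<Longrightarrow> j < m \<Longrightarrow> (\<lambda>w. X w $$ (i, j)) \<in> borel_measurable M"
  shows "(\<lambda>w. cdf (esd (X w * (X w)\<^sup>T)) x) \<in> borel_measurable M"
  by (rule borel_measurable_cdf_esd[OF n gram_carrier[OF X] borel_measurable_gram_entry[OF X meas] gram_symmetric[OF X]])

lemma esd_gram_neg:
  fixes X :: "real mat"
  assumes n: "n > 0" and X: "X \<in> carrier_mat n m"
  shows "AE x in esd (X * X\<^sup>T). x \<ge> 0"
proof -
  interpret real_distribution "esd (X * X\<^sup>T)" by (rule real_distribution_esd)
  obtain d u where s: "is_gram_spectral n m X d u" using gram_spectrum[OF X] by blast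
  note cp = is_gram_spectralD(4)[OF s]
  have "(\<integral>x. indicator {..<0} x \<partial>esd (X * X\<^sup>T)) = (\<Sum>i<n. indicator {..<0::real} (d i)) / n"
    by (rule integral_esd(2)[OF n cp]) auto
  also have "(\<Sum>i<n. indicator {..<0::real} (d i)) = (0::real)"
    by (rule sum.neutral) (use is_gram_spectralD(1)[OF s] in \<open>auto simp: indicator_def not_less\<close>)
  finally have "prob {..<0} = 0" by simp
  then have "emeasure (esd (X * X\<^sup>T)) {..<0} = 0" by (simp add: emeasure_eq_measure)
  then have "AE x in esd (X * X\<^sup>T). x \<notin> {..<0}" by (intro AE_not_in) (auto simp: null_sets_def)
  then show ?thesis by (simp add: not_less)
qed

text \<open>The random spectral distribution is a probability kernel, since half-lines form an
  intersection-stable generator and its distribution function is measurable; \<open>\<mu>\<close> is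
  the mixture of this kernel. A genuine distribution is wanted so that the method of moments can be
  applied to averages. Because the spectrum of a Gram matrix is nonnegative, the moments of the
  mixture can be computed by nonnegative integrals.\<close>

lemma averaged_esd:
  fixes X :: "'w \<Rightarrow> real mat" and P :: "'w measure"
  assumes P: "prob_space P" and n: "n > 0" and X: "\<And>w. X w \<in> carrier_mat n m"
    and meas: "\<And>i j. i < n \<Longrightarrow> j < m \<Longrightarrow> (\<lambda>w. X w $$ (i, j)) \<in> borel_measurable P"
    and int: "\<And>k::nat. integrable P (\<lambda>w. \<integral>x. x ^ k \<partial>esd (X w * (X w)\<^sup>T))"
  obtains \<mu> where "real_distribution \<mu>" "\<And>x. cdf \<mu> x = (\<integral>w. cdf (esd (X w * (X w)\<^sup>T)) x \<partial>P)"
    "\<And>k::nat. integrable \<mu> (\<lambda>x. x ^ k)"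
    "\<And>k::nat. (\<integral>x. x ^ k \<partial>\<mu>) = (\<integral>w. (\<integral>x. x ^ k \<partial>esd (X w * (X w)\<^sup>T)) \<partial>P)"
proof -
  interpret P: prob_space P by (rule P)
  define K where "K w = esd (X w * (X w)\<^sup>T)" for w
  have rd: "real_distribution (K w)" for w unfolding K_def by (rule real_distribution_esd)
  have sK: "sets (K w) = sets borel" "space (K w) = UNIV" for w
    using rd[of w] sets_eq_imp_space_eq[of "K w" borel]
    by (auto simp: real_distribution_def real_distribution_axioms_def)
  have cm: "(\<lambda>w. cdf (K w) x) \<in> borel_measurable P" for x
    unfolding K_def by (rule borel_measurable_cdf_gram[OF n X meas])
  have em: "emeasure (K w) {..x} = ennreal (cdf (K w) x)" for w x
  proof -
    interpret real_distribution "K w" by (rule rd)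
    show ?thesis by (simp add: emeasure_eq_measure cdf_def)
  qed
  have KM: "K \<in> measurable P (subprob_algebra borel)"
  proof (rule measurable_subprob_algebra_generated[where \<Omega> = UNIV and G = "range (\<lambda>a. {..a})"])
    show "sets borel = sigma_sets UNIV (range (\<lambda>a::real. {..a}))"
      by (subst borel_eq_atMost) simp
    show "Int_stable (range (\<lambda>a::real. {..a}))" by (auto simp: Int_stable_def)
    show "range (\<lambda>a::real. {..a}) \<subseteq> Pow UNIV" by simp
    show "subprob_space (K w)" for w
      using rd[of w] by (intro prob_space_imp_subprob_space) (simp add: real_distribution_def)
    show "sets (K w) = sets borel" for w by (rule sK)
    show "(\<lambda>w. emeasure (K w) A) \<in> borel_measurable P" if "A \<in> range (\<lambda>a. {..a})" for A
      using that cm em by auto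
    show "(\<lambda>w. emeasure (K w) UNIV) \<in> borel_measurable P"
    proof -
      have "emeasure (K w) UNIV = 1" for w
        using prob_space.emeasure_space_1[of "K w"] rd[of w] sK(2)[of w] by (simp add: real_distribution_def)
      then show ?thesis by simp
    qed
  qed
  define \<mu> where "\<mu> = P \<bind> K"
  have ne: "space P \<noteq> {}" by (rule P.not_empty)
  have s\<mu>: "sets \<mu> = sets borel" unfolding \<mu>_def by (rule sets_bind[OF _ ne]) (simp add: sK)
  have p\<mu>: "prob_space \<mu>"
    unfolding \<mu>_def by (rule P.prob_space_bind[OF _ KM]) (use rd in \<open>auto simp: real_distribution_def\<close>)
  interpret \<mu>: prob_space \<mu> by (rule p\<mu>)
  have rd\<mu>: "real_distribution \<mu>"
    by (intro real_distribution.intro real_distribution_axioms.intro p\<mu> s\<mu>)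
  have cb: "\<bar>cdf (K w) x\<bar> \<le> 1" for w x
  proof -
    interpret real_distribution "K w" by (rule rd)
    show ?thesis using cdf_nonneg[of x] cdf_bounded_prob[of x] by simp
  qed
  have c: "cdf \<mu> x = (\<integral>w. cdf (K w) x \<partial>P)" for x
  proof -
    have "emeasure \<mu> {..x} = (\<integral>\<^sup>+w. emeasure (K w) {..x} \<partial>P)"
      unfolding \<mu>_def by (rule emeasure_bind[OF ne KM]) simp
    also have "\<dots> = (\<integral>\<^sup>+w. ennreal (cdf (K w) x) \<partial>P)" by (simp add: em)
    also have "\<dots> = ennreal (\<integral>w. cdf (K w) x \<partial>P)"
    proof (rule nn_integral_eq_integral)
      show "integrable P (\<lambda>w. cdf (K w) x)"
        by (rule P.integrable_const_bound[of _ 1]) (use cm cb in auto)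
      show "AE w in P. 0 \<le> cdf (K w) x" by (simp add: cdf_def)
    qed
    finally show ?thesis
      by (simp add: \<mu>.emeasure_eq_measure cdf_def integral_nonneg_AE)
  qed
  have nn: "AE x in K w. x \<ge> 0" for w unfolding K_def by (rule esd_gram_neg[OF n X])
  have iK: "integrable (K w) (\<lambda>x. x ^ k)" for w and k :: nat
  proof -
    obtain d u where s: "is_gram_spectral n m (X w) d u" using gram_spectrum[OF X] by blast
    show ?thesis unfolding K_def by (rule integral_esd(1)[OF n is_gram_spectralD(4)[OF s]]) auto
  qed
  have AE\<mu>: "AE x in \<mu>. x \<ge> 0"
    unfolding \<mu>_def by (subst AE_bind[OF KM]) (use nn in auto)
  have nnk: "(\<integral>\<^sup>+x. ennreal (x ^ k) \<partial>\<mu>) = ennreal (\<integral>w. (\<integral>x. x ^ k \<partial>K w) \<partial>P)" for k :: nat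
  proof -
    have "(\<integral>\<^sup>+x. ennreal (x ^ k) \<partial>\<mu>) = (\<integral>\<^sup>+w. (\<integral>\<^sup>+x. ennreal (x ^ k) \<partial>K w) \<partial>P)"
      unfolding \<mu>_def by (rule nn_integral_bind[OF _ KM]) simp
    also have "\<dots> = (\<integral>\<^sup>+w. ennreal (\<integral>x. x ^ k \<partial>K w) \<partial>P)"
      by (intro nn_integral_cong nn_integral_eq_integral iK eventually_mono[OF nn]) auto
    also have "\<dots> = ennreal (\<integral>w. (\<integral>x. x ^ k \<partial>K w) \<partial>P)"
    proof (rule nn_integral_eq_integral)
      show "integrable P (\<lambda>w. \<integral>x. x ^ k \<partial>K w)" using int[of k] by (simp add: K_def)
      show "AE w in P. 0 \<le> (\<integral>x. x ^ k \<partial>K w)"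
        by (intro AE_I2 integral_nonneg_AE eventually_mono[OF nn]) auto
    qed
    finally show ?thesis .
  qed
  have bm: "(\<lambda>x. x ^ k) \<in> borel_measurable \<mu>" for k :: nat
    unfolding measurable_cong_sets[OF s\<mu> refl] by simp
  have AEk: "AE x in \<mu>. 0 \<le> x ^ k" for k :: nat by (rule eventually_mono[OF AE\<mu>]) simp
  have ik: "integrable \<mu> (\<lambda>x. x ^ k)" for k :: nat
    by (rule integrableI_nonneg[OF bm AEk]) (simp add: nnk)
  have "(\<integral>x. x ^ k \<partial>\<mu>) = (\<integral>w. (\<integral>x. x ^ k \<partial>K w) \<partial>P)" for k :: nat
  proof -
    have "0 \<le> (\<integral>w. (\<integral>x. x ^ k \<partial>K w) \<partial>P)"
      by (intro integral_nonneg_AE AE_I2 eventually_mono[OF nn]) auto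
    then show ?thesis
      using integral_eq_nn_integral[OF bm AEk, of k] nnk[of k] by simp
  qed
  then show ?thesis using that[OF rd\<mu>] c ik by (simp add: K_def)
qed

section \<open>The bounded differences inequality\<close>

text \<open>Induction on the coordinates. Integrating out the coordinate \<open>i\<close> leaves
  \<open>g\<close>, which has the same bounded differences. With the other coordinates fixed, the
  fluctuation of \<open>f\<close> around \<open>g\<close> is controlled by Hoeffding's lemma and
  costs one factor \<open>exp (l^2 c^2 / 2)\<close>.\<close>

lemma bounded_differences_mgf:
  fixes M :: "'i \<Rightarrow> 'b measure" and f :: "('i \<Rightarrow> 'b) \<Rightarrow> real"
  assumes pM: "\<And>i. prob_space (M i)" and fin: "finite I"
    and f: "f \<in> borel_measurable (PiM I M)"
    and B: "\<And>w. w \<in> space (PiM I M) \<Longrightarrow> \<bar>f w\<bar> \<le> B"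
    and d: "\<And>w i x. w \<in> space (PiM I M) \<Longrightarrow> i \<in> I \<Longrightarrow> x \<in> space (M i) \<Longrightarrow> \<bar>f (w(i := x)) - f w\<bar> \<le> c"
    and l: "l > 0"
  shows "(\<integral>\<^sup>+w. ennreal (exp (l * (f w - (\<integral>v. f v \<partial>PiM I M)))) \<partial>PiM I M)
     \<le> ennreal (exp (card I * (l\<^sup>2 * c\<^sup>2 / 2)))"
  using fin f B d
proof (induction I arbitrary: f rule: finite_induct)
  case empty
  interpret product_prob_space M by (simp add: pM product_prob_spaceI)
  interpret E: prob_space "PiM {} M" by (rule prob_space_PiM) (rule pM)
  have "(\<integral>v. f v \<partial>PiM {} M) = f (\<lambda>_. undefined)"
  proof -
    have "(\<integral>v. f v \<partial>PiM {} M) = (\<integral>v. f (\<lambda>_. undefined) \<partial>PiM {} M)"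
      by (intro Bochner_Integration.integral_cong) (auto simp: space_PiM_empty)
    then show ?thesis by (simp add: E.prob_space)
  qed
  moreover have "(\<integral>\<^sup>+w. ennreal (exp (l * (f w - f (\<lambda>_. undefined)))) \<partial>PiM {} M)
      = (\<integral>\<^sup>+w. 1 \<partial>PiM {} M)"
    by (intro nn_integral_cong) (auto simp: space_PiM_empty)
  ultimately show ?case by (simp add: E.emeasure_space_1)
next
  case (insert i I f)
  interpret Mi: prob_space "M i" by (rule pM)
  interpret product_prob_space M by (simp add: pM product_prob_spaceI)
  interpret Pi: prob_space "PiM I M" by (rule prob_space_PiM) (rule pM)
  interpret Pii: prob_space "PiM (insert i I) M" by (rule prob_space_PiM) (rule pM)
  note f = insert.prems(1)
  have upd: "w(i := x) \<in> space (PiM (insert i I) M)" if "w \<in> space (PiM I M)" "x \<in> space (M i)" for w x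
    using that by (auto simp: space_PiM PiE_iff extensional_def)
  define g where "g w = (\<integral>x. f (w(i := x)) \<partial>M i)" for w
  have pm: "(\<lambda>(w, x). f (w(i := x))) \<in> borel_measurable (PiM I M \<Otimes>\<^sub>M M i)"
    using measurable_comp[OF measurable_add_dim[of i I M] f] by (simp add: comp_def case_prod_beta')
  have gm: "g \<in> borel_measurable (PiM I M)"
    unfolding g_def by (rule Mi.borel_measurable_lebesgue_integral[OF pm])
  have fx: "(\<lambda>x. f (w(i := x))) \<in> borel_measurable (M i)" if "w \<in> space (PiM I M)" for w
    using measurable_compose[OF measurable_Pair1'[OF that] pm] by simp
  have fxi: "integrable (M i) (\<lambda>x. f (w(i := x)))" if "w \<in> space (PiM I M)" for w
    by (rule Mi.integrable_const_bound[of _ B], rule AE_I2)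
      (use fx[OF that] insert.prems(2)[OF upd[OF that]] in \<open>simp_all only: real_norm_def\<close>)
  have fi: "integrable (PiM (insert i I) M) f"
    by (rule Pii.integrable_const_bound[of _ B]) (use f insert.prems(2) in auto)
  have gB: "\<bar>g w\<bar> \<le> B" if "w \<in> space (PiM I M)" for w
  proof -
    have "\<bar>g w\<bar> \<le> (\<integral>x. \<bar>f (w(i := x))\<bar> \<partial>M i)" unfolding g_def by (rule integral_abs_bound)
    also have "\<dots> \<le> (\<integral>x. B \<partial>M i)"
      by (rule integral_mono[OF integrable_abs[OF fxi[OF that]] Mi.integrable_const insert.prems(2)[OF upd[OF that]]])
    finally show ?thesis by (simp add: Mi.prob_space)
  qed
  have gd: "\<bar>g (w(j := y)) - g w\<bar> \<le> c" if w: "w \<in> space (PiM I M)" and j: "j \<in> I" and y: "y \<in> space (M j)" for w j y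
  proof -
    have w': "w(j := y) \<in> space (PiM I M)" using w j y by (auto simp: space_PiM PiE_iff extensional_def)
    have ne: "i \<noteq> j" using insert.hyps j by auto
    have "\<bar>g (w(j := y)) - g w\<bar> = \<bar>\<integral>x. f (w(j := y, i := x)) - f (w(i := x)) \<partial>M i\<bar>"
      unfolding g_def by (subst Bochner_Integration.integral_diff) (use fxi[OF w] fxi[OF w'] in auto)
    also have "\<dots> \<le> (\<integral>x. \<bar>f (w(j := y, i := x)) - f (w(i := x))\<bar> \<partial>M i)" by (rule integral_abs_bound)
    also have "\<dots> \<le> (\<integral>x. c \<partial>M i)"
    proof (rule integral_mono)
      fix x assume x: "x \<in> space (M i)"
      show "\<bar>f (w(j := y, i := x)) - f (w(i := x))\<bar> \<le> c"
using insert.prems(3)[OF upd[OF w x] _ y] j unfolding fun_upd_twist[OF ne[symmetric]] by blast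
    qed (use fxi[OF w] fxi[OF w'] in auto)
    finally show ?thesis by (simp add: Mi.prob_space)
  qed
  have Ef: "(\<integral>v. f v \<partial>PiM (insert i I) M) = (\<integral>w. g w \<partial>PiM I M)"
    unfolding g_def by (rule product_integral_insert[OF insert.hyps fi])
  define m where "m = (\<integral>w. g w \<partial>PiM I M)"
  have em: "(\<lambda>w. ennreal (exp (l * (f w - m)))) \<in> borel_measurable (PiM (insert i I) M)" using f by measurable
  have "(\<integral>\<^sup>+w. ennreal (exp (l * (f w - m))) \<partial>PiM (insert i I) M)
      = (\<integral>\<^sup>+w. (\<integral>\<^sup>+x. ennreal (exp (l * (f (w(i := x)) - m))) \<partial>M i) \<partial>PiM I M)"
    by (rule product_nn_integral_insert[OF insert.hyps em])
  also have "\<dots> \<le> (\<integral>\<^sup>+w. ennreal (exp (l * (g w - m))) * ennreal (exp (l\<^sup>2 * c\<^sup>2 / 2)) \<partial>PiM I M)"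
  proof (rule nn_integral_mono)
    fix w assume w: "w \<in> space (PiM I M)"
    obtain x0 where x0: "x0 \<in> space (M i)" using Mi.not_empty by blast
    \<comment> \<open>All values lie within \<open>c\<close> of the value at one reference point,
      hence in an interval of length \<open>2 c\<close>. Hoeffding's exponent
      \<open>l^2 (2 c)^2 / 8\<close> is the \<open>l^2 c^2 / 2\<close> of the statement.\<close>
    define a where "a = f (w(i := x0))"
    have rng: "f (w(i := x)) \<in> {a - c..a + c}" if "x \<in> space (M i)" for x
      using insert.prems(3)[OF upd[OF w x0] _ that] unfolding fun_upd_upd a_def atLeastAtMost_iff abs_le_iff
      by (smt (verit) insertI1)
    interpret b: interval_bounded_random_variable "M i" "\<lambda>x. f (w(i := x))" "a - c" "a + c"
      by unfold_locales (use fx[OF w] rng in auto)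
    have "(\<integral>\<^sup>+x. ennreal (exp (l * (f (w(i := x)) - m))) \<partial>M i)
       = (\<integral>\<^sup>+x. ennreal (exp (l * (g w - m))) * ennreal (exp (l * (f (w(i := x)) - g w))) \<partial>M i)"
      by (intro nn_integral_cong) (simp add: ennreal_mult[symmetric] exp_add[symmetric] algebra_simps)
    also have "\<dots> = ennreal (exp (l * (g w - m))) * (\<integral>\<^sup>+x. ennreal (exp (l * (f (w(i := x)) - g w))) \<partial>M i)"
      by (intro nn_integral_cmult) (use fx[OF w] in measurable)
    also have "\<dots> \<le> ennreal (exp (l * (g w - m))) * ennreal (exp (l\<^sup>2 * c\<^sup>2 / 2))"
    proof (rule mult_left_mono)
      have "(\<integral>\<^sup>+x. ennreal (exp (l * (f (w(i := x)) - g w))) \<partial>M i) \<le> ennreal (exp (l\<^sup>2 * ((a + c) - (a - c))\<^sup>2 / 8))"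
        unfolding g_def by (rule b.Hoeffdings_lemma_nn_integral[OF l])
      also have "l\<^sup>2 * ((a + c) - (a - c))\<^sup>2 / 8 = l\<^sup>2 * c\<^sup>2 / 2" by (simp add: power2_eq_square)
      finally show "(\<integral>\<^sup>+x. ennreal (exp (l * (f (w(i := x)) - g w))) \<partial>M i) \<le> ennreal (exp (l\<^sup>2 * c\<^sup>2 / 2))" .
    qed simp
    finally show "(\<integral>\<^sup>+x. ennreal (exp (l * (f (w(i := x)) - m))) \<partial>M i)
      \<le> ennreal (exp (l * (g w - m))) * ennreal (exp (l\<^sup>2 * c\<^sup>2 / 2))" .
  qed
  also have "\<dots> = (\<integral>\<^sup>+w. ennreal (exp (l * (g w - m))) \<partial>PiM I M) * ennreal (exp (l\<^sup>2 * c\<^sup>2 / 2))"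
    by (intro nn_integral_multc) (use gm in measurable)
  also have "\<dots> \<le> ennreal (exp (card I * (l\<^sup>2 * c\<^sup>2 / 2))) * ennreal (exp (l\<^sup>2 * c\<^sup>2 / 2))"
    unfolding m_def by (rule mult_right_mono[OF insert.IH[OF gm gB gd]]) auto
  also have "\<dots> = ennreal (exp (card (insert i I) * (l\<^sup>2 * c\<^sup>2 / 2)))"
    using insert.hyps by (simp add: ennreal_mult[symmetric] exp_add[symmetric] algebra_simps)
  finally show ?case unfolding Ef m_def[symmetric] .
qed

text \<open>Chernoff's bound, that is, Markov's inequality for \<open>exp (l (f - m))\<close>. The
  choice \<open>l = \<delta> / (c^2 |I|)\<close> minimises the exponent
  \<open>- l \<delta> + |I| l^2 c^2 / 2\<close>.\<close>

lemma bounded_differences_upper_tail: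
  fixes M :: "'i \<Rightarrow> 'b measure" and f :: "('i \<Rightarrow> 'b) \<Rightarrow> real"
  assumes pM: "\<And>i. prob_space (M i)" and fin: "finite I" and ne: "I \<noteq> {}" and c: "c > 0"
    and f: "f \<in> borel_measurable (PiM I M)"
    and B: "\<And>w. w \<in> space (PiM I M) \<Longrightarrow> \<bar>f w\<bar> \<le> B"
    and d: "\<And>w i x. w \<in> space (PiM I M) \<Longrightarrow> i \<in> I \<Longrightarrow> x \<in> space (M i) \<Longrightarrow> \<bar>f (w(i := x)) - f w\<bar> \<le> c"
    and \<delta>: "\<delta> > 0"
  shows "measure (PiM I M) {w\<in>space (PiM I M). \<delta> \<le> f w - (\<integral>v. f v \<partial>PiM I M)}
     \<le> exp (- \<delta>\<^sup>2 / (2 * c\<^sup>2 * card I))"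
proof -
  interpret Pi: prob_space "PiM I M" by (rule prob_space_PiM) (rule pM)
  define m where "m = (\<integral>v. f v \<partial>PiM I M)"
  define l where "l = \<delta> / (c\<^sup>2 * card I)"
  have N: "real (card I) > 0" using fin ne by (simp add: card_gt_0_iff)
  have l: "l > 0" using \<delta> c N by (simp add: l_def)
  have "emeasure (PiM I M) {w\<in>space (PiM I M). \<delta> \<le> f w - m}
     \<le> emeasure (PiM I M) ({w\<in>space (PiM I M). 1 \<le> ennreal (exp (- l * \<delta>)) * ennreal (exp (l * (f w - m)))})"
  proof (rule emeasure_mono)
    show "{w \<in> space (PiM I M). \<delta> \<le> f w - m} \<subseteq> {w\<in>space (PiM I M). 1 \<le> ennreal (exp (- l * \<delta>)) * ennreal (exp (l * (f w - m)))}"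
      using l by (auto simp: ennreal_mult[symmetric] exp_add[symmetric] ennreal_1[symmetric] simp del: ennreal_1 intro!: mult_left_mono)
  qed (use f in measurable)
  also have "\<dots> \<le> ennreal (exp (- l * \<delta>)) * (\<integral>\<^sup>+w. ennreal (exp (l * (f w - m))) \<partial>PiM I M)"
  proof -
    have "emeasure (PiM I M) ({w\<in>space (PiM I M). 1 \<le> ennreal (exp (- l * \<delta>)) * ennreal (exp (l * (f w - m)))})
        \<le> ennreal (exp (- l * \<delta>)) * (\<integral>\<^sup>+w. ennreal (exp (l * (f w - m))) * indicator (space (PiM I M)) w \<partial>PiM I M)"
      by (rule nn_integral_Markov_inequality) (use f in measurable)
    also have "(\<integral>\<^sup>+w. ennreal (exp (l * (f w - m))) * indicator (space (PiM I M)) w \<partial>PiM I M) = (\<integral>\<^sup>+w. ennreal (exp (l * (f w - m))) \<partial>PiM I M)"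
      by (intro nn_integral_cong) simp
    finally show ?thesis .
  qed
  also have "\<dots> \<le> ennreal (exp (- l * \<delta>)) * ennreal (exp (card I * (l\<^sup>2 * c\<^sup>2 / 2)))"
    unfolding m_def by (rule mult_left_mono[OF bounded_differences_mgf[OF pM fin f B d l]]) auto
  also have "\<dots> = ennreal (exp (- l * \<delta> + card I * (l\<^sup>2 * c\<^sup>2 / 2)))"
    by (simp add: ennreal_mult[symmetric] exp_add[symmetric])
  also have "- l * \<delta> + card I * (l\<^sup>2 * c\<^sup>2 / 2) = - \<delta>\<^sup>2 / (2 * c\<^sup>2 * card I)"
    using N c unfolding l_def by (simp add: field_simps power2_eq_square)
  finally show ?thesis unfolding m_def by (simp add: Pi.emeasure_eq_measure)
qed

lemma mcdiarmid:
  fixes M :: "'i \<Rightarrow> 'b measure" and f :: "('i \<Rightarrow> 'b) \<Rightarrow> real"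
  assumes pM: "\<And>i. prob_space (M i)" and fin: "finite I" and ne: "I \<noteq> {}" and c: "c > 0"
    and f: "f \<in> borel_measurable (PiM I M)"
    and B: "\<And>w. w \<in> space (PiM I M) \<Longrightarrow> \<bar>f w\<bar> \<le> B"
    and d: "\<And>w i x. w \<in> space (PiM I M) \<Longrightarrow> i \<in> I \<Longrightarrow> x \<in> space (M i) \<Longrightarrow> \<bar>f (w(i := x)) - f w\<bar> \<le> c"
    and \<delta>: "\<delta> > 0"
  shows "measure (PiM I M) {w\<in>space (PiM I M). \<delta> \<le> \<bar>f w - (\<integral>v. f v \<partial>PiM I M)\<bar>}
     \<le> 2 * exp (- \<delta>\<^sup>2 / (2 * c\<^sup>2 * card I))"
proof -
  interpret Pi: prob_space "PiM I M" by (rule prob_space_PiM) (rule pM)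
  define m where "m = (\<integral>v. f v \<partial>PiM I M)"
  let ?A = "{w\<in>space (PiM I M). \<delta> \<le> f w - m}" and ?B = "{w\<in>space (PiM I M). \<delta> \<le> - f w - (- m)}"
  have "Pi.prob {w\<in>space (PiM I M). \<delta> \<le> \<bar>f w - m\<bar>} \<le> Pi.prob (?A \<union> ?B)"
    by (rule Pi.finite_measure_mono) (use f in auto)
  also have "\<dots> \<le> Pi.prob ?A + Pi.prob ?B"
    by (rule measure_Un_le) (use f in measurable)
  also have "Pi.prob ?A \<le> exp (- \<delta>\<^sup>2 / (2 * c\<^sup>2 * card I))"
    unfolding m_def by (rule bounded_differences_upper_tail[OF pM fin ne c f B d \<delta>])
  also have "Pi.prob ?B \<le> exp (- \<delta>\<^sup>2 / (2 * c\<^sup>2 * card I))"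
  proof -
    have "measure (PiM I M) {w\<in>space (PiM I M). \<delta> \<le> - f w - (\<integral>v. - f v \<partial>PiM I M)} \<le> exp (- \<delta>\<^sup>2 / (2 * c\<^sup>2 * card I))"
    proof (rule bounded_differences_upper_tail[OF pM fin ne c _ _ _ \<delta>])
      show "(\<lambda>w. - f w) \<in> borel_measurable (PiM I M)" using f by measurable
      show "\<bar>- f w\<bar> \<le> B" if "w \<in> space (PiM I M)" for w using B[OF that] by simp
      show "\<bar>- f (w(i := x)) - - f w\<bar> \<le> c" if "w \<in> space (PiM I M)" "i \<in> I" "x \<in> space (M i)" for w i x
        using d[OF that] by linarith
    qed
    then show ?thesis by (simp add: m_def)
  qed
  finally show ?thesis unfolding m_def by simp
qed

section \<open>The method of moments\<close>

text \<open>Equal moments give equal Taylor polynomials of the characteristic functions. The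
  remainder of even order is bounded through the moment of order \<open>2 k\<close>, so the two
  functions differ by at most \<open>4 (|t| C)^(2 k) / (2 k)!\<close>, which tends to 0 for every
  \<open>t\<close>.\<close>

lemma char_eq_of_moments:
  assumes M: "real_distribution M" and N: "real_distribution N"
    and iM: "\<And>k::nat. integrable M (\<lambda>x. x ^ k)" and iN: "\<And>k::nat. integrable N (\<lambda>x. x ^ k)"
    and eq: "\<And>k::nat. (\<integral>x. x ^ k \<partial>M) = (\<integral>x. x ^ k \<partial>N)"
    and C: "\<And>k::nat. (\<integral>x. x ^ (2 * k) \<partial>M) \<le> C ^ (2 * k)"
  shows "char M t = char N t"
proof -
  interpret M: real_distribution M by (rule M)
  interpret N: real_distribution N by (rule N)
  define S where "S n = (\<Sum>k\<le>n. ((\<i> * complex_of_real t) ^ k / fact k) * complex_of_real (\<integral>x. x ^ k \<partial>M))" for n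
  have b: "cmod (char M t - char N t) \<le> 4 * (\<bar>t\<bar> * C) ^ (2 * k) / fact (2 * k)" for k
  proof -
    have 1: "cmod (char M t - S (2 * k)) \<le> (2 * \<bar>t\<bar> ^ (2 * k) / fact (2 * k)) * (\<integral>x. \<bar>x\<bar> ^ (2 * k) \<partial>M)"
      unfolding S_def by (rule M.char_approx1) (rule iM)
    have 2: "cmod (char N t - S (2 * k)) \<le> (2 * \<bar>t\<bar> ^ (2 * k) / fact (2 * k)) * (\<integral>x. \<bar>x\<bar> ^ (2 * k) \<partial>N)"
      unfolding S_def eq by (rule N.char_approx1) (rule iN)
    have ab: "\<bar>x\<bar> ^ (2 * k) = x ^ (2 * k)" for x :: real by (simp add: power_even_abs)
    have "cmod (char M t - char N t) \<le> cmod (char M t - S (2 * k)) + cmod (char N t - S (2 * k))"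
      using norm_triangle_ineq4[of "char M t - S (2 * k)" "char N t - S (2 * k)"] by simp
    also have "\<dots> \<le> (2 * \<bar>t\<bar> ^ (2 * k) / fact (2 * k)) * (\<integral>x. x ^ (2 * k) \<partial>M)
        + (2 * \<bar>t\<bar> ^ (2 * k) / fact (2 * k)) * (\<integral>x. x ^ (2 * k) \<partial>M)"
      using 1 2 unfolding ab eq by (rule add_mono)
    also have "\<dots> \<le> (2 * \<bar>t\<bar> ^ (2 * k) / fact (2 * k)) * C ^ (2 * k) + (2 * \<bar>t\<bar> ^ (2 * k) / fact (2 * k)) * C ^ (2 * k)"
      by (intro add_mono mult_left_mono C) auto
    also have "\<dots> = 4 * (\<bar>t\<bar> * C) ^ (2 * k) / fact (2 * k)" by (simp add: power_mult_distrib)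
    finally show ?thesis .
  qed
  have "(\<lambda>n. (\<bar>t\<bar> * C) ^ n / fact n) \<longlonglongrightarrow> 0"
    using summable_LIMSEQ_zero[OF summable_exp[of "\<bar>t\<bar> * C"]] by (simp add: field_simps)
  then have "(\<lambda>k. 4 * ((\<bar>t\<bar> * C) ^ (2 * k) / fact (2 * k))) \<longlonglongrightarrow> 4 * 0"
    by (intro tendsto_mult tendsto_const LIMSEQ_subseq_LIMSEQ[where f = "\<lambda>k. 2 * k", unfolded o_def]) (auto simp: strict_mono_def)
  then have "cmod (char M t - char N t) \<le> 0"
    by (intro LIMSEQ_le_const[where X = "\<lambda>k. 4 * (\<bar>t\<bar> * C) ^ (2 * k) / fact (2 * k)"]) (use b in auto)
  then show ?thesis by simp
qed

lemma moment_determinate: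
  assumes M: "real_distribution M" and N: "real_distribution N"
    and iM: "\<And>k::nat. integrable M (\<lambda>x. x ^ k)" and iN: "\<And>k::nat. integrable N (\<lambda>x. x ^ k)"
    and eq: "\<And>k::nat. (\<integral>x. x ^ k \<partial>M) = (\<integral>x. x ^ k \<partial>N)"
    and C: "\<And>k::nat. (\<integral>x. x ^ (2 * k) \<partial>M) \<le> C ^ (2 * k)"
  shows "M = N"
  by (rule Levy_uniqueness[OF M N]) (rule ext, rule char_eq_of_moments[OF assms])

text \<open>Powers are unbounded, so weak convergence is applied to powers of the clipped identity
  \<open>cl a\<close>. Bounds on even moments pass to \<open>F\<close> by monotone convergence in
  \<open>a\<close>, and they control the error of clipping uniformly in \<open>n\<close>; this is
  uniform integrability in quantitative form.\<close>

lemma weak_limit_moments: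
  fixes \<mu> :: "nat \<Rightarrow> real measure"
  assumes \<mu>: "\<And>n. real_distribution (\<mu> n)" and F: "real_distribution F" and w: "weak_conv_m \<mu> F"
    and i: "\<And>n k. integrable (\<mu> n) (\<lambda>x. x ^ (k::nat))"
    and lim: "\<And>k::nat. (\<lambda>n. \<integral>x. x ^ k \<partial>\<mu> n) \<longlonglongrightarrow> m k"
  shows "integrable F (\<lambda>x. x ^ (k::nat))" "(\<integral>x. x ^ k \<partial>F) = m k"
proof -
  interpret F: real_distribution F by (rule F)
  have rd: "real_distribution (\<mu> n)" for n by (rule \<mu>)
  have "\<exists>B. \<forall>n. (\<integral>x. x ^ (2 * k) \<partial>\<mu> n) \<le> B k" for k :: nat
  proof -
    have "Bseq (\<lambda>n. \<integral>x. x ^ (2 * k) \<partial>\<mu> n)" using lim[of "2 * k"] by (rule convergent_imp_Bseq[OF convergentI])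
    then obtain K where "\<And>n. norm (\<integral>x. x ^ (2 * k) \<partial>\<mu> n) \<le> K" by (auto simp: Bseq_def)
    then show ?thesis by (intro exI[of _ "\<lambda>_. K"]) (auto simp: abs_le_iff)
  qed
  then have "\<forall>k. \<exists>b. \<forall>n. (\<integral>x. x ^ (2 * k) \<partial>\<mu> n) \<le> b" by blast
  then obtain B where B: "\<And>k n. (\<integral>x. x ^ (2 * k) \<partial>\<mu> n) \<le> B k" by metis
  define cl where "cl a x = max (- a) (min a x)" for a x :: real
  have cl_bd: "\<bar>cl a x\<bar> \<le> a" if "a \<ge> 0" for a x using that by (auto simp: cl_def)
  have cl_abs: "\<bar>cl a x\<bar> \<le> \<bar>x\<bar>" if "a \<ge> 0" for a x using that by (auto simp: cl_def)
  have cl_id: "\<bar>x\<bar> \<le> a \<Longrightarrow> cl a x = x" for a x by (auto simp: cl_def)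
  have cl_cont: "continuous_on UNIV (\<lambda>x. cl a x ^ k)" for a and k :: nat
    unfolding cl_def by (intro continuous_intros)
  have cl_meas: "(\<lambda>x. cl a x ^ k) \<in> borel_measurable borel" for a and k :: nat
    by (rule borel_measurable_continuous_onI[OF cl_cont])
  have cl_le: "\<bar>cl a x ^ k\<bar> \<le> a ^ k" if "a \<ge> 0" for a x and k :: nat
    unfolding power_abs by (intro power_mono cl_bd that) simp
  have cl_lim: "(\<lambda>n. \<integral>x. cl a x ^ k \<partial>\<mu> n) \<longlonglongrightarrow> (\<integral>x. cl a x ^ k \<partial>F)" if "a \<ge> 0" for a and k :: nat
    by (rule weak_conv_imp_integral_bdd_continuous_conv[OF rd F w, where B = "a ^ k"])
      (use cl_le[OF that] cl_cont in \<open>auto simp: continuous_on_eq_continuous_at\<close>)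
  have evF: "integrable F (\<lambda>x. x ^ (2 * k))" and evB: "(\<integral>x. x ^ (2 * k) \<partial>F) \<le> B k" for k :: nat
  proof -
    have le: "(\<integral>x. cl a x ^ (2 * k) \<partial>F) \<le> B k" if a: "a \<ge> 0" for a
    proof (rule LIMSEQ_le_const2[OF cl_lim[OF a]], intro exI allI impI)
      fix n
      interpret mn: real_distribution "\<mu> n" by (rule rd)
      have "(\<integral>x. cl a x ^ (2 * k) \<partial>\<mu> n) \<le> (\<integral>x. x ^ (2 * k) \<partial>\<mu> n)"
      proof (rule integral_mono[OF _ i])
        show "integrable (\<mu> n) (\<lambda>x. cl a x ^ (2 * k))"
          by (rule mn.integrable_const_bound[of _ "a ^ (2 * k)"]) (use cl_le[OF a, of _ "2 * k"] cl_meas in auto)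
        fix x
        show "cl a x ^ (2 * k) \<le> x ^ (2 * k)"
          using power_mono[OF cl_abs[OF a, of x], of "2 * k"] by (simp add: power_even_abs)
      qed
      also have "\<dots> \<le> B k" by (rule B)
      finally show "(\<integral>x. cl a x ^ (2 * k) \<partial>\<mu> n) \<le> B k" .
    qed
    have mc: "integrable F (\<lambda>x. x ^ (2 * k)) \<and> (\<integral>x. x ^ (2 * k) \<partial>F) = lim (\<lambda>n. \<integral>x. cl (real n) x ^ (2 * k) \<partial>F)
      \<and> (\<lambda>n. \<integral>x. cl (real n) x ^ (2 * k) \<partial>F) \<longlonglongrightarrow> (\<integral>x. x ^ (2 * k) \<partial>F)"
    proof -
      have int: "integrable F (\<lambda>x. cl (real n) x ^ (2 * k))" for n
        by (rule F.integrable_const_bound[of _ "real n ^ (2 * k)"]) (use cl_le[of "real n" _ "2 * k"] cl_meas in auto)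
      have mono: "cl (real n) x ^ (2 * k) \<le> cl (real n') x ^ (2 * k)" if "n \<le> n'" for n n' x
      proof -
        have "\<bar>cl (real n) x\<bar> \<le> \<bar>cl (real n') x\<bar>" using that by (auto simp: cl_def)
        then show ?thesis using power_mono[of "\<bar>cl (real n) x\<bar>" "\<bar>cl (real n') x\<bar>" "2 * k"] by (simp add: power_even_abs)
      qed
      have "incseq (\<lambda>n. \<integral>x. cl (real n) x ^ (2 * k) \<partial>F)"
        by (intro incseq_SucI integral_mono int mono) simp
      then obtain L where L: "(\<lambda>n. \<integral>x. cl (real n) x ^ (2 * k) \<partial>F) \<longlonglongrightarrow> L"
        using incseq_convergent[of _ "B k"] le by (metis of_nat_0_le_iff)
      have pw: "(\<lambda>n. cl (real n) x ^ (2 * k)) \<longlonglongrightarrow> x ^ (2 * k)" for x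
      proof (rule tendsto_eventually)
        show "\<forall>\<^sub>F n in sequentially. cl (real n) x ^ (2 * k) = x ^ (2 * k)"
          using eventually_ge_at_top[of "nat \<lceil>\<bar>x\<bar>\<rceil>"]
        proof eventually_elim
          case (elim n)
          then have "\<bar>x\<bar> \<le> real n" by linarith
          then show ?case by (simp add: cl_id)
        qed
      qed
      have "has_bochner_integral F (\<lambda>x. x ^ (2 * k)) L"
        by (rule has_bochner_integral_monotone_convergence[OF int _ _ L])
          (use mono pw in \<open>auto simp: mono_def\<close>)
      then show ?thesis using L by (auto simp: has_bochner_integral_iff limI)
    qed
    show "integrable F (\<lambda>x. x ^ (2 * k))" using mc by blast
    show "(\<integral>x. x ^ (2 * k) \<partial>F) \<le> B k"
      by (rule LIMSEQ_le_const2[OF mc[THEN conjunct2, THEN conjunct2]]) (use le in auto)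
  qed
  have intF: "integrable F (\<lambda>x. x ^ k)" for k :: nat
  proof (rule Bochner_Integration.integrable_bound[of F "\<lambda>x. 1 + x ^ (2 * k)"])
    show "integrable F (\<lambda>x. 1 + x ^ (2 * k))" using evF by simp
    have "\<bar>x ^ k\<bar> \<le> 1 + x ^ (2 * k)" for x :: real
    proof -
      have "x ^ (2 * k) = \<bar>x ^ k\<bar> * \<bar>x ^ k\<bar>" by (simp add: power_mult power2_eq_square mult.commute[of 2 k] flip: abs_mult)
      moreover have "\<bar>x ^ k\<bar> \<le> 1 + \<bar>x ^ k\<bar> * \<bar>x ^ k\<bar>"
        using zero_le_power2[of "\<bar>x ^ k\<bar> - 1 / 2"] unfolding power2_eq_square by (simp add: algebra_simps)
      ultimately show ?thesis by simp
    qed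
    then show "AE x in F. norm (x ^ k) \<le> norm (1 + x ^ (2 * k))" by (intro AE_I2) (smt (verit) real_norm_def)
  qed simp
  then show "integrable F (\<lambda>x. x ^ k)" .
  have tail: "\<bar>(\<integral>x. x ^ k \<partial>M) - (\<integral>x. cl a x ^ k \<partial>M)\<bar> \<le> 2 * B k / a ^ k"
    if M: "real_distribution M" and iM: "\<And>k::nat. integrable M (\<lambda>x. x ^ k)" and BM: "(\<integral>x. x ^ (2 * k) \<partial>M) \<le> B k"
      and a: "a > 0" for M a
  proof -
    interpret M: real_distribution M by (rule M)
    have ic: "integrable M (\<lambda>x. cl a x ^ k)"
      by (rule M.integrable_const_bound[of _ "a ^ k"]) (use cl_le[of a _ k] a cl_meas in auto)
    \<comment> \<open>Outside the interval from \<open>-a\<close> to \<open>a\<close> one has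
      \<open>|x|^k a^k \<le> x^(2 k)\<close>: the doubled order of the moment pays for the
      tail.\<close>
    have pt: "\<bar>x ^ k - cl a x ^ k\<bar> \<le> 2 * x ^ (2 * k) / a ^ k" for x
    proof (cases "\<bar>x\<bar> \<le> a")
      case False
      have "\<bar>x ^ k - cl a x ^ k\<bar> \<le> \<bar>x\<bar> ^ k + \<bar>cl a x\<bar> ^ k"
        using abs_triangle_ineq4[of "x ^ k" "cl a x ^ k"] by (simp add: power_abs)
      also have "\<bar>cl a x\<bar> ^ k \<le> \<bar>x\<bar> ^ k" using a by (intro power_mono cl_abs) auto
      finally have "\<bar>x ^ k - cl a x ^ k\<bar> \<le> 2 * \<bar>x\<bar> ^ k" by simp
      moreover have "\<bar>x\<bar> ^ k * a ^ k \<le> x ^ (2 * k)"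
      proof -
        have "\<bar>x\<bar> ^ k * a ^ k \<le> \<bar>x\<bar> ^ k * \<bar>x\<bar> ^ k" using False a by (intro mult_left_mono power_mono) auto
        also have "\<dots> = x ^ (2 * k)" by (simp add: power_add[symmetric] mult_2[symmetric] power_even_abs)
        finally show ?thesis .
      qed
      then have "2 * \<bar>x\<bar> ^ k \<le> 2 * x ^ (2 * k) / a ^ k" using a by (simp add: field_simps)
      ultimately show ?thesis by linarith
    qed (use a in \<open>simp add: cl_id\<close>)
    have "\<bar>(\<integral>x. x ^ k \<partial>M) - (\<integral>x. cl a x ^ k \<partial>M)\<bar> = \<bar>\<integral>x. x ^ k - cl a x ^ k \<partial>M\<bar>"
      using iM ic by simp
    also have "\<dots> \<le> (\<integral>x. \<bar>x ^ k - cl a x ^ k\<bar> \<partial>M)" by (rule integral_abs_bound)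
    also have "\<dots> \<le> (\<integral>x. 2 * x ^ (2 * k) / a ^ k \<partial>M)"
      by (rule integral_mono) (use iM[of k] iM[of "2 * k"] ic pt in auto)
    also have "\<dots> = 2 * (\<integral>x. x ^ (2 * k) \<partial>M) / a ^ k" by simp
    also have "\<dots> \<le> 2 * B k / a ^ k" using BM a by (intro divide_right_mono mult_left_mono) auto
    finally show ?thesis .
  qed
  show "(\<integral>x. x ^ k \<partial>F) = m k"
  \<comment> \<open>For \<open>k = 0\<close> the bound \<open>4 B / a^k\<close> does not decay in
    \<open>a\<close>; the total masses are compared directly.\<close>
  proof (cases "k = 0")
    case True
    have "measure (\<mu> n) (space (\<mu> n)) = 1" for n
    proof -
      interpret mn: real_distribution "\<mu> n" by (rule rd)
      show ?thesis by (rule mn.prob_space)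
    qed
    then have "(\<lambda>n. 1) \<longlonglongrightarrow> m 0" using lim[of 0] by simp
    then have "m 0 = 1" using LIMSEQ_unique tendsto_const by blast
    then show ?thesis using True F.prob_space by simp
  next
    case False
    have est: "\<bar>(\<integral>x. x ^ k \<partial>F) - m k\<bar> \<le> 4 * B k / a ^ k" if a: "a > 0" for a
    proof -
      have "\<bar>(\<integral>x. cl a x ^ k \<partial>F) - m k\<bar> \<le> 2 * B k / a ^ k"
      proof (rule LIMSEQ_le_const2)
        show "(\<lambda>n. \<bar>(\<integral>x. cl a x ^ k \<partial>\<mu> n) - (\<integral>x. x ^ k \<partial>\<mu> n)\<bar>) \<longlonglongrightarrow> \<bar>(\<integral>x. cl a x ^ k \<partial>F) - m k\<bar>"
          using a by (intro tendsto_rabs tendsto_diff cl_lim lim) auto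
        show "\<exists>n0. \<forall>n\<ge>n0. \<bar>(\<integral>x. cl a x ^ k \<partial>\<mu> n) - (\<integral>x. x ^ k \<partial>\<mu> n)\<bar> \<le> 2 * B k / a ^ k"
          using tail[OF rd i B a] by (simp add: abs_minus_commute)
      qed
      then show ?thesis using tail[OF F intF evB a] by linarith
    qed
    have "(\<lambda>n. 4 * B k * (1 / real (Suc n)) ^ k) \<longlonglongrightarrow> 4 * B k * 0 ^ k"
      using LIMSEQ_inverse_real_of_nat by (intro tendsto_intros) (simp add: inverse_eq_divide)
    moreover have "\<bar>(\<integral>x. x ^ k \<partial>F) - m k\<bar> \<le> 4 * B k * (1 / real (Suc n)) ^ k" for n
      using est[of "real (Suc n)"] by (simp add: power_divide)
    ultimately have "\<bar>(\<integral>x. x ^ k \<partial>F) - m k\<bar> \<le> 4 * B k * 0 ^ k"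
      by (intro LIMSEQ_le_const[where X = "\<lambda>n. 4 * B k * (1 / real (Suc n)) ^ k"]) auto
    then show ?thesis using False by (simp add: power_0_left)
  qed
qed

text \<open>Bounded second moments give tightness by Chebyshev's inequality. Every subsequential
  weak limit has the moments \<open>m\<close>, and the geometric bound on the even ones determines
  it, so all subsequences share one limit.\<close>

theorem method_of_moments:
  fixes \<mu> :: "nat \<Rightarrow> real measure"
  assumes \<mu>: "\<And>n. real_distribution (\<mu> n)"
    and i: "\<And>n k. integrable (\<mu> n) (\<lambda>x. x ^ (k::nat))"
    and lim: "\<And>k::nat. (\<lambda>n. \<integral>x. x ^ k \<partial>\<mu> n) \<longlonglongrightarrow> m k"
    and C: "\<And>k::nat. m (2 * k) \<le> C ^ (2 * k)"
  shows "\<exists>F. real_distribution F \<and> weak_conv_m \<mu> F \<and> (\<forall>k. integrable F (\<lambda>x. x ^ k) \<and> (\<integral>x. x ^ k \<partial>F) = m k)"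
proof -
  have tight: "tight \<mu>"
    unfolding tight_def
  proof (intro conjI allI impI \<mu>)
    fix \<epsilon> :: real assume \<epsilon>: "\<epsilon> > 0"
    have "Bseq (\<lambda>n. \<integral>x. x ^ 2 \<partial>\<mu> n)" using lim[of 2] by (rule convergent_imp_Bseq[OF convergentI])
    then obtain K where K: "K > 0" "\<And>n. norm (\<integral>x. x ^ 2 \<partial>\<mu> n) \<le> K" by (auto simp: Bseq_def)
    \<comment> \<open>With \<open>a^2 > K / \<epsilon>\<close> Chebyshev leaves mass below
      \<open>\<epsilon>\<close> outside the interval; the summand 1 makes both \<open>a > 0\<close>
      and this inequality strict.\<close>
    define a where "a = sqrt (K / \<epsilon>) + 1"
    have a: "a > 0" "a\<^sup>2 > K / \<epsilon>"
    proof -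
      have s: "sqrt (K / \<epsilon>) \<ge> 0" using K \<epsilon> by simp
      then show "a > 0" unfolding a_def by linarith
      have "K / \<epsilon> = (sqrt (K / \<epsilon>))\<^sup>2" using K \<epsilon> by simp
      also have "\<dots> < a\<^sup>2" unfolding a_def using s by (intro power_strict_mono) auto
      finally show "a\<^sup>2 > K / \<epsilon>" .
    qed
    have "measure (\<mu> n) {- a<..a} > 1 - \<epsilon>" for n
    proof -
      interpret mn: real_distribution "\<mu> n" by (rule \<mu>)
      have "measure (\<mu> n) {x \<in> space (\<mu> n). a \<le> \<bar>x\<bar>} \<le> (\<integral>x. x\<^sup>2 \<partial>\<mu> n) / a\<^sup>2"
      proof -
        have "measure (\<mu> n) {x \<in> space (\<mu> n). a\<^sup>2 \<le> x\<^sup>2} \<le> (\<integral>x. x\<^sup>2 \<partial>\<mu> n) / a\<^sup>2"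
          using i[of n 2] a by (intro integral_Markov_inequality_measure[where A = "{}"]) auto
        moreover have "(a\<^sup>2 \<le> x\<^sup>2) = (a \<le> \<bar>x\<bar>)" for x using a by (simp add: abs_le_square_iff[symmetric])
        ultimately show ?thesis by simp
      qed
      also have "\<dots> \<le> K / a\<^sup>2" using K(2)[of n] by (intro divide_right_mono) auto
      also have "\<dots> < \<epsilon>" using a \<epsilon> K by (simp add: field_simps)
      finally have "measure (\<mu> n) {x \<in> space (\<mu> n). a \<le> \<bar>x\<bar>} < \<epsilon>" .
      moreover have "measure (\<mu> n) (space (\<mu> n) - {- a<..a}) \<le> measure (\<mu> n) {x \<in> space (\<mu> n). a \<le> \<bar>x\<bar>}"
        by (rule mn.finite_measure_mono) auto
      moreover have "measure (\<mu> n) (space (\<mu> n) - {- a<..a}) = 1 - measure (\<mu> n) {- a<..a}"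
        by (rule mn.prob_compl) simp
      ultimately show ?thesis by linarith
    qed
    then show "\<exists>a b. a < b \<and> (\<forall>n. 1 - \<epsilon> < measure (\<mu> n) {a<..b})"
      using a by (intro exI[of _ "- a"] exI[of _ a]) auto
  qed
  have sub: "integrable \<nu> (\<lambda>x. x ^ k)" "(\<integral>x. x ^ k \<partial>\<nu>) = m k"
    if "strict_mono s" "real_distribution \<nu>" "weak_conv_m (\<mu> \<circ> s) \<nu>" for s \<nu> and k :: nat
  proof -
    have l: "(\<lambda>n. \<integral>x. x ^ k \<partial>(\<mu> \<circ> s) n) \<longlonglongrightarrow> m k" for k :: nat
      using LIMSEQ_subseq_LIMSEQ[OF lim that(1), of k] by (simp add: o_def)
    show "integrable \<nu> (\<lambda>x. x ^ k)" "(\<integral>x. x ^ k \<partial>\<nu>) = m k"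
      using weak_limit_moments[OF _ that(2,3) _ l, of k] \<mu> i by (auto simp: o_def)
  qed
  obtain r F where rF: "strict_mono r" "real_distribution F" "weak_conv_m (\<mu> \<circ> id \<circ> r) F"
    using tight_imp_convergent_subsubsequence[OF tight, of id] by (auto simp: strict_mono_def)
  have Fm: "integrable F (\<lambda>x. x ^ k)" "(\<integral>x. x ^ k \<partial>F) = m k" for k :: nat
    using sub[OF rF(1,2)] rF(3) by (auto simp: o_def)
  have "weak_conv_m \<mu> F"
  proof (rule tight_subseq_weak_converge[OF \<mu> rF(2) tight])
    fix s \<nu> assume s: "strict_mono s" "real_distribution \<nu>" "weak_conv_m (\<mu> \<circ> s) \<nu>"
    have "F = \<nu>"
      by (rule moment_determinate[OF rF(2) s(2) Fm(1) sub(1)[OF s]]) (use Fm(2) sub(2)[OF s] C in auto)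
    then show "weak_conv_m (\<mu> \<circ> s) F" using s by simp
  qed
  then show ?thesis using rF(2) Fm by blast
qed

section \<open>Lagrange inversion\<close>

text \<open>Up to the factor \<open>n + 1\<close> the series is the derivative of a power of
  \<open>F\<close>, and derivatives have residue 0. Negative powers are treated in the same way
  below; the logarithmic derivative \<open>F' / F\<close> is the exception.\<close>

lemma fls_residue_power_times_deriv:
  fixes F :: "real fls"
  assumes F: "F \<noteq> 0"
  shows "fls_residue (F ^ n * fls_deriv F) = 0"
proof -
  have "fls_deriv (F ^ Suc n) = of_nat (Suc n) * (F ^ n * fls_deriv F)"
    by (subst fls_deriv_power) (simp add: mult_ac)
  then have "of_nat (Suc n) * fls_residue (F ^ n * fls_deriv F) = (0::real)"
    using fls_residue_of_int_times(1)[of "int (Suc n)" "F ^ n * fls_deriv F"] fls_residue_deriv[of "F ^ Suc n"]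
    by (metis of_int_of_nat_eq)
  then show ?thesis by (metis mult_eq_0_iff of_nat_neq_0)
qed

lemma fls_residue_inverse_power_times_deriv:
  fixes F :: "real fls"
  assumes F: "F \<noteq> 0" and n: "n \<noteq> 1"
  shows "fls_residue (inverse F ^ n * fls_deriv F) = 0"
proof (cases "n = 0")
  case True
  then show ?thesis using fls_residue_deriv[of F] by simp
next
  case False
  then obtain m where m: "n = Suc (Suc m)" using n by (metis One_nat_def old.nat.exhaust)
  have d: "fls_deriv (inverse F) = - (fls_deriv F * (inverse F)\<^sup>2)"
    using F by (simp add: fls_inverse_deriv power2_eq_square)
  have "fls_deriv (inverse F ^ Suc m) = - of_nat (Suc m) * (inverse F ^ n * fls_deriv F)"
    by (subst fls_deriv_power) (simp add: d m power2_eq_square algebra_simps)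
  then have "of_nat (Suc m) * fls_residue (inverse F ^ n * fls_deriv F) = (0::real)"
    using fls_residue_of_int_times(1)[of "- int (Suc m)" "inverse F ^ n * fls_deriv F"] fls_residue_deriv[of "inverse F ^ Suc m"]
    by (metis mult_minus_left neg_equal_0_iff_equal of_int_minus of_int_of_nat_eq)
  then show ?thesis by (metis mult_eq_0_iff of_nat_neq_0)
qed

text \<open>Lagrange inversion: divide \<open>a ^ k = X ^ k \<phi>(a) ^ k\<close> by \<open>a ^ k X ^ k\<close>, multiply by \<open>a'\<close>,
  and take residues; only the term \<open>a' / a\<close> survives on the right.\<close>

lemma lagrange_inversion:
  fixes a :: "real fps" and e :: "'j \<Rightarrow> nat"
  assumes sub: "subdegree a = 1" and k: "k \<ge> 1" and J: "finite J"
    and eq: "a ^ k = fps_X ^ k * (\<Sum>j\<in>J. fps_const (c j) * a ^ e j)"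
  shows "real k * fps_nth a k = (\<Sum>j\<in>J. if e j = k - 1 then c j else 0)"
proof -
  define F where "F = fps_to_fls a"
  have nz: "a \<noteq> 0" using sub by auto
  have F: "F \<noteq> 0" using nz by (simp add: F_def)
  have "fps_to_fls (\<Sum>j\<in>J. fps_const (c j) * a ^ e j) = (\<Sum>j\<in>J. fls_const (c j) * F ^ e j)"
    using J by (induction J rule: finite_induct)
      (simp_all add: F_def fls_times_fps_to_fls fps_to_fls_power fps_const_to_fls)
  then have FE: "F ^ k = fls_X ^ k * (\<Sum>j\<in>J. fls_const (c j) * F ^ e j)"
    using arg_cong[OF eq, of fps_to_fls] by (simp add: F_def fls_times_fps_to_fls fps_to_fls_power)
  have Xi: "fls_X_inv ^ k * fls_X ^ k = (1 :: real fls)"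
    by (metis fls_inverse_X_power left_inverse power_not_zero fls_X_nonzero)
  have Fi: "inverse F ^ k * F ^ k = 1"
    using F by (simp add: power_mult_distrib[symmetric])
  have "fls_X_inv ^ k * fls_deriv F = (inverse F ^ k * F ^ k) * fls_X_inv ^ k * fls_deriv F" by (simp add: Fi)
  also have "\<dots> = (fls_X_inv ^ k * fls_X ^ k) * (\<Sum>j\<in>J. fls_const (c j) * F ^ e j) * inverse F ^ k * fls_deriv F"
    by (simp only: FE mult_ac)
  also have "\<dots> = (\<Sum>j\<in>J. fls_const (c j) * (F ^ e j * inverse F ^ k * fls_deriv F))"
    by (simp only: Xi mult_1_left sum_distrib_right mult.assoc)
  finally have "fls_residue (fls_X_inv ^ k * fls_deriv F)
      = fls_residue (\<Sum>j\<in>J. fls_const (c j) * (F ^ e j * inverse F ^ k * fls_deriv F))" by simp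
  also have "\<dots> = (\<Sum>j\<in>J. fls_residue (fls_const (c j) * (F ^ e j * inverse F ^ k * fls_deriv F)))"
    using J by (induction J rule: finite_induct) simp_all
  also have "\<dots> = (\<Sum>j\<in>J. if e j = k - 1 then c j else 0)"
  proof (intro sum.cong refl)
    fix j assume "j \<in> J"
    \<comment> \<open>The net power of \<open>F\<close> is \<open>e j - k\<close>. The residue
      vanishes unless it is \<open>-1\<close>, that is, \<open>e j = k - 1\<close>; then it is the
      order of \<open>F\<close> at 0, here 1.\<close>
    have "fls_residue (F ^ e j * inverse F ^ k * fls_deriv F) = (if e j = k - 1 then 1 else 0)"
    proof (cases "e j \<ge> k")
      case True
      then obtain n where n: "e j = n + k" by (metis add.commute le_Suc_ex)
      have "F ^ e j * inverse F ^ k = F ^ n" using Fi by (simp add: n power_add mult_ac)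
      then show ?thesis using fls_residue_power_times_deriv[OF F, of n] n k by auto
    next
      case False
      then obtain n where n: "k = n + e j" "n \<noteq> 0" by (metis add.commute le_Suc_ex linear add_0)
      have "F ^ e j * inverse F ^ k = inverse F ^ n * (inverse F ^ e j * F ^ e j)" by (simp add: n power_add mult_ac)
      also have "\<dots> = inverse F ^ n" using F by (simp add: power_mult_distrib[symmetric])
      finally have *: "F ^ e j * inverse F ^ k = inverse F ^ n" .
      show ?thesis
      proof (cases "n = 1")
        case True
        have "fls_residue (inverse F * fls_deriv F) = 1"
          using fls_residue_deriv_times_inverse_eq_subdegree(2)[of F] sub by (simp add: F_def fls_subdegree_fls_to_fps)
        then show ?thesis using True n unfolding * by simp
      next
        case False
        then show ?thesis using fls_residue_inverse_power_times_deriv[OF F False] n unfolding * by auto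
      qed
    qed
    then show "fls_residue (fls_const (c j) * (F ^ e j * inverse F ^ k * fls_deriv F)) = (if e j = k - 1 then c j else 0)"
      by (subst fls_residue_fls_const_times) simp
  qed
  \<comment> \<open>On this side the residue is the coefficient of \<open>a'\<close> at
    \<open>k - 1\<close>, that is, \<open>k\<close> times the coefficient of \<open>a\<close> at
    \<open>k\<close>.\<close>
  also have "fls_residue (fls_X_inv ^ k * fls_deriv F) = fls_nth (fls_deriv F) (int k - 1)"
    by (subst fls_X_inv_power_times_conv_shift) simp
  also have "\<dots> = real k * fps_nth a k" using k by (simp add: F_def)
  finally show ?thesis .
qed

text \<open>Lagrange inversion for \<open>\<phi>(a) = (1 + a) (y + a)^2\<close>: the power
  \<open>\<phi>(a)^k\<close> is expanded by two binomial sums, and the pairs of exponents with sum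
  \<open>k - 1\<close> are collected.\<close>

lemma cubic_series_coeff:
  fixes a :: "real fps" and y :: real
  assumes eq: "a = fps_X * (1 + a) * (fps_const y + a)\<^sup>2" and y: "y \<noteq> 0" and k: "k \<ge> 1"
  shows "fps_nth a k = (\<Sum>i = 0..k - 1. 1 / real k * real ((2 * k) choose i) * real (k choose (i + 1)) * y ^ (2 * k - i))"
proof -
  have a0: "fps_nth a 0 = 0" by (subst eq) simp
  have "a = fps_X * ((1 + a) * (fps_const y + a)\<^sup>2)" using eq by (simp only: mult.assoc)
  then have "fps_nth a 1 = fps_nth ((1 + a) * (fps_const y + a)\<^sup>2) 0" by (metis One_nat_def diff_Suc_1 fps_X_mult_nth less_numeral_extra(1) neq0_conv not_one_less_zero)
  then have a1: "fps_nth a 1 = y\<^sup>2" by (simp add: a0 power2_eq_square)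
  \<comment> \<open>Here \<open>y \<noteq> 0\<close> enters: the linear coefficient of
    \<open>a\<close> is \<open>y^2\<close>, so the order of \<open>a\<close> is exactly 1.\<close>
  have sub: "subdegree a = 1"
    by (rule subdegreeI) (use a0 a1 y in auto)
  \<comment> \<open>A pair \<open>(i, j)\<close> stands for the term \<open>a^i\<close> of
    \<open>(1 + a)^k\<close> times the term \<open>a^j\<close> of
    \<open>(y + a)^(2 k)\<close>.\<close>
  define J where "J = {..k} \<times> {..2 * k}"
  define e where "e = (\<lambda>(i::nat, j::nat). i + j)"
  define c where "c = (\<lambda>(i, j). real (k choose i) * real ((2 * k) choose j) * y ^ (2 * k - j))"
  have "(1 + a) ^ k = (\<Sum>i\<le>k. fps_const (real (k choose i)) * a ^ i)"
    using binomial_ring[of a 1 k] by (simp add: add.commute fps_of_nat)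
  moreover have "(fps_const y + a) ^ (2 * k) = (\<Sum>j\<le>2*k. fps_const (real ((2 * k) choose j) * y ^ (2 * k - j)) * a ^ j)"
    using binomial_ring[of a "fps_const y" "2 * k"]
    by (simp add: add.commute fps_of_nat[symmetric] fps_const_power mult_ac flip: fps_const_mult)
  ultimately have "((1 + a) * (fps_const y + a)\<^sup>2) ^ k = (\<Sum>j\<in>J. fps_const (c j) * a ^ e j)"
    by (simp only: power_mult_distrib power_mult[symmetric] sum_product J_def sum.cartesian_product)
      (intro sum.cong refl, auto simp: c_def e_def power_add mult_ac simp flip: fps_const_mult)
  moreover have "a ^ k = fps_X ^ k * ((1 + a) * (fps_const y + a)\<^sup>2) ^ k"
    by (subst eq) (simp only: power_mult_distrib mult.assoc)
  ultimately have "a ^ k = fps_X ^ k * (\<Sum>j\<in>J. fps_const (c j) * a ^ e j)" by simp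
  from lagrange_inversion[OF sub k _ this]
  have "real k * fps_nth a k = (\<Sum>j\<in>J. if e j = k - 1 then c j else 0)" by (simp add: J_def)
  also have "\<dots> = (\<Sum>j\<in>{j\<in>J. e j = k - 1}. c j)"
    by (rule sum.inter_filter[symmetric]) (simp add: J_def)
  also have "\<dots> = (\<Sum>i\<in>{0..k-1}. c (k - 1 - i, i))"
    by (rule sum.reindex_bij_witness[of _ "\<lambda>i. (k - 1 - i, i)" snd]) (auto simp: J_def e_def intro!: arg_cong[of _ _ c])
  also have "\<dots> = (\<Sum>i = 0..k - 1. real ((2 * k) choose i) * real (k choose (i + 1)) * y ^ (2 * k - i))"
  proof (intro sum.cong refl)
    fix i assume i: "i \<in> {0..k-1}"
    then have "k choose (k - 1 - i) = k choose (i + 1)"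
      using k by (subst binomial_symmetric) auto
    then show "c (k - 1 - i, i) = real ((2 * k) choose i) * real (k choose (i + 1)) * y ^ (2 * k - i)"
      by (simp add: c_def)
  qed
  finally have "fps_nth a k = (1 / real k) * (\<Sum>i = 0..k - 1. real ((2 * k) choose i) * real (k choose (i + 1)) * y ^ (2 * k - i))"
    using k by (simp add: field_simps)
  then show ?thesis by (simp add: sum_distrib_left mult.assoc)
qed

section \<open>The limiting moments\<close>

text \<open>Limits of normalised traces of words in the Gram matrix and the shift; a word is given by the
  list of its shift exponents, with a Gram matrix between any two of them.\<close>

function word_limit :: "real \<Rightarrow> int list \<Rightarrow> real" where
  "word_limit y [] = 0"
| "word_limit y [z] = of_bool (z = 0)"
| "word_limit y (z # x # xs) = (let w = butlast (x # xs) @ [last (x # xs) + z] in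
     y * word_limit y w
     + (\<Sum>j\<in>{1..<length w}. word_limit y (0 # take j w) * word_limit y (drop j w)))"
  by pat_completeness auto
termination
  by (relation "Wellfounded.measure (\<lambda>(y, zs). length zs)") (auto split: if_splits)

text \<open>Cyclic rotation under a trace: the leading exponent of a word moves behind the last one,
  and the two shifts multiply.\<close>

definition shift_last :: "int list \<Rightarrow> int \<Rightarrow> int list" where
  "shift_last w z = butlast w @ [last w + z]"

lemma length_shift_last [simp]: "w \<noteq> [] \<Longrightarrow> length (shift_last w z) = length w"
  by (simp add: shift_last_def)

lemma word_limit_Cons:
  "w \<noteq> [] \<Longrightarrow> word_limit y (z # w) = y * word_limit y (shift_last w z)
     + (\<Sum>j\<in>{1..<length w}. word_limit y (0 # take j (shift_last w z)) * word_limit y (drop j (shift_last w z)))"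
  by (cases w) (auto simp: shift_last_def Let_def)

lemma sum_list_shift_last: "w \<noteq> [] \<Longrightarrow> sum_list (shift_last w z) = sum_list w + z"
  by (induction w) (auto simp: shift_last_def)

text \<open>The total exponent survives \<open>shift_last\<close> and is additive over a cut, so in
  each product of the recursion at least one factor is again unbalanced. This removes the odd cuts
  of alternating words.\<close>

lemma word_limit_unbalanced: "sum_list zs \<noteq> 0 \<Longrightarrow> word_limit y zs = 0"
proof (induction zs rule: length_induct)
  case (1 zs)
  show ?case
  proof (cases zs)
    case (Cons z w)
    show ?thesis
    proof (cases "w = []")
      case True
      then show ?thesis using 1 Cons by simp
    next
      case False
      let ?w = "shift_last w z"
      have s: "sum_list ?w \<noteq> 0" using 1(2) False by (simp add: Cons sum_list_shift_last)
      have "word_limit y (0 # take j ?w) * word_limit y (drop j ?w) = 0" if j: "j \<in> {1..<length w}" for j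
      proof -
        have "sum_list (take j ?w) + sum_list (drop j ?w) \<noteq> 0"
          using s by (metis append_take_drop_id sum_list_append)
        then have "sum_list (0 # take j ?w) \<noteq> 0 \<or> sum_list (drop j ?w) \<noteq> 0" by auto
        moreover have "length (0 # take j ?w) < length zs" "length (drop j ?w) < length zs"
          using j False by (auto simp: Cons)
        ultimately show ?thesis using 1(1) by auto
      qed
      then have "(\<Sum>j\<in>{1..<length w}. word_limit y (0 # take j ?w) * word_limit y (drop j ?w)) = 0"
        by (intro sum.neutral) blast
      moreover have "word_limit y ?w = 0" using 1(1) s False by (simp add: Cons)
      ultimately show ?thesis by (simp add: Cons word_limit_Cons[OF False])
    qed
  qed simp
qed

lemma shift_last_uminus: "w \<noteq> [] \<Longrightarrow> map uminus (shift_last w z) = shift_last (map uminus w) (- z)"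
  by (simp add: shift_last_def map_butlast last_map)

text \<open>All operations in the recursion commute with negation, and the base case does not see
  the sign. Hence alternating words may start with \<open>1\<close> or with
  \<open>-1\<close>.\<close>

lemma word_limit_uminus: "word_limit y (map uminus zs) = word_limit y zs"
proof (induction zs rule: length_induct)
  case (1 zs)
  show ?case
  proof (cases zs)
    case (Cons z w)
    show ?thesis
    proof (cases "w = []")
      case True
      then show ?thesis using Cons by simp
    next
      case False
      let ?w = "shift_last w z"
      have "word_limit y (0 # take j (map uminus ?w)) = word_limit y (0 # take j ?w)"
        "word_limit y (drop j (map uminus ?w)) = word_limit y (drop j ?w)" if j: "j \<in> {1..<length w}" for j
      proof -
        have "length (0 # take j ?w) < length zs" "length (drop j ?w) < length zs"
          using j False by (auto simp: Cons)
        then have "word_limit y (map uminus (0 # take j ?w)) = word_limit y (0 # take j ?w)"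
          "word_limit y (map uminus (drop j ?w)) = word_limit y (drop j ?w)" using 1 by blast+
        then show "word_limit y (0 # take j (map uminus ?w)) = word_limit y (0 # take j ?w)"
          "word_limit y (drop j (map uminus ?w)) = word_limit y (drop j ?w)" by (simp_all add: take_map drop_map)
      qed
      moreover have "word_limit y (map uminus ?w) = word_limit y ?w" using 1 False by (simp add: Cons)
      ultimately show ?thesis
        using False by (simp add: Cons word_limit_Cons shift_last_uminus[OF False, symmetric])
    qed
  qed simp
qed

section \<open>Alternating words and their generating functions\<close>

definition alt :: "int \<Rightarrow> nat \<Rightarrow> int list" where
  "alt b n = map (\<lambda>i. if even i then b else - b) [0..<n]"

lemma length_alt [simp]: "length (alt b n) = n" by (simp add: alt_def)

lemma take_alt: "j \<le> n \<Longrightarrow> take j (alt b n) = alt b j"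
  by (simp add: alt_def take_map)

lemma drop_alt: "even j \<Longrightarrow> drop j (alt b n) = alt b (n - j)"
  by (rule nth_equalityI) (auto simp: alt_def)

lemma alt_Suc: "alt b (Suc n) = b # alt (- b) n"
  by (auto simp: alt_def map_upt_Suc simp del: upt_Suc)

lemma alt_Suc_snoc: "alt b (Suc n) = alt b n @ [if even n then b else - b]"
  by (simp add: alt_def)

lemma sum_list_alt: "sum_list (alt b n) = (if even n then 0 else b)"
  by (induction n) (auto simp: alt_Suc_snoc, simp add: alt_def)

lemma uminus_alt: "map uminus (alt b n) = alt (- b) n"
  by (auto simp: alt_def)

text \<open>This word has \<open>2 k\<close> Gram factors, as in the trace of
  \<open>(X X^T)^k\<close>. The word of \<open>alt_limit'\<close> has \<open>2 k - 1\<close> and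
  arises from it in one step of the recursion.\<close>

definition alt_limit :: "real \<Rightarrow> nat \<Rightarrow> real" where
  "alt_limit y k = word_limit y (0 # alt 1 (2 * k))"

definition alt_limit' :: "real \<Rightarrow> nat \<Rightarrow> real" where
  "alt_limit' y k = word_limit y (alt 1 (2 * k))"

lemma alt_limit_0: "alt_limit y 0 = 1"
  by (simp add: alt_limit_def alt_def)

lemma alt_limit_uminus: "word_limit y (0 # alt (- 1) (2 * k)) = alt_limit y k"
  using word_limit_uminus[of y "0 # alt 1 (2 * k)"] by (simp add: alt_limit_def uminus_alt)

lemma sum_even_only:
  fixes f :: "nat \<Rightarrow> real"
  assumes odd: "\<And>j. odd j \<Longrightarrow> j < n \<Longrightarrow> f j = 0"
    and n: "n = 2 * k \<or> n + 1 = 2 * k"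
  shows "(\<Sum>j\<in>{1..<n}. f j) = (\<Sum>i\<in>{1..<k}. f (2 * i))"
proof -
  have "(\<Sum>j\<in>{1..<n}. f j) = (\<Sum>j\<in>(\<lambda>i. 2 * i) ` {1..<k}. f j)"
  proof (rule sum.mono_neutral_right)
    show "\<forall>j\<in>{1..<n} - (\<lambda>i. 2 * i) ` {1..<k}. f j = 0"
    proof
      fix j assume j: "j \<in> {1..<n} - (\<lambda>i. 2 * i) ` {1..<k}"
      have "odd j"
      proof
        assume "even j"
        then obtain i where "j = 2 * i" by blast
        then have "j \<in> (\<lambda>i. 2 * i) ` {1..<k}" using j n by auto
        then show False using j by simp
      qed
      then show "f j = 0" using odd j by simp
    qed
  qed (use n in auto)
  also have "\<dots> = (\<Sum>i\<in>{1..<k}. f (2 * i))" by (subst sum.reindex) (auto intro: inj_onI)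
  finally show ?thesis .
qed

text \<open>A cut of \<open>alt 1 (2 * k)\<close> at an odd place leaves unbalanced pieces. The even
  cuts leave two shorter alternating words.\<close>

lemma alt_limit_rec:
  assumes k: "k \<ge> 1"
  shows "alt_limit y k = y * alt_limit' y k + (\<Sum>i\<in>{1..<k}. alt_limit y i * alt_limit' y (k - i))"
proof -
  let ?w = "alt 1 (2 * k)"
  have ne: "?w \<noteq> []" using k by (metis length_alt length_0_conv mult_eq_0_iff not_one_le_zero zero_neq_numeral)
  have sl: "shift_last ?w 0 = ?w" using ne by (simp add: shift_last_def)
  have "(\<Sum>j\<in>{1..<2 * k}. word_limit y (0 # take j ?w) * word_limit y (drop j ?w))
     = (\<Sum>i\<in>{1..<k}. word_limit y (0 # take (2 * i) ?w) * word_limit y (drop (2 * i) ?w))"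
  proof (rule sum_even_only)
    fix j assume "odd j" "j < 2 * k"
    then show "word_limit y (0 # take j ?w) * word_limit y (drop j ?w) = 0"
      by (simp add: word_limit_unbalanced take_alt sum_list_alt)
  qed simp
  also have "\<dots> = (\<Sum>i\<in>{1..<k}. alt_limit y i * alt_limit' y (k - i))"
    by (intro sum.cong refl) (simp add: take_alt drop_alt alt_limit_def alt_limit'_def diff_mult_distrib2)
  finally show ?thesis
    using word_limit_Cons[OF ne, of y 0] by (simp add: alt_limit_def alt_limit'_def sl)
qed

text \<open>For \<open>m > 0\<close> this word and that of \<open>alt_limit y m\<close> are cyclic
  rotations of each other: both become \<open>alt 1 (2 * m)\<close> under \<open>shift_last\<close>,
  so their recursions have the same right-hand side.\<close>

lemma alt_limit_snoc: "word_limit y (alt (- 1) (2 * m) @ [0]) = alt_limit y m"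
proof (cases m)
  case 0
  then show ?thesis by (simp add: alt_limit_0 alt_def)
next
  case (Suc k)
  have e: "alt (- 1) (2 * m) @ [0] = - 1 # (alt 1 (2 * k + 1) @ [0])"
    using alt_Suc[of "- 1" "2 * k + 1"] by (simp add: Suc)
  have "shift_last (alt 1 (2 * k + 1) @ [0]) (- 1) = alt 1 (2 * m)"
    using alt_Suc_snoc[of 1 "2 * k + 1"] by (simp add: shift_last_def Suc)
  moreover have "shift_last (alt 1 (2 * m)) 0 = alt 1 (2 * m)"
    using alt_Suc_snoc[of 1 "2 * k + 1"] by (simp add: shift_last_def Suc)
  moreover have "alt 1 (2 * m) \<noteq> []" using alt_Suc_snoc[of 1 "2 * k + 1"] by (simp add: Suc)
  ultimately show ?thesis
    unfolding e alt_limit_def by (subst word_limit_Cons, simp, subst word_limit_Cons) (simp_all add: Suc)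
qed

text \<open>The leading \<open>1\<close>, moved to the end, cancels the final \<open>-1\<close> and
  leaves the exponent \<open>0\<close>. Therefore both pieces of an even cut, and the uncut word,
  are of the kind evaluated by \<open>alt_limit\<close>.\<close>

lemma alt_limit'_rec:
  assumes k: "k \<ge> 1"
  shows "alt_limit' y k = y * alt_limit y (k - 1) + (\<Sum>i\<in>{1..<k}. alt_limit y i * alt_limit y (k - 1 - i))"
proof -
  obtain m where m: "k = Suc m" using k by (cases k) auto
  let ?v = "alt (- 1) (2 * m + 1)"
  have e: "alt 1 (2 * k) = 1 # ?v"
    using alt_Suc[of 1 "2 * m + 1"] by (simp add: m)
  have sl: "shift_last ?v 1 = alt (- 1) (2 * m) @ [0]"
    using alt_Suc_snoc[of "- 1" "2 * m"] by (simp add: shift_last_def)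
  let ?w = "alt (- 1) (2 * m) @ [0]"
  have "(\<Sum>j\<in>{1..<2 * m + 1}. word_limit y (0 # take j ?w) * word_limit y (drop j ?w))
     = (\<Sum>i\<in>{1..<k}. word_limit y (0 # take (2 * i) ?w) * word_limit y (drop (2 * i) ?w))"
  proof (rule sum_even_only)
    fix j assume "odd j" "j < 2 * m + 1"
    then show "word_limit y (0 # take j ?w) * word_limit y (drop j ?w) = 0"
      by (simp add: word_limit_unbalanced take_alt sum_list_alt)
  qed (simp add: m)
  also have "\<dots> = (\<Sum>i\<in>{1..<k}. alt_limit y i * alt_limit y (k - 1 - i))"
  proof (intro sum.cong refl)
    fix i assume "i \<in> {1..<k}"
    then have i: "i \<le> m" by (simp add: m)
    have "drop (2 * i) ?w = alt (- 1) (2 * (m - i)) @ [0]" using i by (simp add: drop_alt diff_mult_distrib2)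
    moreover have "take (2 * i) ?w = alt (- 1) (2 * i)" using i by (simp add: take_alt)
    ultimately show "word_limit y (0 # take (2 * i) ?w) * word_limit y (drop (2 * i) ?w)
        = alt_limit y i * alt_limit y (k - 1 - i)"
      by (simp only: alt_limit_uminus alt_limit_snoc) (simp add: m)
  qed
  finally have S: "(\<Sum>j\<in>{1..<2 * m + 1}. word_limit y (0 # take j ?w) * word_limit y (drop j ?w))
    = (\<Sum>i\<in>{1..<k}. alt_limit y i * alt_limit y (k - 1 - i))" .
  have "?v \<noteq> []" by (metis length_alt length_0_conv add_is_0 one_neq_zero)
  from word_limit_Cons[OF this, of y 1] have "alt_limit' y k = y * word_limit y ?w
     + (\<Sum>j\<in>{1..<2 * m + 1}. word_limit y (0 # take j ?w) * word_limit y (drop j ?w))"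
    unfolding alt_limit'_def e sl length_alt .
  also have "word_limit y ?w = alt_limit y (k - 1)" by (simp only: alt_limit_snoc) (simp add: m)
  finally show ?thesis by (simp only: S)
qed

text \<open>For the generating functions without constant term the two recursions read
  \<open>a = b (y + a)\<close> and \<open>b = z (1 + a) (y + a)\<close>, where the 1 stands for
  \<open>alt_limit y 0\<close>. Eliminating \<open>b\<close> gives the cubic equation.\<close>

lemma alt_limit_formula:
  assumes y: "y \<noteq> 0" and k: "k \<ge> 1"
  shows "alt_limit y k = (\<Sum>i = 0..k - 1. 1 / real k * real ((2 * k) choose i) * real (k choose (i + 1)) * y ^ (2 * k - i))"
proof -
  define a where "a = Abs_fps (\<lambda>k. if k = 0 then 0 else alt_limit y k)"
  define b where "b = Abs_fps (\<lambda>k. if k = 0 then 0 else alt_limit' y k)"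
  have ab: "a = fps_const y * b + a * b"
  proof (rule fps_ext)
    fix n
    show "fps_nth a n = fps_nth (fps_const y * b + a * b) n"
    proof (cases "n = 0")
      case False
      have "fps_nth (a * b) n = (\<Sum>i\<in>{1..<n}. alt_limit y i * alt_limit' y (n - i))"
        unfolding fps_mult_nth by (rule sum.mono_neutral_cong_right) (auto simp: a_def b_def)
      then show ?thesis using alt_limit_rec[of n y] False by (simp add: a_def b_def)
    qed (simp add: a_def b_def)
  qed
  have b: "b = fps_X * ((1 + a) * (fps_const y + a))"
  proof (rule fps_ext)
    fix n
    have split: "(1 + a) * (fps_const y + a) = fps_const y * (1 + a) + (1 + a) * a"
      by (simp add: algebra_simps)
    show "fps_nth b n = fps_nth (fps_X * ((1 + a) * (fps_const y + a))) n"
    proof (cases n)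
      case (Suc m)
      have a1: "fps_nth (1 + a) i = alt_limit y i" for i by (simp add: a_def alt_limit_0)
      have "fps_nth ((1 + a) * a) m = (\<Sum>i=0..m. alt_limit y (m - i) * fps_nth a i)"
        by (subst mult.commute) (simp only: fps_mult_nth a1 mult.commute)
      also have "\<dots> = (\<Sum>i\<in>{1..<Suc m}. alt_limit y i * alt_limit y (m - i))"
        by (rule sum.mono_neutral_cong_right) (auto simp: a_def)
      finally have "fps_nth ((1 + a) * (fps_const y + a)) m
          = y * alt_limit y m + (\<Sum>i\<in>{1..<Suc m}. alt_limit y i * alt_limit y (m - i))"
        unfolding split by (simp only: fps_add_nth[of "fps_const y * (1 + a)" "(1 + a) * a"] fps_mult_left_const_nth a1)
      then show ?thesis using alt_limit'_rec[of n y] by (simp add: Suc b_def)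
    qed (simp add: b_def)
  qed
  have "a = fps_X * (1 + a) * (fps_const y + a)\<^sup>2"
  proof -
    have "a = b * (fps_const y + a)" using ab by (simp add: algebra_simps)
    also have "\<dots> = fps_X * (1 + a) * (fps_const y + a)\<^sup>2"
      unfolding b power2_eq_square by (simp only: mult.assoc)
    finally show ?thesis .
  qed
  from cubic_series_coeff[OF this y k] show ?thesis using k by (simp add: a_def)
qed

section \<open>Gaussian integration by parts\<close>

text \<open>Polynomial functions as the closure under the operations from which traces are built.
  Integrability and integration by parts are thereby settled once, on monomials.\<close>

inductive polyfun :: "'i set \<Rightarrow> (('i \<Rightarrow> real) \<Rightarrow> real) \<Rightarrow> bool" for I where
  polyfun_const: "polyfun I (\<lambda>_. c)"
| polyfun_var: "e \<in> I \<Longrightarrow> polyfun I (\<lambda>w. w e)"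
| polyfun_add: "polyfun I f \<Longrightarrow> polyfun I g \<Longrightarrow> polyfun I (\<lambda>w. f w + g w)"
| polyfun_mult: "polyfun I f \<Longrightarrow> polyfun I g \<Longrightarrow> polyfun I (\<lambda>w. f w * g w)"

lemma polyfun_sum:
  assumes "\<And>x. x \<in> A \<Longrightarrow> polyfun I (f x)"
  shows "polyfun I (\<lambda>w. \<Sum>x\<in>A. f x w)"
  using assms
  by (induction A rule: infinite_finite_induct) (auto intro: polyfun.intros)

lemma polyfun_prod_list:
  assumes "\<And>x. x \<in> set xs \<Longrightarrow> polyfun I (f x)"
  shows "polyfun I (\<lambda>w. \<Prod>x\<leftarrow>xs. f x w)"
  using assms
  by (induction xs) (auto intro: polyfun.intros)

definition monom_fun :: "'i set \<Rightarrow> ('i \<Rightarrow> nat) \<Rightarrow> ('i \<Rightarrow> real) \<Rightarrow> real" where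
  "monom_fun I n w = (\<Prod>e\<in>I. w e ^ n e)"

lemma monom_fun_add: "monom_fun I n w * monom_fun I m w = monom_fun I (\<lambda>e. n e + m e) w"
  by (simp add: monom_fun_def power_add prod.distrib)

lemma monom_fun_split:
  assumes "finite I" "e \<in> I"
  shows "monom_fun I n w = w e ^ n e * (\<Prod>e'\<in>I - {e}. w e' ^ n e')"
  unfolding monom_fun_def using assms by (rule prod.remove)

text \<open>Repeated monomials are allowed in the list, so a sum is a concatenation and no normal
  form has to be maintained.\<close>

lemma polyfun_monomials:
  assumes fin: "finite I" and "polyfun I f"
  shows "\<exists>L. f = (\<lambda>w. \<Sum>(c, n)\<leftarrow>L. c * monom_fun I n w)"
  using assms(2)
proof induction
  case (polyfun_const c)
  show ?case by (rule exI[of _ "[(c, \<lambda>_. 0)]"]) (simp add: monom_fun_def)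
next
  case (polyfun_var e)
  have "monom_fun I (\<lambda>e'. if e' = e then 1 else 0) w = w e" for w
    using fin polyfun_var by (simp add: monom_fun_split[OF fin polyfun_var])
  then show ?case by (intro exI[of _ "[(1, \<lambda>e'. if e' = e then 1 else 0)]"]) simp
next
  case (polyfun_add f g)
  then obtain L M where "f = (\<lambda>w. \<Sum>(c, n)\<leftarrow>L. c * monom_fun I n w)"
    "g = (\<lambda>w. \<Sum>(c, n)\<leftarrow>M. c * monom_fun I n w)" by blast
  then show ?case by (intro exI[of _ "L @ M"]) simp
next
  case (polyfun_mult f g)
  then obtain L M where LM: "f = (\<lambda>w. \<Sum>(c, n)\<leftarrow>L. c * monom_fun I n w)"
    "g = (\<lambda>w. \<Sum>(c, n)\<leftarrow>M. c * monom_fun I n w)" by blast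
  have "f w * g w = (\<Sum>(c, n)\<leftarrow>concat (map (\<lambda>(c, n). map (\<lambda>(d, m). (c * d, \<lambda>e. n e + m e)) M) L). c * monom_fun I n w)" for w
    unfolding LM
  proof (induction L)
    case (Cons x L)
    obtain c n where x: "x = (c, n)" by force
    have "c * monom_fun I n w * (\<Sum>(c, n)\<leftarrow>M. c * monom_fun I n w)
        = (\<Sum>(c, n)\<leftarrow>map (\<lambda>(d, m). (c * d, \<lambda>e. n e + m e)) M. c * monom_fun I n w)"
      by (induction M) (auto simp: algebra_simps monom_fun_add[symmetric])
    then show ?case using Cons by (simp add: x distrib_right)
  qed simp
  then show ?case by (intro exI) (rule ext)
qed

section \<open>Moments of standard normal variables and of their products\<close>

abbreviation std_normal :: "real measure" where
  "std_normal \<equiv> density lborel std_normal_density"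

definition normal_moment :: "nat \<Rightarrow> real" where
  "normal_moment n = (\<integral>x. x ^ n \<partial>std_normal)"

lemma prob_space_std_normal: "prob_space std_normal"
  by (rule prob_space_normal_density) simp

lemma std_normal_moments:
  "has_bochner_integral std_normal (\<lambda>x. x ^ (2 * k)) (fact (2 * k) / (2 ^ k * fact k))"
  "has_bochner_integral std_normal (\<lambda>x. x ^ (2 * k + 1)) 0"
  using std_normal_moment_even[of k] std_normal_moment_odd[of k]
  by (auto simp: has_bochner_integral_density)

lemma integrable_std_normal_power: "integrable std_normal (\<lambda>x. x ^ n)"
proof (cases "even n")
  case True
  then show ?thesis using std_normal_moments(1)[of "n div 2"] by (auto elim!: evenE simp: has_bochner_integral_iff)
next
  case False
  then show ?thesis using std_normal_moments(2)[of "n div 2"] by (auto elim!: oddE simp: has_bochner_integral_iff)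
qed

lemma normal_moment_even: "normal_moment (2 * k) = fact (2 * k) / (2 ^ k * fact k)"
  and normal_moment_odd: "normal_moment (2 * k + 1) = 0"
  using std_normal_moments[of k] by (simp_all add: normal_moment_def has_bochner_integral_iff)

text \<open>Stein's identity on monomials. At \<open>n = 0\<close> the truncated difference
  \<open>n - 1\<close> does no harm, because the factor \<open>real n\<close> vanishes.\<close>

lemma normal_moment_Suc: "normal_moment (Suc n) = real n * normal_moment (n - 1)"
proof (cases "even n")
  case True
  then obtain k where k: "n = 2 * k" by blast
  have "normal_moment (n - 1) = 0" if "k > 0"
    using that normal_moment_odd[of "k - 1"] by (cases k) (auto simp: k)
  then show ?thesis using normal_moment_odd[of k] by (cases "k = 0") (auto simp: k)
next
  case False
  then obtain k where k: "n = 2 * k + 1" by (auto elim: oddE)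
  have "normal_moment (2 * Suc k) = real (2 * k + 1) * normal_moment (2 * k)"
  proof -
    have f: "fact (2 * Suc k) = (2 * real (Suc k)) * (real (2 * k + 1) * fact (2 * k))"
      by (simp add: algebra_simps)
    have g: "2 ^ Suc k * fact (Suc k) = (2 * real (Suc k)) * (2 ^ k * fact k)" by simp
    show ?thesis
      unfolding normal_moment_even f g by (subst mult_divide_mult_cancel_left) simp_all
  qed
  then show ?thesis by (simp add: k)
qed

definition gauss :: "'i set \<Rightarrow> ('i \<Rightarrow> real) measure" where
  "gauss I = PiM I (\<lambda>_. std_normal)"

lemma gauss_monomial:
  assumes fin: "finite I"
  shows "integrable (gauss I) (monom_fun I n)"
    and "(\<integral>w. monom_fun I n w \<partial>gauss I) = (\<Prod>e\<in>I. normal_moment (n e))"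
proof -
  interpret product_prob_space "\<lambda>_::'a. std_normal"
    by (intro product_prob_spaceI prob_space_std_normal)
  show "integrable (gauss I) (monom_fun I n)"
    unfolding gauss_def monom_fun_def
    by (rule product_integrable_prod[OF fin integrable_std_normal_power])
  show "(\<integral>w. monom_fun I n w \<partial>gauss I) = (\<Prod>e\<in>I. normal_moment (n e))"
    unfolding gauss_def monom_fun_def normal_moment_def
    by (rule product_integral_prod[OF fin integrable_std_normal_power])
qed

lemma integrable_gauss_sum_list:
  assumes fin: "finite I"
  shows "integrable (gauss I) (\<lambda>w. \<Sum>(c, n)\<leftarrow>L. c * monom_fun I n w)"
    and "(\<integral>w. (\<Sum>(c, n)\<leftarrow>L. c * monom_fun I n w) \<partial>gauss I) = (\<Sum>(c, n)\<leftarrow>L. c * (\<Prod>e\<in>I. normal_moment (n e)))"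
proof (induction L)
  case (Cons x L)
  { case 1 show ?case using Cons(1) gauss_monomial(1)[OF fin, of "snd x"] by (simp add: case_prod_beta) }
  { case 2 show ?case using Cons gauss_monomial[OF fin, of "snd x"] by (simp add: case_prod_beta) }
qed simp_all

lemma polyfun_integrable:
  assumes "finite I" "polyfun I f"
  shows "integrable (gauss I) f"
  using polyfun_monomials[OF assms] integrable_gauss_sum_list(1)[OF assms(1)] by auto

text \<open>On a monomial the claim is the moment recursion in the coordinate \<open>e\<close>, the
  other coordinates factoring out. The derivative is supplied as a function \<open>g\<close>, so
  that applications can find it by the product rule; uniqueness of derivatives identifies it with
  the derivative of the monomial expansion.\<close>

lemma gaussian_integration_by_parts:
  assumes fin: "finite I" and f: "polyfun I f" and e: "e \<in> I"
    and g: "\<And>w. ((\<lambda>x. f (w(e := x))) has_real_derivative g w) (at (w e))"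
  shows "(\<integral>w. w e * f w \<partial>gauss I) = (\<integral>w. g w \<partial>gauss I)"
proof -
  obtain L where L: "f = (\<lambda>w. \<Sum>(c, n)\<leftarrow>L. c * monom_fun I n w)"
    using polyfun_monomials[OF fin f] by blast
  have mult: "w e * monom_fun I n w = monom_fun I (n(e := Suc (n e))) w" for w n
    by (simp add: monom_fun_split[OF fin e] mult_ac)
  have upd: "monom_fun I n (w(e := x)) = x ^ n e * (\<Prod>e'\<in>I - {e}. w e' ^ n e')" for n w x
    unfolding monom_fun_split[OF fin e] by (auto intro!: prod.cong)
  have dm: "((\<lambda>x. monom_fun I n (w(e := x))) has_real_derivative real (n e) * monom_fun I (n(e := n e - 1)) w) (at (w e))" for n w
    unfolding upd monom_fun_split[OF fin e] by (auto intro!: derivative_eq_intros prod.cong)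
  have "((\<lambda>x. f (w(e := x))) has_real_derivative
      (\<Sum>(c, n)\<leftarrow>map (\<lambda>(c, n). (c * real (n e), n(e := n e - 1))) L. c * monom_fun I n w)) (at (w e))" for w
    unfolding L
  proof (induction L)
    case (Cons x L)
    obtain c n where x: "x = (c, n)" by force
    show ?case
      unfolding x list.map sum_list.Cons prod.case
      by (rule DERIV_cong[OF DERIV_add[OF DERIV_cmult[OF dm[of n w]] Cons]]) (simp only: mult_ac)
  qed simp
  then have "g = (\<lambda>w. \<Sum>(c, n)\<leftarrow>map (\<lambda>(c, n). (c * real (n e), n(e := n e - 1))) L. c * monom_fun I n w)"
    using g DERIV_unique by blast
  moreover have "w e * f w = (\<Sum>(c, n)\<leftarrow>map (\<lambda>(c, n). (c, n(e := Suc (n e)))) L. c * monom_fun I n w)" for w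
    unfolding L
  proof (induction L)
    case (Cons x L)
    obtain c n where x: "x = (c, n)" by force
    have "w e * (c * monom_fun I n w) = c * monom_fun I (n(e := Suc (n e))) w"
      by (simp only: mult[symmetric] mult_ac)
    then show ?case by (simp only: x list.map sum_list.Cons prod.case distrib_left Cons)
  qed simp
  moreover have "(\<Sum>(c, n)\<leftarrow>map (\<lambda>(c, n). (c, n(e := Suc (n e)))) L. c * (\<Prod>e\<in>I. normal_moment (n e)))
      = (\<Sum>(c, n)\<leftarrow>map (\<lambda>(c, n). (c * real (n e), n(e := n e - 1))) L. c * (\<Prod>e\<in>I. normal_moment (n e)))"
  proof (induction L)
    case (Cons x L)
    obtain c n where x: "x = (c, n)" by force
    have sp: "(\<Prod>e'\<in>I. normal_moment ((n(e := k)) e')) = normal_moment k * (\<Prod>e'\<in>I - {e}. normal_moment (n e'))" for k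
      by (subst prod.remove[OF fin e]) (auto intro!: prod.cong)
    show ?case using Cons unfolding x by (simp add: sp normal_moment_Suc del: fun_upd_apply)
  qed simp
  ultimately show ?thesis by (simp only: integrable_gauss_sum_list(2)[OF fin])
qed

section \<open>Traces of words in the Gram matrix and the shift\<close>

text \<open>Matrices of varying size \<open>N\<close> are functions on pairs of indices below \<open>N\<close>. With \<open>K\<close> the Gram matrix of
  the \<open>N\<close> columns and \<open>J\<close> the cyclic shift by \<open>s\<close>, the word \<open>[z\<^sub>0, \<dots>, z\<^sub>n]\<close> stands for
  \<open>J^z\<^sub>0 K J^z\<^sub>1 K \<dots> K J^z\<^sub>n\<close>.\<close>

definition fmm :: "nat \<Rightarrow> (nat \<Rightarrow> nat \<Rightarrow> real) \<Rightarrow> (nat \<Rightarrow> nat \<Rightarrow> real) \<Rightarrow> nat \<Rightarrow> nat \<Rightarrow> real" where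
  "fmm N A B a b = (\<Sum>c<N. A a c * B c b)"

lemma fmm_assoc: "fmm N (fmm N A B) C = fmm N A (fmm N B C)"
proof (intro ext)
  fix a b
  have "fmm N (fmm N A B) C a b = (\<Sum>d<N. \<Sum>c<N. A a c * B c d * C d b)"
    by (simp add: fmm_def sum_distrib_right)
  also have "\<dots> = (\<Sum>c<N. \<Sum>d<N. A a c * B c d * C d b)" by (rule sum.swap)
  also have "\<dots> = fmm N A (fmm N B C) a b" by (simp add: fmm_def sum_distrib_left mult.assoc)
  finally show "fmm N (fmm N A B) C a b = fmm N A (fmm N B C) a b" .
qed

definition gramK :: "nat \<Rightarrow> nat \<Rightarrow> (nat \<times> nat \<Rightarrow> real) \<Rightarrow> nat \<Rightarrow> nat \<Rightarrow> real" where
  "gramK p N w a b = (\<Sum>i<p. w (i, a) * w (i, b)) / real N"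

text \<open>The matrix of the power \<open>J^z\<close>. The congruence modulo \<open>N\<close>
  covers negative \<open>z\<close> as well.\<close>

definition shiftJ :: "nat \<Rightarrow> nat \<Rightarrow> int \<Rightarrow> nat \<Rightarrow> nat \<Rightarrow> real" where
  "shiftJ N s z a b = of_bool ((int b - int a - z * int s) mod int N = 0)"

fun word :: "nat \<Rightarrow> nat \<Rightarrow> nat \<Rightarrow> int list \<Rightarrow> (nat \<times> nat \<Rightarrow> real) \<Rightarrow> nat \<Rightarrow> nat \<Rightarrow> real" where
  "word p N s [] w = shiftJ N s 0"
| "word p N s [z] w = shiftJ N s z"
| "word p N s (z # z' # zs) w = fmm N (shiftJ N s z) (fmm N (gramK p N w) (word p N s (z' # zs) w))"

definition tau :: "nat \<Rightarrow> nat \<Rightarrow> nat \<Rightarrow> int list \<Rightarrow> (nat \<times> nat \<Rightarrow> real) \<Rightarrow> real" where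
  "tau p N s zs w = (\<Sum>a<N. word p N s zs w a a) / real N"

lemma word_Cons:
  "zs \<noteq> [] \<Longrightarrow> word p N s (z # zs) w = fmm N (shiftJ N s z) (fmm N (gramK p N w) (word p N s zs w))"
  by (cases zs) auto

lemma gramK_sym: "gramK p N w a b = gramK p N w b a"
  by (simp add: gramK_def mult.commute)

lemma shiftJ_transpose: "shiftJ N s z a b = shiftJ N s (- z) b a"
proof -
  have e: "int a - int b - (- z) * int s = - (int b - int a - z * int s)" by simp
  show ?thesis unfolding shiftJ_def mod_eq_0_iff_dvd e dvd_minus_iff ..
qed

lemma shiftJ_mult:
  assumes N: "N > 0"
  shows "fmm N (shiftJ N s z) (shiftJ N s z') = shiftJ N s (z + z')"
proof (intro ext)
  fix a b
  \<comment> \<open>\<open>c\<close> is the only column in which row \<open>a\<close> of the first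
    factor is nonzero.\<close>
  define c where "c = nat ((int a + z * int s) mod int N)"
  have c: "int c = (int a + z * int s) mod int N" "c < N"
    using N by (auto simp: c_def nat_less_iff)
  have iff: "(int d - int a - z * int s) mod int N = 0 \<longleftrightarrow> d = c" if "d < N" for d
  proof -
    have "(int d - int a - z * int s) mod int N = 0 \<longleftrightarrow> int d mod int N = (int a + z * int s) mod int N"
      by (simp only: mod_eq_0_iff_dvd mod_eq_dvd_iff diff_diff_eq)
    also have "\<dots> \<longleftrightarrow> int d = int c" using that c by simp
    finally show ?thesis by simp
  qed
  have "fmm N (shiftJ N s z) (shiftJ N s z') a b = (\<Sum>d<N. if d = c then shiftJ N s z' c b else 0)"
    unfolding fmm_def by (intro sum.cong refl) (auto simp: shiftJ_def iff)
  also have "\<dots> = shiftJ N s z' c b" using c by simp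
  also have "\<dots> = shiftJ N s (z + z') a b"
  proof -
    have "(int b - int c - z' * int s) mod int N = (int b - int a - (z + z') * int s) mod int N"
    proof -
      have "(int b - int c - z' * int s) mod int N = (int b - z' * int s - (int a + z * int s) mod int N) mod int N"
        unfolding c by (simp add: algebra_simps)
      also have "\<dots> = (int b - z' * int s - (int a + z * int s)) mod int N" by (rule mod_diff_right_eq)
      finally show ?thesis by (simp add: algebra_simps)
    qed
    then show ?thesis by (simp add: shiftJ_def)
  qed
  finally show "fmm N (shiftJ N s z) (shiftJ N s z') a b = shiftJ N s (z + z') a b" .
qed

lemma shiftJ_0: "a < N \<Longrightarrow> b < N \<Longrightarrow> shiftJ N s 0 a b = of_bool (a = b)"
proof -
  assume ab: "a < N" "b < N"
  have "(int b - int a) mod int N = 0 \<longleftrightarrow> int b mod int N = int a mod int N"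
    by (simp only: mod_eq_0_iff_dvd mod_eq_dvd_iff)
  then show ?thesis using ab by (auto simp: shiftJ_def)
qed

lemma word_append:
  "us \<noteq> [] \<Longrightarrow> vs \<noteq> [] \<Longrightarrow>
   word p N s (us @ vs) w = fmm N (word p N s us w) (fmm N (gramK p N w) (word p N s vs w))"
proof (induction us)
  case (Cons z us)
  show ?case
  proof (cases "us = []")
    case True
    then show ?thesis using Cons by (simp add: word_Cons)
  next
    case False
    then show ?thesis using Cons by (simp add: word_Cons fmm_assoc)
  qed
qed simp

text \<open>Multiplication of words with no Gram matrix in between: the shifts that meet are
  multiplied, so their exponents add.\<close>

definition merge_words :: "int list \<Rightarrow> int list \<Rightarrow> int list" where
  "merge_words us vs = butlast us @ (last us + hd vs) # tl vs"

lemma length_merge_words [simp]: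
  "us \<noteq> [] \<Longrightarrow> vs \<noteq> [] \<Longrightarrow> length (merge_words us vs) = length us + length vs - 1"
  by (cases vs) (auto simp: merge_words_def)

lemma merge_words_ne [simp]: "merge_words us vs \<noteq> []"
  by (simp add: merge_words_def)

lemma word_merge:
  assumes N: "N > 0" and us: "us \<noteq> []" and vs: "vs \<noteq> []"
  shows "fmm N (word p N s us w) (word p N s vs w) = word p N s (merge_words us vs) w"
proof -
  obtain us' z where u: "us = us' @ [z]" using us by (metis append_butlast_last_id)
  obtain z' vs' where v: "vs = z' # vs'" using vs by (cases vs) auto
  have base: "fmm N (shiftJ N s z) (word p N s (z' # vs') w) = word p N s ((z + z') # vs') w"
    by (cases "vs' = []") (simp_all add: word_Cons shiftJ_mult[OF N] fmm_assoc[symmetric])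
  show ?thesis
  proof (cases "us' = []")
    case True
    then show ?thesis using base by (simp add: u v merge_words_def)
  next
    case False
    then show ?thesis
      using base by (simp add: u v merge_words_def word_append fmm_assoc)
  qed
qed

text \<open>Transposition of a word: the order is reversed, the Gram matrix is symmetric, and the
  transpose of a shift is its inverse.\<close>

definition revneg :: "int list \<Rightarrow> int list" where
  "revneg zs = map uminus (rev zs)"

lemma length_revneg [simp]: "length (revneg zs) = length zs"
  and revneg_Nil_iff [simp]: "revneg zs = [] \<longleftrightarrow> zs = []"
  by (auto simp: revneg_def)

lemma fmm_transpose: "fmm N A B a b = fmm N (\<lambda>a b. B b a) (\<lambda>a b. A b a) b a"
  by (simp add: fmm_def mult.commute)

lemma word_transpose:
  "zs \<noteq> [] \<Longrightarrow> word p N s zs w a b = word p N s (revneg zs) w b a"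
proof (induction zs arbitrary: a b)
  case (Cons z zs)
  show ?case
  proof (cases "zs = []")
    case True
    then show ?thesis using shiftJ_transpose[of N s z a b] by (simp add: revneg_def)
  next
    case False
    have IH: "(\<lambda>a b. word p N s zs w b a) = word p N s (revneg zs) w"
      using Cons.IH[OF False] by (intro ext) simp
    have K: "(\<lambda>a b. gramK p N w b a) = gramK p N w" by (intro ext) (rule gramK_sym)
    have J: "(\<lambda>a b. shiftJ N s z b a) = shiftJ N s (- z)" by (intro ext) (rule shiftJ_transpose)
    have "word p N s (z # zs) w a b
        = fmm N (shiftJ N s z) (fmm N (gramK p N w) (word p N s zs w)) a b"
      using False by (simp add: word_Cons)
    also have "\<dots> = fmm N (fmm N (word p N s (revneg zs) w) (gramK p N w)) (shiftJ N s (- z)) b a"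
    proof -
      have KW: "(\<lambda>a b. fmm N (gramK p N w) (word p N s zs w) b a) = fmm N (word p N s (revneg zs) w) (gramK p N w)"
        unfolding IH[symmetric] by (subst (2) K[symmetric]) (intro ext fmm_transpose)
      show ?thesis unfolding fmm_transpose[of N "shiftJ N s z" _ a b] KW J ..
    qed
    also have "\<dots> = word p N s (revneg zs @ [- z]) w b a"
      using False by (simp add: word_append fmm_assoc)
    finally show ?thesis by (simp add: revneg_def)
  qed
qed simp

lemma tau_Cons_0:
  assumes N: "N > 0" and us: "us \<noteq> []"
  shows "(\<Sum>a<N. \<Sum>c<N. gramK p N w a c * word p N s us w c a) = real N * tau p N s (0 # us) w"
proof -
  have "word p N s (0 # us) w a a = (\<Sum>c<N. gramK p N w a c * word p N s us w c a)" if "a < N" for a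
  proof -
    have "word p N s (0 # us) w a a = (\<Sum>d<N. if a = d then (\<Sum>c<N. gramK p N w d c * word p N s us w c a) else 0)"
      unfolding word_Cons[OF us] fmm_def by (intro sum.cong refl) (use that shiftJ_0 in auto)
    then show ?thesis using that by simp
  qed
  then show ?thesis using N by (simp add: tau_def)
qed

text \<open>Rotation under the trace puts a Gram matrix in front, so that one of its entries is
  exposed for integration by parts.\<close>

lemma tau_cyclic:
  assumes N: "N > 0" and ne: "zs \<noteq> []"
  shows "tau p N s (z # zs) w = tau p N s (0 # merge_words zs [z]) w"
proof -
  have tr: "(\<Sum>a<N. fmm N A B a a) = (\<Sum>a<N. fmm N B A a a)" for A B
    unfolding fmm_def by (subst sum.swap) (simp add: mult.commute)
  have "(\<Sum>a<N. word p N s (z # zs) w a a) = (\<Sum>a<N. fmm N (fmm N (gramK p N w) (word p N s zs w)) (shiftJ N s z) a a)"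
    unfolding word_Cons[OF ne] by (rule tr)
  also have "\<dots> = (\<Sum>a<N. fmm N (gramK p N w) (word p N s (merge_words zs [z]) w) a a)"
    using word_merge[OF N ne, of "[z]" p s w] by (simp add: fmm_assoc)
  also have "\<dots> = real N * tau p N s (0 # merge_words zs [z]) w"
    unfolding fmm_def by (rule tau_Cons_0[OF N]) simp
  finally show ?thesis using N by (simp add: tau_def)
qed

definition rowmul :: "nat \<Rightarrow> (nat \<times> nat \<Rightarrow> real) \<Rightarrow> nat \<Rightarrow> (nat \<Rightarrow> nat \<Rightarrow> real) \<Rightarrow> nat \<Rightarrow> real" where
  "rowmul N w i B t = (\<Sum>c<N. w (i, c) * B c t)"

text \<open>Summation over the row index turns \<open>w (i, u) * w (i, c)\<close> into
  \<open>N\<close> times an entry of the Gram matrix. Transposing one of the words closes the chain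
  of column indices into a trace, whose normalisation is the second factor \<open>N\<close>.\<close>

lemma quadratic_contraction:
  assumes N: "N > 0" and us: "us \<noteq> []" and vs: "vs \<noteq> []"
  shows "(\<Sum>i<p. \<Sum>t<N. \<Sum>u<N. w (i, u) * word p N s us w u t * rowmul N w i (word p N s vs w) t)
    = (real N)\<^sup>2 * tau p N s (0 # merge_words vs (revneg us)) w"
proof -
  let ?U = "word p N s us w" and ?V = "word p N s vs w" and ?U' = "word p N s (revneg us) w"
  have "(\<Sum>i<p. \<Sum>t<N. \<Sum>u<N. w (i, u) * ?U u t * rowmul N w i ?V t)
     = (\<Sum>i<p. \<Sum>t<N. \<Sum>u<N. \<Sum>c<N. (w (i, u) * w (i, c)) * (?V c t * ?U' t u))"
    by (intro sum.cong refl) (simp add: rowmul_def sum_distrib_left word_transpose[OF us] mult_ac)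
  also have "\<dots> = (\<Sum>i<p. \<Sum>u<N. \<Sum>t<N. \<Sum>c<N. (w (i, u) * w (i, c)) * (?V c t * ?U' t u))"
    by (rule sum.cong[OF refl], rule sum.swap)
  also have "\<dots> = (\<Sum>u<N. \<Sum>i<p. \<Sum>t<N. \<Sum>c<N. (w (i, u) * w (i, c)) * (?V c t * ?U' t u))"
    by (rule sum.swap)
  also have "\<dots> = (\<Sum>u<N. \<Sum>i<p. \<Sum>c<N. \<Sum>t<N. (w (i, u) * w (i, c)) * (?V c t * ?U' t u))"
    by (rule sum.cong[OF refl], rule sum.cong[OF refl], rule sum.swap)
  also have "\<dots> = (\<Sum>u<N. \<Sum>c<N. \<Sum>i<p. \<Sum>t<N. (w (i, u) * w (i, c)) * (?V c t * ?U' t u))"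
    by (rule sum.cong[OF refl], rule sum.swap)
  also have "\<dots> = (\<Sum>u<N. \<Sum>c<N. real N * (gramK p N w u c * fmm N ?V ?U' c u))"
    using N by (intro sum.cong refl) (simp add: gramK_def fmm_def sum_product)
  also have "\<dots> = real N * (\<Sum>u<N. \<Sum>c<N. gramK p N w u c * word p N s (merge_words vs (revneg us)) w c u)"
    using us by (simp add: word_merge[OF N vs] sum_distrib_left)
  also have "\<dots> = (real N)\<^sup>2 * tau p N s (0 # merge_words vs (revneg us)) w"
    by (subst tau_Cons_0[OF N]) (simp_all add: power2_eq_square)
  finally show ?thesis .
qed

lemma diagonal_contraction:
  assumes N: "N > 0" and us: "us \<noteq> []"
  shows "(\<Sum>i<p. \<Sum>u<N. w (i, u) * (\<Sum>c<N. word p N s us w u c * w (i, c)))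
    = (real N)\<^sup>2 * tau p N s (0 # us) w"
proof -
  let ?U = "word p N s us w"
  have "(\<Sum>i<p. \<Sum>u<N. w (i, u) * (\<Sum>c<N. ?U u c * w (i, c)))
     = (\<Sum>i<p. \<Sum>u<N. \<Sum>c<N. (w (i, c) * w (i, u)) * ?U u c)"
    by (intro sum.cong refl) (simp add: sum_distrib_left mult_ac)
  also have "\<dots> = (\<Sum>i<p. \<Sum>c<N. \<Sum>u<N. (w (i, c) * w (i, u)) * ?U u c)"
    by (rule sum.cong[OF refl], rule sum.swap)
  also have "\<dots> = (\<Sum>c<N. \<Sum>i<p. \<Sum>u<N. (w (i, c) * w (i, u)) * ?U u c)" by (rule sum.swap)
  also have "\<dots> = (\<Sum>c<N. \<Sum>u<N. \<Sum>i<p. (w (i, c) * w (i, u)) * ?U u c)"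
    by (rule sum.cong[OF refl], rule sum.swap)
  also have "\<dots> = (\<Sum>c<N. \<Sum>u<N. real N * (gramK p N w c u * ?U u c))"
    using N by (intro sum.cong refl) (simp add: gramK_def sum_distrib_right)
  also have "\<dots> = (real N)\<^sup>2 * tau p N s (0 # us) w"
    using tau_Cons_0[OF N us, of p w s] by (simp add: sum_distrib_left[symmetric] power2_eq_square)
  finally show ?thesis .
qed

text \<open>The derivative of a word in the entry \<open>w (i, t)\<close>: the cut at
  \<open>j\<close> marks the Gram factor that is differentiated. Each entry of that factor is
  bilinear in the array, whence the two terms.\<close>

definition dword :: "nat \<Rightarrow> nat \<Rightarrow> nat \<Rightarrow> nat \<Rightarrow> nat \<Rightarrow> int list \<Rightarrow> (nat \<times> nat \<Rightarrow> real) \<Rightarrow> nat \<Rightarrow> nat \<Rightarrow> real" where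
  "dword p N s i t zs w a b = (\<Sum>j\<in>{1..<length zs}.
     (word p N s (take j zs) w a t * rowmul N w i (word p N s (drop j zs) w) b
      + (\<Sum>c<N. word p N s (take j zs) w a c * w (i, c)) * word p N s (drop j zs) w t b) / real N)"

lemma gramK_deriv:
  assumes "i < p"
  shows "((\<lambda>x. gramK p N (w((i, t) := x)) a b) has_real_derivative
      (of_bool (a = t) * w (i, b) + w (i, a) * of_bool (b = t)) / real N) (at (w (i, t)))"
proof -
  have v: "((\<lambda>x. (w((i, t) := x)) (i', a)) has_real_derivative of_bool (i' = i \<and> a = t)) (at (w (i, t)))" for i' a
    by (cases "i' = i \<and> a = t") (auto intro!: derivative_eq_intros)
  have "((\<lambda>x. (w((i, t) := x)) (i', a) * (w((i, t) := x)) (i', b)) has_real_derivative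
      of_bool (i' = i \<and> a = t) * w (i', b) + of_bool (i' = i \<and> b = t) * w (i', a)) (at (w (i, t)))" for i'
    using DERIV_mult[OF v[of i' a] v[of i' b]] by simp
  then have "((\<lambda>x. gramK p N (w((i, t) := x)) a b) has_real_derivative
      (\<Sum>i'<p. of_bool (i' = i \<and> a = t) * w (i', b) + of_bool (i' = i \<and> b = t) * w (i', a)) / real N) (at (w (i, t)))"
    unfolding gramK_def by (intro DERIV_cdivide DERIV_sum) auto
  moreover have "(\<Sum>i'<p. of_bool (i' = i \<and> a = t) * w (i', b) + of_bool (i' = i \<and> b = t) * w (i', a))
      = (\<Sum>i'<p. if i' = i then of_bool (a = t) * w (i, b) + w (i, a) * of_bool (b = t) else 0)"
    by (intro sum.cong refl) auto
  ultimately show ?thesis using assms by simp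
qed

lemma word_deriv:
  assumes N: "N > 0" and i: "i < p" and t: "t < N" and ne: "zs \<noteq> []"
  shows "((\<lambda>x. word p N s zs (w((i, t) := x)) a b) has_real_derivative dword p N s i t zs w a b) (at (w (i, t)))"
  using ne
proof (induction zs arbitrary: a)
  case (Cons z zs)
  show ?case
  proof (cases "zs = []")
    case True
    then show ?thesis by (simp add: dword_def)
  next
    case False
    let ?w = "\<lambda>x. w((i, t) := x)"
    let ?J = "shiftJ N s z" and ?K = "gramK p N w" and ?W = "word p N s zs w"
    let ?dK = "\<lambda>c d. (of_bool (c = t) * w (i, d) + w (i, c) * of_bool (d = t)) / real N"
    note IH = Cons.IH[OF False]
    have "((\<lambda>x. \<Sum>c<N. ?J a c * (\<Sum>d<N. gramK p N (?w x) c d * word p N s zs (?w x) d b)) has_real_derivative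
      (\<Sum>c<N. ?J a c * (\<Sum>d<N. ?dK c d * ?W d b + dword p N s i t zs w d b * ?K c d))) (at (w (i, t)))"
    proof (intro DERIV_sum DERIV_cmult)
      fix c d
      show "((\<lambda>x. gramK p N (?w x) c d * word p N s zs (?w x) d b) has_real_derivative
          ?dK c d * ?W d b + dword p N s i t zs w d b * ?K c d) (at (w (i, t)))"
        using DERIV_mult[OF gramK_deriv[OF i, of N w t c d] IH[of d]] by (simp only: fun_upd_triv)
    qed
    moreover have "(\<Sum>c<N. ?J a c * (\<Sum>d<N. ?dK c d * ?W d b + dword p N s i t zs w d b * ?K c d))
       = dword p N s i t (z # zs) w a b"
    proof -
      have dK: "(\<Sum>d<N. ?dK c d * ?W d b) = (of_bool (c = t) * rowmul N w i ?W b + w (i, c) * ?W t b) / real N" for c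
      proof -
        have "(\<Sum>d<N. ?dK c d * ?W d b) = (\<Sum>d<N. of_bool (c = t) / real N * (w (i, d) * ?W d b)
            + (if d = t then w (i, c) * ?W t b / real N else 0))"
          by (intro sum.cong refl) (auto simp: field_simps)
        then show ?thesis using t
          by (simp add: sum.distrib rowmul_def sum_distrib_left[symmetric] add_divide_distrib sum_divide_distrib)
      qed
      have one: "(\<Sum>c<N. ?J a c * (\<Sum>d<N. ?dK c d * ?W d b))
          = (?J a t * rowmul N w i ?W b + (\<Sum>c<N. ?J a c * w (i, c)) * ?W t b) / real N"
      proof -
        have "(\<Sum>c<N. ?J a c * (\<Sum>d<N. ?dK c d * ?W d b))
          = (\<Sum>c<N. (if c = t then ?J a t * rowmul N w i ?W b / real N else 0) + ?J a c * w (i, c) * (?W t b / real N))"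
          unfolding dK by (intro sum.cong refl) (auto simp: field_simps)
        then show ?thesis using t by (simp add: sum.distrib sum_distrib_right add_divide_distrib sum_divide_distrib)
      qed
      have two: "(\<Sum>c<N. ?J a c * (\<Sum>d<N. dword p N s i t zs w d b * ?K c d))
          = (\<Sum>j\<in>{1..<length zs}. (word p N s (z # take j zs) w a t * rowmul N w i (word p N s (drop j zs) w) b
      + (\<Sum>c<N. word p N s (z # take j zs) w a c * w (i, c)) * word p N s (drop j zs) w t b) / real N)"
      proof -
        let ?P = "\<lambda>j. word p N s (take j zs) w"
        let ?r = "\<lambda>j. rowmul N w i (word p N s (drop j zs) w) b" and ?q = "\<lambda>j. word p N s (drop j zs) w t b"
        \<comment> \<open>Left multiplication by \<open>J^z K\<close> acts on the left pieces
          \<open>?P j\<close> alone and passes through the sum over cuts.\<close>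
        have lin: "fmm N ?J (fmm N ?K (\<lambda>d b'. \<Sum>j\<in>{1..<length zs}. (?P j d t * ?r j + (\<Sum>c<N. ?P j d c * w (i, c)) * ?q j) / real N)) a b
          = (\<Sum>j\<in>{1..<length zs}. (fmm N ?J (fmm N ?K (?P j)) a t * ?r j
               + (\<Sum>c<N. fmm N ?J (fmm N ?K (?P j)) a c * w (i, c)) * ?q j) / real N)"
        proof -
          have comb: "fmm N A (\<lambda>d b'. \<Sum>j\<in>S. (F j d t * ?r j + (\<Sum>c<N. F j d c * w (i, c)) * ?q j) / real N) a' b'
            = (\<Sum>j\<in>S. (fmm N A (F j) a' t * ?r j + (\<Sum>c<N. fmm N A (F j) a' c * w (i, c)) * ?q j) / real N)" for A F S a' b'
          proof -
            have "(\<Sum>c<N. fmm N A (F j) a' c * w (i, c)) = (\<Sum>d<N. A a' d * (\<Sum>c<N. F j d c * w (i, c)))" for j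
              unfolding fmm_def sum_distrib_right sum_distrib_left mult.assoc by (rule sum.swap)
            note sw = this
            have e: "(fmm N A (F j) a' t * ?r j + (\<Sum>c<N. fmm N A (F j) a' c * w (i, c)) * ?q j) / real N
               = (\<Sum>d<N. A a' d * ((F j d t * ?r j + (\<Sum>c<N. F j d c * w (i, c)) * ?q j) / real N))" for j
              unfolding sw unfolding fmm_def sum_distrib_right[of _ "{..<N}"]
              unfolding sum.distrib[symmetric] sum_divide_distrib
              by (intro sum.cong refl) (simp add: algebra_simps add_divide_distrib sum_distrib_left sum_divide_distrib)
            show ?thesis unfolding e by (subst sum.swap) (simp add: fmm_def sum_distrib_left)
          qed
          have "fmm N ?K (\<lambda>d b'. \<Sum>j\<in>{1..<length zs}. (?P j d t * ?r j + (\<Sum>c<N. ?P j d c * w (i, c)) * ?q j) / real N)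
             = (\<lambda>d b'. \<Sum>j\<in>{1..<length zs}. (fmm N ?K (?P j) d t * ?r j + (\<Sum>c<N. fmm N ?K (?P j) d c * w (i, c)) * ?q j) / real N)"
            by (intro ext comb)
          then show ?thesis using comb[of ?J "\<lambda>j. fmm N ?K (?P j)" "{1..<length zs}" a b] by (simp only:)
        qed
        have "(\<Sum>c<N. ?J a c * (\<Sum>d<N. dword p N s i t zs w d b * ?K c d))
          = fmm N ?J (fmm N ?K (\<lambda>d b'. \<Sum>j\<in>{1..<length zs}. (?P j d t * ?r j + (\<Sum>c<N. ?P j d c * w (i, c)) * ?q j) / real N)) a b"
          by (simp add: fmm_def dword_def mult.commute)
        also have "\<dots> = (\<Sum>j\<in>{1..<length zs}. (word p N s (z # take j zs) w a t * ?r j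
               + (\<Sum>c<N. word p N s (z # take j zs) w a c * w (i, c)) * ?q j) / real N)"
          unfolding lin by (intro sum.cong refl, subst (1 2) word_Cons) (use False in auto)
        finally show ?thesis .
      qed
      have "dword p N s i t (z # zs) w a b =
        (?J a t * rowmul N w i ?W b + (\<Sum>c<N. ?J a c * w (i, c)) * ?W t b) / real N
        + (\<Sum>j\<in>{1..<length zs}. (word p N s (z # take j zs) w a t * rowmul N w i (word p N s (drop j zs) w) b
      + (\<Sum>c<N. word p N s (z # take j zs) w a c * w (i, c)) * word p N s (drop j zs) w t b) / real N)"
      proof -
        have "length zs \<ge> 1" using False by (cases zs) auto
        \<comment> \<open>The cut at 1 differentiates the newly added Gram factor; the later cuts
          are those of the shorter word, moved by one place.\<close>
        then have sh: "(\<Sum>j\<in>{1..<length (z # zs)}. g j) = g 1 + (\<Sum>j\<in>{1..<length zs}. g (Suc j))" for g :: "nat \<Rightarrow> real"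
        proof -
          have "(\<Sum>j\<in>{1..<length (z # zs)}. g j) = (\<Sum>j\<in>{0..<length zs}. g (Suc j))"
            unfolding One_nat_def list.size(4) add_Suc_right add_0_right by (rule sum.shift_bounds_Suc_ivl)
          also have "\<dots> = g 1 + (\<Sum>j\<in>{1..<length zs}. g (Suc j))"
            using \<open>length zs \<ge> 1\<close> by (subst sum.atLeast_Suc_lessThan) auto
          finally show ?thesis .
        qed
        show ?thesis
          unfolding dword_def sh by simp
      qed
      then show ?thesis using one two by (simp add: distrib_left sum.distrib)
    qed
    ultimately show ?thesis unfolding word_Cons[OF False] fmm_def by (rule DERIV_cong)
  qed
qed simp

lemma polyfun_word:
  "polyfun ({..<p} \<times> {..<N}) (\<lambda>w. word p N s zs w a b)"
proof (induction zs arbitrary: a)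
  case (Cons z zs)
  show ?case
  proof (cases "zs = []")
    case False
    have "polyfun ({..<p} \<times> {..<N}) (\<lambda>w. gramK p N w c d)" if "c < N" "d < N" for c d
      unfolding gramK_def divide_inverse
      by (intro polyfun_mult polyfun_sum polyfun_var polyfun_const) (use that in auto)
    then show ?thesis
      unfolding word_Cons[OF False] fmm_def
      by (intro polyfun_sum polyfun_mult polyfun_const Cons.IH) auto
  qed (simp add: polyfun_const)
qed (simp add: polyfun_const)

lemma polyfun_tau: "polyfun ({..<p} \<times> {..<N}) (tau p N s zs)"
  unfolding tau_def[abs_def] divide_inverse
  by (intro polyfun_sum polyfun_mult polyfun_const polyfun_word)

text \<open>Products over a list of words are the quantities on which the Gaussian recursion
  closes.\<close>

definition tprod :: "nat \<Rightarrow> nat \<Rightarrow> nat \<Rightarrow> int list list \<Rightarrow> (nat \<times> nat \<Rightarrow> real) \<Rightarrow> real" where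
  "tprod p N s ws w = (\<Prod>v\<leftarrow>ws. tau p N s v w)"

lemma tprod_simps [simp]:
  "tprod p N s [] w = 1" "tprod p N s (v # ws) w = tau p N s v w * tprod p N s ws w"
  by (simp_all add: tprod_def)

lemma polyfun_tprod: "polyfun ({..<p} \<times> {..<N}) (tprod p N s ws)"
  unfolding tprod_def[abs_def] by (intro polyfun_prod_list polyfun_tau)

definition dtau :: "nat \<Rightarrow> nat \<Rightarrow> nat \<Rightarrow> nat \<Rightarrow> nat \<Rightarrow> int list \<Rightarrow> (nat \<times> nat \<Rightarrow> real) \<Rightarrow> real" where
  "dtau p N s i t zs w = (\<Sum>a<N. dword p N s i t zs w a a) / real N"

fun dtprod :: "nat \<Rightarrow> nat \<Rightarrow> nat \<Rightarrow> nat \<Rightarrow> nat \<Rightarrow> int list list \<Rightarrow> (nat \<times> nat \<Rightarrow> real) \<Rightarrow> real" where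
  "dtprod p N s i t [] w = 0"
| "dtprod p N s i t (v # ws) w = dtau p N s i t v w * tprod p N s ws w + tau p N s v w * dtprod p N s i t ws w"

lemma tau_deriv:
  assumes "N > 0" "i < p" "t < N" "zs \<noteq> []"
  shows "((\<lambda>x. tau p N s zs (w((i, t) := x))) has_real_derivative dtau p N s i t zs w) (at (w (i, t)))"
  unfolding tau_def dtau_def by (intro DERIV_cdivide DERIV_sum word_deriv assms)

lemma tprod_deriv:
  assumes "N > 0" "i < p" "t < N" "[] \<notin> set ws"
  shows "((\<lambda>x. tprod p N s ws (w((i, t) := x))) has_real_derivative dtprod p N s i t ws w) (at (w (i, t)))"
  using assms(4)
proof (induction ws)
  case (Cons v ws)
  have "((\<lambda>x. tau p N s v (w((i, t) := x))) has_real_derivative dtau p N s i t v w) (at (w (i, t)))"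
    by (rule tau_deriv) (use assms Cons in auto)
  moreover have "((\<lambda>x. tprod p N s ws (w((i, t) := x))) has_real_derivative dtprod p N s i t ws w) (at (w (i, t)))"
    by (rule Cons.IH) (use Cons.prems in auto)
  ultimately have "((\<lambda>x. tau p N s v (w((i, t) := x)) * tprod p N s ws (w((i, t) := x))) has_real_derivative
      dtau p N s i t v w * tprod p N s ws (w((i, t) := w (i, t))) + dtprod p N s i t ws w * tau p N s v (w((i, t) := w (i, t)))) (at (w (i, t)))"
    by (rule DERIV_mult)
  then show ?case unfolding tprod_simps dtprod.simps fun_upd_triv by (simp only: mult.commute)
qed simp

text \<open>Inside a trace the two pieces of a cut word can be rejoined in the opposite order, which
  opens the cycle at the differentiated Gram factor. The two terms of the derivative then carry this
  rejoined word and its transpose.\<close>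

lemma dtau_eq:
  assumes N: "N > 0"
  shows "dtau p N s i t v w = (\<Sum>j\<in>{1..<length v}.
     rowmul N w i (word p N s (merge_words (drop j v) (take j v)) w) t
     + rowmul N w i (word p N s (revneg (merge_words (drop j v) (take j v))) w) t) / (real N)\<^sup>2"
proof -
  have *: "(\<Sum>a<N. word p N s (take j v) w a t * rowmul N w i (word p N s (drop j v) w) a
      + (\<Sum>c<N. word p N s (take j v) w a c * w (i, c)) * word p N s (drop j v) w t a)
    = rowmul N w i (word p N s (merge_words (drop j v) (take j v)) w) t
     + rowmul N w i (word p N s (revneg (merge_words (drop j v) (take j v))) w) t"
    if j: "j \<in> {1..<length v}" for j
  proof -
    let ?P = "word p N s (take j v) w" and ?Q = "word p N s (drop j v) w"
    have ne: "take j v \<noteq> []" "drop j v \<noteq> []" using j by auto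
    have "(\<Sum>a<N. ?P a t * rowmul N w i ?Q a) = (\<Sum>c<N. \<Sum>a<N. w (i, c) * (?Q c a * ?P a t))"
      unfolding rowmul_def sum_distrib_left by (subst sum.swap) (simp add: mult_ac)
    also have "\<dots> = rowmul N w i (fmm N ?Q ?P) t" by (simp add: rowmul_def fmm_def sum_distrib_left)
    finally have 1: "(\<Sum>a<N. ?P a t * rowmul N w i ?Q a) = rowmul N w i (word p N s (merge_words (drop j v) (take j v)) w) t"
      using ne by (simp add: word_merge[OF N])
    have "(\<Sum>a<N. (\<Sum>c<N. ?P a c * w (i, c)) * ?Q t a) = (\<Sum>c<N. \<Sum>a<N. w (i, c) * (?Q t a * ?P a c))"
      unfolding sum_distrib_right by (subst sum.swap) (simp add: mult_ac)
    also have "\<dots> = (\<Sum>c<N. w (i, c) * word p N s (merge_words (drop j v) (take j v)) w t c)"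
      unfolding word_merge[OF N ne(2,1), symmetric] by (simp add: fmm_def sum_distrib_left)
    also have "\<dots> = rowmul N w i (word p N s (revneg (merge_words (drop j v) (take j v))) w) t"
      unfolding rowmul_def by (subst word_transpose) auto
    finally show ?thesis using 1 by (simp add: sum.distrib)
  qed
  have "dtau p N s i t v w = (\<Sum>j\<in>{1..<length v}. \<Sum>a<N. (word p N s (take j v) w a t * rowmul N w i (word p N s (drop j v) w) a
      + (\<Sum>c<N. word p N s (take j v) w a c * w (i, c)) * word p N s (drop j v) w t a) / real N) / real N"
    unfolding dtau_def dword_def by (subst sum.swap) simp
  also have "\<dots> = (\<Sum>j\<in>{1..<length v}. \<Sum>a<N. (word p N s (take j v) w a t * rowmul N w i (word p N s (drop j v) w) a
      + (\<Sum>c<N. word p N s (take j v) w a c * w (i, c)) * word p N s (drop j v) w t a)) / (real N)\<^sup>2"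
    by (simp only: sum_divide_distrib[symmetric] power2_eq_square divide_divide_eq_left)
  also have "\<dots> = (\<Sum>j\<in>{1..<length v}.
     rowmul N w i (word p N s (merge_words (drop j v) (take j v)) w) t
     + rowmul N w i (word p N s (revneg (merge_words (drop j v) (take j v))) w) t) / (real N)\<^sup>2"
    by (rule arg_cong[of _ _ "\<lambda>x. x / (real N)\<^sup>2"]) (intro sum.cong refl *)
  finally show ?thesis .
qed

text \<open>The traces arising when the derivative falls on another factor of the product; in the recursion
  they carry a factor \<open>1 / N\<^sup>2\<close>.\<close>

fun errs :: "int list \<Rightarrow> int list list \<Rightarrow> int list list list" where
  "errs u [] = []"
| "errs u (v # ws) =
     map (\<lambda>j. (0 # merge_words (merge_words (drop j v) (take j v)) (revneg u)) # ws) [1..<length v]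
   @ map (\<lambda>j. (0 # merge_words (revneg (merge_words (drop j v) (take j v))) (revneg u)) # ws) [1..<length v]
   @ map ((#) v) (errs u ws)"

text \<open>Differentiating another trace opens its cycle at a Gram factor, and the contraction
  glues it to \<open>u\<close>: two traces become one, in either orientation. The factor
  \<open>N^2\<close> from the contraction cancels the one in \<open>dtau\<close>.\<close>

lemma dtprod_contraction:
  assumes N: "N > 0" and u: "u \<noteq> []"
  shows "(\<Sum>i<p. \<Sum>t<N. \<Sum>u'<N. w (i, u') * word p N s u w u' t * dtprod p N s i t ws w)
    = (\<Sum>hs\<leftarrow>errs u ws. tprod p N s hs w)"
proof (induction ws)
  case (Cons v ws)
  let ?V = "word p N s u w"
  let ?M = "\<lambda>j. merge_words (drop j v) (take j v)"
  let ?r = "\<lambda>i m t. rowmul N w i (word p N s m w) t"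
  have q: "(\<Sum>i<p. \<Sum>t<N. \<Sum>u'<N. w (i, u') * ?V u' t * ?r i m t) = (real N)\<^sup>2 * tau p N s (0 # merge_words m (revneg u)) w"
    if "m \<noteq> []" for m by (rule quadratic_contraction[OF N u that])
  have "(\<Sum>i<p. \<Sum>t<N. \<Sum>u'<N. w (i, u') * ?V u' t * dtau p N s i t v w)
    = (\<Sum>i<p. \<Sum>t<N. \<Sum>u'<N. \<Sum>j\<in>{1..<length v}. (w (i, u') * ?V u' t * ?r i (?M j) t
        + w (i, u') * ?V u' t * ?r i (revneg (?M j)) t) / (real N)\<^sup>2)"
    unfolding dtau_eq[OF N] by (intro sum.cong refl) (simp add: sum_distrib_left distrib_left sum_divide_distrib)
  also have "\<dots> = (\<Sum>i<p. \<Sum>t<N. \<Sum>j\<in>{1..<length v}. \<Sum>u'<N. (w (i, u') * ?V u' t * ?r i (?M j) t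
        + w (i, u') * ?V u' t * ?r i (revneg (?M j)) t) / (real N)\<^sup>2)"
    by (rule sum.cong[OF refl], rule sum.cong[OF refl], rule sum.swap)
  also have "\<dots> = (\<Sum>i<p. \<Sum>j\<in>{1..<length v}. \<Sum>t<N. \<Sum>u'<N. (w (i, u') * ?V u' t * ?r i (?M j) t
        + w (i, u') * ?V u' t * ?r i (revneg (?M j)) t) / (real N)\<^sup>2)"
    by (rule sum.cong[OF refl], rule sum.swap)
  also have "\<dots> = (\<Sum>j\<in>{1..<length v}. \<Sum>i<p. \<Sum>t<N. \<Sum>u'<N. (w (i, u') * ?V u' t * ?r i (?M j) t
        + w (i, u') * ?V u' t * ?r i (revneg (?M j)) t) / (real N)\<^sup>2)"
    by (rule sum.swap)
  also have "\<dots> = (\<Sum>j\<in>{1..<length v}. ((real N)\<^sup>2 * tau p N s (0 # merge_words (?M j) (revneg u)) w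
       + (real N)\<^sup>2 * tau p N s (0 # merge_words (revneg (?M j)) (revneg u)) w) / (real N)\<^sup>2)"
    by (intro sum.cong refl) (simp only: sum_divide_distrib[symmetric] sum.distrib q merge_words_ne revneg_Nil_iff not_False_eq_True)
  also have "\<dots> = (\<Sum>j\<in>{1..<length v}. tau p N s (0 # merge_words (?M j) (revneg u)) w)
       + (\<Sum>j\<in>{1..<length v}. tau p N s (0 # merge_words (revneg (?M j)) (revneg u)) w)"
    using N by (simp add: distrib_left[symmetric] sum.distrib)
  finally have d: "(\<Sum>i<p. \<Sum>t<N. \<Sum>u'<N. w (i, u') * ?V u' t * dtau p N s i t v w) = \<dots>" .
  have "(\<Sum>i<p. \<Sum>t<N. \<Sum>u'<N. w (i, u') * ?V u' t * dtprod p N s i t (v # ws) w)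
    = (\<Sum>i<p. \<Sum>t<N. \<Sum>u'<N. w (i, u') * ?V u' t * dtau p N s i t v w) * tprod p N s ws w
      + tau p N s v w * (\<Sum>i<p. \<Sum>t<N. \<Sum>u'<N. w (i, u') * ?V u' t * dtprod p N s i t ws w)"
    by (simp add: sum_distrib_left sum_distrib_right sum.distrib[symmetric] algebra_simps)
  also have "\<dots> = (\<Sum>hs\<leftarrow>errs u (v # ws). tprod p N s hs w)"
    unfolding d Cons
    by (simp add: o_def interv_sum_list_conv_sum_set_nat sum_distrib_right distrib_right sum_list_const_mult)
  finally show ?case .
qed simp

lemma polyfun_dword: "i < p \<Longrightarrow> polyfun ({..<p} \<times> {..<N}) (\<lambda>w. dword p N s i t zs w a b)"
  unfolding dword_def rowmul_def divide_inverse
  by (intro polyfun_sum polyfun_mult polyfun_add polyfun_var polyfun_word polyfun_const) auto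

lemma polyfun_dtprod: "i < p \<Longrightarrow> polyfun ({..<p} \<times> {..<N}) (dtprod p N s i t ws)"
proof (induction ws)
  case (Cons v ws)
  have "polyfun ({..<p} \<times> {..<N}) (dtau p N s i t v)"
    unfolding dtau_def[abs_def] divide_inverse
    by (intro polyfun_mult polyfun_sum polyfun_dword polyfun_const) (use Cons in auto)
  then have "polyfun ({..<p} \<times> {..<N}) (\<lambda>w. dtau p N s i t v w * tprod p N s ws w + tau p N s v w * dtprod p N s i t ws w)"
    using Cons by (intro polyfun_add polyfun_mult polyfun_tprod polyfun_tau) auto
  then show ?case by (simp add: dtprod.simps[abs_def])
qed (simp add: dtprod.simps[abs_def] polyfun_const)

lemma integral_sum_list:
  fixes f :: "'b \<Rightarrow> 'a \<Rightarrow> real"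
  assumes "\<And>x. x \<in> set xs \<Longrightarrow> integrable M (f x)"
  shows "integrable M (\<lambda>w. \<Sum>x\<leftarrow>xs. f x w)" "(\<integral>w. (\<Sum>x\<leftarrow>xs. f x w) \<partial>M) = (\<Sum>x\<leftarrow>xs. \<integral>w. f x w \<partial>M)"
  using assms by (induction xs) simp_all

definition gauss_tau :: "nat \<Rightarrow> nat \<Rightarrow> nat \<Rightarrow> int list list \<Rightarrow> real" where
  "gauss_tau p N s ws = (\<integral>w. tprod p N s ws w \<partial>gauss ({..<p} \<times> {..<N}))"

lemma shift_last_merge: "w \<noteq> [] \<Longrightarrow> merge_words w [z] = shift_last w z"
  by (simp add: merge_words_def shift_last_def)

lemma shift_last_ne [simp]: "shift_last w z \<noteq> []"
  by (simp add: shift_last_def)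

lemma integrable_tprod: "integrable (gauss ({..<p} \<times> {..<N})) (tprod p N s ws)"
  by (rule polyfun_integrable[OF _ polyfun_tprod]) simp

text \<open>The loop equation (Schwinger-Dyson equation) of the Gaussian model. Integration by parts
  in \<open>w (i, t)\<close> differentiates three things. The other entry of the exposed Gram factor
  gives the coefficient \<open>p / N\<close>. A Gram factor of \<open>V\<close> gives two terms: one
  cuts the cycle into two traces at leading order, the other reconnects it with a reversed piece at
  order \<open>1 / N\<close>. A Gram factor of another trace merges two cycles at order
  \<open>1 / N^2\<close>.\<close>

lemma gauss_tau_rec:
  assumes N: "N > 0" and w0: "w0 \<noteq> []" and ws: "[] \<notin> set ws"
    and u_def: "u = shift_last w0 z"
  shows "gauss_tau p N s ((z # w0) # ws) = real p / real N * gauss_tau p N s (u # ws)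
    + (\<Sum>j\<in>{1..<length w0}. gauss_tau p N s ((0 # take j u) # drop j u # ws))
    + (1 / real N) * (\<Sum>j\<in>{1..<length w0}. gauss_tau p N s ((0 # merge_words (drop j u) (revneg (take j u))) # ws))
    + (1 / (real N)\<^sup>2) * (\<Sum>hs\<leftarrow>errs u ws. gauss_tau p N s hs)"
proof -
  let ?I = "{..<p} \<times> {..<N}"
  let ?V = "word p N s u"
  let ?G = "tprod p N s ws"
  have une: "u \<noteq> []" and lu: "length u = length w0" using w0 by (simp_all add: u_def)
  have fin: "finite ?I" by simp
  note int = polyfun_integrable[OF fin]
  \<comment> \<open>After rotation the word is \<open>K V\<close>; writing out \<open>K\<close>
    exposes the two entries \<open>w (i, t)\<close> and \<open>w (i, u')\<close>.\<close>
  have t1: "tau p N s (z # w0) w = (\<Sum>i<p. \<Sum>t<N. \<Sum>u'<N. w (i, t) * (w (i, u') * ?V w u' t)) / (real N)\<^sup>2" for w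
  proof -
    have "real N * tau p N s (z # w0) w = (\<Sum>a<N. \<Sum>c<N. gramK p N w a c * ?V w c a)"
      using tau_cyclic[OF N w0, of p s z w] tau_Cons_0[OF N une, of p w s] by (simp add: u_def shift_last_merge[OF w0])
    also have "\<dots> = (\<Sum>a<N. \<Sum>c<N. \<Sum>i<p. w (i, a) * (w (i, c) * ?V w c a)) / real N"
      unfolding gramK_def sum_divide_distrib sum_distrib_right
      by (intro sum.cong refl) (simp add: mult_ac)
    also have "(\<Sum>a<N. \<Sum>c<N. \<Sum>i<p. w (i, a) * (w (i, c) * ?V w c a)) = (\<Sum>a<N. \<Sum>i<p. \<Sum>c<N. w (i, a) * (w (i, c) * ?V w c a))"
      by (rule sum.cong[OF refl], rule sum.swap)
    also have "\<dots> = (\<Sum>i<p. \<Sum>a<N. \<Sum>c<N. w (i, a) * (w (i, c) * ?V w c a))" by (rule sum.swap)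
    finally show ?thesis using N by (simp add: field_simps power2_eq_square)
  qed
  \<comment> \<open>The product rule: the derivative of \<open>w (i, u')\<close>, of the word
    \<open>V\<close>, and of the remaining traces.\<close>
  define D where "D i t u' w = of_bool (u' = t) * ?V w u' t * ?G w + w (i, u') * dword p N s i t u w u' t * ?G w
      + w (i, u') * ?V w u' t * dtprod p N s i t ws w" for i t u' w
  have pf: "polyfun ?I (\<lambda>w. w (i, u') * ?V w u' t * ?G w)" if "i < p" "u' < N" for i t u'
    by (intro polyfun_mult polyfun_var polyfun_word polyfun_tprod) (use that in auto)
  have pf': "polyfun ?I (\<lambda>w. w (i, t) * (w (i, u') * ?V w u' t * ?G w))" if "i < p" "u' < N" "t < N" for i t u'
    using that by (intro polyfun_mult[OF polyfun_var pf]) auto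
  have ibp: "(\<integral>w. w (i, t) * (w (i, u') * ?V w u' t * ?G w) \<partial>gauss ?I) = (\<integral>w. D i t u' w \<partial>gauss ?I)"
    if i: "i < p" and t: "t < N" and u': "u' < N" for i t u'
  proof (rule gaussian_integration_by_parts[OF fin pf[OF i u']])
    show "(i, t) \<in> ?I" using i t by simp
    fix w
    have v: "((\<lambda>x. (w((i, t) := x)) (i, u')) has_real_derivative of_bool (u' = t)) (at (w (i, t)))"
      by (cases "u' = t") (auto intro!: derivative_eq_intros)
    have "((\<lambda>x. ((w((i, t) := x)) (i, u') * ?V (w((i, t) := x)) u' t) * ?G (w((i, t) := x))) has_real_derivative
        (of_bool (u' = t) * ?V (w((i, t) := w (i, t))) u' t + dword p N s i t u w u' t * (w((i, t) := w (i, t))) (i, u')) * ?G (w((i, t) := w (i, t)))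
        + dtprod p N s i t ws w * ((w((i, t) := w (i, t))) (i, u') * ?V (w((i, t) := w (i, t))) u' t)) (at (w (i, t)))"
      by (rule DERIV_mult[OF DERIV_mult[OF v word_deriv[OF N i t une, where s = s and w = w and a = u' and b = t]]
            tprod_deriv[OF N i t ws, where s = s and w = w]])
    then show "((\<lambda>x. (w((i, t) := x)) (i, u') * ?V (w((i, t) := x)) u' t * ?G (w((i, t) := x))) has_real_derivative D i t u' w) (at (w (i, t)))"
      unfolding fun_upd_triv D_def by (rule DERIV_cong) (simp only: algebra_simps)
  qed
  have sumD: "(\<Sum>i<p. \<Sum>t<N. \<Sum>u'<N. D i t u' w) / (real N)\<^sup>2 = real p / real N * tprod p N s (u # ws) w
    + (\<Sum>j\<in>{1..<length w0}. tprod p N s ((0 # take j u) # drop j u # ws) w)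
    + (1 / real N) * (\<Sum>j\<in>{1..<length w0}. tprod p N s ((0 # merge_words (drop j u) (revneg (take j u))) # ws) w)
    + (1 / (real N)\<^sup>2) * (\<Sum>hs\<leftarrow>errs u ws. tprod p N s hs w)" for w
  proof -
    have A: "(\<Sum>i<p. \<Sum>t<N. \<Sum>u'<N. of_bool (u' = t) * ?V w u' t * ?G w) = real p * real N * tau p N s u w * ?G w"
    proof -
      have "(\<Sum>u'<N. of_bool (u' = t) * ?V w u' t * ?G w) = ?V w t t * ?G w" if "t < N" for t
      proof -
        have "(\<Sum>u'<N. of_bool (u' = t) * ?V w u' t * ?G w) = (\<Sum>u'<N. if u' = t then ?V w t t * ?G w else 0)"
          by (intro sum.cong refl) auto
        then show ?thesis using that by simp
      qed
      then have "(\<Sum>i<p. \<Sum>t<N. \<Sum>u'<N. of_bool (u' = t) * ?V w u' t * ?G w) = (\<Sum>i<p. \<Sum>t<N. ?V w t t * ?G w)"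
        by (intro sum.cong refl) simp
      also have "\<dots> = real p * ((\<Sum>t<N. ?V w t t) * ?G w)" by (simp add: sum_distrib_right)
      also have "(\<Sum>t<N. ?V w t t) = real N * tau p N s u w" using N by (simp add: tau_def)
      finally show ?thesis by (simp only: mult.assoc)
    qed
    \<comment> \<open>The two halves of \<open>dword\<close>: the first closes up to a single trace
      with a reversed piece, the second to a product of two traces, whose extra normalisation
      supplies one more factor \<open>N\<close>.\<close>
    have B: "(\<Sum>i<p. \<Sum>t<N. \<Sum>u'<N. w (i, u') * dword p N s i t u w u' t)
      = (\<Sum>j\<in>{1..<length u}. (real N)\<^sup>2 * tau p N s (0 # merge_words (drop j u) (revneg (take j u))) w
           + (real N)\<^sup>2 * tau p N s (0 # take j u) w * (real N * tau p N s (drop j u) w)) / real N"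
    proof -
      let ?P = "\<lambda>j. word p N s (take j u) w" and ?Q = "\<lambda>j. word p N s (drop j u) w"
      have "(\<Sum>i<p. \<Sum>t<N. \<Sum>u'<N. w (i, u') * dword p N s i t u w u' t)
        = (\<Sum>i<p. \<Sum>t<N. \<Sum>u'<N. \<Sum>j\<in>{1..<length u}. w (i, u') * ?P j u' t * rowmul N w i (?Q j) t
           + w (i, u') * (\<Sum>c<N. ?P j u' c * w (i, c)) * ?Q j t t) / real N"
        unfolding dword_def sum_divide_distrib
        by (intro sum.cong refl)
          (subst sum_distrib_left, intro sum.cong refl, simp only: distrib_left times_divide_eq_right mult.assoc)
      also have "(\<Sum>i<p. \<Sum>t<N. \<Sum>u'<N. \<Sum>j\<in>{1..<length u}. w (i, u') * ?P j u' t * rowmul N w i (?Q j) t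
           + w (i, u') * (\<Sum>c<N. ?P j u' c * w (i, c)) * ?Q j t t)
        = (\<Sum>i<p. \<Sum>t<N. \<Sum>j\<in>{1..<length u}. \<Sum>u'<N. w (i, u') * ?P j u' t * rowmul N w i (?Q j) t
           + w (i, u') * (\<Sum>c<N. ?P j u' c * w (i, c)) * ?Q j t t)"
        by (rule sum.cong[OF refl], rule sum.cong[OF refl], rule sum.swap)
      also have "\<dots> = (\<Sum>i<p. \<Sum>j\<in>{1..<length u}. \<Sum>t<N. \<Sum>u'<N. w (i, u') * ?P j u' t * rowmul N w i (?Q j) t
           + w (i, u') * (\<Sum>c<N. ?P j u' c * w (i, c)) * ?Q j t t)"
        by (rule sum.cong[OF refl], rule sum.swap)
      also have "\<dots> = (\<Sum>j\<in>{1..<length u}. \<Sum>i<p. \<Sum>t<N. \<Sum>u'<N. w (i, u') * ?P j u' t * rowmul N w i (?Q j) t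
           + w (i, u') * (\<Sum>c<N. ?P j u' c * w (i, c)) * ?Q j t t)"
        by (rule sum.swap)
      also have "\<dots> = (\<Sum>j\<in>{1..<length u}. (real N)\<^sup>2 * tau p N s (0 # merge_words (drop j u) (revneg (take j u))) w
           + (real N)\<^sup>2 * tau p N s (0 # take j u) w * (real N * tau p N s (drop j u) w))"
      proof (intro sum.cong refl)
        fix j assume "j \<in> {1..<length u}"
        then have ne: "take j u \<noteq> []" "drop j u \<noteq> []" by auto
        have "(\<Sum>i<p. \<Sum>t<N. \<Sum>u'<N. w (i, u') * (\<Sum>c<N. ?P j u' c * w (i, c)) * ?Q j t t)
            = (\<Sum>i<p. \<Sum>u'<N. w (i, u') * (\<Sum>c<N. ?P j u' c * w (i, c))) * (\<Sum>t<N. ?Q j t t)"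
          unfolding sum_distrib_right[of _ "{..<p}"] sum_product
          by (intro sum.cong refl, rule sum_distrib_right[symmetric])
        also have "(\<Sum>t<N. ?Q j t t) = real N * tau p N s (drop j u) w" using N by (simp add: tau_def)
        finally have "(\<Sum>i<p. \<Sum>t<N. \<Sum>u'<N. w (i, u') * (\<Sum>c<N. ?P j u' c * w (i, c)) * ?Q j t t)
            = (real N)\<^sup>2 * tau p N s (0 # take j u) w * (real N * tau p N s (drop j u) w)"
          by (simp only: diagonal_contraction[OF N ne(1)])
        then show "(\<Sum>i<p. \<Sum>t<N. \<Sum>u'<N. w (i, u') * ?P j u' t * rowmul N w i (?Q j) t
           + w (i, u') * (\<Sum>c<N. ?P j u' c * w (i, c)) * ?Q j t t)
          = (real N)\<^sup>2 * tau p N s (0 # merge_words (drop j u) (revneg (take j u))) w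
           + (real N)\<^sup>2 * tau p N s (0 # take j u) w * (real N * tau p N s (drop j u) w)"
          by (simp only: sum.distrib quadratic_contraction[OF N ne])
      qed
      finally show ?thesis .
    qed
    have e1: "(\<Sum>i<p. \<Sum>t<N. \<Sum>u'<N. D i t u' w) =
       (\<Sum>i<p. \<Sum>t<N. \<Sum>u'<N. of_bool (u' = t) * ?V w u' t * ?G w)
       + (\<Sum>i<p. \<Sum>t<N. \<Sum>u'<N. w (i, u') * dword p N s i t u w u' t) * ?G w
       + (\<Sum>i<p. \<Sum>t<N. \<Sum>u'<N. w (i, u') * ?V w u' t * dtprod p N s i t ws w)"
      unfolding D_def sum_distrib_right sum.distrib ..
      have B': "(\<Sum>i<p. \<Sum>t<N. \<Sum>u'<N. w (i, u') * dword p N s i t u w u' t) * ?G w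
         = real N * (\<Sum>j\<in>{1..<length w0}. tprod p N s ((0 # merge_words (drop j u) (revneg (take j u))) # ws) w)
         + (real N)\<^sup>2 * (\<Sum>j\<in>{1..<length w0}. tprod p N s ((0 # take j u) # drop j u # ws) w)"
        unfolding B lu sum_distrib_left sum.distrib[symmetric] sum_divide_distrib sum_distrib_right tprod_simps
        by (intro sum.cong refl) (use N in \<open>simp add: field_simps power2_eq_square\<close>)
      show ?thesis
        unfolding e1 A B' dtprod_contraction[OF N une] tprod_simps(2)
        using N by (simp add: field_simps power2_eq_square)
  qed
  have pfD: "integrable (gauss ?I) (D i t u')" if "i < p" "t < N" "u' < N" for i t u'
  proof (rule int)
    have "polyfun ?I (\<lambda>w. of_bool (u' = t) * ?V w u' t * ?G w)"
      by (intro polyfun_mult polyfun_const polyfun_word polyfun_tprod)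
    moreover have "polyfun ?I (\<lambda>w. w (i, u') * dword p N s i t u w u' t * ?G w)"
      by (intro polyfun_mult polyfun_var polyfun_tprod polyfun_dword) (use that in auto)
    moreover have "polyfun ?I (\<lambda>w. w (i, u') * ?V w u' t * dtprod p N s i t ws w)"
      by (intro polyfun_mult polyfun_var polyfun_word polyfun_dtprod) (use that in auto)
    ultimately show "polyfun ?I (D i t u')"
      unfolding D_def[abs_def] by (intro polyfun_add)
  qed
  have I3: "(\<integral>w. (\<Sum>i<p. \<Sum>t<N. \<Sum>u'<N. F i t u' w) / c \<partial>gauss ?I) = (\<Sum>i<p. \<Sum>t<N. \<Sum>u'<N. \<integral>w. F i t u' w \<partial>gauss ?I) / c"
    if F: "\<And>i t u'. i < p \<Longrightarrow> t < N \<Longrightarrow> u' < N \<Longrightarrow> integrable (gauss ?I) (F i t u')"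
    for F :: "nat \<Rightarrow> nat \<Rightarrow> nat \<Rightarrow> (nat \<times> nat \<Rightarrow> real) \<Rightarrow> real" and c :: real
  proof -
    have "(\<integral>w. (\<Sum>i<p. \<Sum>t<N. \<Sum>u'<N. F i t u' w) \<partial>gauss ?I) = (\<Sum>i<p. \<integral>w. (\<Sum>t<N. \<Sum>u'<N. F i t u' w) \<partial>gauss ?I)"
      by (rule Bochner_Integration.integral_sum) (auto intro!: Bochner_Integration.integrable_sum F)
    also have "\<dots> = (\<Sum>i<p. \<Sum>t<N. \<integral>w. (\<Sum>u'<N. F i t u' w) \<partial>gauss ?I)"
      by (rule sum.cong[OF refl], rule Bochner_Integration.integral_sum) (auto intro!: Bochner_Integration.integrable_sum F)
    also have "\<dots> = (\<Sum>i<p. \<Sum>t<N. \<Sum>u'<N. \<integral>w. F i t u' w \<partial>gauss ?I)"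
      by (rule sum.cong[OF refl], rule sum.cong[OF refl], rule Bochner_Integration.integral_sum) (auto intro!: F)
    finally show ?thesis by (simp only: integral_divide_zero)
  qed
  have "gauss_tau p N s ((z # w0) # ws)
     = (\<integral>w. (\<Sum>i<p. \<Sum>t<N. \<Sum>u'<N. w (i, t) * (w (i, u') * ?V w u' t * ?G w)) / (real N)\<^sup>2 \<partial>gauss ?I)"
    unfolding gauss_tau_def tprod_simps t1
    by (intro Bochner_Integration.integral_cong refl) (simp only: sum_distrib_right times_divide_eq_left mult.assoc)
  also have "\<dots> = (\<Sum>i<p. \<Sum>t<N. \<Sum>u'<N. \<integral>w. w (i, t) * (w (i, u') * ?V w u' t * ?G w) \<partial>gauss ?I) / (real N)\<^sup>2"
    by (rule I3) (intro int pf')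
  also have "\<dots> = (\<Sum>i<p. \<Sum>t<N. \<Sum>u'<N. \<integral>w. D i t u' w \<partial>gauss ?I) / (real N)\<^sup>2"
    by (intro arg_cong[of _ _ "\<lambda>x. x / (real N)\<^sup>2"] sum.cong refl ibp) auto
  also have "\<dots> = (\<integral>w. (\<Sum>i<p. \<Sum>t<N. \<Sum>u'<N. D i t u' w) / (real N)\<^sup>2 \<partial>gauss ?I)"
    by (rule I3[symmetric]) (rule pfD)
  also have "\<dots> = real p / real N * gauss_tau p N s (u # ws)
    + (\<Sum>j\<in>{1..<length w0}. gauss_tau p N s ((0 # take j u) # drop j u # ws))
    + (1 / real N) * (\<Sum>j\<in>{1..<length w0}. gauss_tau p N s ((0 # merge_words (drop j u) (revneg (take j u))) # ws))
    + (1 / (real N)\<^sup>2) * (\<Sum>hs\<leftarrow>errs u ws. gauss_tau p N s hs)"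
  proof -
    have iS: "integrable (gauss ?I) (\<lambda>w. \<Sum>j\<in>S. tprod p N s (h j) w)"
      and eS: "(\<integral>w. (\<Sum>j\<in>S. tprod p N s (h j) w) \<partial>gauss ?I) = (\<Sum>j\<in>S. gauss_tau p N s (h j))"
      for S :: "nat set" and h
      unfolding gauss_tau_def
      by (rule Bochner_Integration.integrable_sum, rule integrable_tprod)
         (rule Bochner_Integration.integral_sum, rule integrable_tprod)
    have iL: "integrable (gauss ?I) (\<lambda>w. \<Sum>hs\<leftarrow>errs u ws. tprod p N s hs w)"
      and eL: "(\<integral>w. (\<Sum>hs\<leftarrow>errs u ws. tprod p N s hs w) \<partial>gauss ?I) = (\<Sum>hs\<leftarrow>errs u ws. gauss_tau p N s hs)"
      unfolding gauss_tau_def by (intro integral_sum_list integrable_tprod)+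
    note iM = Bochner_Integration.integrable_mult_right
    note iA = Bochner_Integration.integrable_add
    show ?thesis
      unfolding sumD
      apply (subst Bochner_Integration.integral_add[OF iA[OF iA[OF iM[OF integrable_tprod] iS] iM[OF iS]] iM[OF iL]])
      apply (subst Bochner_Integration.integral_add[OF iA[OF iM[OF integrable_tprod] iS] iM[OF iS]])
      apply (subst Bochner_Integration.integral_add[OF iM[OF integrable_tprod] iS])
      apply (simp only: Bochner_Integration.integral_mult_right_zero eS eL gauss_tau_def[symmetric])
      done
  qed
  finally show ?thesis .
qed

lemma tau_singleton: "N > 0 \<Longrightarrow> tau p N s [z] w = of_bool (z * int s mod int N = 0)"
proof -
  assume N: "N > 0"
  have "(- (z * int s)) mod int N = 0 \<longleftrightarrow> z * int s mod int N = 0"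
    by (simp only: mod_eq_0_iff_dvd dvd_minus_iff)
  then show ?thesis using N by (simp add: tau_def shiftJ_def)
qed

text \<open>Cutting preserves the total length of all words, and the number of Gram factors does not
  drop when a word of length 1 is evaluated. The weight \<open>2 * length v - 1\<close> decreases in
  every case: a cut turns \<open>2 n + 1\<close> into \<open>2 n\<close>, where \<open>n\<close> is
  the length of \<open>u\<close>, and each word of length 1 counts 1.\<close>

definition word_measure :: "int list list \<Rightarrow> nat" where
  "word_measure ws = (\<Sum>v\<leftarrow>ws. 2 * length v - 1)"

lemma word_measure_simps [simp]:
  "word_measure [] = 0" "word_measure (v # ws) = (2 * length v - 1) + word_measure ws"
  by (simp_all add: word_measure_def)

text \<open>Gluing two words into one lowers the weight, so the merged traces fall under the
  induction of the limit theorem.\<close>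

lemma errs_props:
  assumes "u \<noteq> []" "[] \<notin> set ws" "hs \<in> set (errs u ws)"
  shows "[] \<notin> set hs \<and> word_measure hs < 2 * length u + 1 + word_measure ws"
  using assms(2,3)
proof (induction ws arbitrary: hs)
  case (Cons v ws)
  let ?M = "\<lambda>j. merge_words (drop j v) (take j v)"
  have l: "length (?M j) = length v - 1" if "j \<in> {1..<length v}" for j
  proof -
    have "drop j v \<noteq> []" "take j v \<noteq> []" using that by auto
    then show ?thesis using that by simp
  qed
  have l': "length (merge_words m (revneg u)) = length m + length u - 1" if "m \<noteq> []" for m
    using that assms(1) by simp
  have u: "length u \<ge> 1" using assms(1) by (cases u) auto
  consider (a) j where "j \<in> {1..<length v}" "hs = (0 # merge_words (?M j) (revneg u)) # ws"
    | (b) j where "j \<in> {1..<length v}" "hs = (0 # merge_words (revneg (?M j)) (revneg u)) # ws"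
    | (c) hs' where "hs' \<in> set (errs u ws)" "hs = v # hs'"
    using Cons.prems(2) by auto
  then show ?case
  proof cases
    case a
    then show ?thesis using u l[OF a(1)] l'[of "?M j"] Cons.prems(1) by auto
  next
    case b
    then show ?thesis using u l[OF b(1)] l'[of "revneg (?M j)"] Cons.prems(1) by auto
  next
    case c
    then show ?thesis using Cons.IH[of hs'] Cons.prems(1) by auto
  qed
qed simp

text \<open>All terms of the recursion are products of smaller weight, so their limits are known by
  induction; the coefficients tend to \<open>y\<close>, \<open>1\<close>, \<open>0\<close> and
  \<open>0\<close>, and what is left is the recursion of \<open>word_limit\<close> times the limits
  of the other words. Factorisation of the limit is thus part of the induction.\<close>

theorem gauss_tau_limit:
  fixes p N :: "nat \<Rightarrow> nat"
  assumes N: "filterlim N at_top sequentially" and y: "(\<lambda>n. real (p n) / real (N n)) \<longlonglongrightarrow> y"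
    and s: "s \<ge> 1"
  shows "[] \<notin> set ws \<Longrightarrow> (\<lambda>n. gauss_tau (p n) (N n) s ws) \<longlonglongrightarrow> (\<Prod>v\<leftarrow>ws. word_limit y v)"
proof (induction ws rule: measure_induct_rule[where f = word_measure])
  case (less ws)
  have Npos: "\<forall>\<^sub>F n in sequentially. N n > m" for m
  proof -
    have "\<forall>\<^sub>F n in sequentially. Suc m \<le> N n" using N unfolding filterlim_at_top by blast
    then show ?thesis by (rule eventually_mono) simp
  qed
  have N1: "(\<lambda>n. 1 / real (N n)) \<longlonglongrightarrow> 0"
    by (rule tendsto_divide_0[OF tendsto_const filterlim_compose[OF filterlim_real_sequentially N, THEN filterlim_at_top_imp_at_infinity]])
  show ?case
  proof (cases ws)
    case Nil
    have "gauss_tau p N s [] = 1" for p N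
    proof -
      interpret prob_space "gauss ({..<p} \<times> {..<N})"
        unfolding gauss_def by (intro prob_space_PiM prob_space_std_normal)
      show ?thesis by (simp add: gauss_tau_def prob_space)
    qed
    then show ?thesis using Nil by simp
  next
    case (Cons v vs)
    have vs: "[] \<notin> set vs" and v: "v \<noteq> []" using less.prems by (auto simp: Cons)
    obtain z w0 where zw: "v = z # w0" using v by (cases v) auto
    show ?thesis
    proof (cases "w0 = []")
      case True
      have IH: "(\<lambda>n. gauss_tau (p n) (N n) s vs) \<longlonglongrightarrow> (\<Prod>v\<leftarrow>vs. word_limit y v)"
        by (rule less.IH) (use vs in \<open>simp_all add: Cons zw\<close>)
      have "\<forall>\<^sub>F n in sequentially. gauss_tau (p n) (N n) s ws = of_bool (z = 0) * gauss_tau (p n) (N n) s vs"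
        using Npos[of "nat \<bar>z * int s\<bar>"]
      proof eventually_elim
        case (elim n)
        \<comment> \<open>Once \<open>N\<close> exceeds \<open>|z s|\<close>, the shift by
          \<open>z s\<close> closes up modulo \<open>N\<close> for \<open>z = 0\<close> alone; this
          is where \<open>s \<ge> 1\<close> matters.\<close>
        have "z * int s mod int (N n) = 0 \<longleftrightarrow> z = 0"
        proof
          assume "z * int s mod int (N n) = 0"
          then have "int (N n) dvd z * int s" by auto
          then have "z * int s = 0" using elim dvd_imp_le_int[of "z * int s" "int (N n)"] by linarith
          then show "z = 0" using s by simp
        qed simp
        then show ?case using elim True
          by (simp add: gauss_tau_def Cons zw tau_singleton)
      qed
      moreover have "(\<lambda>n. of_bool (z = 0) * gauss_tau (p n) (N n) s vs) \<longlonglongrightarrow> of_bool (z = 0) * (\<Prod>v\<leftarrow>vs. word_limit y v)"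
        by (intro tendsto_intros IH)
      ultimately show ?thesis
        using True by (subst tendsto_cong) (auto simp: Cons zw)
    next
      case False
      define u where "u = shift_last w0 z"
      have lu: "length u = length w0" "u \<noteq> []" using False by (simp_all add: u_def)
      have l0: "length w0 \<ge> 1" using False by (cases w0) auto
      let ?L = "\<lambda>ws. \<Prod>v\<leftarrow>ws. word_limit y v"
      have m: "word_measure ws = 2 * length w0 + 1 + word_measure vs" by (simp add: Cons zw)
      have 1: "(\<lambda>n. gauss_tau (p n) (N n) s (u # vs)) \<longlonglongrightarrow> ?L (u # vs)"
        by (rule less.IH) (use vs lu in \<open>auto simp: m\<close>)
      have 2: "(\<lambda>n. gauss_tau (p n) (N n) s ((0 # take j u) # drop j u # vs)) \<longlonglongrightarrow> ?L ((0 # take j u) # drop j u # vs)"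
        if "j \<in> {1..<length w0}" for j
        by (rule less.IH) (use vs lu that in \<open>auto simp: m\<close>)
      have 3: "(\<lambda>n. gauss_tau (p n) (N n) s ((0 # merge_words (drop j u) (revneg (take j u))) # vs)) \<longlonglongrightarrow>
          ?L ((0 # merge_words (drop j u) (revneg (take j u))) # vs)"
        if j: "j \<in> {1..<length w0}" for j
      proof (rule less.IH)
        have "drop j u \<noteq> []" "take j u \<noteq> []" using j lu by auto
        then show "word_measure ((0 # merge_words (drop j u) (revneg (take j u))) # vs) < word_measure ws"
          using j lu by (simp add: m)
      qed (use vs in auto)
      have 4: "(\<lambda>n. gauss_tau (p n) (N n) s hs) \<longlonglongrightarrow> ?L hs" if "hs \<in> set (errs u vs)" for hs
        by (rule less.IH) (use errs_props[OF lu(2) vs that] lu in \<open>auto simp: m\<close>)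
      have 5: "(\<lambda>n. \<Sum>hs\<leftarrow>hss. gauss_tau (p n) (N n) s hs) \<longlonglongrightarrow> (\<Sum>hs\<leftarrow>hss. ?L hs)" if "set hss \<subseteq> set (errs u vs)" for hss
        using that by (induction hss) (auto intro!: tendsto_add 4)
      have "(\<lambda>n. real (p n) / real (N n) * gauss_tau (p n) (N n) s (u # vs)
        + (\<Sum>j\<in>{1..<length w0}. gauss_tau (p n) (N n) s ((0 # take j u) # drop j u # vs))
        + (1 / real (N n)) * (\<Sum>j\<in>{1..<length w0}. gauss_tau (p n) (N n) s ((0 # merge_words (drop j u) (revneg (take j u))) # vs))
        + ((1 / real (N n)) * (1 / real (N n))) * (\<Sum>hs\<leftarrow>errs u vs. gauss_tau (p n) (N n) s hs)) \<longlonglongrightarrow>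
        y * ?L (u # vs) + (\<Sum>j\<in>{1..<length w0}. ?L ((0 # take j u) # drop j u # vs))
        + 0 * (\<Sum>j\<in>{1..<length w0}. ?L ((0 # merge_words (drop j u) (revneg (take j u))) # vs))
        + (0 * 0) * (\<Sum>hs\<leftarrow>errs u vs. ?L hs)"
        by (intro tendsto_add tendsto_mult tendsto_sum y N1 1 2 3 5) auto
      moreover have "y * ?L (u # vs) + (\<Sum>j\<in>{1..<length w0}. ?L ((0 # take j u) # drop j u # vs))
        + 0 * (\<Sum>j\<in>{1..<length w0}. ?L ((0 # merge_words (drop j u) (revneg (take j u))) # vs))
        + (0 * 0) * (\<Sum>hs\<leftarrow>errs u vs. ?L hs) = ?L ws"
        by (simp add: Cons zw word_limit_Cons[OF False] u_def[symmetric] algebra_simps sum_distrib_left)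
      moreover have "\<forall>\<^sub>F n in sequentially. gauss_tau (p n) (N n) s ws =
        real (p n) / real (N n) * gauss_tau (p n) (N n) s (u # vs)
        + (\<Sum>j\<in>{1..<length w0}. gauss_tau (p n) (N n) s ((0 # take j u) # drop j u # vs))
        + (1 / real (N n)) * (\<Sum>j\<in>{1..<length w0}. gauss_tau (p n) (N n) s ((0 # merge_words (drop j u) (revneg (take j u))) # vs))
        + ((1 / real (N n)) * (1 / real (N n))) * (\<Sum>hs\<leftarrow>errs u vs. gauss_tau (p n) (N n) s hs)"
        using Npos[of 0]
        by eventually_elim (use gauss_tau_rec[OF _ False vs u_def] in \<open>simp add: Cons zw u_def power2_eq_square\<close>)
      ultimately show ?thesis by (subst tendsto_cong) simp_all
    qed
  qed
qed

section \<open>Universality of the mixed moments\<close>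

text \<open>Counting lists by the number of distinct new entries: every entry is either one of those seen
  before or one of at most \<open>L\<close> continuations.\<close>

fun chain_bound :: "nat \<Rightarrow> nat \<Rightarrow> nat" where
  "chain_bound 0 v = 1"
| "chain_bound (Suc n) v = (v + 1) * chain_bound n (v + 1)"

lemma chain_bound_mono: "v \<le> v' \<Longrightarrow> chain_bound n v \<le> chain_bound n v'"
proof (induction n arbitrary: v v')
  case (Suc n)
  show ?case
    unfolding chain_bound.simps by (intro mult_le_mono Suc.IH) (use Suc.prems in auto)
qed simp

text \<open>\<open>V\<close> holds the entries met earlier and \<open>r\<close> counts the new ones.
  The bound is required for every finite \<open>V\<close>, so that \<open>V\<close> can grow along
  the induction.\<close>

definition chain_set :: "nat \<Rightarrow> nat \<Rightarrow> 'e list set \<Rightarrow> bool" where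
  "chain_set n L S \<longleftrightarrow> finite S \<and> (\<forall>V r. finite V \<longrightarrow>
     card {es \<in> S. card (set es - V) = r} \<le> chain_bound n (card V) * L ^ r)"

lemma chain_set_Nil: "S \<subseteq> {[]} \<Longrightarrow> chain_set 0 L S"
proof -
  assume S: "S \<subseteq> {[]}"
  have "card {es \<in> S. card (set es - V) = r} \<le> L ^ r" for V r
  proof (cases "r = 0")
    case True
    have "card {es \<in> S. card (set es - V) = r} \<le> card {[]::'a list}"
      using S by (intro card_mono) auto
    then show ?thesis using True by simp
  next
    case False
    then have "{es \<in> S. card (set es - V) = r} = {}" using S by auto
    then show ?thesis by (metis card.empty le0)
  qed
  then show ?thesis using S by (auto simp: chain_set_def intro: finite_subset)
qed

text \<open>The first entry is either old, with at most \<open>card V\<close> choices, or new, with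
  at most \<open>L\<close> choices and joined to \<open>V\<close>. The two cases together account
  for the factor \<open>v + 1\<close>.\<close>

lemma chain_set_Cons:
  assumes A: "finite A" "card A \<le> L" and B: "\<And>e. e \<in> A \<Longrightarrow> chain_set n L (B e)"
  shows "chain_set (Suc n) L (\<Union>e\<in>A. (#) e ` B e)"
  unfolding chain_set_def
proof (intro conjI allI impI)
  show "finite (\<Union>e\<in>A. (#) e ` B e)" using A B by (auto simp: chain_set_def)
  fix V :: "'a set" and r assume V: "finite V"
  let ?F = "\<lambda>e V r. {es \<in> B e. card (set es - V) = r}"
  have fF: "finite (?F e V r)" if "e \<in> A" for e V r using B[OF that] by (auto simp: chain_set_def)
  have cF: "card (?F e W k) \<le> chain_bound n (card W) * L ^ k" if "e \<in> A" "finite W" for e W k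
    using B[OF that(1)] that(2) by (simp add: chain_set_def)
  define S1 where "S1 = (\<Union>e\<in>A \<inter> V. (#) e ` ?F e V r)"
  define S2 where "S2 = (if r = 0 then {} else (\<Union>e\<in>A - V. (#) e ` ?F e (insert e V) (r - 1)))"
  have sub: "{es \<in> (\<Union>e\<in>A. (#) e ` B e). card (set es - V) = r} \<subseteq> S1 \<union> S2"
  proof
    fix es assume "es \<in> {es \<in> (\<Union>e\<in>A. (#) e ` B e). card (set es - V) = r}"
    then obtain e es' where e: "e \<in> A" "es' \<in> B e" "es = e # es'" "card (set es - V) = r" by auto
    show "es \<in> S1 \<union> S2"
    proof (cases "e \<in> V")
      case True
      then have "set es - V = set es' - V" using e by auto
      then show ?thesis using e True by (auto simp: S1_def)
    next
      case False
      then have "set es - V = insert e (set es' - insert e V)" using e by auto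
      then have "r = Suc (card (set es' - insert e V))" using e(4) by simp
      then show ?thesis using e False by (auto simp: S2_def)
    qed
  qed
  have "card S1 \<le> (\<Sum>e\<in>A \<inter> V. card ((#) e ` ?F e V r))"
    unfolding S1_def using A V by (intro card_UN_le) auto
  also have "\<dots> \<le> (\<Sum>e\<in>A \<inter> V. chain_bound n (card V) * L ^ r)"
    by (intro sum_mono order_trans[OF card_image_le[OF fF] cF]) (use V in auto)
  also have "\<dots> \<le> card V * (chain_bound n (card V) * L ^ r)"
    using V by (simp add: card_mono)
  also have "\<dots> \<le> card V * (chain_bound n (card V + 1) * L ^ r)"
    by (intro mult_le_mono le_refl chain_bound_mono) simp
  finally have c1: "card S1 \<le> card V * (chain_bound n (card V + 1) * L ^ r)" .
  have c2: "card S2 \<le> chain_bound n (card V + 1) * L ^ r"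
  proof (cases "r = 0")
    case False
    have "card S2 \<le> (\<Sum>e\<in>A - V. card ((#) e ` ?F e (insert e V) (r - 1)))"
      unfolding S2_def using A False by (simp add: card_UN_le)
    also have "\<dots> \<le> (\<Sum>e\<in>A - V. chain_bound n (card V + 1) * L ^ (r - 1))"
    proof (intro sum_mono order_trans[OF card_image_le[OF fF]])
      fix e assume e: "e \<in> A - V"
      show "card (?F e (insert e V) (r - 1)) \<le> chain_bound n (card V + 1) * L ^ (r - 1)"
        using cF[of e "insert e V" "r - 1"] e V by simp
    qed auto
    also have "\<dots> = card (A - V) * (chain_bound n (card V + 1) * L ^ (r - 1))" by simp
    also have "\<dots> \<le> L * (chain_bound n (card V + 1) * L ^ (r - 1))"
      using A by (intro mult_le_mono le_refl order_trans[OF card_mono A(2)]) auto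
    also have "\<dots> = chain_bound n (card V + 1) * L ^ r" using False by (cases r) auto
    finally show ?thesis .
  qed (simp add: S2_def)
  have "card {es \<in> (\<Union>e\<in>A. (#) e ` B e). card (set es - V) = r} \<le> card (S1 \<union> S2)"
    by (rule card_mono[OF _ sub]) (use A V fF in \<open>auto simp: S1_def S2_def\<close>)
  also have "\<dots> \<le> card S1 + card S2" by (rule card_Un_le)
  also have "\<dots> \<le> chain_bound (Suc n) (card V) * L ^ r" using c1 c2 by (simp add: algebra_simps)
  finally show "card {es \<in> (\<Union>e\<in>A. (#) e ` B e). card (set es - V) = r} \<le> chain_bound (Suc n) (card V) * L ^ r" .
qed

text \<open>The index paths of a word, recorded as lists of array positions. Each Gram factor
  contributes two positions in a common row; the column of the first is reached from the previous
  column by the shift, and the column of the second is free.\<close>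

fun wpaths :: "nat \<Rightarrow> nat \<Rightarrow> nat \<Rightarrow> int list \<Rightarrow> nat \<Rightarrow> nat \<Rightarrow> (nat \<times> nat) list set" where
  "wpaths p N s [] a b = {}"
| "wpaths p N s [z] a b = (if shiftJ N s z a b = 1 then {[]} else {})"
| "wpaths p N s (z # z' # zs) a b =
     (\<Union>e\<in>{..<p} \<times> {c. c < N \<and> shiftJ N s z a c = 1}. (#) e ` (\<Union>e'\<in>{fst e} \<times> {..<N}. (#) e' ` wpaths p N s (z' # zs) (snd e') b))"

lemma wpaths_Cons:
  "zs \<noteq> [] \<Longrightarrow> wpaths p N s (z # zs) a b =
     (\<Union>e\<in>{..<p} \<times> {c. c < N \<and> shiftJ N s z a c = 1}. (#) e ` (\<Union>e'\<in>{fst e} \<times> {..<N}. (#) e' ` wpaths p N s zs (snd e') b))"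
  by (cases zs) auto

lemma shiftJ_01: "shiftJ N s z a b = 0 \<or> shiftJ N s z a b = 1"
  by (simp add: shiftJ_def)

lemma card_shiftJ_le: "card {c. c < N \<and> shiftJ N s z a c = 1} \<le> 1"
proof -
  have "c = c'" if "c < N" "c' < N" "shiftJ N s z a c = 1" "shiftJ N s z a c' = 1" for c c'
  proof -
    have "int N dvd (int c - int a - z * int s)" "int N dvd (int c' - int a - z * int s)"
      using that by (auto simp: shiftJ_def mod_eq_0_iff_dvd split: if_splits)
    then have "int N dvd (int c - int a - z * int s) - (int c' - int a - z * int s)" by (rule dvd_diff)
    then have "int N dvd (int c - int c')" by simp
    then have "int c - int c' = 0" using that dvd_imp_le_int[of "int c - int c'" "int N"] by linarith
    then show ?thesis by simp
  qed
  then show ?thesis unfolding One_nat_def by (subst card_le_Suc0_iff_eq) auto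
qed

text \<open>For the first position of a Gram factor the shift leaves at most one column, so at most
  \<open>p\<close> rows are to be chosen. For the second the row is fixed and \<open>N\<close>
  columns remain.\<close>

lemma chain_set_wpaths:
  assumes L: "p \<le> L" "N \<le> L" and ne: "zs \<noteq> []"
  shows "chain_set (2 * (length zs - 1)) L (wpaths p N s zs a b)"
  using ne
proof (induction zs arbitrary: a)
  case (Cons z zs)
  show ?case
  proof (cases "zs = []")
    case True
    then show ?thesis by (auto intro: chain_set_Nil)
  next
    case False
    have len: "2 * (length (z # zs) - 1) = Suc (Suc (2 * (length zs - 1)))" using False by (cases zs) auto
    show ?thesis
      unfolding len wpaths_Cons[OF False]
    proof (rule chain_set_Cons)
      show "card ({..<p} \<times> {c. c < N \<and> shiftJ N s z a c = 1}) \<le> L"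
        using mult_le_mono[OF L(1) card_shiftJ_le[of N s z a]] by (simp add: card_cartesian_product)
      fix e assume "e \<in> {..<p} \<times> {c. c < N \<and> shiftJ N s z a c = 1}"
      show "chain_set (Suc (2 * (length zs - 1))) L (\<Union>e'\<in>{fst e} \<times> {..<N}. (#) e' ` wpaths p N s zs (snd e') b)"
        by (rule chain_set_Cons) (use L Cons.IH[OF False] in \<open>auto simp: card_cartesian_product\<close>)
    qed simp
  qed
qed simp

lemma wpaths_subset:
  assumes "es \<in> wpaths p N s zs a b"
  shows "set es \<subseteq> {..<p} \<times> {..<N}" "length es = 2 * (length zs - 1)"
proof -
  have "set es \<subseteq> {..<p} \<times> {..<N} \<and> length es = 2 * (length zs - 1)"
    using assms
  proof (induction zs arbitrary: a es)
    case (Cons z zs)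
    show ?case
    proof (cases "zs = []")
      case True
      then show ?thesis using Cons.prems by (auto split: if_splits)
    next
      case False
      obtain e e' es' where e: "es = e # e' # es'" "e \<in> {..<p} \<times> {..<N}" "e' \<in> {fst e} \<times> {..<N}" "es' \<in> wpaths p N s zs (snd e') b"
        using Cons.prems unfolding wpaths_Cons[OF False] by auto
      have "length zs \<ge> 1" using False by (cases zs) auto
      then show ?thesis using Cons.IH[OF e(4)] e(1-3) by auto
    qed
  qed simp
  then show "set es \<subseteq> {..<p} \<times> {..<N}" "length es = 2 * (length zs - 1)" by auto
qed

lemma sum_UN_Cons:
  assumes "finite A" "\<And>e. e \<in> A \<Longrightarrow> finite (B e)"
  shows "sum f (\<Union>e\<in>A. (#) e ` B e) = (\<Sum>e\<in>A. \<Sum>es\<in>B e. f (e # es))"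
proof -
  have "sum f (\<Union>e\<in>A. (#) e ` B e) = (\<Sum>e\<in>A. sum f ((#) e ` B e))"
    by (rule sum.UNION_disjoint) (use assms in auto)
  also have "\<dots> = (\<Sum>e\<in>A. \<Sum>es\<in>B e. f (e # es))"
    by (rule sum.cong[OF refl], subst sum.reindex) auto
  finally show ?thesis .
qed

lemma sum_Times: "(\<Sum>e\<in>A \<times> B. g e) = (\<Sum>i\<in>A. \<Sum>c\<in>B. g (i, c))"
  by (simp add: sum.cartesian_product)

lemma word_eq_path_sum:
  assumes N: "N > 0" and ne: "zs \<noteq> []"
  shows "word p N s zs w a b = (\<Sum>es\<in>wpaths p N s zs a b. \<Prod>e\<leftarrow>es. w e) / real N ^ (length zs - 1)"
  using ne
proof (induction zs arbitrary: a)
  case (Cons z zs)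
  show ?case
  proof (cases "zs = []")
    case True
    then show ?thesis using shiftJ_01[of N s z a b] by auto
  next
    case False
    let ?C = "{c. c < N \<and> shiftJ N s z a c = 1}"
    have fin: "finite (wpaths p N s zs d b)" for d
      using chain_set_wpaths[of p "max p N" N zs s d b] False by (simp add: chain_set_def)
    have len: "length (z # zs) - 1 = Suc (length zs - 1)" using False by (cases zs) auto
    have "(\<Sum>es\<in>wpaths p N s (z # zs) a b. \<Prod>e\<leftarrow>es. w e)
      = (\<Sum>e\<in>{..<p} \<times> ?C. \<Sum>e'\<in>{fst e} \<times> {..<N}. \<Sum>es\<in>wpaths p N s zs (snd e') b. w e * (w e' * (\<Prod>e\<leftarrow>es. w e)))"
      unfolding wpaths_Cons[OF False]
      by (subst sum_UN_Cons) (auto intro!: sum.cong finite_UN_I simp: sum_UN_Cons fin)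
    also have "\<dots> = (\<Sum>i<p. \<Sum>c\<in>?C. \<Sum>d<N. w (i, c) * (w (i, d) * (\<Sum>es\<in>wpaths p N s zs d b. \<Prod>e\<leftarrow>es. w e)))"
      by (simp add: sum_Times sum_distrib_left)
    also have "\<dots> = (\<Sum>i<p. \<Sum>c\<in>?C. \<Sum>d<N. w (i, c) * (w (i, d) * (word p N s zs w d b * real N ^ (length zs - 1))))"
      using N by (simp add: Cons.IH[OF False])
    also have "\<dots> = (\<Sum>c\<in>?C. \<Sum>i<p. \<Sum>d<N. w (i, c) * (w (i, d) * (word p N s zs w d b * real N ^ (length zs - 1))))"
      by (rule sum.swap)
    also have "\<dots> = (\<Sum>c\<in>?C. \<Sum>d<N. \<Sum>i<p. w (i, c) * (w (i, d) * (word p N s zs w d b * real N ^ (length zs - 1))))"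
      by (rule sum.cong[OF refl], rule sum.swap)
    also have "\<dots> = (\<Sum>c\<in>?C. \<Sum>d<N. gramK p N w c d * word p N s zs w d b) * real N ^ (length (z # zs) - 1)"
      unfolding len gramK_def sum_distrib_right sum_divide_distrib
      using N by (intro sum.cong refl) (simp add: sum_distrib_right sum_divide_distrib)
    also have "(\<Sum>c\<in>?C. \<Sum>d<N. gramK p N w c d * word p N s zs w d b) = word p N s (z # zs) w a b"
    proof -
      have "word p N s (z # zs) w a b = (\<Sum>c<N. if shiftJ N s z a c = 1 then (\<Sum>d<N. gramK p N w c d * word p N s zs w d b) else 0)"
        unfolding word_Cons[OF False] fmm_def
        by (intro sum.cong refl) (use shiftJ_01[of N s z a] in auto)
      also have "\<dots> = (\<Sum>c\<in>?C. \<Sum>d<N. gramK p N w c d * word p N s zs w d b)"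
        by (simp add: sum.inter_filter[symmetric])
      finally show ?thesis by simp
    qed
    finally show ?thesis using N by simp
  qed
qed simp

lemma tau_eq_path_sum:
  assumes "N > 0" "zs \<noteq> []"
  shows "tau p N s zs w = (\<Sum>a<N. \<Sum>es\<in>wpaths p N s zs a a. \<Prod>e\<leftarrow>es. w e) / real N ^ length zs"
proof -
  have "length zs = Suc (length zs - 1)" using assms(2) by (cases zs) auto
  then have "real N ^ length zs = real N * real N ^ (length zs - 1)" by (metis power_Suc)
  then show ?thesis
    unfolding tau_def word_eq_path_sum[OF assms] sum_divide_distrib[symmetric] by (simp add: mult.commute)
qed

text \<open>Independence is used entry by entry, so the product along a path is regrouped by
  multiplicities.\<close>

lemma prod_list_eq_count:
  fixes f :: "'i \<Rightarrow> real"
  assumes "finite I" "set es \<subseteq> I"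
  shows "(\<Prod>e\<leftarrow>es. f e) = (\<Prod>e\<in>I. f e ^ count_list es e)"
  using assms(2)
proof (induction es)
  case (Cons x es)
  have x: "x \<in> I" using Cons by simp
  have "(\<Prod>e\<in>I. f e ^ count_list (x # es) e) = (\<Prod>e\<in>I. (if e = x then f e else 1) * f e ^ count_list es e)"
    by (intro prod.cong refl) auto
  also have "\<dots> = f x * (\<Prod>e\<in>I. f e ^ count_list es e)"
    using assms(1) x by (simp add: prod.distrib)
  finally show ?case using Cons by simp
qed simp

text \<open>With every entry occurring at least twice, the exponents of \<open>q\<close> are the
  surplus multiplicities. They add up to the length minus twice the number of distinct
  entries.\<close>

lemma moment_prod_bound:
  fixes m :: "'i \<Rightarrow> nat \<Rightarrow> real"
  assumes I: "finite I" "set es \<subseteq> I" and q: "q \<ge> 1" and D: "D \<ge> 1"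
    and m0: "\<And>e. e \<in> I \<Longrightarrow> m e 0 = 1"
    and mb: "\<And>e k. e \<in> I \<Longrightarrow> 2 \<le> k \<Longrightarrow> k \<le> length es \<Longrightarrow> \<bar>m e k\<bar> \<le> D * q ^ (k - 2)"
    and c2: "\<And>e. e \<in> set es \<Longrightarrow> 2 \<le> count_list es e"
  shows "\<bar>\<Prod>e\<in>I. m e (count_list es e)\<bar> \<le> D ^ length es * q ^ (length es - 2 * card (set es))"
proof -
  have "(\<Prod>e\<in>I. m e (count_list es e)) = (\<Prod>e\<in>set es. m e (count_list es e))"
    by (rule prod.mono_neutral_right) (use I m0 in \<open>auto simp: count_list_0_iff\<close>)
  then have "\<bar>\<Prod>e\<in>I. m e (count_list es e)\<bar> = (\<Prod>e\<in>set es. \<bar>m e (count_list es e)\<bar>)"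
    by (simp add: abs_prod)
  also have "\<dots> \<le> (\<Prod>e\<in>set es. D * q ^ (count_list es e - 2))"
    by (intro prod_mono conjI abs_ge_zero mb) (use I c2 count_le_length[of es] in auto)
  also have "\<dots> = D ^ card (set es) * q ^ (\<Sum>e\<in>set es. count_list es e - 2)"
    by (simp add: prod.distrib power_sum)
  also have "(\<Sum>e\<in>set es. count_list es e - 2) = length es - 2 * card (set es)"
  proof -
    have "(\<Sum>e\<in>set es. count_list es e - 2) + (\<Sum>e\<in>set es. 2) = (\<Sum>e\<in>set es. count_list es e)"
      unfolding sum.distrib[symmetric] by (rule sum.cong[OF refl], drule c2, simp)
    also have "\<dots> = length es" by (rule sum_count_set) auto
    finally show ?thesis by simp
  qed
  also have "D ^ card (set es) * q ^ (length es - 2 * card (set es)) \<le> D ^ length es * q ^ (length es - 2 * card (set es))"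
    using D q by (intro mult_right_mono power_increasing card_length) auto
  finally show ?thesis .
qed

text \<open>Both products vanish if an entry occurs once, and both are \<open>1\<close> if every entry occurs twice.\<close>

lemma moment_prod_diff:
  fixes m m' :: "'i \<Rightarrow> nat \<Rightarrow> real"
  assumes I: "finite I" "set es \<subseteq> I" and q: "q \<ge> 1" and D: "D \<ge> 1"
    and m: "\<And>e. e \<in> I \<Longrightarrow> m e 0 = 1" "\<And>e. e \<in> I \<Longrightarrow> m e 1 = 0" "\<And>e. e \<in> I \<Longrightarrow> m e 2 = 1"
      "\<And>e k. e \<in> I \<Longrightarrow> 2 \<le> k \<Longrightarrow> k \<le> length es \<Longrightarrow> \<bar>m e k\<bar> \<le> D * q ^ (k - 2)"
    and m': "\<And>e. e \<in> I \<Longrightarrow> m' e 0 = 1" "\<And>e. e \<in> I \<Longrightarrow> m' e 1 = 0" "\<And>e. e \<in> I \<Longrightarrow> m' e 2 = 1"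
      "\<And>e k. e \<in> I \<Longrightarrow> 2 \<le> k \<Longrightarrow> k \<le> length es \<Longrightarrow> \<bar>m' e k\<bar> \<le> D * q ^ (k - 2)"
  shows "\<bar>(\<Prod>e\<in>I. m e (count_list es e)) - (\<Prod>e\<in>I. m' e (count_list es e))\<bar>
    \<le> (if 2 * card (set es) < length es then 2 * D ^ length es * q ^ (length es - 2 * card (set es)) else 0)"
proof (cases "\<exists>e\<in>set es. count_list es e = 1")
  case True
  then obtain e where e: "e \<in> I" "count_list es e = 1" using I by auto
  have "(\<Prod>e\<in>I. m e (count_list es e)) = 0" "(\<Prod>e\<in>I. m' e (count_list es e)) = 0"
    by (rule prod_zero[OF I(1)], use e m(2) m'(2) in force)+
  then show ?thesis using D q by auto
next
  case False
  have c2: "2 \<le> count_list es e" if "e \<in> set es" for e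
  proof -
    have "count_list es e \<noteq> 0" "count_list es e \<noteq> 1" using that False by (auto simp: count_list_0_iff)
    then show ?thesis by linarith
  qed
  have tot: "(\<Sum>e\<in>set es. count_list es e) = length es" by (rule sum_count_set) auto
  show ?thesis
  proof (cases "2 * card (set es) < length es")
    case True
    have "\<bar>\<Prod>e\<in>I. m e (count_list es e)\<bar> \<le> D ^ length es * q ^ (length es - 2 * card (set es))"
      by (rule moment_prod_bound[OF I q D m(1) m(4) c2])
    moreover have "\<bar>\<Prod>e\<in>I. m' e (count_list es e)\<bar> \<le> D ^ length es * q ^ (length es - 2 * card (set es))"
      by (rule moment_prod_bound[OF I q D m'(1) m'(4) c2])
    ultimately show ?thesis using True by (simp add: abs_le_iff)
  next
    case False
    have "count_list es e = 2" if e: "e \<in> set es" for e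
    proof (rule ccontr)
      assume "count_list es e \<noteq> 2"
      then have "2 < count_list es e" using c2[OF e] by simp
      then have "(\<Sum>e\<in>set es. 2) < (\<Sum>e\<in>set es. count_list es e)"
        using e c2 by (intro sum_strict_mono_ex1) auto
      then show False using False tot by simp
    qed
    then have c: "count_list es e = 2 \<or> count_list es e = 0" for e
      by (cases "e \<in> set es") (auto simp: count_list_0_iff)
    have "(\<Prod>e\<in>I. m e (count_list es e)) = 1" "(\<Prod>e\<in>I. m' e (count_list es e)) = 1"
      by (rule prod.neutral, use c m(1,3) m'(1,3) in metis)+
    then show ?thesis using False by simp
  qed
qed

text \<open>For each of the \<open>N\<close> starting indices there are at most a constant times
  \<open>L^r\<close> paths with \<open>r\<close> distinct entries, and such a path contributes at
  most a constant times \<open>q^(2 (k - r))\<close>, and nothing for \<open>r \<ge> k\<close>.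
  Since \<open>q^2 \<le> N\<close>, all but one of the factors \<open>q^2\<close> are absorbed by
  the missing factors \<open>N\<close>; the last one, set against the last missing \<open>N\<close>,
  leaves \<open>q^2 / N\<close>. \<open>L\<close> is comparable to \<open>N\<close> by
  \<open>K\<close>.\<close>

lemma tau_moment_universality:
  fixes m m' :: "nat \<times> nat \<Rightarrow> nat \<Rightarrow> real" and E E' :: "((nat \<times> nat \<Rightarrow> real) \<Rightarrow> real) \<Rightarrow> real"
  defines "I p N \<equiv> {..<p} \<times> {..<N}"
  assumes N: "N > 0" and zs: "zs \<noteq> []" and pK: "real p \<le> K * real N" and K: "K \<ge> 1"
    and q: "q \<ge> 1" "q\<^sup>2 \<le> real N" and D: "D \<ge> 1"
    and m: "\<And>e. e \<in> I p N \<Longrightarrow> m e 0 = 1" "\<And>e. e \<in> I p N \<Longrightarrow> m e 1 = 0" "\<And>e. e \<in> I p N \<Longrightarrow> m e 2 = 1"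
      "\<And>e k. e \<in> I p N \<Longrightarrow> 2 \<le> k \<Longrightarrow> k \<le> 2 * (length zs - 1) \<Longrightarrow> \<bar>m e k\<bar> \<le> D * q ^ (k - 2)"
    and m': "\<And>e. e \<in> I p N \<Longrightarrow> m' e 0 = 1" "\<And>e. e \<in> I p N \<Longrightarrow> m' e 1 = 0" "\<And>e. e \<in> I p N \<Longrightarrow> m' e 2 = 1"
      "\<And>e k. e \<in> I p N \<Longrightarrow> 2 \<le> k \<Longrightarrow> k \<le> 2 * (length zs - 1) \<Longrightarrow> \<bar>m' e k\<bar> \<le> D * q ^ (k - 2)"
  shows "\<bar>(\<Sum>a<N. \<Sum>es\<in>wpaths p N s zs a a. \<Prod>e\<in>I p N. m e (count_list es e)) / real N ^ length zs
        - (\<Sum>a<N. \<Sum>es\<in>wpaths p N s zs a a. \<Prod>e\<in>I p N. m' e (count_list es e)) / real N ^ length zs\<bar>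
    \<le> 2 * D ^ (2 * length zs) * real (chain_bound (2 * (length zs - 1)) 0) * real (length zs) * K ^ length zs * (q\<^sup>2 / real N)"
proof -
  define k where "k = length zs - 1"
  define n where "n = 2 * k"
  have lz: "length zs = Suc k" using zs by (cases zs) (auto simp: k_def)
  define L where "L = max p N"
  have LK: "real L \<le> K * real N" 
  proof -
    have "real N \<le> K * real N" using K by (simp add: mult_le_cancel_right1)
    then show ?thesis using pK by (simp add: L_def max_def)
  qed
  define W where "W a = wpaths p N s zs a a" for a
  define B where "B r = (if 2 * r < n then 2 * D ^ n * q ^ (n - 2 * r) else 0)" for r
  have fW: "finite (W a)" and cW: "card {es \<in> W a. card (set es) = r} \<le> chain_bound n 0 * L ^ r" for a r
  proof -
    have "chain_set n L (W a)"
      unfolding W_def n_def k_def by (rule chain_set_wpaths) (use zs in \<open>auto simp: L_def\<close>)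
    then have c: "finite (W a)" "\<And>V r. finite V \<Longrightarrow> card {es \<in> W a. card (set es - V) = r} \<le> chain_bound n (card V) * L ^ r"
      by (auto simp: chain_set_def)
    show "finite (W a)" by (rule c(1))
    show "card {es \<in> W a. card (set es) = r} \<le> chain_bound n 0 * L ^ r" using c(2)[of "{}" r] by simp
  qed
  have len: "length es = n" "set es \<subseteq> I p N" if "es \<in> W a" for es a
    using wpaths_subset[of es p N s zs a a] that by (auto simp: W_def n_def k_def I_def)
  have tdiff: "\<bar>(\<Prod>e\<in>I p N. m e (count_list es e)) - (\<Prod>e\<in>I p N. m' e (count_list es e))\<bar> \<le> B (card (set es))"
    if es: "es \<in> W a" for es a
  proof -
    note l = len[OF es]
    have le: "length es = 2 * (length zs - 1)" using l(1) by (simp add: n_def k_def)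
    have "\<bar>(\<Prod>e\<in>I p N. m e (count_list es e)) - (\<Prod>e\<in>I p N. m' e (count_list es e))\<bar>
      \<le> (if 2 * card (set es) < length es then 2 * D ^ length es * q ^ (length es - 2 * card (set es)) else 0)"
      by (rule moment_prod_diff) (use l(2) q(1) D m m' le in \<open>simp_all add: I_def\<close>)
    then show ?thesis unfolding B_def l(1) .
  qed
  have Wsum: "(\<Sum>es\<in>W a. B (card (set es))) \<le> (\<Sum>r\<le>k. real (chain_bound n 0) * real L ^ r * B r)" for a
  proof -
    have B0: "B r \<ge> 0" for r using D q by (simp add: B_def)
    have "(\<Sum>es\<in>W a. B (card (set es))) = (\<Sum>r\<le>n. \<Sum>es\<in>{es \<in> W a. card (set es) = r}. B (card (set es)))"
    proof (rule sum.group[symmetric, OF fW])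
      show "(\<lambda>es. card (set es)) ` W a \<subseteq> {..n}" using len card_length by fastforce
    qed simp
    also have "\<dots> = (\<Sum>r\<le>n. real (card {es \<in> W a. card (set es) = r}) * B r)"
      by (intro sum.cong refl) simp
    also have "\<dots> = (\<Sum>r\<le>k. real (card {es \<in> W a. card (set es) = r}) * B r)"
      by (rule sum.mono_neutral_right) (auto simp: B_def n_def)
    also have "\<dots> \<le> (\<Sum>r\<le>k. real (chain_bound n 0) * real L ^ r * B r)"
      by (intro sum_mono mult_right_mono B0) (metis cW of_nat_le_iff of_nat_mult of_nat_power)
    finally show ?thesis .
  qed
  have "\<bar>(\<Sum>a<N. \<Sum>es\<in>W a. \<Prod>e\<in>I p N. m e (count_list es e)) - (\<Sum>a<N. \<Sum>es\<in>W a. \<Prod>e\<in>I p N. m' e (count_list es e))\<bar>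
     \<le> (\<Sum>a<N. \<Sum>es\<in>W a. B (card (set es)))"
    unfolding sum_subtractf[symmetric] by (intro order_trans[OF sum_abs] sum_mono tdiff)
  also have "\<dots> \<le> (\<Sum>a<N. \<Sum>r\<le>k. real (chain_bound n 0) * real L ^ r * B r)"
    by (intro sum_mono Wsum)
  also have "\<dots> = real N * (\<Sum>r\<le>k. real (chain_bound n 0) * real L ^ r * B r)" by simp
  also have "\<dots> \<le> real N * (\<Sum>r\<le>k. 2 * D ^ (2 * length zs) * real (chain_bound n 0) * K ^ length zs * (q\<^sup>2 / real N) * real N ^ k)"
  proof (intro mult_left_mono sum_mono)
    fix r assume r: "r \<in> {..k}"
    show "real (chain_bound n 0) * real L ^ r * B r \<le> 2 * D ^ (2 * length zs) * real (chain_bound n 0) * K ^ length zs * (q\<^sup>2 / real N) * real N ^ k"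
    proof (cases "r = k")
      case True
      then show ?thesis using D K q N by (simp add: B_def n_def)
    next
      case False
      \<comment> \<open>\<open>Suc d\<close> is the number of distinct entries lost against a
        perfect pairing; one of these losses is kept for the gain \<open>q^2 / N\<close>.\<close>
      then obtain d where d: "k = r + Suc d" using r by (metis atMost_iff le_neq_implies_less less_imp_Suc_add add_Suc_right)
      have e: "n - 2 * r = 2 * Suc d" by (simp add: n_def d)
      have "real L ^ r \<le> (K * real N) ^ r" using LK by (intro power_mono) auto
      also have "\<dots> = K ^ r * real N ^ r" by (simp add: power_mult_distrib)
      also have "\<dots> \<le> K ^ length zs * real N ^ r" using K d by (intro mult_right_mono power_increasing) (auto simp: lz)
      finally have 1: "real L ^ r \<le> K ^ length zs * real N ^ r" .
      have "q ^ (n - 2 * r) = q\<^sup>2 * (q\<^sup>2) ^ d" by (simp add: e power_mult[symmetric] power_add[symmetric])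
      also have "\<dots> \<le> q\<^sup>2 * real N ^ d" using q by (intro mult_left_mono power_mono) auto
      finally have 2: "q ^ (n - 2 * r) \<le> q\<^sup>2 * real N ^ d" .
      have "D ^ n \<le> D ^ (2 * length zs)" using D by (intro power_increasing) (auto simp: n_def lz)
      then have 3: "B r \<le> 2 * D ^ (2 * length zs) * (q\<^sup>2 * real N ^ d)"
        unfolding B_def using 2 D q by (auto intro!: mult_mono)
      have "real (chain_bound n 0) * real L ^ r * B r
        \<le> real (chain_bound n 0) * (K ^ length zs * real N ^ r) * (2 * D ^ (2 * length zs) * (q\<^sup>2 * real N ^ d))"
        using 1 3 K D q by (intro mult_mono mult_left_mono) (auto simp: B_def)
      also have "\<dots> = 2 * D ^ (2 * length zs) * real (chain_bound n 0) * K ^ length zs * (q\<^sup>2 / real N) * real N ^ k"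
        using N by (simp add: d power_add)
      finally show ?thesis .
    qed
  qed simp
  also have "\<dots> = (2 * D ^ (2 * length zs) * real (chain_bound n 0) * real (length zs) * K ^ length zs * (q\<^sup>2 / real N)) * real N ^ length zs"
    by (simp add: lz)
  finally have fin: "\<bar>(\<Sum>a<N. \<Sum>es\<in>W a. \<Prod>e\<in>I p N. m e (count_list es e)) - (\<Sum>a<N. \<Sum>es\<in>W a. \<Prod>e\<in>I p N. m' e (count_list es e))\<bar>
     \<le> (2 * D ^ (2 * length zs) * real (chain_bound n 0) * real (length zs) * K ^ length zs * (q\<^sup>2 / real N)) * real N ^ length zs" .
  then show ?thesis
    using N unfolding W_def[symmetric] diff_divide_distrib[symmetric] abs_divide
    by (simp add: n_def k_def divide_le_eq)
qed

section \<open>The cyclic auto-covariance matrix\<close>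

text \<open>Entry \<open>(i, j)\<close> of \<open>w W w^T\<close>, with \<open>w\<close> read as a
  \<open>p\<close> by \<open>N\<close> array.\<close>

definition bil :: "nat \<Rightarrow> (nat \<times> nat \<Rightarrow> real) \<Rightarrow> (nat \<Rightarrow> nat \<Rightarrow> real) \<Rightarrow> nat \<Rightarrow> nat \<Rightarrow> real" where
  "bil N w W i j = (\<Sum>a<N. \<Sum>b<N. w (i, a) * W a b * w (j, b))"

text \<open>In the product of \<open>w W w^T\<close> and \<open>w V w^T\<close> the inner
  \<open>w^T w\<close> is \<open>N\<close> times the Gram matrix.\<close>

lemma bil_compose:
  assumes N: "N > 0"
  shows "(\<Sum>l<p. bil N w W i l * bil N w V l j) = real N * bil N w (fmm N W (fmm N (gramK p N w) V)) i j"
proof -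
  let ?f = "\<lambda>l a b c d. (w (i, a) * W a b * w (l, b)) * (w (l, c) * V c d * w (j, d))"
  have "(\<Sum>l<p. bil N w W i l * bil N w V l j) = (\<Sum>l<p. \<Sum>a<N. \<Sum>c<N. \<Sum>b<N. \<Sum>d<N. ?f l a b c d)"
    by (simp only: bil_def sum_product)
  also have "\<dots> = (\<Sum>a<N. \<Sum>l<p. \<Sum>c<N. \<Sum>b<N. \<Sum>d<N. ?f l a b c d)" by (rule sum.swap)
  also have "\<dots> = (\<Sum>a<N. \<Sum>c<N. \<Sum>l<p. \<Sum>b<N. \<Sum>d<N. ?f l a b c d)"
    by (rule sum.cong[OF refl], rule sum.swap)
  also have "\<dots> = (\<Sum>a<N. \<Sum>c<N. \<Sum>b<N. \<Sum>l<p. \<Sum>d<N. ?f l a b c d)"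
    by (rule sum.cong[OF refl], rule sum.cong[OF refl], rule sum.swap)
  also have "\<dots> = (\<Sum>a<N. \<Sum>c<N. \<Sum>b<N. \<Sum>d<N. \<Sum>l<p. ?f l a b c d)"
    by (rule sum.cong[OF refl], rule sum.cong[OF refl], rule sum.cong[OF refl], rule sum.swap)
  also have "\<dots> = (\<Sum>a<N. \<Sum>c<N. \<Sum>b<N. \<Sum>d<N. real N * (w (i, a) * (W a b * (gramK p N w b c * V c d)) * w (j, d)))"
    using N by (intro sum.cong refl) (simp add: gramK_def sum_distrib_left sum_distrib_right sum_divide_distrib mult_ac)
  also have "\<dots> = (\<Sum>a<N. \<Sum>b<N. \<Sum>c<N. \<Sum>d<N. real N * (w (i, a) * (W a b * (gramK p N w b c * V c d)) * w (j, d)))"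
    by (rule sum.cong[OF refl], rule sum.swap)
  also have "\<dots> = (\<Sum>a<N. \<Sum>b<N. \<Sum>d<N. \<Sum>c<N. real N * (w (i, a) * (W a b * (gramK p N w b c * V c d)) * w (j, d)))"
    by (rule sum.cong[OF refl], rule sum.cong[OF refl], rule sum.swap)
  also have "\<dots> = (\<Sum>a<N. \<Sum>d<N. \<Sum>b<N. \<Sum>c<N. real N * (w (i, a) * (W a b * (gramK p N w b c * V c d)) * w (j, d)))"
    by (rule sum.cong[OF refl], rule sum.swap)
  also have "\<dots> = real N * bil N w (fmm N W (fmm N (gramK p N w) V)) i j"
    by (simp add: bil_def fmm_def sum_distrib_left sum_distrib_right)
  finally show ?thesis .
qed

text \<open>The sample auto-covariance matrix with the time index taken modulo \<open>T + s\<close>; note that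
  \<open>a - s\<close> and \<open>a + T\<close> agree modulo \<open>T + s\<close>.\<close>

definition cyc_mat :: "nat \<Rightarrow> nat \<Rightarrow> nat \<Rightarrow> (nat \<times> nat \<Rightarrow> real) \<Rightarrow> real mat" where
  "cyc_mat s p T w = mat p p (\<lambda>(i, j). (\<Sum>a<T + s. w (i, a) * w (j, (a + T) mod (T + s))) / real T)"

lemma cyc_mat_carrier [simp]: "cyc_mat s p T w \<in> carrier_mat p p"
  by (simp add: cyc_mat_def)

lemma shiftJ_minus_1:
  assumes "T > 0" "a < T + s" "b < T + s"
  shows "shiftJ (T + s) s (- 1) a b = of_bool (b = (a + T) mod (T + s))"
proof -
  have "(int b - int a - (- 1) * int s) mod int (T + s) = 0 \<longleftrightarrow> (int b - (int a + int T) + int (T + s)) mod int (T + s) = 0"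
    by (simp add: algebra_simps)
  also have "\<dots> \<longleftrightarrow> (int b - (int a + int T)) mod int (T + s) = 0" by (simp only: mod_add_self2)
  also have "\<dots> \<longleftrightarrow> int b mod int (T + s) = (int a + int T) mod int (T + s)"
    by (simp only: mod_eq_0_iff_dvd mod_eq_dvd_iff)
  also have "\<dots> \<longleftrightarrow> b mod (T + s) = (a + T) mod (T + s)"
    by (metis of_nat_add of_nat_eq_iff zmod_int)
  also have "\<dots> \<longleftrightarrow> b = (a + T) mod (T + s)" using assms by simp
  finally show ?thesis by (simp add: shiftJ_def)
qed

lemma cyc_mat_index:
  assumes T: "T > 0" and ij: "i < p" "j < p"
  shows "cyc_mat s p T w $$ (i, j) = bil (T + s) w (shiftJ (T + s) s (- 1)) i j / real T"
    and "cyc_mat s p T w $$ (j, i) = bil (T + s) w (shiftJ (T + s) s 1) i j / real T"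
proof -
  have main: "cyc_mat s p T w $$ (i, j) = bil (T + s) w (shiftJ (T + s) s (- 1)) i j / real T" if "i < p" "j < p" for i j
  proof -
    have "w (i, a) * w (j, (a + T) mod (T + s)) = (\<Sum>b<T + s. w (i, a) * shiftJ (T + s) s (- 1) a b * w (j, b))"
      if a: "a < T + s" for a
    proof -
      have "(\<Sum>b<T + s. w (i, a) * shiftJ (T + s) s (- 1) a b * w (j, b))
        = (\<Sum>b<T + s. if b = (a + T) mod (T + s) then w (i, a) * w (j, b) else 0)"
        by (intro sum.cong refl) (use shiftJ_minus_1[OF T a] in auto)
      then show ?thesis using T by simp
    qed
    then have "(\<Sum>a<T + s. w (i, a) * w (j, (a + T) mod (T + s))) = bil (T + s) w (shiftJ (T + s) s (- 1)) i j"
      unfolding bil_def by (intro sum.cong refl) auto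
    then show ?thesis using that by (simp add: cyc_mat_def)
  qed
  show "cyc_mat s p T w $$ (i, j) = bil (T + s) w (shiftJ (T + s) s (- 1)) i j / real T" by (rule main[OF ij])
  have "bil (T + s) w (shiftJ (T + s) s (- 1)) j i = bil (T + s) w (shiftJ (T + s) s 1) i j"
    unfolding bil_def by (subst sum.swap, intro sum.cong refl, subst shiftJ_transpose) (simp add: mult_ac)
  then show "cyc_mat s p T w $$ (j, i) = bil (T + s) w (shiftJ (T + s) s 1) i j / real T"
    using main[OF ij(2,1)] by simp
qed

lemma alt_add_2: "alt b (n + 2) = alt b n @ (if even n then [b, - b] else [- b, b])"
  by (simp add: alt_def)

text \<open>The matrix \<open>Y Y^T\<close> is the word \<open>[-1, 1]\<close> between two copies of
  the array, up to scale. Each further factor appends this word behind a new Gram matrix, which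
  produces the alternating words, with one factor \<open>N\<close> for every Gram matrix.\<close>

lemma cyc_mat_pow:
  assumes T: "T > 0" and ij: "i < p" "j < p"
  shows "((cyc_mat s p T w * (cyc_mat s p T w)\<^sup>T) ^\<^sub>m Suc k) $$ (i, j)
    = real (T + s) ^ (2 * k + 1) / real T ^ (2 * Suc k) * bil (T + s) w (word p (T + s) s (alt (- 1) (2 * Suc k)) w) i j"
  using ij
proof (induction k arbitrary: j)
  let ?Y = "cyc_mat s p T w" and ?N = "T + s"
  let ?A = "?Y * ?Y\<^sup>T"
  have N: "?N > 0" using T by simp
  have A: "?A \<in> carrier_mat p p" by (rule gram_carrier[OF cyc_mat_carrier])
  have base: "?A $$ (i, j) = real ?N / (real T)\<^sup>2 * bil ?N w (word p ?N s [- 1, 1] w) i j" if "i < p" "j < p" for i j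
  proof -
    have "?A $$ (i, j) = (\<Sum>l<p. ?Y $$ (i, l) * ?Y $$ (j, l))"
      by (rule gram_index[OF cyc_mat_carrier that])
    also have "\<dots> = (\<Sum>l<p. bil ?N w (shiftJ ?N s (- 1)) i l * bil ?N w (shiftJ ?N s 1) l j) / (real T)\<^sup>2"
      unfolding sum_divide_distrib
      by (intro sum.cong refl) (use that in \<open>simp add: cyc_mat_index(1)[OF T that(1)] cyc_mat_index(2)[OF T _ that(2)] power2_eq_square\<close>)
    finally show ?thesis by (simp add: bil_compose[OF N])
  qed
  { case 0
    have "?A ^\<^sub>m 1 = ?A" using A by simp
    then show ?case using base[OF 0] by (simp add: alt_def power2_eq_square numeral_2_eq_2) }
  { case (Suc k)
    let ?W = "word p ?N s (alt (- 1) (2 * Suc k)) w" and ?V = "word p ?N s [- 1, 1] w"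
    let ?c = "real ?N ^ (2 * k + 1) / real T ^ (2 * Suc k)"
    have "(?A ^\<^sub>m Suc (Suc k)) $$ (i, j) = (\<Sum>l<p. (?A ^\<^sub>m Suc k) $$ (i, l) * ?A $$ (l, j))"
      by (rule index_pow_mat_Suc[OF A Suc.prems])
    also have "\<dots> = (\<Sum>l<p. (?c * bil ?N w ?W i l) * (real ?N / (real T)\<^sup>2 * bil ?N w ?V l j))"
      by (rule sum.cong[OF refl]) (use Suc in \<open>simp only: Suc.IH base lessThan_iff\<close>)
    also have "\<dots> = ?c * (real ?N / (real T)\<^sup>2) * (\<Sum>l<p. bil ?N w ?W i l * bil ?N w ?V l j)"
      by (simp add: sum_distrib_left mult_ac)
    also have "\<dots> = ?c * (real ?N / (real T)\<^sup>2) * (real ?N * bil ?N w (fmm ?N ?W (fmm ?N (gramK p ?N w) ?V)) i j)"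
      by (simp only: bil_compose[OF N])
    also have "fmm ?N ?W (fmm ?N (gramK p ?N w) ?V) = word p ?N s (alt (- 1) (2 * Suc (Suc k))) w"
    proof -
      have "alt (- 1) (2 * Suc (Suc k)) = alt (- 1) (2 * Suc k) @ [- 1, 1]" using alt_add_2[of "- 1" "2 * Suc k"] by simp
      moreover have "alt (- 1) (2 * Suc k) \<noteq> []" by (simp add: alt_def)
      ultimately show ?thesis by (simp only: word_append list.distinct not_False_eq_True)
    qed
    also have "?c * (real ?N / (real T)\<^sup>2) * (real ?N * bil ?N w (word p ?N s (alt (- 1) (2 * Suc (Suc k))) w) i j)
      = real ?N ^ (2 * Suc k + 1) / real T ^ (2 * Suc (Suc k)) * bil ?N w (word p ?N s (alt (- 1) (2 * Suc (Suc k))) w) i j"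
      by (simp add: power2_eq_square mult_ac)
    finally show ?case . }
qed

text \<open>Taking the trace joins the two outer copies of the array to one more Gram matrix,
  recorded by the leading \<open>0\<close>. The \<open>2 k\<close> Gram matrices give
  \<open>N^(2 k)\<close>; the remaining \<open>N / p\<close> converts the normalisation of
  \<open>tau\<close> into that of the spectral distribution.\<close>

lemma cyc_mat_moment:
  assumes T: "T > 0" and p: "p > 0" and k: "k \<ge> 1"
  shows "(\<integral>x. x ^ k \<partial>esd (cyc_mat s p T w * (cyc_mat s p T w)\<^sup>T))
    = real (T + s) ^ (2 * k + 1) / (real T ^ (2 * k) * real p) * tau p (T + s) s (0 # alt (- 1) (2 * k)) w"
proof -
  let ?Y = "cyc_mat s p T w" and ?N = "T + s"
  have N: "?N > 0" using T by simp
  obtain k' where k': "k = Suc k'" using k by (cases k) auto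
  let ?W = "word p ?N s (alt (- 1) (2 * k)) w"
  have ne: "alt (- 1) (2 * k) \<noteq> []" by (simp add: alt_def k')
  have tr: "(\<Sum>i<p. bil ?N w ?W i i) = (real ?N)\<^sup>2 * tau p ?N s (0 # alt (- 1) (2 * k)) w"
    using diagonal_contraction[OF N ne, where p = p and w = w and s = s] by (simp add: bil_def sum_distrib_left mult.assoc)
  have "(\<integral>x. x ^ k \<partial>esd (?Y * ?Y\<^sup>T)) = (\<Sum>i<p. ((?Y * ?Y\<^sup>T) ^\<^sub>m k) $$ (i, i)) / real p"
    by (rule moment_esd[OF p gram_carrier[OF cyc_mat_carrier] gram_symmetric[OF cyc_mat_carrier]])
  also have "(\<Sum>i<p. ((?Y * ?Y\<^sup>T) ^\<^sub>m k) $$ (i, i)) = (\<Sum>i<p. real ?N ^ (2 * k' + 1) / real T ^ (2 * k) * bil ?N w ?W i i)"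
    unfolding k' by (rule sum.cong[OF refl], rule cyc_mat_pow[OF T]) auto
  also have "\<dots> = real ?N ^ (2 * k' + 1) / real T ^ (2 * k) * ((real ?N)\<^sup>2 * tau p ?N s (0 # alt (- 1) (2 * k)) w)"
    by (simp only: sum_distrib_left[symmetric] tr)
  also have "\<dots> / real p = real ?N ^ (2 * k + 1) / (real T ^ (2 * k) * real p) * tau p ?N s (0 # alt (- 1) (2 * k)) w"
    by (simp add: k' power2_eq_square)
  finally show ?thesis .
qed

section \<open>Expected traces for independent entries\<close>

lemma expectation_tau:
  fixes \<kappa> :: "nat \<times> nat \<Rightarrow> 'b measure" and h :: "nat \<times> nat \<Rightarrow> 'b \<Rightarrow> real"
  assumes \<kappa>: "\<And>e. prob_space (\<kappa> e)" and int: "\<And>e k. e \<in> {..<p} \<times> {..<N} \<Longrightarrow> integrable (\<kappa> e) (\<lambda>x. h e x ^ (k::nat))"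
    and N: "N > 0" and zs: "zs \<noteq> []"
  shows "integrable (PiM ({..<p} \<times> {..<N}) \<kappa>) (\<lambda>\<omega>. tau p N s zs (\<lambda>e. h e (\<omega> e)))"
    and "(\<integral>\<omega>. tau p N s zs (\<lambda>e. h e (\<omega> e)) \<partial>PiM ({..<p} \<times> {..<N}) \<kappa>)
      = (\<Sum>a<N. \<Sum>es\<in>wpaths p N s zs a a. \<Prod>e\<in>{..<p} \<times> {..<N}. (\<integral>x. h e x ^ count_list es e \<partial>\<kappa> e)) / real N ^ length zs"
proof -
  let ?I = "{..<p} \<times> {..<N}"
  interpret product_prob_space \<kappa> by (rule product_prob_spaceI) (rule \<kappa>)
  have I: "finite ?I" by simp
  have eq: "tau p N s zs (\<lambda>e. h e (\<omega> e)) = (\<Sum>a<N. \<Sum>es\<in>wpaths p N s zs a a. \<Prod>e\<in>?I. h e (\<omega> e) ^ count_list es e) / real N ^ length zs" for \<omega>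
    unfolding tau_eq_path_sum[OF N zs]
    by (intro arg_cong[of _ _ "\<lambda>x. x / real N ^ length zs"] sum.cong refl prod_list_eq_count I wpaths_subset)
  have i1: "integrable (PiM ?I \<kappa>) (\<lambda>\<omega>. \<Prod>e\<in>?I. h e (\<omega> e) ^ count_list es e)" for es
    by (rule product_integrable_prod[OF I int])
  have i2: "(\<integral>\<omega>. (\<Prod>e\<in>?I. h e (\<omega> e) ^ count_list es e) \<partial>PiM ?I \<kappa>) = (\<Prod>e\<in>?I. (\<integral>x. h e x ^ count_list es e \<partial>\<kappa> e))" for es
    by (rule product_integral_prod[OF I int])
  show "integrable (PiM ?I \<kappa>) (\<lambda>\<omega>. tau p N s zs (\<lambda>e. h e (\<omega> e)))"
    unfolding eq by (intro integrable_divide_zero Bochner_Integration.integrable_sum i1) 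
  have "(\<integral>\<omega>. (\<Sum>a<N. \<Sum>es\<in>wpaths p N s zs a a. \<Prod>e\<in>?I. h e (\<omega> e) ^ count_list es e) \<partial>PiM ?I \<kappa>)
      = (\<Sum>a<N. \<integral>\<omega>. (\<Sum>es\<in>wpaths p N s zs a a. \<Prod>e\<in>?I. h e (\<omega> e) ^ count_list es e) \<partial>PiM ?I \<kappa>)"
    by (rule Bochner_Integration.integral_sum) (intro Bochner_Integration.integrable_sum i1)
  also have "\<dots> = (\<Sum>a<N. \<Sum>es\<in>wpaths p N s zs a a. \<integral>\<omega>. (\<Prod>e\<in>?I. h e (\<omega> e) ^ count_list es e) \<partial>PiM ?I \<kappa>)"
    by (rule sum.cong[OF refl], rule Bochner_Integration.integral_sum) (rule i1)
  finally show "(\<integral>\<omega>. tau p N s zs (\<lambda>e. h e (\<omega> e)) \<partial>PiM ?I \<kappa>)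
      = (\<Sum>a<N. \<Sum>es\<in>wpaths p N s zs a a. \<Prod>e\<in>?I. (\<integral>x. h e x ^ count_list es e \<partial>\<kappa> e)) / real N ^ length zs"
    unfolding eq integral_divide_zero by (simp only: i2)
qed

lemma normal_moment_0: "normal_moment 0 = 1"
  using normal_moment_even[of 0] by simp

lemma normal_moment_abs_le: "\<bar>normal_moment k\<bar> \<le> fact k"
proof (induction k rule: less_induct)
  case (less k)
  show ?case
  proof (cases k)
    case 0
    then show ?thesis by (simp add: normal_moment_0)
  next
    case (Suc n)
    have "\<bar>normal_moment (Suc n)\<bar> = real n * \<bar>normal_moment (n - 1)\<bar>"
      unfolding normal_moment_Suc by (simp add: abs_mult)
    also have "\<dots> \<le> real n * fact (n - 1)" using less[of "n - 1"] by (intro mult_left_mono) (auto simp: Suc)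
    also have "\<dots> \<le> real (Suc n) * fact n" by (intro mult_mono fact_mono) auto
    finally show ?thesis by (simp add: Suc)
  qed
qed

text \<open>Since \<open>h\<close> is bounded by \<open>q\<close> and has second moment 1, its
  moments of order \<open>k \<ge> 2\<close> are at most \<open>q^(k - 2)\<close>. Normal moments are
  bounded by factorials, and the largest factorial that can occur is covered by the common constant
  \<open>D = (2 length zs)!\<close>.\<close>

lemma expectation_tau_universal:
  fixes \<kappa> :: "nat \<times> nat \<Rightarrow> 'b measure" and h :: "nat \<times> nat \<Rightarrow> 'b \<Rightarrow> real"
  assumes \<kappa>: "\<And>e. prob_space (\<kappa> e)" and hm: "\<And>e. e \<in> {..<p} \<times> {..<N} \<Longrightarrow> h e \<in> borel_measurable (\<kappa> e)"
    and hq: "\<And>e x. e \<in> {..<p} \<times> {..<N} \<Longrightarrow> \<bar>h e x\<bar> \<le> q"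
    and h1: "\<And>e. e \<in> {..<p} \<times> {..<N} \<Longrightarrow> (\<integral>x. h e x \<partial>\<kappa> e) = 0"
    and h2: "\<And>e. e \<in> {..<p} \<times> {..<N} \<Longrightarrow> (\<integral>x. (h e x)\<^sup>2 \<partial>\<kappa> e) = 1"
    and N: "N > 0" and zs: "zs \<noteq> []" and pK: "real p \<le> K * real N" and K: "K \<ge> 1"
    and q: "q \<ge> 1" "q\<^sup>2 \<le> real N"
  shows "\<bar>(\<integral>\<omega>. tau p N s zs (\<lambda>e. h e (\<omega> e)) \<partial>PiM ({..<p} \<times> {..<N}) \<kappa>) - gauss_tau p N s [zs]\<bar>
    \<le> 2 * fact (2 * length zs) ^ (2 * length zs) * real (chain_bound (2 * (length zs - 1)) 0) * real (length zs) * K ^ length zs * (q\<^sup>2 / real N)"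
proof -
  let ?I = "{..<p} \<times> {..<N}"
  let ?D = "fact (2 * length zs) :: real"
  have int: "integrable (\<kappa> e) (\<lambda>x. h e x ^ k)" if e: "e \<in> ?I" for e k
  proof -
    interpret prob_space "\<kappa> e" by (rule \<kappa>)
    show ?thesis
      by (rule integrable_const_bound[of _ "q ^ k"])
        (use hm[OF e] hq[OF e] in \<open>auto simp: power_abs intro!: power_mono\<close>)
  qed
  have mb: "\<bar>\<integral>x. h e x ^ k \<partial>\<kappa> e\<bar> \<le> ?D * q ^ (k - 2)" if e: "e \<in> ?I" and k: "2 \<le> k" for e k
  proof -
    have "\<bar>\<integral>x. h e x ^ k \<partial>\<kappa> e\<bar> \<le> (\<integral>x. \<bar>h e x ^ k\<bar> \<partial>\<kappa> e)" by (rule integral_abs_bound)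
    also have "\<dots> \<le> (\<integral>x. q ^ (k - 2) * (h e x)\<^sup>2 \<partial>\<kappa> e)"
    proof (rule integral_mono)
      show "integrable (\<kappa> e) (\<lambda>x. \<bar>h e x ^ k\<bar>)" using int[OF e] by (rule integrable_abs)
      show "integrable (\<kappa> e) (\<lambda>x. q ^ (k - 2) * (h e x)\<^sup>2)" using int[OF e, of 2] by simp
      fix x
      have "\<bar>h e x ^ k\<bar> = \<bar>h e x\<bar> ^ (k - 2) * \<bar>h e x\<bar> ^ 2"
        by (metis k le_add_diff_inverse2 power_abs power_add)
      also have "\<dots> \<le> q ^ (k - 2) * \<bar>h e x\<bar> ^ 2" using hq[OF e] by (intro mult_right_mono power_mono) auto
      finally show "\<bar>h e x ^ k\<bar> \<le> q ^ (k - 2) * (h e x)\<^sup>2" by simp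
    qed
    also have "\<dots> = q ^ (k - 2)" using h2[OF e] by simp
    also have "\<dots> \<le> ?D * q ^ (k - 2)" using q by (simp add: mult_le_cancel_right1)
    finally show ?thesis .
  qed
  have nb: "\<bar>normal_moment k\<bar> \<le> ?D * q ^ (k - 2)" if k: "k \<le> 2 * (length zs - 1)" for k
  proof -
    have "\<bar>normal_moment k\<bar> \<le> fact k" by (rule normal_moment_abs_le)
    also have "\<dots> \<le> ?D" using k by (intro fact_mono) auto
    also have "\<dots> \<le> ?D * q ^ (k - 2)" using q by (simp add: mult_le_cancel_left1)
    finally show ?thesis .
  qed
  have g: "gauss_tau p N s [zs] = (\<Sum>a<N. \<Sum>es\<in>wpaths p N s zs a a. \<Prod>e\<in>?I. normal_moment (count_list es e)) / real N ^ length zs"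
    using expectation_tau(2)[of "\<lambda>_. std_normal" p N "\<lambda>_ x. x" zs s] prob_space_std_normal integrable_std_normal_power N zs
    by (simp add: gauss_tau_def gauss_def normal_moment_def)
  have nm2: "normal_moment 2 = 1" using normal_moment_Suc[of 1] by (simp add: normal_moment_0 numeral_2_eq_2)
  have nm1: "normal_moment 1 = 0" using normal_moment_Suc[of 0] by simp
  have e: "(\<integral>\<omega>. tau p N s zs (\<lambda>e. h e (\<omega> e)) \<partial>PiM ?I \<kappa>)
      = (\<Sum>a<N. \<Sum>es\<in>wpaths p N s zs a a. \<Prod>e\<in>?I. (\<integral>x. h e x ^ count_list es e \<partial>\<kappa> e)) / real N ^ length zs"
    by (rule expectation_tau(2)[where h = h and \<kappa> = \<kappa>, OF \<kappa> int N zs])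
  show ?thesis
    unfolding g e
  proof (rule tau_moment_universality[OF N zs pK K q])
    show "(1::real) \<le> ?D" by simp
    show "(\<integral>x. h e x ^ 0 \<partial>\<kappa> e) = 1" for e using prob_space.prob_space[OF \<kappa>] by simp
    show "(\<integral>x. h e x ^ 1 \<partial>\<kappa> e) = 0" if "e \<in> ?I" for e using h1[OF that] by simp
    show "(\<integral>x. h e x ^ 2 \<partial>\<kappa> e) = 1" if "e \<in> ?I" for e using h2[OF that] by simp
  qed (use mb nb normal_moment_0 nm1 nm2 in auto)
qed

section \<open>Truncation and coupling\<close>

definition rademacher :: "bool \<Rightarrow> real" where
  "rademacher b = (if b then 1 else - 1)"

abbreviation coin :: "bool measure" where
  "coin \<equiv> measure_pmf (bernoulli_pmf (1 / 2))"

lemma coin_integrals: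
  "integrable coin (f :: bool \<Rightarrow> real)" "(\<integral>b. rademacher b \<partial>coin) = 0" "(\<integral>b. (rademacher b)\<^sup>2 \<partial>coin) = 1"
  by (auto intro!: integrable_measure_pmf_finite simp: rademacher_def)

text \<open>A standardised variable is replaced by a bounded one with the same first two moments: truncate,
  centre, and restore the lost variance by an independent fair sign.\<close>

lemma bounded_standardisation:
  fixes M :: "real measure" and \<tau> :: real
  assumes M: "prob_space M" and sM: "sets M = sets borel"
    and i1: "integrable M (\<lambda>x. x)" and m1: "(\<integral>x. x \<partial>M) = 0"
    and i2: "integrable M (\<lambda>x. x\<^sup>2)" and m2: "(\<integral>x. x\<^sup>2 \<partial>M) = 1" and \<tau>: "\<tau> \<ge> 1"
  shows "\<exists>h. h \<in> borel_measurable (M \<Otimes>\<^sub>M coin) \<and> (\<forall>z. \<bar>h z\<bar> \<le> 3 * \<tau>)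
     \<and> (\<integral>z. h z \<partial>(M \<Otimes>\<^sub>M coin)) = 0 \<and> (\<integral>z. (h z)\<^sup>2 \<partial>(M \<Otimes>\<^sub>M coin)) = 1
     \<and> (\<integral>z. (fst z - h z)\<^sup>2 \<partial>(M \<Otimes>\<^sub>M coin)) \<le> 3 * (\<integral>x. x\<^sup>2 * indicator {x. \<tau> \<le> \<bar>x\<bar>} x \<partial>M)"
proof -
  interpret M: prob_space M by (rule M)
  interpret C: prob_space coin by (rule measure_pmf.prob_space_axioms)
  interpret MC: pair_prob_space M coin ..
  have mM: "f \<in> borel_measurable M \<longleftrightarrow> f \<in> borel_measurable borel" for f :: "real \<Rightarrow> real"
    by (simp only: measurable_cong_sets[OF sM refl])
  define t where "t x = x * indicator {x. \<bar>x\<bar> < \<tau>} x" for x :: real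
  define r where "r x = x * indicator {x. \<tau> \<le> \<bar>x\<bar>} x" for x :: real
  have tr: "t x + r x = x" for x by (auto simp: t_def r_def indicator_def)
  have tr2: "(t x)\<^sup>2 + (r x)\<^sup>2 = x\<^sup>2" for x by (auto simp: t_def r_def indicator_def)
  have trz: "t x * r x = 0" for x by (auto simp: t_def r_def indicator_def)
  have tm: "t \<in> borel_measurable M" and rm: "r \<in> borel_measurable M"
    unfolding mM t_def[abs_def] r_def[abs_def] by measurable
  have tb: "\<bar>t x\<bar> \<le> \<tau>" for x using \<tau> by (auto simp: t_def indicator_def)
  have it: "integrable M t" by (rule M.integrable_const_bound[of _ \<tau>]) (use tb tm in auto)
  have tb2: "(t x)\<^sup>2 \<le> \<tau>\<^sup>2" for x using tb[of x] \<tau> by (simp add: abs_le_square_iff[symmetric])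
  have it2: "integrable M (\<lambda>x. (t x)\<^sup>2)"
    by (rule M.integrable_const_bound[of _ "\<tau>\<^sup>2"]) (use tb2 tm in auto)
  have ir: "integrable M r"
  proof -
    have "r = (\<lambda>x. x - t x)" using tr by (auto simp: fun_eq_iff algebra_simps eq_diff_eq)
    then show ?thesis using i1 it by simp
  qed
  have ir2: "integrable M (\<lambda>x. (r x)\<^sup>2)"
  proof -
    have "(\<lambda>x. (r x)\<^sup>2) = (\<lambda>x. x\<^sup>2 - (t x)\<^sup>2)" using tr2 by (auto simp: fun_eq_iff algebra_simps)
    then show ?thesis using i2 it2 by simp
  qed
  define d where "d = (\<integral>x. (r x)\<^sup>2 \<partial>M)"
  define a where "a = (\<integral>x. t x \<partial>M)"
  define v where "v = (\<integral>x. (t x - a)\<^sup>2 \<partial>M)"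
  have ra: "(\<integral>x. r x \<partial>M) = - a"
  proof -
    have "(\<integral>x. t x + r x \<partial>M) = 0" using m1 by (simp add: tr)
    then show ?thesis using it ir by (simp add: a_def)
  qed
  have t2: "(\<integral>x. (t x)\<^sup>2 \<partial>M) = 1 - d"
  proof -
    have "(\<integral>x. (t x)\<^sup>2 + (r x)\<^sup>2 \<partial>M) = 1" using m2 by (simp add: tr2)
    then show ?thesis using it2 ir2 by (simp add: d_def)
  qed
  have v: "v = 1 - d - a\<^sup>2"
  proof -
    have "v = (\<integral>x. (t x)\<^sup>2 - 2 * a * t x + a\<^sup>2 \<partial>M)" by (simp add: v_def power2_diff algebra_simps)
    also have "\<dots> = (\<integral>x. (t x)\<^sup>2 \<partial>M) - 2 * a * (\<integral>x. t x \<partial>M) + a\<^sup>2"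
      using it it2 M.prob_space by simp
    finally show ?thesis unfolding t2 a_def[symmetric] by (simp add: power2_eq_square)
  qed
  have ad: "a\<^sup>2 \<le> d"
  proof -
    have "0 \<le> (\<integral>x. (r x + a)\<^sup>2 \<partial>M)" by simp
    also have "\<dots> = (\<integral>x. (r x)\<^sup>2 + 2 * a * r x + a\<^sup>2 \<partial>M)" by (simp add: power2_sum algebra_simps)
    also have "\<dots> = d - a\<^sup>2" using ir ir2 M.prob_space by (simp add: ra d_def power2_eq_square)
    finally show ?thesis by simp
  qed
  have v0: "v \<ge> 0" by (simp add: v_def)
  have d0: "d \<ge> 0" by (simp add: d_def)
  \<comment> \<open>The centred truncation has variance \<open>v \<le> 1\<close>. A fair sign of
    size \<open>c\<close> adds the missing \<open>1 - v\<close>, which equals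
    \<open>d + a^2\<close>.\<close>
  define c where "c = sqrt (1 - v)"
  have v1: "v \<le> 1" using v d0 zero_le_power2[of a] by linarith
  have c2: "c\<^sup>2 = 1 - v" using v1 by (simp add: c_def)
  have c01: "0 \<le> c" "c \<le> 1" using v0 v1 by (simp_all add: c_def real_le_lsqrt)
  have a\<tau>: "\<bar>a\<bar> \<le> \<tau>"
  proof -
    have "\<bar>a\<bar> \<le> (\<integral>x. \<bar>t x\<bar> \<partial>M)" unfolding a_def by (rule integral_abs_bound)
    also have "\<dots> \<le> (\<integral>x. \<tau> \<partial>M)" by (rule integral_mono) (use it tb in auto)
    finally show ?thesis by (simp add: M.prob_space)
  qed
  define h where "h z = t (fst z) - a + c * rademacher (snd z)" for z :: "real \<times> bool"
  have r1: "\<bar>rademacher b\<bar> = 1" for b by (simp add: rademacher_def)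
  have r2: "(rademacher b)\<^sup>2 = 1" for b by (simp add: rademacher_def)
  \<comment> \<open>The truncated value and its mean are each at most \<open>\<tau>\<close>, and the
    sign term is at most \<open>1 \<le> \<tau>\<close>.\<close>
  have hb: "\<bar>h z\<bar> \<le> 3 * \<tau>" for z
  proof -
    have "\<bar>c * rademacher (snd z)\<bar> \<le> 1" using c01 by (simp add: abs_mult r1)
    then show ?thesis using tb[of "fst z"] a\<tau> \<tau> unfolding h_def by linarith
  qed
  have rad_m: "rademacher \<in> borel_measurable coin" by simp
  have hm: "h \<in> borel_measurable (M \<Otimes>\<^sub>M coin)"
    unfolding h_def[abs_def]
    by (intro borel_measurable_add borel_measurable_diff borel_measurable_times borel_measurable_const
        measurable_compose[OF measurable_fst tm] measurable_compose[OF measurable_snd rad_m])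
  have prod: "integrable (M \<Otimes>\<^sub>M coin) (\<lambda>z. f (fst z) * g (snd z))"
      "(\<integral>z. f (fst z) * g (snd z) \<partial>(M \<Otimes>\<^sub>M coin)) = (\<integral>x. f x \<partial>M) * (\<integral>b. g b \<partial>coin)"
    if "integrable M f" for f :: "real \<Rightarrow> real" and g :: "bool \<Rightarrow> real"
  proof -
    show i: "integrable (M \<Otimes>\<^sub>M coin) (\<lambda>z. f (fst z) * g (snd z))"
    proof (rule MC.Fubini_integrable)
      have gm: "g \<in> borel_measurable coin" by simp
      show "(\<lambda>z. f (fst z) * g (snd z)) \<in> borel_measurable (M \<Otimes>\<^sub>M coin)"
        by (intro borel_measurable_times measurable_compose[OF measurable_fst borel_measurable_integrable[OF that]]
            measurable_compose[OF measurable_snd gm])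
      show "integrable M (\<lambda>x. \<integral>b. norm (f (fst (x, b)) * g (snd (x, b))) \<partial>coin)"
        using that by (simp add: abs_mult)
      show "AE x in M. integrable coin (\<lambda>b. f (fst (x, b)) * g (snd (x, b)))"
        by (intro AE_I2 coin_integrals)
    qed
    have "(\<integral>z. f (fst z) * g (snd z) \<partial>(M \<Otimes>\<^sub>M coin)) = (\<integral>x. (\<integral>b. f x * g b \<partial>coin) \<partial>M)"
      using MC.integral_fst'[OF i] by simp
    then show "(\<integral>z. f (fst z) * g (snd z) \<partial>(M \<Otimes>\<^sub>M coin)) = (\<integral>x. f x \<partial>M) * (\<integral>b. g b \<partial>coin)" by simp
  qed
  have f1: "integrable (M \<Otimes>\<^sub>M coin) (\<lambda>z. f (fst z))" "(\<integral>z. f (fst z) \<partial>(M \<Otimes>\<^sub>M coin)) = (\<integral>x. f x \<partial>M)"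
    if "integrable M f" for f :: "real \<Rightarrow> real"
    using prod[OF that, of "\<lambda>_. 1"] by simp_all
  have fr: "integrable (M \<Otimes>\<^sub>M coin) (\<lambda>z. f (fst z) * rademacher (snd z))" "(\<integral>z. f (fst z) * rademacher (snd z) \<partial>(M \<Otimes>\<^sub>M coin)) = 0"
    if "integrable M f" for f :: "real \<Rightarrow> real"
    using prod[OF that, of rademacher] by (simp_all add: coin_integrals)
  have comb: "(\<integral>z. f (fst z) + g (fst z) * rademacher (snd z) \<partial>(M \<Otimes>\<^sub>M coin)) = (\<integral>x. f x \<partial>M)"
    if "integrable M f" "integrable M g" for f g :: "real \<Rightarrow> real"
    using f1[OF that(1)] fr[OF that(2)] by simp
  have h1: "(\<integral>z. h z \<partial>(M \<Otimes>\<^sub>M coin)) = 0"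
    using comb[of "\<lambda>x. t x - a" "\<lambda>_. c"] it M.prob_space by (simp add: h_def a_def[symmetric])
  have ita2: "integrable M (\<lambda>x. (t x - a)\<^sup>2)"
    using it it2 by (simp add: power2_diff)
  have h2: "(\<integral>z. (h z)\<^sup>2 \<partial>(M \<Otimes>\<^sub>M coin)) = 1"
  proof -
    have "(h z)\<^sup>2 = ((t (fst z) - a)\<^sup>2 + c\<^sup>2) + (2 * c * (t (fst z) - a)) * rademacher (snd z)" for z
      unfolding h_def power2_sum power_mult_distrib r2 by (simp add: algebra_simps)
    then have "(\<integral>z. (h z)\<^sup>2 \<partial>(M \<Otimes>\<^sub>M coin)) = (\<integral>x. (t x - a)\<^sup>2 + c\<^sup>2 \<partial>M)"
      using comb[of "\<lambda>x. (t x - a)\<^sup>2 + c\<^sup>2" "\<lambda>x. 2 * c * (t x - a)"] it ita2 by simp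
    also have "\<dots> = v + c\<^sup>2" using ita2 M.prob_space by (simp add: v_def)
    finally show ?thesis by (simp add: c2)
  qed
  \<comment> \<open>The difference is \<open>r + a\<close> minus the sign term, and the mixed term
    has mean 0. Its mean square is \<open>d - a^2 + c^2 = 2 d\<close>.\<close>
  have h3: "(\<integral>z. (fst z - h z)\<^sup>2 \<partial>(M \<Otimes>\<^sub>M coin)) \<le> 3 * d"
  proof -
    have ira2: "integrable M (\<lambda>x. (r x + a)\<^sup>2)" using ir ir2 by (simp add: power2_sum)
    have "(fst z - h z)\<^sup>2 = ((r (fst z) + a)\<^sup>2 + c\<^sup>2) + (- 2 * c * (r (fst z) + a)) * rademacher (snd z)" for z
    proof -
      have "fst z - h z = (r (fst z) + a) - c * rademacher (snd z)"
        using tr[of "fst z"] by (simp add: h_def)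
      then have "(fst z - h z)\<^sup>2 = ((r (fst z) + a) - c * rademacher (snd z))\<^sup>2" by (simp only:)
      also have "\<dots> = (r (fst z) + a)\<^sup>2 + c\<^sup>2 * 1 - 2 * (r (fst z) + a) * (c * rademacher (snd z))"
        unfolding power2_diff power_mult_distrib r2 by (rule refl)
      finally show ?thesis by (simp add: algebra_simps)
    qed
    then have "(\<integral>z. (fst z - h z)\<^sup>2 \<partial>(M \<Otimes>\<^sub>M coin)) = (\<integral>x. (r x + a)\<^sup>2 + c\<^sup>2 \<partial>M)"
      using comb[of "\<lambda>x. (r x + a)\<^sup>2 + c\<^sup>2" "\<lambda>x. - 2 * c * (r x + a)"] ir ira2 by simp
    also have "\<dots> = (\<integral>x. (r x)\<^sup>2 + 2 * a * r x + a\<^sup>2 + c\<^sup>2 \<partial>M)" by (simp add: power2_sum algebra_simps)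
    also have "\<dots> = d - a\<^sup>2 + c\<^sup>2" using ir ir2 M.prob_space by (simp add: ra d_def power2_eq_square)
    also have "\<dots> = 2 * d" by (simp add: c2 v)
    finally show ?thesis using d0 by simp
  qed
  have "d = (\<integral>x. x\<^sup>2 * indicator {x. \<tau> \<le> \<bar>x\<bar>} x \<partial>M)"
    unfolding d_def r_def by (intro Bochner_Integration.integral_cong refl) (auto simp: indicator_def)
  then show ?thesis using hm hb h1 h2 h3 by (intro exI[of _ h]) auto
qed

text \<open>Mean square of \<open>\<Sum> f(i,a) g(j,\<sigma> a)\<close>: for \<open>a \<noteq> a'\<close> some index occurs only once among the four factors,
  so the mixed terms vanish.\<close>

lemma mean_square_bilinear:
  fixes \<kappa> :: "'i \<Rightarrow> 'b measure" and f g :: "'i \<Rightarrow> 'b \<Rightarrow> real" and u v :: "nat \<Rightarrow> 'i"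
  assumes \<kappa>: "\<And>e. prob_space (\<kappa> e)" and I: "finite I" and A: "finite A"
    and u: "\<And>a. a \<in> A \<Longrightarrow> u a \<in> I" and v: "\<And>a. a \<in> A \<Longrightarrow> v a \<in> I"
    and fm: "\<And>e. e \<in> I \<Longrightarrow> f e \<in> borel_measurable (\<kappa> e)" and gm: "\<And>e. e \<in> I \<Longrightarrow> g e \<in> borel_measurable (\<kappa> e)"
    and f2: "\<And>e. e \<in> I \<Longrightarrow> integrable (\<kappa> e) (\<lambda>x. (f e x)\<^sup>2)" and g2: "\<And>e. e \<in> I \<Longrightarrow> integrable (\<kappa> e) (\<lambda>x. (g e x)\<^sup>2)"
    and f1: "\<And>e. e \<in> I \<Longrightarrow> (\<integral>x. f e x \<partial>\<kappa> e) = 0"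
    and uv: "\<And>a. a \<in> A \<Longrightarrow> u a \<noteq> v a" and iu: "inj_on u A" and iv: "inj_on v A"
    and single: "\<And>a a'. a \<in> A \<Longrightarrow> a' \<in> A \<Longrightarrow> a \<noteq> a' \<Longrightarrow> u a \<noteq> v a' \<or> u a' \<noteq> v a"
  shows "integrable (PiM I \<kappa>) (\<lambda>\<omega>. (\<Sum>a\<in>A. f (u a) (\<omega> (u a)) * g (v a) (\<omega> (v a)))\<^sup>2)"
    and "(\<integral>\<omega>. (\<Sum>a\<in>A. f (u a) (\<omega> (u a)) * g (v a) (\<omega> (v a)))\<^sup>2 \<partial>PiM I \<kappa>)
      = (\<Sum>a\<in>A. (\<integral>x. (f (u a) x)\<^sup>2 \<partial>\<kappa> (u a)) * (\<integral>x. (g (v a) x)\<^sup>2 \<partial>\<kappa> (v a)))"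
proof -
  interpret product_prob_space \<kappa> by (rule product_prob_spaceI) (rule \<kappa>)
  have cs: "integrable (\<kappa> e) (\<lambda>x. F x * G x)"
    if "F \<in> borel_measurable (\<kappa> e)" "G \<in> borel_measurable (\<kappa> e)" "integrable (\<kappa> e) (\<lambda>x. (F x)\<^sup>2)" "integrable (\<kappa> e) (\<lambda>x. (G x)\<^sup>2)"
    for e and F G :: "'b \<Rightarrow> real"
  proof (rule Bochner_Integration.integrable_bound[of _ "\<lambda>x. (F x)\<^sup>2 + (G x)\<^sup>2"])
    have "\<bar>F x * G x\<bar> \<le> (F x)\<^sup>2 + (G x)\<^sup>2" for x
    proof -
      have "2 * \<bar>F x * G x\<bar> \<le> (F x)\<^sup>2 + (G x)\<^sup>2"
        using sum_squares_bound[of "\<bar>F x\<bar>" "\<bar>G x\<bar>"] by (simp add: abs_mult)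
      then show ?thesis by linarith
    qed
    then show "AE x in \<kappa> e. norm (F x * G x) \<le> norm ((F x)\<^sup>2 + (G x)\<^sup>2)" by simp
  qed (use that in auto)
  have L1: "integrable (\<kappa> e) F" if "F \<in> borel_measurable (\<kappa> e)" "integrable (\<kappa> e) (\<lambda>x. (F x)\<^sup>2)" for e and F :: "'b \<Rightarrow> real"
  proof -
    interpret e: prob_space "\<kappa> e" by (rule \<kappa>)
    show ?thesis using cs[of F e "\<lambda>_. 1"] that by simp
  qed
  \<comment> \<open>The part of a mixed product that depends on the coordinate \<open>e\<close>,
    with 1 for coordinates that do not occur; the integral then becomes a product over all of
    \<open>I\<close>.\<close>
  define \<phi> where "\<phi> a a' e x = ((if e = u a then f e x else 1) * (if e = v a then g e x else 1))
      * ((if e = u a' then f e x else 1) * (if e = v a' then g e x else 1))" for a a' e and x :: 'b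
  have split: "(f (u a) (\<omega> (u a)) * g (v a) (\<omega> (v a))) * (f (u a') (\<omega> (u a')) * g (v a') (\<omega> (v a')))
      = (\<Prod>e\<in>I. \<phi> a a' e (\<omega> e))" if "a \<in> A" "a' \<in> A" for a a' and \<omega> :: "'i \<Rightarrow> 'b"
  proof -
    have d: "(\<Prod>e\<in>I. if e = k then F e else 1) = F k" if "k \<in> I" for k and F :: "'i \<Rightarrow> real"
      using that I by (simp add: prod.delta)
    show ?thesis unfolding \<phi>_def prod.distrib using d[of "u a"] d[of "v a"] d[of "u a'"] d[of "v a'"] u v that by simp
  qed
  have int\<phi>: "integrable (\<kappa> e) (\<phi> a a' e)" if a: "a \<in> A" "a' \<in> A" and e: "e \<in> I" for a a' e
  proof -
    interpret e: prob_space "\<kappa> e" by (rule \<kappa>)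
    define F where "F b x = (if e = u b then f e x else 1) * (if e = v b then g e x else 1)" for b and x :: 'b
    have Fm: "F b \<in> borel_measurable (\<kappa> e)" for b
      unfolding F_def using fm[OF e] gm[OF e] by (cases "e = u b"; cases "e = v b"; simp)
    have F2: "integrable (\<kappa> e) (\<lambda>x. (F b x)\<^sup>2)" if "b \<in> A" for b
      unfolding F_def using f2[OF e] g2[OF e] uv[OF that] by (cases "e = u b"; cases "e = v b"; simp)
    show ?thesis
      unfolding \<phi>_def F_def[symmetric] by (rule cs[OF Fm Fm F2[OF a(1)] F2[OF a(2)]])
  qed
  have E: "(\<integral>\<omega>. (f (u a) (\<omega> (u a)) * g (v a) (\<omega> (v a))) * (f (u a') (\<omega> (u a')) * g (v a') (\<omega> (v a'))) \<partial>PiM I \<kappa>)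
      = (\<Prod>e\<in>I. (\<integral>x. \<phi> a a' e x \<partial>\<kappa> e))"
    and EI: "integrable (PiM I \<kappa>) (\<lambda>\<omega>. (f (u a) (\<omega> (u a)) * g (v a) (\<omega> (v a))) * (f (u a') (\<omega> (u a')) * g (v a') (\<omega> (v a'))))"
    if "a \<in> A" "a' \<in> A" for a a'
    unfolding split[OF that]
    by (rule product_integral_prod[OF I int\<phi>[OF that]], assumption) (rule product_integrable_prod[OF I int\<phi>[OF that]], assumption)
  have off: "(\<Prod>e\<in>I. (\<integral>x. \<phi> a a' e x \<partial>\<kappa> e)) = 0" if a: "a \<in> A" "a' \<in> A" "a \<noteq> a'" for a a'
  proof -
    have uu: "u a \<noteq> u a'" using iu a by (auto simp: inj_on_def)
    have "\<exists>e\<in>I. (\<integral>x. \<phi> a a' e x \<partial>\<kappa> e) = 0"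
    proof (cases "u a \<noteq> v a'")
      case True
      have "\<phi> a a' (u a) x = f (u a) x" for x using True uu uv[OF a(1)] by (simp add: \<phi>_def)
      then show ?thesis using f1[OF u[OF a(1)]] u[OF a(1)] by (intro bexI[of _ "u a"]) simp_all
    next
      case False
      then have "u a' \<noteq> v a" using single[OF a] by simp
      then have "\<phi> a a' (u a') x = f (u a') x" for x using uu uv[OF a(2)] by (simp add: \<phi>_def)
      then show ?thesis using f1[OF u[OF a(2)]] u[OF a(2)] by (intro bexI[of _ "u a'"]) simp_all
    qed
    then show ?thesis using I by (simp add: prod_zero_iff)
  qed
  have diag: "(\<Prod>e\<in>I. (\<integral>x. \<phi> a a e x \<partial>\<kappa> e)) = (\<integral>x. (f (u a) x)\<^sup>2 \<partial>\<kappa> (u a)) * (\<integral>x. (g (v a) x)\<^sup>2 \<partial>\<kappa> (v a))" if a: "a \<in> A" for a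
  proof -
    have "(\<integral>x. \<phi> a a e x \<partial>\<kappa> e) = (if e = u a then (\<integral>x. (f e x)\<^sup>2 \<partial>\<kappa> e) else 1) * (if e = v a then (\<integral>x. (g e x)\<^sup>2 \<partial>\<kappa> e) else 1)" for e
    proof -
      show ?thesis using uv[OF a] prob_space.prob_space[OF \<kappa>[of e]] by (auto simp: \<phi>_def power2_eq_square)
    qed
    then show ?thesis using u[OF a] v[OF a] I by (simp add: prod.distrib prod.delta)
  qed
  have sq: "(\<Sum>a\<in>A. f (u a) (\<omega> (u a)) * g (v a) (\<omega> (v a)))\<^sup>2
      = (\<Sum>a\<in>A. \<Sum>a'\<in>A. (f (u a) (\<omega> (u a)) * g (v a) (\<omega> (v a))) * (f (u a') (\<omega> (u a')) * g (v a') (\<omega> (v a'))))" for \<omega>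
    by (simp only: power2_eq_square sum_product)
  show "integrable (PiM I \<kappa>) (\<lambda>\<omega>. (\<Sum>a\<in>A. f (u a) (\<omega> (u a)) * g (v a) (\<omega> (v a)))\<^sup>2)"
    unfolding sq by (intro Bochner_Integration.integrable_sum EI)
  have "(\<integral>\<omega>. (\<Sum>a\<in>A. f (u a) (\<omega> (u a)) * g (v a) (\<omega> (v a)))\<^sup>2 \<partial>PiM I \<kappa>)
     = (\<Sum>a\<in>A. \<integral>\<omega>. (\<Sum>a'\<in>A. (f (u a) (\<omega> (u a)) * g (v a) (\<omega> (v a))) * (f (u a') (\<omega> (u a')) * g (v a') (\<omega> (v a')))) \<partial>PiM I \<kappa>)"
    unfolding sq by (rule Bochner_Integration.integral_sum) (intro Bochner_Integration.integrable_sum EI)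
  also have "\<dots> = (\<Sum>a\<in>A. \<Sum>a'\<in>A. (\<Prod>e\<in>I. (\<integral>x. \<phi> a a' e x \<partial>\<kappa> e)))"
    by (intro sum.cong refl, subst Bochner_Integration.integral_sum) (auto intro!: EI sum.cong simp: E)
  also have "\<dots> = (\<Sum>a\<in>A. \<Sum>a'\<in>A. if a' = a then (\<Prod>e\<in>I. (\<integral>x. \<phi> a a e x \<partial>\<kappa> e)) else 0)"
    by (intro sum.cong refl) (use off in auto)
  also have "\<dots> = (\<Sum>a\<in>A. (\<integral>x. (f (u a) x)\<^sup>2 \<partial>\<kappa> (u a)) * (\<integral>x. (g (v a) x)\<^sup>2 \<partial>\<kappa> (v a)))"
    using A by (intro sum.cong refl) (simp add: diag)
  finally show "(\<integral>\<omega>. (\<Sum>a\<in>A. f (u a) (\<omega> (u a)) * g (v a) (\<omega> (v a)))\<^sup>2 \<partial>PiM I \<kappa>)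
      = (\<Sum>a\<in>A. (\<integral>x. (f (u a) x)\<^sup>2 \<partial>\<kappa> (u a)) * (\<integral>x. (g (v a) x)\<^sup>2 \<partial>\<kappa> (v a)))" .
qed

lemma expected_cdf_gram_le:
  fixes X Y :: "'w \<Rightarrow> real mat" and P :: "'w measure"
  assumes P: "prob_space P" and n: "n > 0"
    and X: "\<And>w. X w \<in> carrier_mat n m" and Y: "\<And>w. Y w \<in> carrier_mat n m"
    and Xm: "\<And>i j. i < n \<Longrightarrow> j < m \<Longrightarrow> (\<lambda>w. X w $$ (i, j)) \<in> borel_measurable P"
    and Ym: "\<And>i j. i < n \<Longrightarrow> j < m \<Longrightarrow> (\<lambda>w. Y w $$ (i, j)) \<in> borel_measurable P"
    and int: "integrable P (\<lambda>w. \<Sum>i<n. \<Sum>j<m. (Y w $$ (i, j) - X w $$ (i, j))\<^sup>2)"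
    and \<theta>: "\<theta> > 0" and x: "x \<ge> 0"
  shows "(\<integral>w. cdf (esd (X w * (X w)\<^sup>T)) x \<partial>P) \<le> (\<integral>w. cdf (esd (Y w * (Y w)\<^sup>T)) ((sqrt x + \<theta>)\<^sup>2) \<partial>P)
     + (\<integral>w. (\<Sum>i<n. \<Sum>j<m. (Y w $$ (i, j) - X w $$ (i, j))\<^sup>2) \<partial>P) / (n * \<theta>\<^sup>2)"
proof -
  interpret P: prob_space P by (rule P)
  have b: "\<bar>cdf (esd A) t\<bar> \<le> 1" for A t
  proof -
    interpret real_distribution "esd A" by (rule real_distribution_esd)
    show ?thesis using cdf_nonneg[of t] cdf_bounded_prob[of t] by simp
  qed
  have iX: "integrable P (\<lambda>w. cdf (esd (X w * (X w)\<^sup>T)) t)" for t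
    by (rule P.integrable_const_bound[of _ 1]) (use b borel_measurable_cdf_gram[OF n X Xm] in auto)
  have iY: "integrable P (\<lambda>w. cdf (esd (Y w * (Y w)\<^sup>T)) t)" for t
    by (rule P.integrable_const_bound[of _ 1]) (use b borel_measurable_cdf_gram[OF n Y Ym] in auto)
  have iF: "integrable P (\<lambda>w. (\<Sum>i<n. \<Sum>j<m. (Y w $$ (i, j) - X w $$ (i, j))\<^sup>2) / (n * \<theta>\<^sup>2))"
    using int by (intro integrable_divide_zero impI)
  have "(\<integral>w. cdf (esd (X w * (X w)\<^sup>T)) x \<partial>P) \<le> (\<integral>w. cdf (esd (Y w * (Y w)\<^sup>T)) ((sqrt x + \<theta>)\<^sup>2)
      + (\<Sum>i<n. \<Sum>j<m. (Y w $$ (i, j) - X w $$ (i, j))\<^sup>2) / (n * \<theta>\<^sup>2) \<partial>P)"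
    by (rule integral_mono[OF iX Bochner_Integration.integrable_add[OF iY iF]])
       (rule cdf_gram_perturb_frobenius[OF n X Y \<theta> x])
  also have "\<dots> = (\<integral>w. cdf (esd (Y w * (Y w)\<^sup>T)) ((sqrt x + \<theta>)\<^sup>2) \<partial>P)
     + (\<integral>w. (\<Sum>i<n. \<Sum>j<m. (Y w $$ (i, j) - X w $$ (i, j))\<^sup>2) \<partial>P) / (n * \<theta>\<^sup>2)"
    by (subst Bochner_Integration.integral_add[OF iY iF]) (simp only: integral_divide_zero)
  finally show ?thesis .
qed

text \<open>Time is counted from \<open>0\<close> from here on.\<close>

definition lag_mat :: "nat \<Rightarrow> nat \<Rightarrow> nat \<Rightarrow> (nat \<times> nat \<Rightarrow> real) \<Rightarrow> real mat" where
  "lag_mat s p T w = sample_autocov s p T (\<lambda>i t. w (i, t - 1))"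

lemma lag_mat_carrier [simp]: "lag_mat s p T w \<in> carrier_mat p p"
  by (simp add: lag_mat_def sample_autocov_def)

lemma lag_mat_index:
  assumes "i < p" "j < p"
  shows "lag_mat s p T w $$ (i, j) = (\<Sum>b<T. w (i, b + s) * w (j, b)) / real T"
proof -
  have "(\<Sum>t = s + 1..s + T. w (i, t - 1) * w (j, t - s - 1)) = (\<Sum>b<T. w (i, b + s) * w (j, b))"
    by (rule sum.reindex_bij_witness[of _ "\<lambda>b. b + s + 1" "\<lambda>t. t - s - 1"]) auto
  then show ?thesis using assms by (simp add: lag_mat_def sample_autocov_def)
qed

text \<open>The times \<open>a = b + s\<close> have partner \<open>b\<close> and form the lagged
  sum; for the times \<open>a < s\<close> the partner \<open>a - s\<close> wraps around to
  \<open>a + T\<close>.\<close>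

lemma cyc_mat_index_split:
  assumes "i < p" "j < p" "T > 0"
  shows "cyc_mat s p T w $$ (i, j) = ((\<Sum>b<T. w (i, b + s) * w (j, b)) + (\<Sum>a<s. w (i, a) * w (j, a + T))) / real T"
proof -
  let ?f = "\<lambda>a. w (i, a) * w (j, (a + T) mod (T + s))"
  have "{..<T + s} = {..<s} \<union> (\<lambda>b. b + s) ` {..<T}"
  proof (intro equalityI subsetI)
    fix a assume a: "a \<in> {..<T + s}"
    show "a \<in> {..<s} \<union> (\<lambda>b. b + s) ` {..<T}"
    proof (cases "a < s")
      case False
      then have "a = (a - s) + s" "a - s < T" using a by auto
      then show ?thesis by blast
    qed simp
  qed auto
  moreover have "{..<s} \<inter> (\<lambda>b. b + s) ` {..<T} = {}" by auto
  ultimately have "(\<Sum>a<T + s. ?f a) = (\<Sum>a<s. ?f a) + (\<Sum>a\<in>(\<lambda>b. b + s) ` {..<T}. ?f a)"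
    by (simp only:) (rule sum.union_disjoint; simp)
  also have "(\<Sum>a<s. ?f a) = (\<Sum>a<s. w (i, a) * w (j, a + T))"
    by (intro sum.cong refl) auto
  also have "(\<Sum>a\<in>(\<lambda>b. b + s) ` {..<T}. ?f a) = (\<Sum>b<T. w (i, b + s) * w (j, b))"
  proof -
    have "(b + s + T) mod (T + s) = b" if "b < T" for b
    proof -
      have "(b + s + T) mod (T + s) = (b + (T + s)) mod (T + s)" by (simp add: add_ac)
      also have "\<dots> = b" using that by simp
      finally show ?thesis .
    qed
    then show ?thesis by (subst sum.reindex) auto
  qed
  finally show ?thesis using assms by (simp add: cyc_mat_def add.commute)
qed

text \<open>One factor is replaced at a time, \<open>x x' - h h' = (x - h) x' + h (x' - h')\<close>,
  which gives \<open>S1\<close> and \<open>S2\<close>; \<open>S3\<close> collects the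
  \<open>s\<close> products created by the cyclic shift. Within each sum the terms are uncorrelated,
  so its mean square is a sum of products of second moments: a sum of values of
  \<open>\<delta>\<close> for \<open>S1\<close> and \<open>S2\<close>, and \<open>s\<close> for
  \<open>S3\<close>.\<close>

lemma coupling_frobenius:
  fixes \<kappa> :: "nat \<times> nat \<Rightarrow> 'b measure" and x h :: "nat \<times> nat \<Rightarrow> 'b \<Rightarrow> real"
  defines "I p T s \<equiv> {..<p} \<times> {..<T + s}"
  assumes \<kappa>: "\<And>e. prob_space (\<kappa> e)" and T: "T > 0" and s: "s > 0"
    and xm: "\<And>e. e \<in> I p T s \<Longrightarrow> x e \<in> borel_measurable (\<kappa> e)" and hm: "\<And>e. e \<in> I p T s \<Longrightarrow> h e \<in> borel_measurable (\<kappa> e)"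
    and xi2: "\<And>e. e \<in> I p T s \<Longrightarrow> integrable (\<kappa> e) (\<lambda>z. (x e z)\<^sup>2)" and hi2: "\<And>e. e \<in> I p T s \<Longrightarrow> integrable (\<kappa> e) (\<lambda>z. (h e z)\<^sup>2)"
    and x1: "\<And>e. e \<in> I p T s \<Longrightarrow> (\<integral>z. x e z \<partial>\<kappa> e) = 0" and h1: "\<And>e. e \<in> I p T s \<Longrightarrow> (\<integral>z. h e z \<partial>\<kappa> e) = 0"
    and x2: "\<And>e. e \<in> I p T s \<Longrightarrow> (\<integral>z. (x e z)\<^sup>2 \<partial>\<kappa> e) = 1" and h2: "\<And>e. e \<in> I p T s \<Longrightarrow> (\<integral>z. (h e z)\<^sup>2 \<partial>\<kappa> e) = 1"
  defines "X \<equiv> \<lambda>\<omega>. lag_mat s p T (\<lambda>e. x e (\<omega> e))" and "Y \<equiv> \<lambda>\<omega>. cyc_mat s p T (\<lambda>e. h e (\<omega> e))"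
  shows "integrable (PiM (I p T s) \<kappa>) (\<lambda>\<omega>. \<Sum>i<p. \<Sum>j<p. (Y \<omega> $$ (i, j) - X \<omega> $$ (i, j))\<^sup>2)" (is ?int)
    and "(\<integral>\<omega>. (\<Sum>i<p. \<Sum>j<p. (Y \<omega> $$ (i, j) - X \<omega> $$ (i, j))\<^sup>2) \<partial>PiM (I p T s) \<kappa>)
      \<le> 3 * (2 * real p * (\<Sum>e\<in>I p T s. (\<integral>z. (x e z - h e z)\<^sup>2 \<partial>\<kappa> e)) + (real p)\<^sup>2 * real s) / (real T)\<^sup>2" (is ?bound)
proof -
  define II where "II = I p T s"
  note hyps = xm hm xi2 hi2 x1 h1 x2 h2
  define \<delta> where "\<delta> e = (\<integral>z. (x e z - h e z)\<^sup>2 \<partial>\<kappa> e)" for e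
  define P where "P = PiM II \<kappa>"
  have fin: "finite II" by (simp add: II_def I_def)
  have mem: "i < p \<Longrightarrow> a < T + s \<Longrightarrow> (i, a) \<in> II" for i a by (simp add: II_def I_def)
  let ?D = "\<lambda>e z. x e z - h e z"
  have L1: "integrable (\<kappa> e) F" if "F \<in> borel_measurable (\<kappa> e)" "integrable (\<kappa> e) (\<lambda>z. (F z)\<^sup>2)" for e and F :: "'b \<Rightarrow> real"
  proof (rule Bochner_Integration.integrable_bound[of _ "\<lambda>z. 1 + (F z)\<^sup>2"])
    interpret e: prob_space "\<kappa> e" by (rule \<kappa>)
    show "integrable (\<kappa> e) (\<lambda>z. 1 + (F z)\<^sup>2)" using that(2) by simp
    have "\<bar>F z\<bar> \<le> 1 + (F z)\<^sup>2" for z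
      using zero_le_power2[of "\<bar>F z\<bar> - 1 / 2"] by (simp add: power2_diff) (simp add: power2_eq_square)
    then show "AE z in \<kappa> e. norm (F z) \<le> norm (1 + (F z)\<^sup>2)" by simp
  qed (rule that(1))
  have Dm: "?D e \<in> borel_measurable (\<kappa> e)" if "e \<in> II" for e
    using hyps(1,2)[of e] that by (simp add: II_def)
  have Di2: "integrable (\<kappa> e) (\<lambda>z. (?D e z)\<^sup>2)" if e: "e \<in> II" for e
  proof (rule Bochner_Integration.integrable_bound[of _ "\<lambda>z. 2 * (x e z)\<^sup>2 + 2 * (h e z)\<^sup>2"])
    show "integrable (\<kappa> e) (\<lambda>z. 2 * (x e z)\<^sup>2 + 2 * (h e z)\<^sup>2)" using hyps(3,4)[of e] e by (simp add: II_def)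
    have "(?D e z)\<^sup>2 \<le> 2 * (x e z)\<^sup>2 + 2 * (h e z)\<^sup>2" for z
      using zero_le_power2[of "x e z + h e z"] by (simp add: power2_diff power2_sum)
    then show "AE z in \<kappa> e. norm ((?D e z)\<^sup>2) \<le> norm (2 * (x e z)\<^sup>2 + 2 * (h e z)\<^sup>2)" by (simp add: abs_of_nonneg)
  qed (use Dm[OF e] in simp)
  have D1: "(\<integral>z. ?D e z \<partial>\<kappa> e) = 0" if e: "e \<in> II" for e
  proof -
    have "integrable (\<kappa> e) (x e)" "integrable (\<kappa> e) (h e)"
      using e by (auto intro!: L1 hyps simp: II_def)
    then have "(\<integral>z. ?D e z \<partial>\<kappa> e) = (\<integral>z. x e z \<partial>\<kappa> e) - (\<integral>z. h e z \<partial>\<kappa> e)"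
      by (rule Bochner_Integration.integral_diff)
    then show ?thesis using hyps(5,6)[of e] e by (simp add: II_def)
  qed
  have xi: "e \<in> II \<Longrightarrow> x e \<in> borel_measurable (\<kappa> e)" "e \<in> II \<Longrightarrow> integrable (\<kappa> e) (\<lambda>z. (x e z)\<^sup>2)" "e \<in> II \<Longrightarrow> (\<integral>z. (x e z)\<^sup>2 \<partial>\<kappa> e) = 1" for e
    using hyps by (auto simp: II_def)
  have hi: "e \<in> II \<Longrightarrow> h e \<in> borel_measurable (\<kappa> e)" "e \<in> II \<Longrightarrow> integrable (\<kappa> e) (\<lambda>z. (h e z)\<^sup>2)" "e \<in> II \<Longrightarrow> (\<integral>z. (h e z)\<^sup>2 \<partial>\<kappa> e) = 1"
     "e \<in> II \<Longrightarrow> (\<integral>z. h e z \<partial>\<kappa> e) = 0" for e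
    using hyps by (auto simp: II_def)
  \<comment> \<open>In all three sums the first factor is centred, and the times of the two factors
    differ by \<open>s\<close> or by \<open>T\<close>, so no entry is multiplied by itself.\<close>
  define S1 where "S1 i j \<omega> = (\<Sum>b<T. ?D (i, b + s) (\<omega> (i, b + s)) * x (j, b) (\<omega> (j, b)))" for i j \<omega>
  define S2 where "S2 i j \<omega> = (\<Sum>b<T. h (i, b + s) (\<omega> (i, b + s)) * ?D (j, b) (\<omega> (j, b)))" for i j \<omega>
  define S3 where "S3 i j \<omega> = (\<Sum>a<s. h (i, a) (\<omega> (i, a)) * h (j, a + T) (\<omega> (j, a + T)))" for i j \<omega>
  have e1: "integrable P (\<lambda>\<omega>. (S1 i j \<omega>)\<^sup>2)" "(\<integral>\<omega>. (S1 i j \<omega>)\<^sup>2 \<partial>P) = (\<Sum>b<T. \<delta> (i, b + s))" if ij: "i < p" "j < p" for i j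
  proof -
    note ms = mean_square_bilinear[of \<kappa> II "{..<T}" "\<lambda>b. (i, b + s)" "\<lambda>b. (j, b)" ?D x, OF \<kappa> fin]
    show "integrable P (\<lambda>\<omega>. (S1 i j \<omega>)\<^sup>2)"
      unfolding P_def S1_def by (rule ms(1)) (use ij s in \<open>auto intro: mem Dm Di2 D1 xi simp: inj_on_def\<close>)
    have "(\<integral>\<omega>. (S1 i j \<omega>)\<^sup>2 \<partial>P) = (\<Sum>b<T. (\<integral>z. (?D (i, b + s) z)\<^sup>2 \<partial>\<kappa> (i, b + s)) * (\<integral>z. (x (j, b) z)\<^sup>2 \<partial>\<kappa> (j, b)))"
      unfolding P_def S1_def by (rule ms(2)) (use ij s in \<open>auto intro: mem Dm Di2 D1 xi simp: inj_on_def\<close>)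
    also have "\<dots> = (\<Sum>b<T. \<delta> (i, b + s))"
      by (rule sum.cong[OF refl]) (use ij in \<open>simp add: xi(3) mem \<delta>_def\<close>)
    finally show "(\<integral>\<omega>. (S1 i j \<omega>)\<^sup>2 \<partial>P) = (\<Sum>b<T. \<delta> (i, b + s))" .
  qed
  have e2: "integrable P (\<lambda>\<omega>. (S2 i j \<omega>)\<^sup>2)" "(\<integral>\<omega>. (S2 i j \<omega>)\<^sup>2 \<partial>P) = (\<Sum>b<T. \<delta> (j, b))" if ij: "i < p" "j < p" for i j
  proof -
    note ms = mean_square_bilinear[of \<kappa> II "{..<T}" "\<lambda>b. (i, b + s)" "\<lambda>b. (j, b)" h ?D, OF \<kappa> fin]
    show "integrable P (\<lambda>\<omega>. (S2 i j \<omega>)\<^sup>2)"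
      unfolding P_def S2_def by (rule ms(1)) (use ij s in \<open>auto intro: mem Dm Di2 D1 hi simp: inj_on_def\<close>)
    have "(\<integral>\<omega>. (S2 i j \<omega>)\<^sup>2 \<partial>P) = (\<Sum>b<T. (\<integral>z. (h (i, b + s) z)\<^sup>2 \<partial>\<kappa> (i, b + s)) * (\<integral>z. (?D (j, b) z)\<^sup>2 \<partial>\<kappa> (j, b)))"
      unfolding P_def S2_def by (rule ms(2)) (use ij s in \<open>auto intro: mem Dm Di2 D1 hi simp: inj_on_def\<close>)
    also have "\<dots> = (\<Sum>b<T. \<delta> (j, b))"
      by (rule sum.cong[OF refl]) (use ij in \<open>simp add: hi(3) mem \<delta>_def\<close>)
    finally show "(\<integral>\<omega>. (S2 i j \<omega>)\<^sup>2 \<partial>P) = (\<Sum>b<T. \<delta> (j, b))" .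
  qed
  have e3: "integrable P (\<lambda>\<omega>. (S3 i j \<omega>)\<^sup>2)" "(\<integral>\<omega>. (S3 i j \<omega>)\<^sup>2 \<partial>P) = real s" if ij: "i < p" "j < p" for i j
  proof -
    note ms = mean_square_bilinear[of \<kappa> II "{..<s}" "\<lambda>a. (i, a)" "\<lambda>a. (j, a + T)" h h, OF \<kappa> fin]
    show "integrable P (\<lambda>\<omega>. (S3 i j \<omega>)\<^sup>2)"
      unfolding P_def S3_def by (rule ms(1)) (use ij T in \<open>auto intro: mem hi simp: inj_on_def\<close>)
    have "(\<integral>\<omega>. (S3 i j \<omega>)\<^sup>2 \<partial>P) = (\<Sum>a<s. (\<integral>z. (h (i, a) z)\<^sup>2 \<partial>\<kappa> (i, a)) * (\<integral>z. (h (j, a + T) z)\<^sup>2 \<partial>\<kappa> (j, a + T)))"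
      unfolding P_def S3_def by (rule ms(2)) (use ij T in \<open>auto intro: mem hi simp: inj_on_def\<close>)
    also have "\<dots> = (\<Sum>a<s. 1)"
      by (rule sum.cong[OF refl]) (use ij in \<open>simp add: hi(3) mem\<close>)
    finally show "(\<integral>\<omega>. (S3 i j \<omega>)\<^sup>2 \<partial>P) = real s" by simp
  qed
  have Z: "Y \<omega> $$ (i, j) - X \<omega> $$ (i, j) = (S3 i j \<omega> - S1 i j \<omega> - S2 i j \<omega>) / real T" if "i < p" "j < p" for i j \<omega>
    using that T unfolding X_def Y_def
    by (simp add: lag_mat_index cyc_mat_index_split S1_def S2_def S3_def diff_divide_distrib[symmetric] sum_subtractf[symmetric]
        sum.distrib[symmetric] add_diff_eq[symmetric] del: sum_subtractf)
      (simp add: sum_subtractf algebra_simps)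
  \<comment> \<open>Cauchy-Schwarz for three summands, the source of the outer factor 3.\<close>
  have three: "((a - b - c) / t)\<^sup>2 \<le> (3 * a\<^sup>2 + 3 * b\<^sup>2 + 3 * c\<^sup>2) / t\<^sup>2" for a b c t :: real
  proof -
    have "(a - b - c)\<^sup>2 \<le> 3 * a\<^sup>2 + 3 * b\<^sup>2 + 3 * c\<^sup>2"
      using zero_le_power2[of "a + b"] zero_le_power2[of "a + c"] zero_le_power2[of "b - c"]
      by (simp add: power2_eq_square algebra_simps)
    then show ?thesis unfolding power_divide by (rule divide_right_mono) simp
  qed
  define G where "G \<omega> = (\<Sum>i<p. \<Sum>j<p. (3 * (S3 i j \<omega>)\<^sup>2 + 3 * (S1 i j \<omega>)\<^sup>2 + 3 * (S2 i j \<omega>)\<^sup>2) / (real T)\<^sup>2)" for \<omega>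
  have iG1: "integrable P (\<lambda>\<omega>. (3 * (S3 i j \<omega>)\<^sup>2 + 3 * (S1 i j \<omega>)\<^sup>2 + 3 * (S2 i j \<omega>)\<^sup>2) / (real T)\<^sup>2)"
    and eG1: "(\<integral>\<omega>. (3 * (S3 i j \<omega>)\<^sup>2 + 3 * (S1 i j \<omega>)\<^sup>2 + 3 * (S2 i j \<omega>)\<^sup>2) / (real T)\<^sup>2 \<partial>P)
      = (3 * real s + 3 * (\<Sum>b<T. \<delta> (i, b + s)) + 3 * (\<Sum>b<T. \<delta> (j, b))) / (real T)\<^sup>2"
    if "i < p" "j < p" for i j
    using e1[OF that] e2[OF that] e3[OF that] by simp_all
  have iG: "integrable P G" unfolding G_def[abs_def] by (intro Bochner_Integration.integrable_sum iG1) auto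
  have meas: "(\<lambda>\<omega>. \<Sum>i<p. \<Sum>j<p. (Y \<omega> $$ (i, j) - X \<omega> $$ (i, j))\<^sup>2) \<in> borel_measurable P"
  proof -
    have c: "(\<lambda>\<omega>. F e (\<omega> e)) \<in> borel_measurable P" if "e \<in> II" "F e \<in> borel_measurable (\<kappa> e)" for F :: "nat \<times> nat \<Rightarrow> 'b \<Rightarrow> real" and e
      unfolding P_def using measurable_compose[OF measurable_component_singleton[OF that(1), of \<kappa>] that(2)] .
    have S1m: "S1 i j \<in> borel_measurable P" if "i < p" "j < p" for i j
      unfolding S1_def[abs_def]
    proof (intro borel_measurable_sum borel_measurable_times)
      fix b assume b: "b \<in> {..<T}"
      show "(\<lambda>\<omega>. ?D (i, b + s) (\<omega> (i, b + s))) \<in> borel_measurable P"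
        by (rule c[where F = ?D]) (use b that in \<open>auto intro!: Dm mem\<close>)
      show "(\<lambda>\<omega>. x (j, b) (\<omega> (j, b))) \<in> borel_measurable P"
        by (rule c[where F = x]) (use b that in \<open>auto intro!: xi mem\<close>)
    qed
    have S2m: "S2 i j \<in> borel_measurable P" if "i < p" "j < p" for i j
      unfolding S2_def[abs_def]
    proof (intro borel_measurable_sum borel_measurable_times)
      fix b assume b: "b \<in> {..<T}"
      show "(\<lambda>\<omega>. h (i, b + s) (\<omega> (i, b + s))) \<in> borel_measurable P"
        by (rule c[where F = h]) (use b that in \<open>auto intro!: hi mem\<close>)
      show "(\<lambda>\<omega>. ?D (j, b) (\<omega> (j, b))) \<in> borel_measurable P"
        by (rule c[where F = ?D]) (use b that in \<open>auto intro!: Dm mem\<close>)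
    qed
    have S3m: "S3 i j \<in> borel_measurable P" if "i < p" "j < p" for i j
      unfolding S3_def[abs_def]
    proof (intro borel_measurable_sum borel_measurable_times)
      fix a assume a: "a \<in> {..<s}"
      show "(\<lambda>\<omega>. h (i, a) (\<omega> (i, a))) \<in> borel_measurable P"
        by (rule c[where F = h]) (use a that in \<open>auto intro!: hi mem\<close>)
      show "(\<lambda>\<omega>. h (j, a + T) (\<omega> (j, a + T))) \<in> borel_measurable P"
        by (rule c[where F = h]) (use a that in \<open>auto intro!: hi mem\<close>)
    qed
    have "(\<lambda>\<omega>. \<Sum>i<p. \<Sum>j<p. ((S3 i j \<omega> - S1 i j \<omega> - S2 i j \<omega>) / real T)\<^sup>2) \<in> borel_measurable P"
      by (intro borel_measurable_sum borel_measurable_power borel_measurable_divide borel_measurable_diff S1m S2m S3m) auto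
    moreover have "(\<Sum>i<p. \<Sum>j<p. (Y \<omega> $$ (i, j) - X \<omega> $$ (i, j))\<^sup>2) = (\<Sum>i<p. \<Sum>j<p. ((S3 i j \<omega> - S1 i j \<omega> - S2 i j \<omega>) / real T)\<^sup>2)" for \<omega>
      by (intro sum.cong refl) (simp add: Z)
    ultimately show ?thesis by simp
  qed
  have le: "(\<Sum>i<p. \<Sum>j<p. (Y \<omega> $$ (i, j) - X \<omega> $$ (i, j))\<^sup>2) \<le> G \<omega>" for \<omega>
    unfolding G_def by (intro sum_mono) (use three in \<open>simp add: Z\<close>)
  have int: "integrable P (\<lambda>\<omega>. \<Sum>i<p. \<Sum>j<p. (Y \<omega> $$ (i, j) - X \<omega> $$ (i, j))\<^sup>2)"
  proof (rule Bochner_Integration.integrable_bound[OF iG meas], rule AE_I2)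
    fix \<omega>
    have "0 \<le> (\<Sum>i<p. \<Sum>j<p. (Y \<omega> $$ (i, j) - X \<omega> $$ (i, j))\<^sup>2)" by (intro sum_nonneg) simp
    then show "norm (\<Sum>i<p. \<Sum>j<p. (Y \<omega> $$ (i, j) - X \<omega> $$ (i, j))\<^sup>2) \<le> norm (G \<omega>)"
      using le[of \<omega>] by simp
  qed
  then show ?int by (simp add: P_def II_def)
  have "(\<integral>\<omega>. (\<Sum>i<p. \<Sum>j<p. (Y \<omega> $$ (i, j) - X \<omega> $$ (i, j))\<^sup>2) \<partial>P) \<le> (\<integral>\<omega>. G \<omega> \<partial>P)"
    by (rule integral_mono[OF int iG le])
  also have "\<dots> = (\<Sum>i<p. \<integral>\<omega>. (\<Sum>j<p. (3 * (S3 i j \<omega>)\<^sup>2 + 3 * (S1 i j \<omega>)\<^sup>2 + 3 * (S2 i j \<omega>)\<^sup>2) / (real T)\<^sup>2) \<partial>P)"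
    unfolding G_def by (rule Bochner_Integration.integral_sum) (intro Bochner_Integration.integrable_sum iG1; simp)
  also have "\<dots> = (\<Sum>i<p. \<Sum>j<p. (3 * real s + 3 * (\<Sum>b<T. \<delta> (i, b + s)) + 3 * (\<Sum>b<T. \<delta> (j, b))) / (real T)\<^sup>2)"
  proof (rule sum.cong[OF refl])
    fix i assume i: "i \<in> {..<p}"
    have "(\<integral>\<omega>. (\<Sum>j<p. (3 * (S3 i j \<omega>)\<^sup>2 + 3 * (S1 i j \<omega>)\<^sup>2 + 3 * (S2 i j \<omega>)\<^sup>2) / (real T)\<^sup>2) \<partial>P)
        = (\<Sum>j<p. \<integral>\<omega>. (3 * (S3 i j \<omega>)\<^sup>2 + 3 * (S1 i j \<omega>)\<^sup>2 + 3 * (S2 i j \<omega>)\<^sup>2) / (real T)\<^sup>2 \<partial>P)"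
      by (rule Bochner_Integration.integral_sum) (use i in \<open>auto intro!: iG1\<close>)
    also have "\<dots> = (\<Sum>j<p. (3 * real s + 3 * (\<Sum>b<T. \<delta> (i, b + s)) + 3 * (\<Sum>b<T. \<delta> (j, b))) / (real T)\<^sup>2)"
      by (rule sum.cong[OF refl], rule eG1) (use i in auto)
    finally show "(\<integral>\<omega>. (\<Sum>j<p. (3 * (S3 i j \<omega>)\<^sup>2 + 3 * (S1 i j \<omega>)\<^sup>2 + 3 * (S2 i j \<omega>)\<^sup>2) / (real T)\<^sup>2) \<partial>P)
        = (\<Sum>j<p. (3 * real s + 3 * (\<Sum>b<T. \<delta> (i, b + s)) + 3 * (\<Sum>b<T. \<delta> (j, b))) / (real T)\<^sup>2)" .
  qed
  also have "\<dots> = (3 * (real p)\<^sup>2 * real s + 3 * real p * (\<Sum>i<p. \<Sum>b<T. \<delta> (i, b + s)) + 3 * real p * (\<Sum>j<p. \<Sum>b<T. \<delta> (j, b))) / (real T)\<^sup>2"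
    by (simp add: sum_divide_distrib[symmetric] sum.distrib sum_distrib_left[symmetric] power2_eq_square mult_ac) (simp add: algebra_simps)
  also have "\<dots> \<le> (3 * (real p)\<^sup>2 * real s + 3 * real p * (\<Sum>e\<in>II. \<delta> e) + 3 * real p * (\<Sum>e\<in>II. \<delta> e)) / (real T)\<^sup>2"
  proof (intro divide_right_mono add_mono mult_left_mono order_refl)
    have \<delta>0: "\<delta> e \<ge> 0" for e by (simp add: \<delta>_def)
    have "(\<Sum>i<p. \<Sum>b<T. \<delta> (i, b + s)) = (\<Sum>e\<in>{..<p} \<times> {..<T}. \<delta> (fst e, snd e + s))"
      by (simp add: sum.cartesian_product case_prod_beta)
    also have "\<dots> = (\<Sum>e\<in>(\<lambda>e. (fst e, snd e + s)) ` ({..<p} \<times> {..<T}). \<delta> e)"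
      by (subst sum.reindex) (auto simp: inj_on_def)
    also have "\<dots> \<le> (\<Sum>e\<in>II. \<delta> e)"
      by (rule sum_mono2[OF fin]) (auto simp: \<delta>0 intro: mem)
    finally show "(\<Sum>i<p. \<Sum>b<T. \<delta> (i, b + s)) \<le> (\<Sum>e\<in>II. \<delta> e)" .
    have "(\<Sum>j<p. \<Sum>b<T. \<delta> (j, b)) = (\<Sum>e\<in>{..<p} \<times> {..<T}. \<delta> e)"
      by (simp add: sum.cartesian_product)
    also have "\<dots> \<le> (\<Sum>e\<in>II. \<delta> e)"
      by (rule sum_mono2[OF fin]) (auto simp: \<delta>0 intro: mem)
    finally show "(\<Sum>j<p. \<Sum>b<T. \<delta> (j, b)) \<le> (\<Sum>e\<in>II. \<delta> e)" .
  qed auto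
  also have "\<dots> = 3 * (2 * real p * (\<Sum>e\<in>II. \<delta> e) + (real p)\<^sup>2 * real s) / (real T)\<^sup>2"
    by (simp add: algebra_simps)
  finally show ?bound by (simp add: P_def II_def \<delta>_def)
qed

section \<open>Concentration\<close>

text \<open>Independence of the columns as vectors and independence within each column combine to
  independence of the whole array. On boxes the probability factors first over times and then over
  rows. The point mass at 0 outside the array makes the marginals a total family of probability
  measures.\<close>

lemma array_law:
  fixes X :: "nat \<Rightarrow> nat \<Rightarrow> 'a \<Rightarrow> real"
  defines "E p N \<equiv> {..<p} \<times> {..<N}"
  assumes M: "prob_space M" and p: "p > 0" and N: "N > 0"
    and cols: "prob_space.indep_vars M (\<lambda>_. \<Pi>\<^sub>M i\<in>{..<p}. borel) (\<lambda>t \<omega>. \<lambda>i\<in>{..<p}. X i t \<omega>) {1..N}"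
    and rows: "\<And>t. t \<in> {1..N} \<Longrightarrow> prob_space.indep_vars M (\<lambda>_. borel) (\<lambda>i. X i t) {..<p}"
  shows "distr M (PiM (E p N) (\<lambda>_. borel)) (\<lambda>\<omega>. \<lambda>e\<in>E p N. X (fst e) (Suc (snd e)) \<omega>)
     = PiM (E p N) (\<lambda>e. if e \<in> E p N then distr M borel (X (fst e) (Suc (snd e))) else return borel 0)"
proof -
  interpret prob_space M by (rule M)
  define II where "II = E p N"
  define x where "x e = X (fst e) (Suc (snd e))" for e
  define L where "L e = (if e \<in> II then distr M borel (x e) else return borel 0)" for e
  have fin: "finite II" by (simp add: II_def E_def)
  have Xm: "random_variable borel (X i t)" if "i < p" "t \<in> {1..N}" for i t
    using rows[OF that(2)] that(1) by (auto simp: indep_vars_def)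
  have xm: "random_variable borel (x e)" if "e \<in> II" for e
    using that by (auto simp: x_def II_def E_def intro!: Xm)
  have rm: "(\<lambda>\<omega>. \<lambda>e\<in>II. x e \<omega>) \<in> measurable M (PiM II (\<lambda>_. borel))"
    by (rule measurable_restrict) (rule xm)
  interpret L: product_prob_space L
    by (rule product_prob_spaceI) (auto simp: L_def intro!: prob_space_distr xm prob_space_return)
  have sL: "sets (L e) = sets borel" for e by (simp add: L_def)
  have "distr M (PiM II (\<lambda>_. borel)) (\<lambda>\<omega>. \<lambda>e\<in>II. x e \<omega>) = PiM II L"
  proof (rule L.PiM_eqI[OF fin])
    show "sets (distr M (PiM II (\<lambda>_. borel)) (\<lambda>\<omega>. \<lambda>e\<in>II. x e \<omega>)) = sets (PiM II L)"
      by (simp add: sL cong: sets_PiM_cong)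
    fix A assume A: "\<And>e. e \<in> II \<Longrightarrow> A e \<in> sets (L e)"
    have Ab: "A e \<in> sets borel" if "e \<in> II" for e using A[OF that] by (simp add: sL)
    define B where "B t = (\<Pi>\<^sub>E i\<in>{..<p}. A (i, t - 1))" for t
    have mem: "(i, t - 1) \<in> II" if "i < p" "t \<in> {1..N}" for i t using that by (auto simp: II_def E_def)
    have Bm: "B t \<in> sets (\<Pi>\<^sub>M i\<in>{..<p}. borel)" if "t \<in> {1..N}" for t
      unfolding B_def by (rule sets_PiM_I_finite) (use that in \<open>auto intro!: Ab mem[simplified]\<close>)
    have pre: "(\<lambda>\<omega>. \<lambda>i\<in>{..<p}. X i t \<omega>) -` B t \<inter> space M = (\<Inter>i\<in>{..<p}. X i t -` A (i, t - 1) \<inter> space M)"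
      if "t \<in> {1..N}" for t
      using p by (auto simp: B_def PiE_iff)
    have PA: "Pi\<^sub>E II A \<in> sets (PiM II (\<lambda>_. borel))"
      by (rule sets_PiM_I_finite[OF fin Ab])
    have "emeasure (distr M (PiM II (\<lambda>_. borel)) (\<lambda>\<omega>. \<lambda>e\<in>II. x e \<omega>)) (Pi\<^sub>E II A)
        = emeasure M ((\<lambda>\<omega>. \<lambda>e\<in>II. x e \<omega>) -` Pi\<^sub>E II A \<inter> space M)"
      by (rule emeasure_distr[OF rm PA])
    also have "(\<lambda>\<omega>. \<lambda>e\<in>II. x e \<omega>) -` Pi\<^sub>E II A \<inter> space M
        = (\<Inter>t\<in>{1..N}. (\<lambda>\<omega>. \<lambda>i\<in>{..<p}. X i t \<omega>) -` B t \<inter> space M)" (is "?L = ?R")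
    proof (intro equalityI subsetI)
      fix \<omega> assume w: "\<omega> \<in> ?L"
      show "\<omega> \<in> ?R"
      proof
        fix t assume t: "t \<in> {1..N}"
        have "x (i, t - 1) \<omega> \<in> A (i, t - 1)" if "i < p" for i
          using w mem[OF that t] by (auto simp: PiE_iff)
        then show "\<omega> \<in> (\<lambda>\<omega>. \<lambda>i\<in>{..<p}. X i t \<omega>) -` B t \<inter> space M"
          using w t by (auto simp: B_def x_def PiE_iff)
      qed
    next
      fix \<omega> assume w: "\<omega> \<in> ?R"
      have "x e \<omega> \<in> A e" if e: "e \<in> II" for e
      proof -
        have t: "Suc (snd e) \<in> {1..N}" "fst e < p" using e by (auto simp: II_def E_def)
        have "(\<lambda>i\<in>{..<p}. X i (Suc (snd e)) \<omega>) \<in> B (Suc (snd e))" using w t(1) by blast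
        then have "\<forall>i<p. X i (Suc (snd e)) \<omega> \<in> A (i, snd e)" by (auto simp: B_def PiE_iff)
        then have "X (fst e) (Suc (snd e)) \<omega> \<in> A (fst e, snd e)" using t(2) by blast
        then show ?thesis by (simp add: x_def)
      qed
      then show "\<omega> \<in> ?L" using w N by (auto simp: PiE_iff)
    qed
    also have "emeasure M \<dots> = ennreal (\<Prod>t\<in>{1..N}. prob ((\<lambda>\<omega>. \<lambda>i\<in>{..<p}. X i t \<omega>) -` B t \<inter> space M))"
      unfolding emeasure_eq_measure by (subst indep_varsD_finite[OF cols]) (use N Bm in auto)
    also have "(\<Prod>t\<in>{1..N}. prob ((\<lambda>\<omega>. \<lambda>i\<in>{..<p}. X i t \<omega>) -` B t \<inter> space M))
        = (\<Prod>t\<in>{1..N}. \<Prod>i\<in>{..<p}. prob (X i t -` A (i, t - 1) \<inter> space M))"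
    proof (rule prod.cong[OF refl])
      fix t assume t: "t \<in> {1..N}"
      show "prob ((\<lambda>\<omega>. \<lambda>i\<in>{..<p}. X i t \<omega>) -` B t \<inter> space M) = (\<Prod>i\<in>{..<p}. prob (X i t -` A (i, t - 1) \<inter> space M))"
        unfolding pre[OF t] by (rule indep_varsD_finite[OF rows[OF t]]) (use p t in \<open>auto intro!: Ab mem[simplified]\<close>)
    qed
    also have "\<dots> = (\<Prod>a\<in>{..<N}. \<Prod>i\<in>{..<p}. prob (x (i, a) -` A (i, a) \<inter> space M))"
      by (rule prod.reindex_bij_witness[of _ Suc "\<lambda>t. t - 1"]) (auto simp: x_def)
    also have "\<dots> = (\<Prod>i\<in>{..<p}. \<Prod>a\<in>{..<N}. prob (x (i, a) -` A (i, a) \<inter> space M))"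
      by (rule prod.swap)
    also have "\<dots> = (\<Prod>e\<in>II. prob (x e -` A e \<inter> space M))"
      by (simp add: prod.cartesian_product II_def E_def case_prod_beta)
    also have "ennreal \<dots> = (\<Prod>e\<in>II. ennreal (prob (x e -` A e \<inter> space M)))"
      by (rule prod_ennreal[symmetric]) simp
    also have "\<dots> = (\<Prod>e\<in>II. emeasure (L e) (A e))"
    proof (rule prod.cong[OF refl])
      fix e assume e: "e \<in> II"
      show "ennreal (prob (x e -` A e \<inter> space M)) = emeasure (L e) (A e)"
        using e by (simp add: L_def emeasure_distr[OF xm[OF e] Ab[OF e]] emeasure_eq_measure)
    qed
    finally show "emeasure (distr M (PiM II (\<lambda>_. borel)) (\<lambda>\<omega>. \<lambda>e\<in>II. x e \<omega>)) (Pi\<^sub>E II A) = (\<Prod>e\<in>II. emeasure (L e) (A e))" .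
  qed
  then show ?thesis unfolding II_def L_def x_def by simp
qed

text \<open>Replacing the column of time \<open>t\<close> only affects \<open>X\<^sup>T w\<close> through the inner products of \<open>w\<close> with the
  change of that column and with the column of time \<open>t + s\<close>: a perturbation of rank two.\<close>

lemma cdf_autocov_column_change:
  fixes v v' :: "nat \<Rightarrow> nat \<Rightarrow> real"
  assumes p: "p > 0" and s: "s > 0" and eq: "\<And>i u. u \<noteq> t \<Longrightarrow> v' i u = v i u"
  shows "\<bar>cdf (esd (sample_autocov s p T v * (sample_autocov s p T v)\<^sup>T)) x
      - cdf (esd (sample_autocov s p T v' * (sample_autocov s p T v')\<^sup>T)) x\<bar> \<le> 2 / p"
proof -
  let ?qs = "[\<lambda>i. v' i t - v i t, \<lambda>i. v i (t + s)]"
  have "(\<Sum>i<p. sample_autocov s p T v' $$ (i, j) * w i) = (\<Sum>i<p. sample_autocov s p T v $$ (i, j) * w i)"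
    if q: "\<And>q. q \<in> set ?qs \<Longrightarrow> (\<Sum>i<p. q i * w i) = 0" and j: "j < p" for w j
  proof -
    have e: "(\<Sum>i<p. sample_autocov s p T u $$ (i, j) * w i) = 1 / real T * (\<Sum>a = s + 1..s + T. (\<Sum>i<p. u i a * w i) * u j (a - s))" for u
    proof -
      have "(\<Sum>i<p. sample_autocov s p T u $$ (i, j) * w i) = (\<Sum>i<p. \<Sum>a = s + 1..s + T. 1 / real T * (u i a * w i * u j (a - s)))"
        using j by (intro sum.cong refl) (simp add: sample_autocov_def sum_distrib_left sum_distrib_right mult_ac)
      also have "\<dots> = (\<Sum>a = s + 1..s + T. \<Sum>i<p. 1 / real T * (u i a * w i * u j (a - s)))" by (rule sum.swap)
      finally show ?thesis by (simp add: sum_distrib_left sum_distrib_right mult_ac)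
    qed
    have "(\<Sum>i<p. v' i a * w i) * v' j (a - s) = (\<Sum>i<p. v i a * w i) * v j (a - s)" if a: "a \<in> {s + 1..s + T}" for a
    proof -
      have 1: "(\<Sum>i<p. v' i a * w i) = (\<Sum>i<p. v i a * w i)"
        using q[of "\<lambda>i. v' i t - v i t"] eq[of a] by (cases "a = t") (auto simp: left_diff_distrib sum_subtractf)
      show ?thesis
      proof (cases "a - s = t")
        case True
        then have "a = t + s" using a by auto
        then have "(\<Sum>i<p. v i a * w i) = 0" using q[of "\<lambda>i. v i (t + s)"] by simp
        then show ?thesis using 1 by simp
      qed (simp add: 1 eq)
    qed
    then show ?thesis unfolding e by simp
  qed
  note ker = this
  have "\<bar>cdf (esd (sample_autocov s p T v * (sample_autocov s p T v)\<^sup>T)) x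
      - cdf (esd (sample_autocov s p T v' * (sample_autocov s p T v')\<^sup>T)) x\<bar> \<le> length ?qs / p"
    by (rule cdf_gram_perturb_rank[where m = p, OF p _ _ ker]) (simp_all add: sample_autocov_def)
  then show ?thesis by simp
qed

text \<open>McDiarmid's inequality on the product space of the columns: \<open>T + s\<close>
  independent vector-valued coordinates, each of which changes the distribution function by at most
  \<open>2 / p\<close>.\<close>

lemma cdf_autocov_concentration:
  fixes X :: "nat \<Rightarrow> nat \<Rightarrow> 'a \<Rightarrow> real" and p T s :: nat
  defines "G \<equiv> \<lambda>x \<omega>. cdf (esd (sample_autocov s p T (\<lambda>i t. X i t \<omega>) * (sample_autocov s p T (\<lambda>i t. X i t \<omega>))\<^sup>T)) x"
  assumes M: "prob_space M" and p: "p > 0" and s: "s > 0" and \<delta>: "\<delta> > 0"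
    and cols: "prob_space.indep_vars M (\<lambda>_. \<Pi>\<^sub>M i\<in>{..<p}. borel) (\<lambda>t \<omega>. \<lambda>i\<in>{..<p}. X i t \<omega>) {1..T + s}"
  shows "measure M {\<omega>\<in>space M. \<delta> \<le> \<bar>G x \<omega> - (\<integral>v. G x v \<partial>M)\<bar>} \<le> 2 * exp (- \<delta>\<^sup>2 * (real p)\<^sup>2 / (8 * real (T + s)))"
    and "G x \<in> borel_measurable M"
proof -
  interpret prob_space M by (rule M)
  define J where "J = {1..T + s}"
  define col where "col t \<omega> = (\<lambda>i\<in>{..<p}. X i t \<omega>)" for t \<omega>
  define C where "C = (\<Pi>\<^sub>M i\<in>{..<p}. (borel :: real measure))"
  define D where "D t = (if t \<in> J then distr M C (col t) else return C (\<lambda>i\<in>{..<p}. 0))" for t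
  define F where "F w = cdf (esd (sample_autocov s p T (\<lambda>i t. w t i) * (sample_autocov s p T (\<lambda>i t. w t i))\<^sup>T)) x" for w :: "nat \<Rightarrow> nat \<Rightarrow> real"
  have J: "finite J" "J \<noteq> {}" "card J = T + s" using s by (auto simp: J_def)
  have cm: "col t \<in> measurable M C" if "t \<in> J" for t
    using cols that by (auto simp: indep_vars_def J_def col_def[abs_def] C_def)
  have z: "(\<lambda>i\<in>{..<p}. 0) \<in> space C" by (auto simp: C_def space_PiM)
  have pD: "prob_space (D t)" for t by (simp add: D_def prob_space_distr cm prob_space_return z)
  have sD: "sets (D t) = sets C" for t by (simp add: D_def)
  have law: "distr M (PiM J (\<lambda>_. C)) (\<lambda>\<omega>. \<lambda>t\<in>J. col t \<omega>) = PiM J D"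
  proof -
    have "distr M (PiM J (\<lambda>_. C)) (\<lambda>\<omega>. \<lambda>t\<in>J. col t \<omega>) = PiM J (\<lambda>t. distr M C (col t))"
      using indep_vars_iff_distr_eq_PiM'[OF J(2) cm] cols by (simp add: J_def C_def col_def[abs_def])
    also have "\<dots> = PiM J D" by (rule PiM_cong) (simp_all add: D_def)
    finally show ?thesis .
  qed
  have cm2: "(\<lambda>\<omega>. \<lambda>t\<in>J. col t \<omega>) \<in> measurable M (PiM J (\<lambda>_. C))" by (rule measurable_restrict) (rule cm)
  have spJ: "PiM J D = PiM J D" by simp
  have sets_eq: "sets (PiM J D) = sets (PiM J (\<lambda>_. C))" by (simp add: sD cong: sets_PiM_cong)
  have entry: "(\<lambda>w. w t i) \<in> borel_measurable (PiM J (\<lambda>_. C))" if "t \<in> J" "i < p" for t i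
  proof -
    have "(\<lambda>w. w t) \<in> measurable (PiM J (\<lambda>_. C)) C" using that(1) by (rule measurable_component_singleton)
    moreover have "(\<lambda>u. u i) \<in> borel_measurable C" unfolding C_def using that(2) by (intro measurable_component_singleton) simp
    ultimately show ?thesis by (rule measurable_compose)
  qed
  have Fm: "F \<in> borel_measurable (PiM J D)"
  proof -
    have "F \<in> borel_measurable (PiM J (\<lambda>_. C))"
      unfolding F_def[abs_def]
    proof (rule borel_measurable_cdf_gram[OF p, of _ p])
      fix i j assume ij: "i < p" "j < p"
      have "(\<lambda>w. 1 / real T * (\<Sum>t = s + 1..s + T. w t i * w (t - s) j)) \<in> borel_measurable (PiM J (\<lambda>_. C))"
        by (intro borel_measurable_times borel_measurable_const borel_measurable_sum entry) (use ij s in \<open>auto simp: J_def\<close>)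
      then show "(\<lambda>w. sample_autocov s p T (\<lambda>i t. w t i) $$ (i, j)) \<in> borel_measurable (PiM J (\<lambda>_. C))"
        using ij by (simp add: sample_autocov_def)
    qed (simp add: sample_autocov_def)
    then show ?thesis by (simp add: measurable_cong_sets[OF sets_eq refl])
  qed
  have FG: "F (\<lambda>t\<in>J. col t \<omega>) = G x \<omega>" for \<omega>
  proof -
    have "sample_autocov s p T (\<lambda>i t. (\<lambda>t\<in>J. col t \<omega>) t i) = sample_autocov s p T (\<lambda>i t. X i t \<omega>)"
      unfolding sample_autocov_def
      by (rule cong_mat) (auto simp: col_def J_def intro!: sum.cong)
    then show ?thesis by (simp add: F_def G_def)
  qed
  have Fm': "F \<in> borel_measurable (PiM J (\<lambda>_. C))" using Fm by (simp add: measurable_cong_sets[OF sets_eq refl])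
  show Gm: "G x \<in> borel_measurable M"
    using measurable_compose[OF cm2 Fm'] by (simp add: FG)
  have b: "\<bar>F w\<bar> \<le> 1" for w
  proof -
    interpret e: real_distribution "esd (sample_autocov s p T (\<lambda>i t. w t i) * (sample_autocov s p T (\<lambda>i t. w t i))\<^sup>T)" by (rule real_distribution_esd)
    show ?thesis unfolding F_def using e.cdf_nonneg[of x] e.cdf_bounded_prob[of x] by simp
  qed
  have bd: "\<bar>F (w(t := u)) - F w\<bar> \<le> 2 / p" for w t u
    unfolding F_def by (rule cdf_autocov_column_change[OF p s, of t]) auto
  have e: "- \<delta>\<^sup>2 / (2 * (2 / p)\<^sup>2 * card J) = - \<delta>\<^sup>2 * (real p)\<^sup>2 / (8 * real (T + s))"
    by (simp add: J(3) power_divide field_simps)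
  have main: "measure (PiM J D) {w\<in>space (PiM J D). \<delta> \<le> \<bar>F w - (\<integral>v. F v \<partial>PiM J D)\<bar>} \<le> 2 * exp (- \<delta>\<^sup>2 * (real p)\<^sup>2 / (8 * real (T + s)))"
    unfolding e[symmetric]
    by (rule mcdiarmid[where M = D and I = J and f = F and c = "2 / p" and B = 1 and \<delta> = \<delta>])
      (use p in \<open>auto intro: pD J(1) Fm b bd \<delta> simp: J(2)\<close>)
  have int: "(\<integral>v. F v \<partial>PiM J D) = (\<integral>v. G x v \<partial>M)"
    unfolding law[symmetric] integral_distr[OF cm2 Fm'] FG ..
  have "measure (PiM J D) {w\<in>space (PiM J D). \<delta> \<le> \<bar>F w - (\<integral>v. F v \<partial>PiM J D)\<bar>}
      = measure M ((\<lambda>\<omega>. \<lambda>t\<in>J. col t \<omega>) -` {w\<in>space (PiM J (\<lambda>_. C)). \<delta> \<le> \<bar>F w - (\<integral>v. G x v \<partial>M)\<bar>} \<inter> space M)"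
    unfolding int unfolding law[symmetric] space_distr by (rule measure_distr[OF cm2]) (use Fm' in measurable)
  also have "(\<lambda>\<omega>. \<lambda>t\<in>J. col t \<omega>) -` {w\<in>space (PiM J (\<lambda>_. C)). \<delta> \<le> \<bar>F w - (\<integral>v. G x v \<partial>M)\<bar>} \<inter> space M
      = {\<omega>\<in>space M. \<delta> \<le> \<bar>G x \<omega> - (\<integral>v. G x v \<partial>M)\<bar>}"
    using measurable_space[OF cm2] by (auto simp: FG)
  finally show "measure M {\<omega>\<in>space M. \<delta> \<le> \<bar>G x \<omega> - (\<integral>v. G x v \<partial>M)\<bar>} \<le> 2 * exp (- \<delta>\<^sup>2 * (real p)\<^sup>2 / (8 * real (T + s)))"
    using main by simp
qed

section \<open>Comparison of the expected distribution functions\<close>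

lemma lag_mat_cong:
  assumes "\<And>e. e \<in> {..<p} \<times> {..<T + s} \<Longrightarrow> w e = w' e"
  shows "lag_mat s p T w = lag_mat s p T w'"
proof (rule eq_matI)
  fix i j assume "i < dim_row (lag_mat s p T w')" "j < dim_col (lag_mat s p T w')"
  then have ij: "i < p" "j < p" by (auto simp: lag_mat_def sample_autocov_def)
  have "(\<Sum>b<T. w (i, b + s) * w (j, b)) = (\<Sum>b<T. w' (i, b + s) * w' (j, b))"
    by (rule sum.cong[OF refl]) (use ij assms in auto)
  then show "lag_mat s p T w $$ (i, j) = lag_mat s p T w' $$ (i, j)"
    by (simp only: lag_mat_index[OF ij])
qed (simp_all add: lag_mat_def sample_autocov_def)

lemma borel_measurable_lag_mat:
  assumes f: "\<And>e. e \<in> {..<p} \<times> {..<T + s} \<Longrightarrow> (\<lambda>w. f e w) \<in> borel_measurable P" and ij: "i < p" "j < p"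
  shows "(\<lambda>w. lag_mat s p T (\<lambda>e. f e w) $$ (i, j)) \<in> borel_measurable P"
  unfolding lag_mat_index[OF ij]
  by (intro borel_measurable_divide borel_measurable_const borel_measurable_sum borel_measurable_times f) (use ij in auto)

lemma borel_measurable_cdf_lag_mat:
  assumes p: "p > 0" and f: "\<And>e. e \<in> {..<p} \<times> {..<T + s} \<Longrightarrow> (\<lambda>w. f e w) \<in> borel_measurable P"
  shows "(\<lambda>w. cdf (esd (lag_mat s p T (\<lambda>e. f e w) * (lag_mat s p T (\<lambda>e. f e w))\<^sup>T)) x) \<in> borel_measurable P"
  by (rule borel_measurable_cdf_gram[OF p _ borel_measurable_lag_mat[OF f]]) simp_all

text \<open>A bound for the mean squared Frobenius distance of the coupled matrices divided by
  \<open>p\<close>. The 6 is the 2 from replacing two factors times the 3 from the standardisation;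
  the outer 3 comes from squaring three summands.\<close>

definition truncation_error :: "nat \<Rightarrow> nat \<Rightarrow> nat \<Rightarrow> real \<Rightarrow> (nat \<times> nat \<Rightarrow> real measure) \<Rightarrow> real" where
  "truncation_error s p T \<tau> L =
     3 * (6 * (\<Sum>e\<in>{..<p} \<times> {..<T + s}. \<integral>x. x\<^sup>2 * indicator {x. \<tau> \<le> \<bar>x\<bar>} x \<partial>L e) + real p * real s) / (real T)\<^sup>2"

text \<open>On the product of the laws \<open>L e\<close> with fair coins the original array, as
  first components, and its bounded standardisation live together. \<open>\<mu>\<close> is the
  averaged spectral distribution of the bounded cyclic model: its moments are close to Gaussian
  traces by universality, and its distribution function is close to that of the original model by
  the Frobenius bound.\<close>

lemma bounded_comparison_law:
  fixes L :: "nat \<times> nat \<Rightarrow> real measure" and p T s :: nat and \<tau> K :: real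
  defines "E \<equiv> {..<p} \<times> {..<T + s}"
  defines "a \<equiv> \<lambda>x. \<integral>w. cdf (esd (lag_mat s p T w * (lag_mat s p T w)\<^sup>T)) x \<partial>PiM E L"
  assumes pL: "\<And>e. prob_space (L e)" and sL: "\<And>e. sets (L e) = sets borel"
    and p: "p > 0" and T: "T > 0" and s: "s > 0" and \<tau>: "\<tau> \<ge> 1"
    and i1: "\<And>e. e \<in> E \<Longrightarrow> integrable (L e) (\<lambda>x. x)" and m1: "\<And>e. e \<in> E \<Longrightarrow> (\<integral>x. x \<partial>L e) = 0"
    and i2: "\<And>e. e \<in> E \<Longrightarrow> integrable (L e) (\<lambda>x. x\<^sup>2)" and m2: "\<And>e. e \<in> E \<Longrightarrow> (\<integral>x. x\<^sup>2 \<partial>L e) = 1"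
    and K: "K \<ge> 1" "real p \<le> K * real (T + s)" and \<tau>2: "9 * \<tau>\<^sup>2 \<le> real (T + s)"
  shows "\<exists>\<mu>. real_distribution \<mu> \<and> (\<forall>k::nat. integrable \<mu> (\<lambda>x. x ^ k)) \<and> (\<forall>x<0. cdf \<mu> x = 0)
    \<and> (\<forall>k\<ge>1. \<bar>(\<integral>x. x ^ k \<partial>\<mu>) - real (T + s) ^ (2 * k + 1) / (real T ^ (2 * k) * real p) * gauss_tau p (T + s) s [0 # alt (- 1) (2 * k)]\<bar>
         \<le> real (T + s) ^ (2 * k + 1) / (real T ^ (2 * k) * real p)
            * (2 * fact (2 * (2 * k + 1)) ^ (2 * (2 * k + 1)) * real (chain_bound (4 * k) 0) * real (2 * k + 1) * K ^ (2 * k + 1) * (9 * \<tau>\<^sup>2 / real (T + s))))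
    \<and> (\<forall>\<theta>>0. \<forall>x\<ge>0. a x \<le> cdf \<mu> ((sqrt x + \<theta>)\<^sup>2) + truncation_error s p T \<tau> L / \<theta>\<^sup>2
         \<and> cdf \<mu> x \<le> a ((sqrt x + \<theta>)\<^sup>2) + truncation_error s p T \<tau> L / \<theta>\<^sup>2)"
proof -
  define \<kappa> where "\<kappa> e = L e \<Otimes>\<^sub>M coin" for e
  have p\<kappa>: "prob_space (\<kappa> e)" for e
  proof -
    interpret L: prob_space "L e" by (rule pL)
    interpret C: prob_space coin by (rule measure_pmf.prob_space_axioms)
    interpret pair_prob_space "L e" coin by unfold_locales
    show ?thesis unfolding \<kappa>_def by (rule prob_space_axioms)
  qed
  have "\<exists>h. e \<in> E \<longrightarrow> h \<in> borel_measurable (\<kappa> e) \<and> (\<forall>z. \<bar>h z\<bar> \<le> 3 * \<tau>)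
     \<and> (\<integral>z. h z \<partial>\<kappa> e) = 0 \<and> (\<integral>z. (h z)\<^sup>2 \<partial>\<kappa> e) = 1
     \<and> (\<integral>z. (fst z - h z)\<^sup>2 \<partial>\<kappa> e) \<le> 3 * (\<integral>x. x\<^sup>2 * indicator {x. \<tau> \<le> \<bar>x\<bar>} x \<partial>L e)" for e
    using bounded_standardisation[OF pL[of e] sL[of e] i1 m1 i2 m2 \<tau>] unfolding \<kappa>_def by blast
  then have "\<forall>e. \<exists>h. e \<in> E \<longrightarrow> h \<in> borel_measurable (\<kappa> e) \<and> (\<forall>z. \<bar>h z\<bar> \<le> 3 * \<tau>)
     \<and> (\<integral>z. h z \<partial>\<kappa> e) = 0 \<and> (\<integral>z. (h z)\<^sup>2 \<partial>\<kappa> e) = 1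
     \<and> (\<integral>z. (fst z - h z)\<^sup>2 \<partial>\<kappa> e) \<le> 3 * (\<integral>x. x\<^sup>2 * indicator {x. \<tau> \<le> \<bar>x\<bar>} x \<partial>L e)" by blast
  from choice[OF this] obtain h where h: "\<And>e. e \<in> E \<Longrightarrow> h e \<in> borel_measurable (\<kappa> e)" "\<And>e z. e \<in> E \<Longrightarrow> \<bar>h e z\<bar> \<le> 3 * \<tau>"
     "\<And>e. e \<in> E \<Longrightarrow> (\<integral>z. h e z \<partial>\<kappa> e) = 0" "\<And>e. e \<in> E \<Longrightarrow> (\<integral>z. (h e z)\<^sup>2 \<partial>\<kappa> e) = 1"
     "\<And>e. e \<in> E \<Longrightarrow> (\<integral>z. (fst z - h e z)\<^sup>2 \<partial>\<kappa> e) \<le> 3 * (\<integral>x. x\<^sup>2 * indicator {x. \<tau> \<le> \<bar>x\<bar>} x \<partial>L e)"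
    by blast
  have N: "T + s > 0" using T by simp
  have finE: "finite E" by (simp add: E_def)
  define P where "P = PiM E \<kappa>"
  have pP: "prob_space P" unfolding P_def by (rule prob_space_PiM) (rule p\<kappa>)
  interpret P: prob_space P by (rule pP)
  define X where "X \<omega> = lag_mat s p T (\<lambda>e. fst (\<omega> e))" for \<omega> :: "nat \<times> nat \<Rightarrow> real \<times> bool"
  define Y where "Y \<omega> = cyc_mat s p T (\<lambda>e. h e (\<omega> e))" for \<omega>
  have fstm: "fst \<in> borel_measurable (\<kappa> e)" for e
  proof -
    have "fst \<in> measurable (\<kappa> e) (L e)" unfolding \<kappa>_def by (rule measurable_fst)
    then show ?thesis by (simp add: measurable_cong_sets[OF refl sL])
  qed
  have fc: "(\<lambda>\<omega>. fst (\<omega> e)) \<in> borel_measurable P" if "e \<in> E" for e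
    unfolding P_def using measurable_compose[OF measurable_component_singleton[OF that, of \<kappa>] fstm] .
  have hc: "(\<lambda>\<omega>. h e (\<omega> e)) \<in> borel_measurable P" if "e \<in> E" for e
    unfolding P_def using measurable_compose[OF measurable_component_singleton[OF that, of \<kappa>] h(1)[OF that]] .
  have dfst: "distr (\<kappa> e) (L e) fst = L e" for e
    unfolding \<kappa>_def by (rule prob_space.distr_pair_fst) (rule measure_pmf.prob_space_axioms)
  have law: "distr P (PiM E L) (compose E fst) = PiM E L"
  proof -
    have "distr P (PiM E L) (compose E fst) = PiM E (\<lambda>e. distr (\<kappa> e) (L e) fst)"
      unfolding P_def by (rule distr_PiM_finite_prob_space'[OF finE p\<kappa> pL]) (simp add: \<kappa>_def)
    then show ?thesis by (simp add: dfst)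
  qed
  have cm: "compose E fst \<in> measurable P (PiM E L)"
  proof -
    have "(\<lambda>\<omega>. \<lambda>e\<in>E. fst (\<omega> e)) \<in> measurable P (PiM E L)"
      by (rule measurable_restrict) (simp add: measurable_cong_sets[OF refl sL] fc)
    then show ?thesis by (simp add: compose_def[abs_def])
  qed
  \<comment> \<open>Forgetting the coins recovers the original product law, so \<open>a\<close> can
    be evaluated on the enlarged space.\<close>
  have aX: "a x = (\<integral>\<omega>. cdf (esd (X \<omega> * (X \<omega>)\<^sup>T)) x \<partial>P)" for x
  proof -
    have "(\<lambda>w. w e) \<in> borel_measurable (PiM E L)" if "e \<in> E" for e
      using measurable_component_singleton[OF that, of L] by (simp add: measurable_cong_sets[OF refl sL])
    then have gm: "(\<lambda>w. cdf (esd (lag_mat s p T w * (lag_mat s p T w)\<^sup>T)) x) \<in> borel_measurable (PiM E L)"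
      using borel_measurable_cdf_lag_mat[OF p, of T s "\<lambda>e w. w e"] by (simp add: E_def)
    have "a x = (\<integral>\<omega>. cdf (esd (lag_mat s p T (compose E fst \<omega>) * (lag_mat s p T (compose E fst \<omega>))\<^sup>T)) x \<partial>P)"
      unfolding a_def by (subst law[symmetric], subst integral_distr[OF cm gm]) (rule refl)
    moreover have "lag_mat s p T (compose E fst \<omega>) = X \<omega>" for \<omega>
      unfolding X_def by (rule lag_mat_cong) (simp add: compose_def E_def)
    ultimately show ?thesis by simp
  qed
  have Xc: "X \<omega> \<in> carrier_mat p p" for \<omega> by (simp add: X_def)
  have Yc: "Y \<omega> \<in> carrier_mat p p" for \<omega> by (simp add: Y_def cyc_mat_carrier)
  have Xm: "(\<lambda>\<omega>. X \<omega> $$ (i, j)) \<in> borel_measurable P" if "i < p" "j < p" for i j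
    unfolding X_def by (rule borel_measurable_lag_mat[OF _ that]) (use fc in \<open>simp add: E_def\<close>)
  have Ym: "(\<lambda>\<omega>. Y \<omega> $$ (i, j)) \<in> borel_measurable P" if "i < p" "j < p" for i j
  proof -
    have E: "(i, a) \<in> E" "(j, a) \<in> E" if "a < T + s" for a using that \<open>i < p\<close> \<open>j < p\<close> by (auto simp: E_def)
    show ?thesis
      unfolding Y_def cyc_mat_index_split[OF that T]
      by (intro borel_measurable_divide borel_measurable_const borel_measurable_sum borel_measurable_add borel_measurable_times hc E) auto
  qed
  have sq: "integrable (\<kappa> e) (\<lambda>z. (F (fst z))::real)" "(\<integral>z. F (fst z) \<partial>\<kappa> e) = (\<integral>x. F x \<partial>L e)"
    if "integrable (L e) F" for F :: "real \<Rightarrow> real" and e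
  proof -
    have m: "fst \<in> measurable (\<kappa> e) (L e)" unfolding \<kappa>_def by (rule measurable_fst)
    have "integrable (distr (\<kappa> e) (L e) fst) F" using that by (simp add: dfst)
    then show "integrable (\<kappa> e) (\<lambda>z. F (fst z))" by (rule integrable_distr[OF m])
    have "(\<integral>x. F x \<partial>L e) = (\<integral>x. F x \<partial>distr (\<kappa> e) (L e) fst)" by (simp add: dfst)
    also have "\<dots> = (\<integral>z. F (fst z) \<partial>\<kappa> e)" by (rule integral_distr[OF m borel_measurable_integrable[OF that]])
    finally show "(\<integral>z. F (fst z) \<partial>\<kappa> e) = (\<integral>x. F x \<partial>L e)" by simp
  qed
  have hint: "integrable (\<kappa> e) (\<lambda>z. (h e z)\<^sup>2)" if e: "e \<in> E" for e
  proof -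
    interpret k: prob_space "\<kappa> e" by (rule p\<kappa>)
    have "(h e z)\<^sup>2 \<le> (3 * \<tau>)\<^sup>2" for z using h(2)[OF e, of z] \<tau> by (intro abs_le_square_iff[THEN iffD1]) simp
    then show ?thesis by (intro k.integrable_const_bound[of _ "(3 * \<tau>)\<^sup>2"]) (use h(1)[OF e] in auto)
  qed
  let ?S = "\<lambda>\<omega>. \<Sum>i<p. \<Sum>j<p. (Y \<omega> $$ (i, j) - X \<omega> $$ (i, j))\<^sup>2"
  have fro: "integrable P ?S" "(\<integral>\<omega>. ?S \<omega> \<partial>P) \<le> 3 * (2 * real p * (\<Sum>e\<in>E. (\<integral>z. (fst z - h e z)\<^sup>2 \<partial>\<kappa> e)) + (real p)\<^sup>2 * real s) / (real T)\<^sup>2"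
  proof -
    note cf = coupling_frobenius[where \<kappa> = \<kappa> and x = "\<lambda>_. fst" and h = h and p = p and T = T and s = s, OF p\<kappa> T s, folded E_def, folded X_def Y_def, folded P_def]
    have f1: "(\<integral>z. fst z \<partial>\<kappa> e) = 0" "integrable (\<kappa> e) (\<lambda>z. (fst z)\<^sup>2)" "(\<integral>z. (fst z)\<^sup>2 \<partial>\<kappa> e) = 1" if e: "e \<in> E" for e
      using sq(2)[OF i1[OF e]] m1[OF e] sq(1)[OF i2[OF e]] sq(2)[OF i2[OF e]] m2[OF e] by simp_all
    show "integrable P ?S"
      by (rule cf(1)) (assumption | rule fstm h f1 hint)+
    show "(\<integral>\<omega>. ?S \<omega> \<partial>P) \<le> 3 * (2 * real p * (\<Sum>e\<in>E. (\<integral>z. (fst z - h e z)\<^sup>2 \<partial>\<kappa> e)) + (real p)\<^sup>2 * real s) / (real T)\<^sup>2"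
      by (rule cf(2)) (assumption | rule fstm h f1 hint)+
  qed
  have R: "(\<integral>\<omega>. ?S \<omega> \<partial>P) / (real p * \<theta>\<^sup>2) \<le> truncation_error s p T \<tau> L / \<theta>\<^sup>2" for \<theta>
  proof -
    let ?D = "\<lambda>e. \<integral>x. x\<^sup>2 * indicator {x. \<tau> \<le> \<bar>x\<bar>} x \<partial>L e"
    have "(\<integral>\<omega>. ?S \<omega> \<partial>P) \<le> 3 * (2 * real p * (\<Sum>e\<in>E. (\<integral>z. (fst z - h e z)\<^sup>2 \<partial>\<kappa> e)) + (real p)\<^sup>2 * real s) / (real T)\<^sup>2" by (rule fro(2))
    also have "\<dots> \<le> 3 * (2 * real p * (\<Sum>e\<in>E. 3 * ?D e) + (real p)\<^sup>2 * real s) / (real T)\<^sup>2"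
      by (intro divide_right_mono mult_left_mono add_mono sum_mono h(5)) auto
    also have "\<dots> = real p * truncation_error s p T \<tau> L"
      by (simp add: truncation_error_def E_def sum_distrib_left[symmetric] power2_eq_square algebra_simps add_divide_distrib)
    finally have "(\<integral>\<omega>. ?S \<omega> \<partial>P) / (real p * \<theta>\<^sup>2) \<le> real p * truncation_error s p T \<tau> L / (real p * \<theta>\<^sup>2)"
      by (rule divide_right_mono) simp
    then show ?thesis using p by simp
  qed
  have moment: "(\<integral>x. x ^ k \<partial>esd (Y \<omega> * (Y \<omega>)\<^sup>T))
      = real (T + s) ^ (2 * k + 1) / (real T ^ (2 * k) * real p) * tau p (T + s) s (0 # alt (- 1) (2 * k)) (\<lambda>e. h e (\<omega> e))"
    if "k \<ge> 1" for k \<omega>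
    unfolding Y_def by (rule cyc_mat_moment[OF T p that])
  have int: "integrable P (\<lambda>\<omega>. \<integral>x. x ^ k \<partial>esd (Y \<omega> * (Y \<omega>)\<^sup>T))" for k :: nat
  proof (cases "k = 0")
    case True
    have "(\<integral>x. x ^ k \<partial>esd (Y \<omega> * (Y \<omega>)\<^sup>T)) = 1" for \<omega>
    proof -
      interpret d: real_distribution "esd (Y \<omega> * (Y \<omega>)\<^sup>T)" by (rule real_distribution_esd)
      show ?thesis using True d.prob_space by simp
    qed
    then show ?thesis by simp
  next
    case False
    then have k1: "k \<ge> 1" by simp
    have pow: "integrable (\<kappa> e) (\<lambda>z. h e z ^ (j::nat))" if e: "e \<in> E" for e j
    proof -
      interpret k: prob_space "\<kappa> e" by (rule p\<kappa>)
      have "\<bar>h e z ^ j\<bar> \<le> (3 * \<tau>) ^ j" for z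
        unfolding power_abs using h(2)[OF e] by (rule power_mono) simp
      then show ?thesis by (intro k.integrable_const_bound[of _ "(3 * \<tau>) ^ j"]) (use h(1)[OF e] in auto)
    qed
    show ?thesis
      unfolding moment[OF k1] P_def E_def
      by (intro Bochner_Integration.integrable_mult_right impI expectation_tau(1)) (use p\<kappa> pow N in \<open>auto simp: E_def\<close>)
  qed
  obtain \<mu> where \<mu>: "real_distribution \<mu>" "\<And>x. cdf \<mu> x = (\<integral>\<omega>. cdf (esd (Y \<omega> * (Y \<omega>)\<^sup>T)) x \<partial>P)"
    "\<And>k::nat. integrable \<mu> (\<lambda>x. x ^ k)"
    "\<And>k::nat. (\<integral>x. x ^ k \<partial>\<mu>) = (\<integral>\<omega>. (\<integral>x. x ^ k \<partial>esd (Y \<omega> * (Y \<omega>)\<^sup>T)) \<partial>P)"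
    using averaged_esd[OF pP p Yc Ym int] by blast
  have "cdf \<mu> x = 0" if "x < 0" for x
    unfolding \<mu>(2) using cdf_gram_neg[OF p Yc that] by simp
  moreover have "\<bar>(\<integral>x. x ^ k \<partial>\<mu>) - c * gauss_tau p (T + s) s [0 # alt (- 1) (2 * k)]\<bar>
         \<le> c * (2 * fact (2 * (2 * k + 1)) ^ (2 * (2 * k + 1)) * real (chain_bound (4 * k) 0) * real (2 * k + 1) * K ^ (2 * k + 1) * (9 * \<tau>\<^sup>2 / real (T + s)))"
    if k: "k \<ge> 1" and c: "c = real (T + s) ^ (2 * k + 1) / (real T ^ (2 * k) * real p)" for k c
  proof -
    let ?zs = "0 # alt (- 1) (2 * k)"
    have "\<bar>(\<integral>\<omega>. tau p (T + s) s ?zs (\<lambda>e. h e (\<omega> e)) \<partial>P) - gauss_tau p (T + s) s [?zs]\<bar>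
      \<le> 2 * fact (2 * length ?zs) ^ (2 * length ?zs) * real (chain_bound (2 * (length ?zs - 1)) 0) * real (length ?zs) * K ^ length ?zs * ((3 * \<tau>)\<^sup>2 / real (T + s))"
      unfolding P_def E_def
      by (rule expectation_tau_universal) (use p\<kappa> h N K \<tau> \<tau>2 in \<open>auto simp: E_def power_mult_distrib\<close>)
    moreover have "c \<ge> 0" by (simp add: c)
    ultimately have "c * \<bar>(\<integral>\<omega>. tau p (T + s) s ?zs (\<lambda>e. h e (\<omega> e)) \<partial>P) - gauss_tau p (T + s) s [?zs]\<bar>
      \<le> c * (2 * fact (2 * length ?zs) ^ (2 * length ?zs) * real (chain_bound (2 * (length ?zs - 1)) 0) * real (length ?zs) * K ^ length ?zs * ((3 * \<tau>)\<^sup>2 / real (T + s)))"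
      by (rule mult_left_mono)
    moreover have "(\<integral>x. x ^ k \<partial>\<mu>) = c * (\<integral>\<omega>. tau p (T + s) s ?zs (\<lambda>e. h e (\<omega> e)) \<partial>P)"
      unfolding \<mu>(4) moment[OF k] c by simp
    moreover have "c * \<bar>A - B\<bar> = \<bar>c * A - c * B\<bar>" for A B
      using \<open>c \<ge> 0\<close> by (simp add: abs_mult flip: right_diff_distrib)
    ultimately show ?thesis by (simp add: power_mult_distrib)
  qed
  moreover have "a x \<le> cdf \<mu> ((sqrt x + \<theta>)\<^sup>2) + truncation_error s p T \<tau> L / \<theta>\<^sup>2
         \<and> cdf \<mu> x \<le> a ((sqrt x + \<theta>)\<^sup>2) + truncation_error s p T \<tau> L / \<theta>\<^sup>2" if "\<theta> > 0" "x \<ge> 0" for \<theta> x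
  proof
    have "a x \<le> cdf \<mu> ((sqrt x + \<theta>)\<^sup>2) + (\<integral>\<omega>. ?S \<omega> \<partial>P) / (real p * \<theta>\<^sup>2)"
      unfolding aX \<mu>(2) by (rule expected_cdf_gram_le[OF pP p Xc Yc Xm Ym fro(1) that])
    then show "a x \<le> cdf \<mu> ((sqrt x + \<theta>)\<^sup>2) + truncation_error s p T \<tau> L / \<theta>\<^sup>2" using R[of \<theta>] by linarith
    have S: "(\<Sum>i<p. \<Sum>j<p. (X \<omega> $$ (i, j) - Y \<omega> $$ (i, j))\<^sup>2) = ?S \<omega>" for \<omega>
      by (intro sum.cong refl) (simp add: power2_commute)
    have "cdf \<mu> x \<le> a ((sqrt x + \<theta>)\<^sup>2) + (\<integral>\<omega>. (\<Sum>i<p. \<Sum>j<p. (X \<omega> $$ (i, j) - Y \<omega> $$ (i, j))\<^sup>2) \<partial>P) / (real p * \<theta>\<^sup>2)"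
      unfolding aX \<mu>(2) by (rule expected_cdf_gram_le[OF pP p Yc Xc Ym Xm _ that]) (simp_all add: S fro(1))
    then show "cdf \<mu> x \<le> a ((sqrt x + \<theta>)\<^sup>2) + truncation_error s p T \<tau> L / \<theta>\<^sup>2" using R[of \<theta>] unfolding S by linarith
  qed
  ultimately show ?thesis using \<mu>(1,3) by (intro exI[of _ \<mu>]) auto
qed

text \<open>A distribution has at most countably many atoms, while the interval is
  uncountable.\<close>

lemma cdf_continuity_point:
  assumes F: "real_distribution F" and ab: "a < b"
  obtains z where "a < z" "z < b" "isCont (cdf F) z"
proof -
  interpret F: real_distribution F by (rule F)
  have "uncountable {a<..<b}" using ab by (simp add: uncountable_open_interval)
  then have "\<not> {a<..<b} \<subseteq> {x. measure F {x} > 0}"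
    using F.countable_atoms countable_subset by blast
  then obtain z where "z \<in> {a<..<b}" "\<not> measure F {z} > 0" by blast
  then have "a < z" "z < b" "isCont (cdf F) z"
    using F.isCont_cdf[of z] zero_less_measure_iff[of F "{z}"] by auto
  then show thesis by (rule that)
qed

text \<open>The comparison moves the argument by \<open>\<theta>\<close> on the square-root scale. A
  continuity point \<open>z\<close> near \<open>x\<close> is fixed and \<open>\<theta>\<close> is
  taken as the distance of \<open>sqrt z\<close> and \<open>sqrt x\<close>; then
  \<open>R n / \<theta>^2\<close> still tends to 0.\<close>

lemma cdf_limit_of_comparison:
  fixes \<mu> :: "nat \<Rightarrow> real measure" and a :: "nat \<Rightarrow> real \<Rightarrow> real" and R :: "nat \<Rightarrow> real"
  assumes F: "real_distribution F" and lim: "weak_conv_m \<mu> F"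
    and \<mu>neg: "\<And>n x. x < 0 \<Longrightarrow> cdf (\<mu> n) x = 0" and aneg: "\<And>n x. x < 0 \<Longrightarrow> a n x = 0" and a0: "\<And>n x. 0 \<le> a n x"
    and R: "R \<longlonglongrightarrow> 0"
    and up: "\<And>n \<theta> x. \<theta> > 0 \<Longrightarrow> x \<ge> 0 \<Longrightarrow> a n x \<le> cdf (\<mu> n) ((sqrt x + \<theta>)\<^sup>2) + R n / \<theta>\<^sup>2"
    and lo: "\<And>n \<theta> x. \<theta> > 0 \<Longrightarrow> x \<ge> 0 \<Longrightarrow> cdf (\<mu> n) x \<le> a n ((sqrt x + \<theta>)\<^sup>2) + R n / \<theta>\<^sup>2"
    and c: "isCont (cdf F) x"
  shows "(\<lambda>n. a n x) \<longlonglongrightarrow> cdf F x"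
proof (cases "x < 0")
  case True
  have "(\<lambda>n. cdf (\<mu> n) x) \<longlonglongrightarrow> cdf F x" using lim c by (simp add: weak_conv_m_def weak_conv_def)
  then show ?thesis by (simp add: \<mu>neg[OF True] aneg[OF True])
next
  case False
  then have x: "x \<ge> 0" by simp
  have conv: "(\<lambda>n. cdf (\<mu> n) z) \<longlonglongrightarrow> cdf F z" if "isCont (cdf F) z" for z
    using lim that by (simp add: weak_conv_m_def weak_conv_def)
  have RT: "(\<lambda>n. R n / t) \<longlonglongrightarrow> 0" for t using tendsto_divide_zero[OF R] .
  show ?thesis
  proof (rule LIMSEQ_I)
    fix e :: real assume "e > 0"
    define r where "r = e / 3"
    have r: "r > 0" and e3: "e = 3 * r" using \<open>e > 0\<close> by (simp_all add: r_def)
    obtain d where d: "d > 0" "\<And>z. \<bar>z - x\<bar> < d \<Longrightarrow> \<bar>cdf F z - cdf F x\<bar> < r"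
      using c r unfolding continuous_at_eps_delta dist_real_def by blast
    have close: "\<forall>\<^sub>F n in sequentially. \<bar>cdf (\<mu> n) z - cdf F z\<bar> < r" if "isCont (cdf F) z" for z
      using tendstoD[OF conv[OF that] r] by (simp add: dist_real_def)
    have closeR: "\<forall>\<^sub>F n in sequentially. R n / t < r" for t
      using order_tendstoD(2)[OF RT r] .
    have U: "\<forall>\<^sub>F n in sequentially. a n x < cdf F x + e"
    proof -
      obtain z where z: "x < z" "z < x + d" "isCont (cdf F) z" using cdf_continuity_point[OF F, of x "x + d"] d(1) by auto
      define \<theta> where "\<theta> = sqrt z - sqrt x"
      have \<theta>: "\<theta> > 0" "(sqrt x + \<theta>)\<^sup>2 = z" using z x by (simp_all add: \<theta>_def)
      show ?thesis using close[OF z(3)] closeR[of "\<theta>\<^sup>2"]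
      proof eventually_elim
        case (elim n)
        have "\<bar>cdf F z - cdf F x\<bar> < r" using z by (intro d(2)) simp
        then show ?case using elim up[OF \<theta>(1) x, of n] unfolding \<theta>(2) e3 by linarith
      qed
    qed
    have Lo: "\<forall>\<^sub>F n in sequentially. a n x > cdf F x - e"
    \<comment> \<open>The comparison is available for nonnegative arguments, so at
      \<open>x = 0\<close> no point below can be used. There \<open>F\<close> vanishes at negative
      continuity points, and continuity makes \<open>cdf F 0\<close> smaller than \<open>r\<close>;
      nonnegativity of \<open>a\<close> suffices.\<close>
    proof (cases "x = 0")
      case True
      obtain z where z: "x - d < z" "z < x" "isCont (cdf F) z" using cdf_continuity_point[OF F, of "x - d" x] d(1) by auto
      have "cdf F z = 0" using conv[OF z(3)] z True by (simp add: \<mu>neg LIMSEQ_const_iff)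
      then have "cdf F x < r" using d(2)[of z] z by (simp add: abs_less_iff)
      then have "cdf F x - e < 0" using r e3 by linarith
      then show ?thesis using a0 by (intro always_eventually allI) (rule less_le_trans)
    next
      case False
      then have "max 0 (x - d) < x" using x d(1) by auto
      then obtain z where z: "max 0 (x - d) < z" "z < x" "isCont (cdf F) z" using cdf_continuity_point[OF F] by blast
      define \<theta> where "\<theta> = sqrt x - sqrt z"
      have \<theta>: "\<theta> > 0" "(sqrt z + \<theta>)\<^sup>2 = x" using z x by (simp_all add: \<theta>_def)
      have z0: "z \<ge> 0" using z by simp
      show ?thesis using close[OF z(3)] closeR[of "\<theta>\<^sup>2"]
      proof eventually_elim
        case (elim n)
        have "\<bar>cdf F z - cdf F x\<bar> < r" using z by (intro d(2)) simp
        then show ?case using elim lo[OF \<theta>(1) z0, of n] unfolding \<theta>(2) e3 by linarith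
      qed
    qed
    have "\<forall>\<^sub>F n in sequentially. norm (a n x - cdf F x) < e"
      using U Lo by eventually_elim (simp add: abs_less_iff)
    then show "\<exists>no. \<forall>n\<ge>no. norm (a n x - cdf F x) < e" by (simp add: eventually_sequentially)
  qed
qed

text \<open>Almost sure statements can be intersected over countably many arguments. Monotonicity
  fills the gaps: a rational is inserted between \<open>x\<close> and a continuity point on either
  side, and \<open>f\<close> is compared with \<open>a\<close> at that rational.\<close>

lemma cdf_limit_from_rationals:
  fixes f a :: "nat \<Rightarrow> real \<Rightarrow> real"
  assumes F: "real_distribution F" and f: "\<And>n. mono (f n)" and a: "\<And>n. mono (a n)"
    and fa: "\<And>q. q \<in> \<rat> \<Longrightarrow> (\<lambda>n. f n q - a n q) \<longlonglongrightarrow> 0"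
    and lim: "\<And>x. isCont (cdf F) x \<Longrightarrow> (\<lambda>n. a n x) \<longlonglongrightarrow> cdf F x"
    and c: "isCont (cdf F) x"
  shows "(\<lambda>n. f n x) \<longlonglongrightarrow> cdf F x"
proof (rule LIMSEQ_I)
  fix e :: real assume "e > 0"
  define r where "r = e / 3"
  have r: "r > 0" and e3: "e = 3 * r" using \<open>e > 0\<close> by (simp_all add: r_def)
  obtain d where d: "d > 0" "\<And>z. \<bar>z - x\<bar> < d \<Longrightarrow> \<bar>cdf F z - cdf F x\<bar> < r"
    using c r unfolding continuous_at_eps_delta dist_real_def by blast
  have close: "\<forall>\<^sub>F n in sequentially. \<bar>a n z - cdf F z\<bar> < r" if "isCont (cdf F) z" for z
    using tendstoD[OF lim[OF that] r] by (simp add: dist_real_def)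
  have closeq: "\<forall>\<^sub>F n in sequentially. \<bar>f n q - a n q\<bar> < r" if "q \<in> \<rat>" for q
    using tendstoD[OF fa[OF that] r] by (simp add: dist_real_def)
  obtain z where z: "x < z" "z < x + d" "isCont (cdf F) z" using cdf_continuity_point[OF F, of x "x + d"] d(1) by auto
  obtain q where q: "q \<in> \<rat>" "x < q" "q < z" using Rats_dense_in_real[OF z(1)] by blast
  obtain z' where z': "x - d < z'" "z' < x" "isCont (cdf F) z'" using cdf_continuity_point[OF F, of "x - d" x] d(1) by auto
  obtain q' where q': "q' \<in> \<rat>" "z' < q'" "q' < x" using Rats_dense_in_real[OF z'(2)] by blast
  have "\<forall>\<^sub>F n in sequentially. norm (f n x - cdf F x) < e"
    using close[OF z(3)] close[OF z'(3)] closeq[OF q(1)] closeq[OF q'(1)]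
  proof eventually_elim
    case (elim n)
    have "f n x \<le> f n q" "a n q \<le> a n z" "f n q' \<le> f n x" "a n z' \<le> a n q'"
      using q q' monoD[OF f[of n]] monoD[OF a[of n]] by simp_all
    moreover have "\<bar>cdf F z - cdf F x\<bar> < r" "\<bar>cdf F z' - cdf F x\<bar> < r" using z z' by (auto intro!: d(2))
    ultimately have "\<bar>f n x - cdf F x\<bar> < e" using elim unfolding e3 by linarith
    then show ?case by simp
  qed
  then show "\<exists>no. \<forall>n\<ge>no. norm (f n x - cdf F x) < e" by (simp add: eventually_sequentially)
qed

text \<open>The binomial coefficients are at most \<open>2^(2 k)\<close> and \<open>2^k\<close>,
  together \<open>8^k\<close>, and \<open>1 / k\<close> cancels the number of summands. This is the
  geometric growth required for determinacy.\<close>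

lemma limit_moment_bound:
  fixes y :: real
  assumes y: "y > 0" and k: "k \<ge> 1"
  shows "(\<Sum>i = 0..k - 1. 1 / real k * real ((2 * k) choose i) * real (k choose (i + 1)) * y ^ (2 * k - 1 - i))
     \<le> (8 * (max 1 y)\<^sup>2) ^ k"
proof -
  define Y where "Y = max 1 y"
  have Y: "Y \<ge> 1" "y \<le> Y" by (simp_all add: Y_def)
  have "1 / real k * real ((2 * k) choose i) * real (k choose (i + 1)) * y ^ (2 * k - 1 - i) \<le> 1 / real k * (2 ^ (2 * k)) * 2 ^ k * Y ^ (2 * k)" for i
  proof (intro mult_mono)
    show "real ((2 * k) choose i) \<le> 2 ^ (2 * k)"
      using binomial_le_pow2[of "2 * k" i] by (metis of_nat_le_iff of_nat_numeral of_nat_power)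
    show "real (k choose (i + 1)) \<le> 2 ^ k"
      using binomial_le_pow2[of k "i + 1"] by (metis of_nat_le_iff of_nat_numeral of_nat_power)
    have "y ^ (2 * k - 1 - i) \<le> Y ^ (2 * k - 1 - i)" using y Y by (intro power_mono) auto
    also have "\<dots> \<le> Y ^ (2 * k)" using Y by (intro power_increasing) auto
    finally show "y ^ (2 * k - 1 - i) \<le> Y ^ (2 * k)" .
  qed (use y in auto)
  then have "(\<Sum>i = 0..k - 1. 1 / real k * real ((2 * k) choose i) * real (k choose (i + 1)) * y ^ (2 * k - 1 - i))
      \<le> (\<Sum>i = 0..k - 1. 1 / real k * (2 ^ (2 * k)) * 2 ^ k * Y ^ (2 * k))"
    by (rule sum_mono)
  also have "\<dots> = 2 ^ (2 * k) * 2 ^ k * Y ^ (2 * k)" using k by simp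
  also have "\<dots> = (8 * Y\<^sup>2) ^ k" by (simp only: power_mult power_mult_distrib[symmetric]) simp
  finally show ?thesis by (simp add: Y_def)
qed

text \<open>The auxiliary laws \<open>\<mu>\<close> carry the argument: their moments converge to
  \<open>m\<close>, so they converge weakly to some \<open>F\<close>, and the expected distribution
  functions \<open>a T\<close> follow them because the truncation error vanishes.\<close>

lemma expected_cdf_limit:
  fixes L :: "nat \<Rightarrow> nat \<times> nat \<Rightarrow> real measure" and p :: "nat \<Rightarrow> nat" and s :: nat and y :: real
  defines "E \<equiv> \<lambda>T. {..<p T} \<times> {..<T + s}"
  defines "a \<equiv> \<lambda>T x. \<integral>w. cdf (esd (lag_mat s (p T) T w * (lag_mat s (p T) T w)\<^sup>T)) x \<partial>PiM (E T) (L T)"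
  assumes pL: "\<And>T e. prob_space (L T e)" and sL: "\<And>T e. sets (L T e) = sets borel" and s: "s \<ge> 1"
    and i1: "\<And>T e. e \<in> E T \<Longrightarrow> integrable (L T e) (\<lambda>x. x)" and m1: "\<And>T e. e \<in> E T \<Longrightarrow> (\<integral>x. x \<partial>L T e) = 0"
    and i2: "\<And>T e. e \<in> E T \<Longrightarrow> integrable (L T e) (\<lambda>x. x\<^sup>2)" and m2: "\<And>T e. e \<in> E T \<Longrightarrow> (\<integral>x. x\<^sup>2 \<partial>L T e) = 1"
    and p: "filterlim p at_top sequentially" and lim: "(\<lambda>T. real (p T) / real T) \<longlonglongrightarrow> y" and y: "y > 0"
    and lind: "(\<lambda>T. (\<Sum>e\<in>E T. \<integral>x. x\<^sup>2 * indicator {x. real T powr (1/4) \<le> \<bar>x\<bar>} x \<partial>L T e) / (real T)\<^sup>2) \<longlonglongrightarrow> 0"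
  shows "\<exists>F. real_distribution F \<and>
     (\<forall>k\<ge>1. integrable F (\<lambda>x. x ^ k) \<and>
        (\<integral>x. x ^ k \<partial>F) = (\<Sum>i = 0..k - 1. 1 / real k * real ((2 * k) choose i) * real (k choose (i + 1)) * y ^ (2 * k - 1 - i))) \<and>
     (\<forall>x. isCont (cdf F) x \<longrightarrow> (\<lambda>T. a T x) \<longlonglongrightarrow> cdf F x)"
proof -
  define K where "K = y + 1"
  define \<tau> where "\<tau> T = real T powr (1/4)" for T :: nat
  define c where "c k T = real (T + s) ^ (2 * k + 1) / (real T ^ (2 * k) * real (p T))" for k T
  define B where "B k = 2 * fact (2 * (2 * k + 1)) ^ (2 * (2 * k + 1)) * real (chain_bound (4 * k) 0) * real (2 * k + 1) * K ^ (2 * k + 1)" for k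
  define R where "R T = truncation_error s (p T) T (\<tau> T) (L T)" for T
  have "\<forall>\<^sub>F T in sequentially. real (p T) / real T < y + 1"
    using order_tendstoD(2)[OF lim, of "y + 1"] by simp
  moreover have "\<forall>\<^sub>F T in sequentially. 1 \<le> p T" using p unfolding filterlim_at_top by blast
  ultimately have "\<forall>\<^sub>F T in sequentially. real (p T) / real T < y + 1 \<and> 1 \<le> p T \<and> 81 \<le> T"
    using eventually_ge_at_top[of "81::nat"] by eventually_elim simp
  \<comment> \<open>From \<open>T \<ge> 81 = 9^2\<close> follows \<open>9 * sqrt T \<le> T\<close>,
    which gives the condition \<open>q^2 \<le> N\<close> for \<open>q = 3 T^(1/4)\<close>. The first
    bound yields \<open>p \<le> K N\<close> with \<open>K = y + 1\<close>.\<close>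
  then obtain n0 where n0: "\<And>T. T \<ge> n0 \<Longrightarrow> real (p T) / real T < y + 1 \<and> 1 \<le> p T \<and> 81 \<le> T"
    unfolding eventually_sequentially by blast
  have ex: "\<exists>\<mu>. real_distribution \<mu> \<and> (\<forall>k::nat. integrable \<mu> (\<lambda>x. x ^ k)) \<and> (\<forall>x<0. cdf \<mu> x = 0)
    \<and> (\<forall>k\<ge>1. \<bar>(\<integral>x. x ^ k \<partial>\<mu>) - c k T * gauss_tau (p T) (T + s) s [0 # alt (- 1) (2 * k)]\<bar>
         \<le> c k T * (B k * (9 * (\<tau> T)\<^sup>2 / real (T + s))))
    \<and> (\<forall>\<theta>>0. \<forall>x\<ge>0. a T x \<le> cdf \<mu> ((sqrt x + \<theta>)\<^sup>2) + R T / \<theta>\<^sup>2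
         \<and> cdf \<mu> x \<le> a T ((sqrt x + \<theta>)\<^sup>2) + R T / \<theta>\<^sup>2)" if T: "T \<ge> n0" for T
  proof -
    have t: "real (p T) / real T < y + 1" "1 \<le> p T" "81 \<le> T" using n0[OF T] by auto
    have t1: "\<tau> T \<ge> 1" unfolding \<tau>_def using t(3) by (intro ge_one_powr_ge_zero) auto
    have sq: "(\<tau> T)\<^sup>2 = sqrt (real T)" unfolding \<tau>_def power2_eq_square powr_add[symmetric] by (simp add: powr_half_sqrt)
    have "9 \<le> sqrt (real T)" using t(3) real_le_rsqrt[of 9 "real T"] by simp
    then have "9 * sqrt (real T) \<le> sqrt (real T) * sqrt (real T)" by (intro mult_right_mono) auto
    then have t2: "9 * (\<tau> T)\<^sup>2 \<le> real (T + s)" by (simp add: sq)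
    have "real (p T) \<le> K * real T" using t by (simp add: K_def field_simps)
    also have "\<dots> \<le> K * real (T + s)" using y by (intro mult_left_mono) (auto simp: K_def)
    finally have pK: "real (p T) \<le> K * real (T + s)" .
    have K1: "K \<ge> 1" using y by (simp add: K_def)
    show ?thesis
      unfolding c_def B_def R_def a_def E_def
      by (rule bounded_comparison_law[OF pL sL _ _ _ t1 i1[unfolded E_def] m1[unfolded E_def] i2[unfolded E_def] m2[unfolded E_def] K1 pK t2])
        (use t s in auto)
  qed
  have "\<forall>n. \<exists>\<mu>. real_distribution \<mu> \<and> (\<forall>k::nat. integrable \<mu> (\<lambda>x. x ^ k)) \<and> (\<forall>x<0. cdf \<mu> x = 0)
    \<and> (\<forall>k\<ge>1. \<bar>(\<integral>x. x ^ k \<partial>\<mu>) - c k (n + n0) * gauss_tau (p (n + n0)) (n + n0 + s) s [0 # alt (- 1) (2 * k)]\<bar>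
         \<le> c k (n + n0) * (B k * (9 * (\<tau> (n + n0))\<^sup>2 / real (n + n0 + s))))
    \<and> (\<forall>\<theta>>0. \<forall>x\<ge>0. a (n + n0) x \<le> cdf \<mu> ((sqrt x + \<theta>)\<^sup>2) + R (n + n0) / \<theta>\<^sup>2
         \<and> cdf \<mu> x \<le> a (n + n0) ((sqrt x + \<theta>)\<^sup>2) + R (n + n0) / \<theta>\<^sup>2)"
    by (intro allI ex) simp
  from choice[OF this] obtain \<mu> where \<mu>: "\<And>n. real_distribution (\<mu> n)" "\<And>n k::nat. integrable (\<mu> n) (\<lambda>x. x ^ k)" "\<And>n x. x < 0 \<Longrightarrow> cdf (\<mu> n) x = 0"
    "\<And>n k. k \<ge> 1 \<Longrightarrow> \<bar>(\<integral>x. x ^ k \<partial>\<mu> n) - c k (n + n0) * gauss_tau (p (n + n0)) (n + n0 + s) s [0 # alt (- 1) (2 * k)]\<bar>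
         \<le> c k (n + n0) * (B k * (9 * (\<tau> (n + n0))\<^sup>2 / real (n + n0 + s)))"
    "\<And>n \<theta> x. \<theta> > 0 \<Longrightarrow> x \<ge> 0 \<Longrightarrow> a (n + n0) x \<le> cdf (\<mu> n) ((sqrt x + \<theta>)\<^sup>2) + R (n + n0) / \<theta>\<^sup>2"
    "\<And>n \<theta> x. \<theta> > 0 \<Longrightarrow> x \<ge> 0 \<Longrightarrow> cdf (\<mu> n) x \<le> a (n + n0) ((sqrt x + \<theta>)\<^sup>2) + R (n + n0) / \<theta>\<^sup>2"
    by blast
  \<comment> \<open>The zeroth moment is set apart, since the formula is meant for
    \<open>k \<ge> 1\<close>.\<close>
  define m where "m k = (if k = 0 then 1 else (\<Sum>i = 0..k - 1. 1 / real k * real ((2 * k) choose i) * real (k choose (i + 1)) * y ^ (2 * k - 1 - i)))" for k :: nat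
  have Tpos: "\<forall>\<^sub>F T::nat in sequentially. T > 0" by (rule eventually_gt_at_top)
  have sT: "(\<lambda>T. real (T + s) / real T) \<longlonglongrightarrow> 1"
    by real_asymp
  \<comment> \<open>The limit \<open>1 / y\<close> reflects the change from traces normalised by
    \<open>N\<close> to traces normalised by \<open>p\<close>. It lowers the exponent of
    \<open>y\<close> from \<open>2 k - i\<close> to \<open>2 k - 1 - i\<close>.\<close>
  have clim: "c k \<longlonglongrightarrow> 1 / y" for k
  proof -
    have "(\<lambda>T. (real (T + s) / real T) ^ (2 * k + 1) / (real (p T) / real T)) \<longlonglongrightarrow> 1 ^ (2 * k + 1) / y"
      by (intro tendsto_divide tendsto_power sT lim) (use y in simp)
    moreover have "\<forall>\<^sub>F T in sequentially. (real (T + s) / real T) ^ (2 * k + 1) / (real (p T) / real T) = c k T"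
      using Tpos by eventually_elim (simp add: c_def power_divide)
    ultimately have "c k \<longlonglongrightarrow> 1 ^ (2 * k + 1) / y" by (rule Lim_transform_eventually)
    then show ?thesis by simp
  qed
  have glim: "(\<lambda>T. gauss_tau (p T) (T + s) s [0 # alt (- 1) (2 * k)]) \<longlonglongrightarrow> alt_limit y k" for k
  proof -
    have "(\<lambda>T. (real (p T) / real T) / (real (T + s) / real T)) \<longlonglongrightarrow> y / 1"
      by (intro tendsto_divide lim sT) simp
    moreover have "\<forall>\<^sub>F T in sequentially. (real (p T) / real T) / (real (T + s) / real T) = real (p T) / real (T + s)"
      using Tpos by eventually_elim simp
    ultimately have "(\<lambda>T. real (p T) / real (T + s)) \<longlonglongrightarrow> y / 1" by (rule Lim_transform_eventually)
    then have pl: "(\<lambda>T. real (p T) / real (T + s)) \<longlonglongrightarrow> y" by simp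
    have Nl: "filterlim (\<lambda>T. T + s) at_top sequentially" by (rule filterlim_add_const_nat_at_top)
    show ?thesis using gauss_tau_limit[OF Nl pl s, of "[0 # alt (- 1) (2 * k)]"] by (simp add: alt_limit_uminus)
  qed
  \<comment> \<open>The error of universality is of order \<open>T^(1/2) / T\<close>.\<close>
  have elim0: "(\<lambda>T. (\<tau> T)\<^sup>2 / real (T + s)) \<longlonglongrightarrow> 0" unfolding \<tau>_def by real_asymp
  have mom: "(\<lambda>n. \<integral>x. x ^ k \<partial>\<mu> n) \<longlonglongrightarrow> m k" for k
  proof (cases "k = 0")
    case True
    have "(\<integral>x. x ^ k \<partial>\<mu> n) = 1" for n
    proof -
      interpret d: real_distribution "\<mu> n" by (rule \<mu>(1))
      show ?thesis using True d.prob_space by simp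
    qed
    then show ?thesis using True by (simp add: m_def)
  next
    case False
    then have k: "k \<ge> 1" by simp
    have mk: "1 / y * alt_limit y k = m k"
    proof -
      have "1 / y * alt_limit y k = (\<Sum>i = 0..k - 1. 1 / y * (1 / real k * real ((2 * k) choose i) * real (k choose (i + 1)) * y ^ (2 * k - i)))"
        using alt_limit_formula[OF _ k, of y] y by (simp only: sum_distrib_left)
      also have "\<dots> = m k"
        unfolding m_def using False
      proof (simp only: if_False, intro sum.cong refl)
        fix i assume i: "i \<in> {0..k - 1}"
        have "2 * k - i = Suc (2 * k - 1 - i)" using i k by auto
        then have "y ^ (2 * k - i) = y * y ^ (2 * k - 1 - i)" by (simp only: power_Suc)
        then show "1 / y * (1 / real k * real ((2 * k) choose i) * real (k choose (i + 1)) * y ^ (2 * k - i))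
          = 1 / real k * real ((2 * k) choose i) * real (k choose (i + 1)) * y ^ (2 * k - 1 - i)" using y by simp
      qed
      finally show ?thesis .
    qed
    have main: "(\<lambda>n. c k (n + n0) * gauss_tau (p (n + n0)) (n + n0 + s) s [0 # alt (- 1) (2 * k)]) \<longlonglongrightarrow> m k"
      using LIMSEQ_ignore_initial_segment[OF tendsto_mult[OF clim[of k] glim[of k]], of n0] unfolding mk .
    have "(\<lambda>T. c k T * (B k * (9 * ((\<tau> T)\<^sup>2 / real (T + s))))) \<longlonglongrightarrow> 1 / y * (B k * (9 * 0))"
      by (intro tendsto_mult tendsto_const clim elim0)
    from LIMSEQ_ignore_initial_segment[OF this, of n0]
    have err: "(\<lambda>n. c k (n + n0) * (B k * (9 * (\<tau> (n + n0))\<^sup>2 / real (n + n0 + s)))) \<longlonglongrightarrow> 0" by simp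
    have "(\<lambda>n. (\<integral>x. x ^ k \<partial>\<mu> n) - c k (n + n0) * gauss_tau (p (n + n0)) (n + n0 + s) s [0 # alt (- 1) (2 * k)]) \<longlonglongrightarrow> 0"
      by (rule Lim_null_comparison[OF _ err], intro always_eventually allI) (unfold real_norm_def, rule \<mu>(4)[OF k])
    from tendsto_add[OF this main] show ?thesis by simp
  qed
  have mb: "m (2 * k) \<le> (8 * (max 1 y)\<^sup>2) ^ (2 * k)" for k
  proof (cases "k = 0")
    case False
    then have "2 * k \<ge> 1" by simp
    from limit_moment_bound[OF y this] show ?thesis using False by (simp add: m_def)
  qed (simp add: m_def)
  obtain F where F: "real_distribution F" "weak_conv_m \<mu> F" "\<And>k. integrable F (\<lambda>x. x ^ k)" "\<And>k. (\<integral>x. x ^ k \<partial>F) = m k"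
    using method_of_moments[OF \<mu>(1,2) mom mb] by blast
  have R0: "R \<longlonglongrightarrow> 0"
  proof -
    have z: "(\<lambda>T. real s / real T) \<longlonglongrightarrow> 0" by (rule lim_const_over_n)
    have "(\<lambda>T. 3 * (6 * ((\<Sum>e\<in>E T. \<integral>x. x\<^sup>2 * indicator {x. real T powr (1/4) \<le> \<bar>x\<bar>} x \<partial>L T e) / (real T)\<^sup>2)
        + real (p T) / real T * (real s / real T))) \<longlonglongrightarrow> 3 * (6 * 0 + y * 0)"
      by (intro tendsto_mult tendsto_add tendsto_const lind lim z)
    moreover have "3 * (6 * ((\<Sum>e\<in>E T. \<integral>x. x\<^sup>2 * indicator {x. real T powr (1/4) \<le> \<bar>x\<bar>} x \<partial>L T e) / (real T)\<^sup>2)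
        + real (p T) / real T * (real s / real T)) = R T" for T
      unfolding R_def truncation_error_def \<tau>_def E_def by (simp add: add_divide_distrib power2_eq_square)
    ultimately show ?thesis by simp
  qed
  have "(\<lambda>T. a T x) \<longlonglongrightarrow> cdf F x" if "isCont (cdf F) x" for x
  proof -
    have b: "0 \<le> cdf (esd A) t" for A t
    proof -
      interpret d: real_distribution "esd A" by (rule real_distribution_esd)
      show ?thesis by (rule d.cdf_nonneg)
    qed
    have "(\<lambda>n. a (n + n0) x) \<longlonglongrightarrow> cdf F x"
    proof (rule cdf_limit_of_comparison[OF F(1,2) \<mu>(3) _ _ LIMSEQ_ignore_initial_segment[OF R0, of n0] \<mu>(5,6) that])
      fix n :: nat and x :: real assume x: "x < 0"
      have "0 < p (n + n0)" using n0[of "n + n0"] by auto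
      then show "a (n + n0) x = 0"
        unfolding a_def using cdf_gram_neg[OF _ lag_mat_carrier x] by simp
    qed (auto simp: a_def intro!: integral_nonneg_AE b)
    then show ?thesis by (rule LIMSEQ_offset)
  qed
  then show ?thesis using F(1,3,4) by (intro exI[of _ F]) (simp add: m_def)
qed

section \<open>From expected distribution functions to almost sure convergence\<close>

lemma lag_mat_array: "lag_mat s p T (\<lambda>e. X (fst e) (Suc (snd e))) = sample_autocov s p T X"
  unfolding lag_mat_def sample_autocov_def by (rule cong_mat) (auto intro!: sum.cong simp: Suc_diff_Suc Suc_le_eq)

definition array_marginal :: "'a measure \<Rightarrow> (nat \<Rightarrow> nat \<Rightarrow> 'a \<Rightarrow> real) \<Rightarrow> nat \<Rightarrow> nat \<Rightarrow> nat \<times> nat \<Rightarrow> real measure" where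
  "array_marginal M X p N e = (if e \<in> {..<p} \<times> {..<N} then distr M borel (X (fst e) (Suc (snd e))) else return borel 0)"

lemma expected_cdf_autocov:
  fixes X :: "nat \<Rightarrow> nat \<Rightarrow> 'a \<Rightarrow> real"
  assumes M: "prob_space M" and p: "p > 0" and s: "s > 0"
    and cols: "prob_space.indep_vars M (\<lambda>_. \<Pi>\<^sub>M i\<in>{..<p}. borel) (\<lambda>t \<omega>. \<lambda>i\<in>{..<p}. X i t \<omega>) {1..T + s}"
    and rows: "\<And>t. t \<in> {1..T + s} \<Longrightarrow> prob_space.indep_vars M (\<lambda>_. borel) (\<lambda>i. X i t) {..<p}"
  shows "(\<integral>w. cdf (esd (lag_mat s p T w * (lag_mat s p T w)\<^sup>T)) x \<partial>PiM ({..<p} \<times> {..<T + s}) (array_marginal M X p (T + s)))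
    = (\<integral>\<omega>. cdf (esd (sample_autocov s p T (\<lambda>i t. X i t \<omega>) * (sample_autocov s p T (\<lambda>i t. X i t \<omega>))\<^sup>T)) x \<partial>M)"
proof -
  interpret prob_space M by (rule M)
  define E where "E = {..<p} \<times> {..<T + s}"
  let ?x = "\<lambda>\<omega>. \<lambda>e\<in>E. X (fst e) (Suc (snd e)) \<omega>"
  have Xm: "X i t \<in> borel_measurable M" if "i < p" "t \<in> {1..T + s}" for i t
    using rows[OF that(2)] that(1) by (auto simp: indep_vars_def)
  have xm: "?x \<in> measurable M (PiM E (\<lambda>_. borel))"
    by (rule measurable_restrict) (auto simp: E_def intro!: Xm)
  have law: "PiM E (array_marginal M X p (T + s)) = distr M (PiM E (\<lambda>_. borel)) ?x"
    using array_law[OF M p _ cols rows] s by (simp add: E_def array_marginal_def[abs_def])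
  have gm: "(\<lambda>w. cdf (esd (lag_mat s p T w * (lag_mat s p T w)\<^sup>T)) x) \<in> borel_measurable (PiM E (\<lambda>_. borel))"
    by (rule borel_measurable_cdf_lag_mat[OF p, where f = "\<lambda>e w. w e"]) (simp add: E_def)
  have eq: "lag_mat s p T (?x \<omega>) = sample_autocov s p T (\<lambda>i t. X i t \<omega>)" for \<omega>
    unfolding lag_mat_array[of s p T "\<lambda>i t. X i t \<omega>", symmetric] by (rule lag_mat_cong) (simp add: E_def)
  show ?thesis unfolding E_def[symmetric] law by (subst integral_distr[OF xm gm]) (simp only: eq)
qed

text \<open>For large \<open>T\<close> a deviation by \<open>\<delta>\<close> has probability at
  most \<open>2 r^T\<close>, because \<open>p^2 / (T + s)\<close> grows linearly in
  \<open>T\<close>. These bounds are summable, and Borel-Cantelli is applied to the countably many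
  levels \<open>1 / (k + 1)\<close>.\<close>

lemma cdf_autocov_fluctuation:
  fixes X :: "nat \<Rightarrow> nat \<Rightarrow> nat \<Rightarrow> 'a \<Rightarrow> real" and p :: "nat \<Rightarrow> nat" and s :: nat
  defines "G \<equiv> \<lambda>T x \<omega>. cdf (esd (sample_autocov s (p T) T (\<lambda>i t. X T i t \<omega>) * (sample_autocov s (p T) T (\<lambda>i t. X T i t \<omega>))\<^sup>T)) x"
  assumes M: "prob_space M" and s: "s \<ge> 1"
    and cols: "\<And>T. prob_space.indep_vars M (\<lambda>_. \<Pi>\<^sub>M i\<in>{..<p T}. borel) (\<lambda>t \<omega>. \<lambda>i\<in>{..<p T}. X T i t \<omega>) {1..T + s}"
    and lim: "(\<lambda>T. real (p T) / real T) \<longlonglongrightarrow> y" and y: "y > 0"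
  shows "AE \<omega> in M. (\<lambda>T. G T x \<omega> - (\<integral>v. G T x v \<partial>M)) \<longlonglongrightarrow> 0"
proof -
  interpret prob_space M by (rule M)
  let ?D = "\<lambda>T \<omega>. \<bar>G T x \<omega> - (\<integral>v. G T x v \<partial>M)\<bar>"
  have "\<forall>\<^sub>F T in sequentially. y / 2 < real (p T) / real T" using order_tendstoD(1)[OF lim, of "y / 2"] y by simp
  then have big: "\<forall>\<^sub>F T in sequentially. 0 < T \<and> s \<le> T \<and> 0 < p T \<and> y / 2 * real T \<le> real (p T)"
    using eventually_gt_at_top[of "0::nat"] eventually_ge_at_top[of s]
  proof eventually_elim
    case (elim T)
    then have "y / 2 * real T < real (p T)" by (simp add: field_simps)
    moreover have "0 < y / 2 * real T" using y elim by simp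
    ultimately show ?case using elim by simp
  qed
  have near: "AE \<omega> in M. \<forall>\<^sub>F T in sequentially. ?D T \<omega> < \<delta>" if \<delta>: "\<delta> > 0" for \<delta>
  proof -
    \<comment> \<open>For \<open>p T = 0\<close> the event is replaced by the empty set, as the
      measurability lemma assumes positive dimension.\<close>
    define A where "A T = (if 0 < p T then {\<omega>\<in>space M. \<delta> \<le> ?D T \<omega>} else {})" for T
    have Gm: "G T x \<in> borel_measurable M" if "0 < p T" for T
      unfolding G_def using cdf_autocov_concentration(2)[OF M that _ \<delta> cols] s by simp
    have Am: "A T \<in> sets M" for T
    proof (cases "0 < p T")
      case True
      from Gm[OF True] show ?thesis unfolding A_def using True by simp
    qed (simp add: A_def)
    \<comment> \<open>From \<open>s \<le> T\<close> and \<open>p \<ge> y T / 2\<close> one gets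
      \<open>p^2 / (8 (T + s)) \<ge> (y T / 2)^2 / (16 T) = y^2 T / 64\<close>.\<close>
    define r where "r = exp (- \<delta>\<^sup>2 * y\<^sup>2 / 64)"
    have r: "0 < r" "r < 1" using \<delta> y by (simp_all add: r_def)
    have "\<forall>\<^sub>F T in sequentially. norm (measure M (A T)) \<le> 2 * r ^ T"
      using big
    proof eventually_elim
      case (elim T)
      have "measure M (A T) \<le> 2 * exp (- \<delta>\<^sup>2 * (real (p T))\<^sup>2 / (8 * real (T + s)))"
        using cdf_autocov_concentration(1)[OF M _ _ \<delta> cols, of T x] elim s by (simp add: A_def G_def)
      also have "exp (- \<delta>\<^sup>2 * (real (p T))\<^sup>2 / (8 * real (T + s))) \<le> exp (real T * (- \<delta>\<^sup>2 * y\<^sup>2 / 64))"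
      proof -
        have "y\<^sup>2 / 64 * real T = (y / 2 * real T)\<^sup>2 / (16 * real T)"
          using elim by (simp add: power2_eq_square field_simps)
        also have "\<dots> \<le> (real (p T))\<^sup>2 / (8 * real (T + s))"
          using elim y by (intro frac_le power_mono) auto
        finally have "\<delta>\<^sup>2 * (y\<^sup>2 / 64 * real T) \<le> \<delta>\<^sup>2 * ((real (p T))\<^sup>2 / (8 * real (T + s)))"
          by (rule mult_left_mono) simp
        then show ?thesis by (simp add: mult_ac)
      qed
      also have "exp (real T * (- \<delta>\<^sup>2 * y\<^sup>2 / 64)) = r ^ T" unfolding r_def by (rule exp_of_nat_mult)
      finally show ?case by simp
    qed
    then have "summable (\<lambda>T. measure M (A T))"
      by (rule summable_comparison_test_ev) (use r in \<open>intro summable_mult summable_geometric; simp\<close>)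
    then have "AE \<omega> in M. \<forall>\<^sub>F T in sequentially. \<omega> \<in> space M - A T"
      by (intro borel_cantelli_AE1 Am) (simp_all add: emeasure_eq_measure)
    then show ?thesis
    proof (rule AE_mp, intro AE_I2 impI)
      fix \<omega> assume "\<forall>\<^sub>F T in sequentially. \<omega> \<in> space M - A T"
      then show "\<forall>\<^sub>F T in sequentially. ?D T \<omega> < \<delta>"
        using big by eventually_elim (auto simp: A_def)
    qed
  qed
  have "AE \<omega> in M. \<forall>k::nat. \<forall>\<^sub>F T in sequentially. ?D T \<omega> < 1 / real (Suc k)"
    unfolding AE_all_countable by (intro allI near) simp
  then show ?thesis
  proof (rule AE_mp, intro AE_I2 impI)
    fix \<omega> assume *: "\<forall>k::nat. \<forall>\<^sub>F T in sequentially. ?D T \<omega> < 1 / real (Suc k)"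
    show "(\<lambda>T. G T x \<omega> - (\<integral>v. G T x v \<partial>M)) \<longlonglongrightarrow> 0"
    proof (rule tendstoI)
      fix e :: real assume "e > 0"
      then obtain k where k: "1 / real (Suc k) < e" using nat_approx_posE by blast
      from *[rule_format, of k] show "\<forall>\<^sub>F T in sequentially. dist (G T x \<omega> - (\<integral>v. G T x v \<partial>M)) 0 < e"
        by eventually_elim (use k in \<open>simp add: dist_real_def\<close>)
    qed
  qed
qed

text \<open>Beyond a level \<open>\<tau> \<ge> 1\<close> squares are at most fourth powers. The
  fourth moment may be infinite, hence the nonnegative integral on the right.\<close>

lemma truncated_second_moment_le:
  fixes X :: "'a \<Rightarrow> real"
  assumes X: "X \<in> borel_measurable M" and int: "integrable M (\<lambda>\<omega>. (X \<omega>)\<^sup>2)" and \<tau>: "\<tau> \<ge> 1"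
  shows "ennreal (\<integral>x. x\<^sup>2 * indicator {x. \<tau> \<le> \<bar>x\<bar>} x \<partial>distr M borel X)
    \<le> (\<integral>\<^sup>+\<omega>. ennreal (\<bar>X \<omega>\<bar> ^ 4 * indicator {\<omega>'. \<tau> \<le> \<bar>X \<omega>'\<bar>} \<omega>) \<partial>M)"
proof -
  have m: "(\<lambda>x::real. x\<^sup>2 * indicator {x. \<tau> \<le> \<bar>x\<bar>} x) \<in> borel_measurable borel" by measurable
  have i: "integrable M (\<lambda>\<omega>. (X \<omega>)\<^sup>2 * indicator {x. \<tau> \<le> \<bar>x\<bar>} (X \<omega>))"
  proof (rule Bochner_Integration.integrable_bound[OF int])
    show "(\<lambda>\<omega>. (X \<omega>)\<^sup>2 * indicator {x. \<tau> \<le> \<bar>x\<bar>} (X \<omega>)) \<in> borel_measurable M"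
      using measurable_compose[OF X m] .
  qed (auto simp: indicator_def)
  have "ennreal (\<integral>x. x\<^sup>2 * indicator {x. \<tau> \<le> \<bar>x\<bar>} x \<partial>distr M borel X)
      = ennreal (\<integral>\<omega>. (X \<omega>)\<^sup>2 * indicator {x. \<tau> \<le> \<bar>x\<bar>} (X \<omega>) \<partial>M)"
    by (subst integral_distr[OF X m]) (rule refl)
  also have "\<dots> = (\<integral>\<^sup>+\<omega>. ennreal ((X \<omega>)\<^sup>2 * indicator {x. \<tau> \<le> \<bar>x\<bar>} (X \<omega>)) \<partial>M)"
    by (rule nn_integral_eq_integral[symmetric, OF i]) simp
  also have "\<dots> \<le> (\<integral>\<^sup>+\<omega>. ennreal (\<bar>X \<omega>\<bar> ^ 4 * indicator {\<omega>'. \<tau> \<le> \<bar>X \<omega>'\<bar>} \<omega>) \<partial>M)"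
  proof (rule nn_integral_mono, rule ennreal_leI)
    fix \<omega>
    have "(X \<omega>)\<^sup>2 \<le> \<bar>X \<omega>\<bar> ^ 4" if "\<tau> \<le> \<bar>X \<omega>\<bar>"
    proof -
      have "\<bar>X \<omega>\<bar> ^ 2 \<le> \<bar>X \<omega>\<bar> ^ 4" using that \<tau> by (intro power_increasing) auto
      then show ?thesis by simp
    qed
    then show "(X \<omega>)\<^sup>2 * indicator {x. \<tau> \<le> \<bar>x\<bar>} (X \<omega>) \<le> \<bar>X \<omega>\<bar> ^ 4 * indicator {\<omega>'. \<tau> \<le> \<bar>X \<omega>'\<bar>} \<omega>"
      by (simp add: indicator_def)
  qed
  finally show ?thesis .
qed

theorem theorem1:
  fixes M :: "'a measure"
    and \<epsilon> :: "nat \<Rightarrow> nat \<Rightarrow> nat \<Rightarrow> 'a \<Rightarrow> real"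
    and s :: nat and p :: "nat \<Rightarrow> nat" and y :: real
  defines "X \<equiv> \<lambda>T \<omega>. sample_autocov s (p T) T (\<lambda>i t. \<epsilon> T i t \<omega>)"
  defines "A \<equiv> \<lambda>T \<omega>. X T \<omega> * (X T \<omega>)\<^sup>T"
  assumes "prob_space M"
    and "1 \<le> s"
    and indep_vectors: "\<And>T. prob_space.indep_vars M (\<lambda>_. \<Pi>\<^sub>M i\<in>{..<p T}. borel)
           (\<lambda>t \<omega>. \<lambda>i\<in>{..<p T}. \<epsilon> T i t \<omega>) {1..T + s}"
    and indep_entries: "\<And>T t. t \<in> {1..T + s} \<Longrightarrow>
           prob_space.indep_vars M (\<lambda>_. borel) (\<lambda>i. \<epsilon> T i t) {..<p T}"
    and mean_zero: "\<And>T i t. i < p T \<Longrightarrow> t \<in> {1..T + s} \<Longrightarrow>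
           integrable M (\<epsilon> T i t) \<and> (\<integral>\<omega>. \<epsilon> T i t \<omega> \<partial>M) = 0"
    and unit_variance: "\<And>T i t. i < p T \<Longrightarrow> t \<in> {1..T + s} \<Longrightarrow>
           integrable M (\<lambda>\<omega>. (\<epsilon> T i t \<omega>)\<^sup>2) \<and> (\<integral>\<omega>. (\<epsilon> T i t \<omega>)\<^sup>2 \<partial>M) = 1"
    and lindeberg: "\<And>\<eta> :: real. 0 < \<eta> \<Longrightarrow>
           (\<lambda>T. ennreal (1 / (\<eta> ^ 4 * real (p T) * real T)) *
              (\<Sum>i<p T. \<Sum>t = 1..T + s. \<integral>\<^sup>+\<omega>. ennreal (\<bar>\<epsilon> T i t \<omega>\<bar> ^ 4 *
                 indicator {\<omega>'. \<eta> * real T powr (1/4) \<le> \<bar>\<epsilon> T i t \<omega>'\<bar>} \<omega>) \<partial>M))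
           \<longlonglongrightarrow> 0"
    and "filterlim p at_top sequentially"
    and "(\<lambda>T. real (p T) / real T) \<longlonglongrightarrow> y"
    and "0 < y"
  shows "\<exists>F. real_distribution F \<and>
           (\<forall>k\<ge>1. integrable F (\<lambda>x. x ^ k) \<and>
              (\<integral>x. x ^ k \<partial>F) = (\<Sum>i = 0..k - 1. 1 / real k * real ((2 * k) choose i) *
                 real (k choose (i + 1)) * y ^ (2 * k - 1 - i))) \<and>
           (AE \<omega> in M. weak_conv_m (\<lambda>T. esd (A T \<omega>)) F)"
proof -
  interpret prob_space M by (rule \<open>prob_space M\<close>)
  note M = \<open>prob_space M\<close> and s = \<open>1 \<le> s\<close> and p = \<open>filterlim p at_top sequentially\<close>
    and lim = \<open>(\<lambda>T. real (p T) / real T) \<longlonglongrightarrow> y\<close> and y = \<open>0 < y\<close>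
  define E where "E T = {..<p T} \<times> {..<T + s}" for T
  define L where "L T = array_marginal M (\<epsilon> T) (p T) (T + s)" for T
  define a where "a T x = (\<integral>w. cdf (esd (lag_mat s (p T) T w * (lag_mat s (p T) T w)\<^sup>T)) x \<partial>PiM (E T) (L T))" for T x
  have \<epsilon>m: "\<epsilon> T i t \<in> borel_measurable M" if "i < p T" "t \<in> {1..T + s}" for T i t
    using mean_zero[OF that] by auto
  have Le: "L T e = distr M borel (\<epsilon> T (fst e) (Suc (snd e)))" "fst e < p T" "Suc (snd e) \<in> {1..T + s}" if "e \<in> E T" for T e
    using that by (auto simp: L_def array_marginal_def E_def)
  have em: "\<epsilon> T (fst e) (Suc (snd e)) \<in> borel_measurable M" if "e \<in> E T" for T e
    using \<epsilon>m[OF Le(2,3)[OF that]] .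
  have pL: "prob_space (L T e)" for T e
  proof (cases "e \<in> E T")
    case True
    then show ?thesis unfolding Le(1)[OF True] by (intro prob_space_distr em)
  next
    case False
    then show ?thesis by (simp add: L_def array_marginal_def E_def prob_space_return)
  qed
  have sL: "sets (L T e) = sets borel" for T e by (simp add: L_def array_marginal_def)
  have L1: "integrable (L T e) (\<lambda>x. x)" "(\<integral>x. x \<partial>L T e) = 0" if e: "e \<in> E T" for T e
    unfolding Le(1)[OF e] using mean_zero[OF Le(2,3)[OF e]] em[OF e]
    by (simp_all add: integrable_distr_eq integral_distr)
  have L2: "integrable (L T e) (\<lambda>x. x\<^sup>2)" "(\<integral>x. x\<^sup>2 \<partial>L T e) = 1" if e: "e \<in> E T" for T e
    unfolding Le(1)[OF e] using unit_variance[OF Le(2,3)[OF e]] em[OF e]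
    by (simp_all add: integrable_distr_eq integral_distr)
  \<comment> \<open>\<open>D\<close> is what the comparison needs, the truncated second moments;
    \<open>S\<close> is what the Lindeberg condition controls, the truncated fourth moments,
    possibly infinite for single \<open>T\<close>.\<close>
  define D where "D T = (\<Sum>e\<in>E T. \<integral>x. x\<^sup>2 * indicator {x. real T powr (1/4) \<le> \<bar>x\<bar>} x \<partial>L T e)" for T
  define S where "S T = (\<Sum>i<p T. \<Sum>t = 1..T + s. \<integral>\<^sup>+\<omega>. ennreal (\<bar>\<epsilon> T i t \<omega>\<bar> ^ 4 *
      indicator {\<omega>'. real T powr (1/4) \<le> \<bar>\<epsilon> T i t \<omega>'\<bar>} \<omega>) \<partial>M)" for T
  have D0: "0 \<le> D T" for T unfolding D_def by (intro sum_nonneg integral_nonneg_AE) simp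
  have Tpos: "\<forall>\<^sub>F T::nat in sequentially. 0 < T" by (rule eventually_gt_at_top)
  have "\<forall>\<^sub>F T in sequentially. 1 \<le> p T" using p unfolding filterlim_at_top by blast
  then have ppos: "\<forall>\<^sub>F T in sequentially. 0 < p T" by (rule eventually_mono) simp
  have DS: "ennreal (D T) \<le> S T" if "0 < T" for T
  proof -
    have \<tau>: "1 \<le> real T powr (1/4)" using that by (intro ge_one_powr_ge_zero) auto
    let ?f = "\<lambda>i t. \<integral>\<^sup>+\<omega>. ennreal (\<bar>\<epsilon> T i t \<omega>\<bar> ^ 4 * indicator {\<omega>'. real T powr (1/4) \<le> \<bar>\<epsilon> T i t \<omega>'\<bar>} \<omega>) \<partial>M"
    have "ennreal (D T) = (\<Sum>e\<in>E T. ennreal (\<integral>x. x\<^sup>2 * indicator {x. real T powr (1/4) \<le> \<bar>x\<bar>} x \<partial>L T e))"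
      unfolding D_def by (rule sum_ennreal[symmetric]) (intro integral_nonneg_AE, simp)
    also have "\<dots> \<le> (\<Sum>e\<in>E T. ?f (fst e) (Suc (snd e)))"
    proof (rule sum_mono)
      fix e assume e: "e \<in> E T"
      show "ennreal (\<integral>x. x\<^sup>2 * indicator {x. real T powr (1/4) \<le> \<bar>x\<bar>} x \<partial>L T e) \<le> ?f (fst e) (Suc (snd e))"
        unfolding Le(1)[OF e] using unit_variance[OF Le(2,3)[OF e]] by (intro truncated_second_moment_le em[OF e] \<tau>) simp
    qed
    also have "\<dots> = (\<Sum>i<p T. \<Sum>a<T + s. ?f i (Suc a))" by (simp add: E_def sum.cartesian_product case_prod_beta)
    also have "\<dots> = S T"
      unfolding S_def by (rule sum.cong[OF refl], rule sum.reindex_bij_witness[of _ "\<lambda>t. t - 1" Suc]) auto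
    finally show ?thesis .
  qed
  have Dlim: "(\<lambda>T. D T / (real (p T) * real T)) \<longlonglongrightarrow> 0"
  proof -
    \<comment> \<open>The instance \<open>\<eta> = 1\<close>, whose threshold is the truncation
      level \<open>T^(1/4)\<close>.\<close>
    have Slim: "(\<lambda>T. ennreal (1 / (real (p T) * real T)) * S T) \<longlonglongrightarrow> 0"
      using lindeberg[of 1] by (simp add: S_def)
    have "\<forall>\<^sub>F T in sequentially. ennreal (D T / (real (p T) * real T)) \<le> ennreal (1 / (real (p T) * real T)) * S T"
      using Tpos
    proof eventually_elim
      case (elim T)
      have "ennreal (D T / (real (p T) * real T)) = ennreal (1 / (real (p T) * real T)) * ennreal (D T)"
        by (subst ennreal_mult[symmetric]) (auto simp: D0)
      also have "\<dots> \<le> ennreal (1 / (real (p T) * real T)) * S T" by (rule mult_left_mono[OF DS[OF elim]]) simp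
      finally show ?case .
    qed
    then have "(\<lambda>T. ennreal (D T / (real (p T) * real T))) \<longlonglongrightarrow> ennreal 0"
      using tendsto_sandwich[OF _ _ tendsto_const Slim, of "\<lambda>T. ennreal (D T / (real (p T) * real T))"] by simp
    then show ?thesis by (subst (asm) tendsto_ennreal_iff) (auto simp: D0)
  qed
  have lind: "(\<lambda>T. D T / (real T)\<^sup>2) \<longlonglongrightarrow> 0"
  proof -
    have "(\<lambda>T. real (p T) / real T * (D T / (real (p T) * real T))) \<longlonglongrightarrow> y * 0"
      by (rule tendsto_mult[OF lim Dlim])
    moreover have "\<forall>\<^sub>F T in sequentially. real (p T) / real T * (D T / (real (p T) * real T)) = D T / (real T)\<^sup>2"
      using ppos by eventually_elim (simp add: power2_eq_square)
    ultimately have "(\<lambda>T. D T / (real T)\<^sup>2) \<longlonglongrightarrow> y * 0" by (rule Lim_transform_eventually)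
    then show ?thesis by simp
  qed
  obtain F where F: "real_distribution F"
    "\<forall>k\<ge>1. integrable F (\<lambda>x. x ^ k) \<and> (\<integral>x. x ^ k \<partial>F) = (\<Sum>i = 0..k - 1. 1 / real k * real ((2 * k) choose i) *
                 real (k choose (i + 1)) * y ^ (2 * k - 1 - i))"
    "\<And>x. isCont (cdf F) x \<Longrightarrow> (\<lambda>T. a T x) \<longlonglongrightarrow> cdf F x"
    using expected_cdf_limit[where L = L and p = p and s = s and y = y, folded E_def, folded a_def D_def,
        OF pL sL s L1 L2 p lim y lind] by blast
  \<comment> \<open>Positive dimension holds for all large \<open>T\<close>, and finitely many terms
    do not affect the limits.\<close>
  have aG: "a T x = (\<integral>\<omega>. cdf (esd (A T \<omega>)) x \<partial>M)" if "0 < p T" for T x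
    unfolding a_def A_def X_def E_def L_def
    by (rule expected_cdf_autocov[OF M that _ indep_vectors indep_entries]) (use s in auto)
  have mono_cdf: "mono (cdf (esd B))" for B
  proof -
    interpret d: real_distribution "esd B" by (rule real_distribution_esd)
    show ?thesis by (rule monoI) (rule d.cdf_nondecreasing)
  qed
  have mono_a: "mono (a T)" for T
  proof (rule monoI)
    fix u v :: real assume uv: "u \<le> v"
    have pE: "prob_space (PiM (E T) (L T))" by (rule prob_space_PiM) (rule pL)
    interpret P: prob_space "PiM (E T) (L T)" by (rule pE)
    show "a T u \<le> a T v"
    proof (cases "0 < p T")
      case True
      have i: "integrable (PiM (E T) (L T)) (\<lambda>w. cdf (esd (lag_mat s (p T) T w * (lag_mat s (p T) T w)\<^sup>T)) x)" for x
      proof (rule P.integrable_const_bound[of _ 1])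
        have "\<bar>cdf (esd B) x\<bar> \<le> 1" for B
        proof -
          interpret d: real_distribution "esd B" by (rule real_distribution_esd)
          show ?thesis using d.cdf_nonneg[of x] d.cdf_bounded_prob[of x] by simp
        qed
        then show "AE w in PiM (E T) (L T). norm (cdf (esd (lag_mat s (p T) T w * (lag_mat s (p T) T w)\<^sup>T)) x) \<le> 1" by simp
        have "(\<lambda>w. w e) \<in> borel_measurable (PiM (E T) (L T))" if "e \<in> E T" for e
          using measurable_component_singleton[OF that, of "L T"] by (simp add: measurable_cong_sets[OF refl sL])
        then show "(\<lambda>w. cdf (esd (lag_mat s (p T) T w * (lag_mat s (p T) T w)\<^sup>T)) x) \<in> borel_measurable (PiM (E T) (L T))"
          by (intro borel_measurable_cdf_lag_mat[OF True, where f = "\<lambda>e w. w e"]) (simp add: E_def)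
      qed
      show ?thesis unfolding a_def by (rule integral_mono[OF i i]) (rule monoD[OF mono_cdf uv])
    next
      case False
      \<comment> \<open>In dimension 0 the product measure lives on a single point, and monotonicity
        is that of one distribution function.\<close>
      then have "E T = {}" by (simp add: E_def)
      then show ?thesis using uv monoD[OF mono_cdf uv] by (simp add: a_def PiM_empty lebesgue_integral_count_space_finite)
    qed
  qed
  \<comment> \<open>One exceptional null set serves all rational arguments.\<close>
  have "AE \<omega> in M. \<forall>q\<in>\<rat>. (\<lambda>T. cdf (esd (A T \<omega>)) q - (\<integral>v. cdf (esd (A T v)) q \<partial>M)) \<longlonglongrightarrow> 0"
    unfolding A_def X_def
    by (intro AE_ball_countable[THEN iffD2] countable_rat ballI cdf_autocov_fluctuation[OF M s indep_vectors lim y])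
  then have "AE \<omega> in M. weak_conv_m (\<lambda>T. esd (A T \<omega>)) F"
  proof (rule AE_mp, intro AE_I2 impI)
    fix \<omega> assume *: "\<forall>q\<in>\<rat>. (\<lambda>T. cdf (esd (A T \<omega>)) q - (\<integral>v. cdf (esd (A T v)) q \<partial>M)) \<longlonglongrightarrow> 0"
    have "(\<lambda>T. cdf (esd (A T \<omega>)) x) \<longlonglongrightarrow> cdf F x" if "isCont (cdf F) x" for x
    proof (rule cdf_limit_from_rationals[OF F(1) mono_cdf mono_a _ F(3) that])
      fix q :: real assume q: "q \<in> \<rat>"
      have "\<forall>\<^sub>F T in sequentially. cdf (esd (A T \<omega>)) q - (\<integral>v. cdf (esd (A T v)) q \<partial>M) = cdf (esd (A T \<omega>)) q - a T q"
        using ppos by eventually_elim (simp add: aG)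
      with *[rule_format, OF q] show "(\<lambda>T. cdf (esd (A T \<omega>)) q - a T q) \<longlonglongrightarrow> 0" by (rule Lim_transform_eventually)
    qed
    then show "weak_conv_m (\<lambda>T. esd (A T \<omega>)) F" by (simp add: weak_conv_m_def weak_conv_def)
  qed
  with F(1,2) show ?thesis by blast
qed

end
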